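(* Fix integers $1\le d<D$ and reals $0<f_{min}\le f_{max}<\infty$, $\rho>0$. Provided the tuning constants $c_1=c_1(d,f_{min},f_{max})$ and $c_2=c_2(d,f_{min},f_{max})$ in the definition of $\hat M_{\mathtt{TDC}}$ (see context) are chosen large enough, $\hat M_{\mathtt{TDC}}=\hat M_{\mathtt{TDC}}(\mathbb{X}_n)$ is a simplicial complex with vertices included in $\mathbb{X}_n$ such that the following holds. There exist $\lambda_*>0$ depending only on $d,f_{min},f_{max}$, and constants $C,C'>0$ depending only on $d,f_{min},f_{max},\rho$, such that if $\sigma=\sigma_n\in[0,\rho)$ satisfies $\sigma\le\lambda\left(\frac{\log n}{n}\right)^{1/d}$ with $\lambda=\lambda_n\le\lambda_*$, then, for an i.i.d. $n$-sample $\mathbb{X}_n$ drawn from a distribution in $\mathcal{G}_{D,d,f_{min},f_{max},\rho,\sigma}$ with associated submanifold $M$, $$\lim_{n\to\infty}\mathbb{P}\left(d_H(M,\hat M_{\mathtt{TDC}})\le C\left\{\left(\frac{\log n}{n}\right)^{2/d}\vee\lambda^2\right\}\ \text{ and }\ M\cong\hat M_{\mathtt{TDC}}\right)=1.$$ Moreover, for $n$ large enough, $$\sup_{Q\in\mathcal{G}_{D,d,f_{min},f_{max},\rho,\sigma}}\mathbb{E}_Q\, d_H(M,\hat M_{\mathtt{TDC}})\le C'\left\{\left(\frac{\log n}{n}\right)^{2/d}\vee\lambda^2\right\}.$$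
   Context: Notation: $\|\cdot\|$ is the Euclidean norm, $\mathcal{B}(x,r)$ the closed Euclidean ball, $a\vee b=\max(a,b)$, $d_H$ the Hausdorff distance, $d(x,A)$ the Euclidean distance to a set, $\cong$ the ambient isotopy relation in $\mathbb{R}^D$ (a simplicial complex is identified with its underlying subset of $\mathbb{R}^D$). Models. The medial axis of $M\subset\mathbb{R}^D$ is $\mathrm{med}(M)=\{x:\exists a\ne b\in M,\ \|x-a\|=\|x-b\|=d(x,M)\}$, and $\mathrm{reach}(M)=\inf_{p\in M}d(p,\mathrm{med}(M))$. $\mathcal{M}_{D,d,\rho}$ is the set of compact connected $d$-dimensional submanifolds $M\subset\mathbb{R}^D$ without boundary with $\mathrm{reach}(M)\ge\rho$; $v_M$ is the $d$-dimensional Hausdorff measure restricted to $M$. $\mathcal{U}_M(f_{min},f_{max})$ is the set of probability distributions having a density $f$ with respect to $v_M$ with $f_{min}\le f(x)\le f_{max}$ for all $x\in M$. $\mathcal{G}_{D,d,f_{min},f_{max},\rho}=\bigcup_{M\in\mathcal{M}_{D,d,\rho}}\mathcal{U}_M(f_{min},f_{max})$. For $0\le\sigma<\rho$, $\mathcal{G}_{D,d,f_{min},f_{max},\rho,\sigma}$ is the set of distributions of random variables $X=Y+Z$ where $Y$ has distribution in $\mathcal{G}_{D,d,f_{min},f_{max},\rho}$ and $\|Z\|\le\sigma$ almost surely ($Y,Z$ need not be independent); the associated submanifold $M$ is the support of the law of $Y$. $\mathbb{E}_Q$ is expectation with respect to an i.i.d. $n$-sample $\mathbb{X}_n=\{X_1,\dots,X_n\}$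 from $Q$. Tangential Delaunay Complex. For a finite $\mathcal{P}\subset\mathbb{R}^D$ and a weight assignment $\omega:\mathcal{P}\to[0,\infty)$, let $d(x,p^\omega)^2=\|x-p\|^2-\omega(p)^2$, $\mathrm{Vor}^\omega(p)=\{x: d(x,p^\omega)^2\le d(x,q^\omega)^2\ \forall q\in\mathcal{P}\}$, and $\mathrm{Vor}^\omega(\tau)=\bigcap_{p\in\tau}\mathrm{Vor}^\omega(p)$ for $\tau\subset\mathcal{P}$. The weighted Delaunay triangulation $\mathrm{Del}^\omega(\mathcal{P})$ consists of the simplices $\tau\subset\mathcal P$ with $\mathrm{Vor}^\omega(\tau)\ne\emptyset$. Given a family $T=\{T_p\}_{p\in\mathcal{P}}$ of $d$-dimensional linear subspaces, identified with the affine spaces $p+T_p$, $\mathrm{Del}^\omega(\mathcal{P},T)$ is the subcomplex of simplices $\tau$ with $\mathrm{Vor}^\omega(\tau)\cap\bigcup_{p\in\tau}(p+T_p)\ne\emptyset$. $\omega_*=\omega_{*\mathcal{P},T}$ is the weight assignment of Boissonnat and Ghosh, a function of $(\mathcal{P},T)$ only, which satisfies: there are $\varepsilon_d,C_d>0$ such that for all $\rho>0$, $\varepsilon\le\varepsilon_d\rho$, $M\in\mathcal{M}_{D,d,\rho}$ and every $\mathcal{P}\subset M$ that is an $(\varepsilon,2\varepsilon)$-net of $M$ (i.e. $d(p,\mathcal{P}\setminus\{p\})\ge\varepsilon$ for all $p\in\mathcal{P}$ and $\sup_{x\in M}d(x,\mathcal{P})\le2\varepsilon$), with $T=\{T_pM\}_{p\in\mathcal{P}}$,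 one has $d_H(M,\mathrm{Del}^{\omega_*}(\mathcal{P},T))\le C_d\varepsilon^2/\rho$ and $M\cong\mathrm{Del}^{\omega_*}(\mathcal{P},T)$. Estimator. For $h>0$ let $\hat\Sigma_j(h)=\frac1{n-1}\sum_{i\ne j}(X_i-\bar X_j)(X_i-\bar X_j)^t\mathbf{1}_{\mathcal{B}(X_j,h)}(X_i)$, where $\bar X_j=\frac1{N_j}\sum_{i\ne j}X_i\mathbf{1}_{\mathcal{B}(X_j,h)}(X_i)$ and $N_j=|\{i\ne j: X_i\in\mathcal{B}(X_j,h)\}|$; let $\hat T_j(h)$ be the span of $d$ eigenvectors of $\hat\Sigma_j(h)$ associated with its $d$ largest eigenvalues. Set $h=\left(c_1\frac{\log n}{n-1}\right)^{1/d}$ and $\varepsilon=c_2\left(h\vee\frac{\rho\sigma}{h}\right)$. Let $\mathbb{Y}_n\subset\mathbb{X}_n$ be the output of farthest point sampling on $\mathbb{X}_n$ with parameter $\varepsilon$: start with $\mathcal{Q}=\{p_1\}$ for one sample point $p_1$, and while $\max_{p\in\mathbb{X}_n}d(p,\mathcal{Q})>\varepsilon$, add to $\mathcal{Q}$ a point of $\mathbb{X}_n$ maximizing $d(\cdot,\mathcal{Q})$. Then $\hat M_{\mathtt{TDC}}=\mathrm{Del}^{\omega_*}\big(\mathbb{Y}_n,\{\hat T_j(h)\}_{X_j\in\mathbb{Y}_n}\big)$. *)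

theory Defs
  imports "HOL-Probability.Probability"
begin

section \<open>Euclidean spaces of varying dimension\<close>

text \<open>
  The constants in the theorem must not depend on the ambient dimension \<open>D\<close>, so \<open>D\<close> has to be
  quantified inside the formula and cannot be a type.  All the spaces \<open>\<real>\<^sup>D\<close> are therefore realised
  inside one real inner product space, the finitely supported real sequences with the \<open>l\<^sup>2\<close>
  inner product: \<open>\<real>\<^sup>D\<close> is \<open>Rn D\<close>, the sequences supported on \<open>{..<D}\<close>
  (see \<open>dim_Rn\<close> and \<open>Rn_isometric\<close> below).
\<close>

typedef fvec = "{f :: nat \<Rightarrow> real. finite {i. f i \<noteq> 0}}"
  morphisms coord Abs_fvec
  by (rule exI[of _ "\<lambda>_. 0"]) simp

setup_lifting type_definition_fvec

lemma finite_coord [simp]: "finite {i. coord x i \<noteq> 0}"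
  using coord[of x] by simp

lemma fvec_eqI: "(\<And>i. coord x i = coord y i) \<Longrightarrow> x = y"
  by (simp add: coord_inject[symmetric] fun_eq_iff)

instantiation fvec :: real_vector
begin

lift_definition zero_fvec :: fvec is "\<lambda>_. 0" by simp

lift_definition plus_fvec :: "fvec \<Rightarrow> fvec \<Rightarrow> fvec" is "\<lambda>f g i. f i + g i"
proof -
  fix f g :: "nat \<Rightarrow> real"
  assume "finite {i. f i \<noteq> 0}" "finite {i. g i \<noteq> 0}"
  then have "finite ({i. f i \<noteq> 0} \<union> {i. g i \<noteq> 0})" by simp
  then show "finite {i. f i + g i \<noteq> 0}" by (rule rev_finite_subset) auto
qed

lift_definition minus_fvec :: "fvec \<Rightarrow> fvec \<Rightarrow> fvec" is "\<lambda>f g i. f i - g i"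
proof -
  fix f g :: "nat \<Rightarrow> real"
  assume "finite {i. f i \<noteq> 0}" "finite {i. g i \<noteq> 0}"
  then have "finite ({i. f i \<noteq> 0} \<union> {i. g i \<noteq> 0})" by simp
  then show "finite {i. f i - g i \<noteq> 0}" by (rule rev_finite_subset) auto
qed

lift_definition uminus_fvec :: "fvec \<Rightarrow> fvec" is "\<lambda>f i. - f i" by simp

lift_definition scaleR_fvec :: "real \<Rightarrow> fvec \<Rightarrow> fvec" is "\<lambda>r f i. r * f i"
  by (rule finite_subset) auto

instance
  by standard (transfer; auto simp: algebra_simps)+

end

lemma coord_simps [simp]:
  "coord 0 i = 0" "coord (x + y) i = coord x i + coord y i"
  "coord (x - y) i = coord x i - coord y i" "coord (- x) i = - coord x i"
  "coord (r *\<^sub>R x) i = r * coord x i"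
  by (transfer; simp)+

lemma coord_sum [simp]: "coord (sum f A) i = (\<Sum>a\<in>A. coord (f a) i)"
  by (induction A rule: infinite_finite_induct) auto

instantiation fvec :: real_inner
begin

definition inner_fvec :: "fvec \<Rightarrow> fvec \<Rightarrow> real" where
  "inner_fvec x y = (\<Sum>i\<in>{i. coord x i \<noteq> 0}. coord x i * coord y i)"

definition norm_fvec :: "fvec \<Rightarrow> real" where
  "norm_fvec x = sqrt (inner x x)"

definition sgn_fvec :: "fvec \<Rightarrow> fvec" where
  "sgn_fvec x = inverse (norm x) *\<^sub>R x"

definition dist_fvec :: "fvec \<Rightarrow> fvec \<Rightarrow> real" where
  "dist_fvec x y = norm (x - y)"

definition uniformity_fvec :: "(fvec \<times> fvec) filter" where
  "uniformity_fvec = (INF e\<in>{0<..}. principal {(x, y). dist x y < e})"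

definition open_fvec :: "fvec set \<Rightarrow> bool" where
  "open_fvec U \<longleftrightarrow> (\<forall>x\<in>U. eventually (\<lambda>(x', y). x' = x \<longrightarrow> y \<in> U) uniformity)"

lemma inner_fvec_superset:
  assumes "finite A" "{i. coord x i \<noteq> 0} \<subseteq> A"
  shows "inner x y = (\<Sum>i\<in>A. coord x i * coord y i)"
  unfolding inner_fvec_def using assms by (intro sum.mono_neutral_left) auto

instance
proof
  fix x y z :: fvec and r :: real
  let ?A = "{i. coord x i \<noteq> 0} \<union> {i. coord y i \<noteq> 0}"
  have A: "finite ?A" by simp
  have s: "{i. coord (x + y) i \<noteq> 0} \<subseteq> ?A" by auto
  have s': "{i. coord (r *\<^sub>R x) i \<noteq> 0} \<subseteq> ?A" by auto
  show "inner x y = inner y x"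
    by (simp add: inner_fvec_superset[OF A] mult.commute)
  show "inner (x + y) z = inner x z + inner y z"
    by (simp add: inner_fvec_superset[OF A s] inner_fvec_superset[OF A] sum.distrib algebra_simps)
  show "inner (r *\<^sub>R x) y = r * inner x y"
    by (simp add: inner_fvec_superset[OF A s'] inner_fvec_superset[OF A] sum_distrib_left
        algebra_simps)
  show "0 \<le> inner x x"
    by (auto simp: inner_fvec_def intro: sum_nonneg)
  show "inner x x = 0 \<longleftrightarrow> x = 0"
    by (auto simp: inner_fvec_def sum_nonneg_eq_0_iff intro!: fvec_eqI)
qed (simp_all only: norm_fvec_def sgn_fvec_def dist_fvec_def uniformity_fvec_def open_fvec_def)

end

definition Rn :: "nat \<Rightarrow> fvec set" where
  "Rn D = {x. \<forall>i\<ge>D. coord x i = 0}"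

lift_definition unit_fvec :: "nat \<Rightarrow> fvec" is "\<lambda>j i. if i = j then 1 else 0"
  by (rule finite_subset[of _ "{_}"]) (auto split: if_splits)

lemma coord_unit_fvec [simp]: "coord (unit_fvec j) i = (if i = j then 1 else 0)"
  by transfer simp

lemma subspace_Rn: "subspace (Rn D)"
  by (auto simp: subspace_def Rn_def)

lemma inner_unit_fvec: "inner (unit_fvec i) (unit_fvec j) = (if i = j then 1 else 0)"
  by (subst inner_fvec_superset[of "{i}"]) auto

lemma unit_fvec_in_Rn [simp]: "unit_fvec i \<in> Rn D \<longleftrightarrow> i < D"
  by (auto simp: Rn_def not_less)

lemma Rn_expand: "x \<in> Rn D \<Longrightarrow> x = (\<Sum>i<D. coord x i *\<^sub>R unit_fvec i)"
  by (rule fvec_eqI) (auto simp: Rn_def if_distrib not_less sum.delta cong: if_cong)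

lemma inj_unit_fvec: "inj unit_fvec"
  by (rule injI) (metis inner_unit_fvec zero_neq_one)

lemma independent_unit_fvec: "independent (unit_fvec ` A)"
proof (rule pairwise_orthogonal_independent)
  show "pairwise orthogonal (unit_fvec ` A)"
    by (auto simp: pairwise_def orthogonal_def inner_unit_fvec)
  show "0 \<notin> unit_fvec ` A"
    by (metis (no_types, lifting) imageE inner_unit_fvec inner_zero_left zero_neq_one)
qed

lemma span_unit_fvec: "span (unit_fvec ` {..<D}) = Rn D"
proof
  show "span (unit_fvec ` {..<D}) \<subseteq> Rn D"
    by (rule span_minimal) (auto simp: subspace_Rn)
  show "Rn D \<subseteq> span (unit_fvec ` {..<D})"
  proof
    fix x assume "x \<in> Rn D"
    then have "x = (\<Sum>i<D. coord x i *\<^sub>R unit_fvec i)" by (rule Rn_expand)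
    also have "\<dots> \<in> span (unit_fvec ` {..<D})"
      by (intro span_sum span_scale span_base) auto
    finally show "x \<in> span (unit_fvec ` {..<D})" .
  qed
qed

lemma dim_Rn: "dim (Rn D) = D"
proof -
  have "dim (Rn D) = card (unit_fvec ` {..<D})"
    using independent_unit_fvec span_unit_fvec
    by (metis dim_span_eq_card_independent)
  also have "\<dots> = D"
    by (simp add: card_image inj_on_subset[OF inj_unit_fvec])
  finally show ?thesis .
qed

lemma Rn_isometric:
  "\<exists>f :: 'a :: euclidean_space \<Rightarrow> fvec. linear f \<and> (\<forall>x. norm (f x) = norm x) \<and> range f = Rn DIM('a)"
proof -
  obtain g :: "'a \<Rightarrow> nat" where g: "bij_betw g Basis {..<DIM('a)}"
    using ex_bij_betw_finite_nat[OF finite_Basis] by (auto simp: atLeast0LessThan)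
  define f :: "'a \<Rightarrow> fvec" where "f x = (\<Sum>b\<in>Basis. inner x b *\<^sub>R unit_fvec (g b))" for x
  have lin: "linear f"
    by (rule linearI)
      (auto simp: f_def inner_add_left scaleR_add_left sum.distrib scaleR_sum_right)
  have inj: "g b = g b' \<longleftrightarrow> b = b'" if "b \<in> Basis" "b' \<in> Basis" for b b'
    using g that by (auto simp: bij_betw_def inj_on_def)
  have "inner (f x) (f x) = inner x x" for x
  proof -
    have "inner (f x) (f x) = (\<Sum>b\<in>Basis. \<Sum>b'\<in>Basis. inner x b * (inner x b' * inner (unit_fvec (g b')) (unit_fvec (g b))))"
      by (simp add: f_def inner_sum_left inner_sum_right sum_distrib_left)
    also have "\<dots> = (\<Sum>b\<in>Basis. \<Sum>b'\<in>Basis. if b' = b then inner x b * inner x b' else 0)"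
      by (intro sum.cong) (auto simp: inner_unit_fvec inj)
    also have "\<dots> = (\<Sum>b\<in>Basis. inner x b * inner x b)"
      by (intro sum.cong) (auto simp: sum.delta)
    also have "\<dots> = inner x x"
      by (rule euclidean_inner[symmetric])
    finally show ?thesis .
  qed
  then have nrm: "norm (f x) = norm x" for x
    by (simp add: norm_eq_sqrt_inner)
  have fb: "f b = unit_fvec (g b)" if "b \<in> Basis" for b
  proof -
    have "f b = (\<Sum>b'\<in>Basis. if b' = b then unit_fvec (g b') else 0)"
      unfolding f_def using that by (intro sum.cong) (auto simp: inner_Basis)
    also have "\<dots> = unit_fvec (g b)"
      using that by (simp add: sum.delta)
    finally show ?thesis .
  qed
  have "f ` Basis = (\<lambda>b. unit_fvec (g b)) ` Basis"
    using fb by (intro image_cong) auto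
  also have "\<dots> = unit_fvec ` {..<DIM('a)}"
    using g by (metis bij_betw_imp_surj_on image_image)
  finally have "f ` Basis = unit_fvec ` {..<DIM('a)}" .
  then have "range f = Rn DIM('a)"
    by (metis lin linear_span_image span_Basis span_unit_fvec)
  with lin nrm show ?thesis by blast
qed

text \<open>Second countability makes \<open>borel \<Otimes>\<^sub>M borel\<close> the Borel sigma algebra of pairs, hence addition measurable.\<close>

lemma fvec_dense: "\<exists>A :: fvec set. countable A \<and> (\<forall>x. \<forall>e>0. \<exists>a\<in>A. dist a x < e)"
proof (intro exI conjI allI impI)
  let ?g = "\<lambda>qs :: rat list. \<Sum>i<length qs. of_rat (qs ! i) *\<^sub>R unit_fvec i"
  show "countable (range ?g)" by simp
  fix x :: fvec and e :: real assume e: "e > 0"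
  obtain D where D: "x \<in> Rn D"
  proof -
    obtain m where "\<forall>i\<in>{i. coord x i \<noteq> 0}. i < m"
      using finite_coord[of x] unfolding finite_nat_set_iff_bounded by blast
    then have "x \<in> Rn m" by (auto simp: Rn_def not_less[symmetric])
    then show ?thesis by (rule that)
  qed
  have "\<exists>q. \<bar>of_rat q - coord x i\<bar> < e / (real D + 1)" for i
  proof -
    obtain r where "coord x i < real_of_rat r" "real_of_rat r < coord x i + e / (real D + 1)"
      using of_rat_dense[of "coord x i" "coord x i + e / (real D + 1)"] e by auto
    then show ?thesis by (intro exI[of _ r]) auto
  qed
  then obtain q where q: "\<And>i. \<bar>of_rat (q i) - coord x i\<bar> < e / (real D + 1)" by metis
  have "dist (?g (map q [0..<D])) x
      = norm ((\<Sum>i<D. of_rat (q i) *\<^sub>R unit_fvec i) - (\<Sum>i<D. coord x i *\<^sub>R unit_fvec i))"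
    unfolding dist_norm by (rule arg_cong[of _ _ norm], rule arg_cong2[of _ _ _ _ "(-)"])
      (use Rn_expand[OF D] in \<open>auto intro!: sum.cong\<close>)
  also have "\<dots> = norm (\<Sum>i<D. (of_rat (q i) - coord x i) *\<^sub>R unit_fvec i)"
    by (simp add: sum_subtractf scaleR_diff_left)
  also have "\<dots> \<le> (\<Sum>i<D. e / (real D + 1))"
  proof (rule sum_norm_le)
    fix i show "norm ((of_rat (q i) - coord x i) *\<^sub>R unit_fvec i) \<le> e / (real D + 1)"
      using q[of i] by (simp add: norm_eq_sqrt_inner[of "unit_fvec i"] inner_unit_fvec)
  qed
  also have "\<dots> < e" using e by (simp add: field_simps)
  finally show "\<exists>a\<in>range ?g. dist a x < e" by blast
qed

instance fvec :: second_countable_topology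
proof
  obtain A :: "fvec set" where A: "countable A" "\<And>x e. e > 0 \<Longrightarrow> \<exists>a\<in>A. dist a x < e"
    using fvec_dense by blast
  let ?B = "(\<lambda>(a, n). ball a (1 / real (Suc n))) ` (A \<times> UNIV)"
  have "topological_basis ?B"
  proof (rule topological_basisI)
    fix U and x :: fvec assume "open U" "x \<in> U"
    then obtain e where e: "e > 0" "ball x e \<subseteq> U" by (meson openE)
    obtain n where n: "1 / real (Suc n) < e / 2"
      using e nat_approx_posE[of "e / 2"] by auto
    obtain a where a: "a \<in> A" "dist a x < 1 / real (Suc n)"
      using A(2)[of "1 / real (Suc n)" x] by auto
    have "ball a (1 / real (Suc n)) \<subseteq> ball x e"
    proof
      fix y assume "y \<in> ball a (1 / real (Suc n))"
      then have "dist a y < e / 2" "dist a x < e / 2" using a n by auto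
      then show "y \<in> ball x e" using dist_triangle[of x y a] by (simp add: dist_commute)
    qed
    then show "\<exists>B\<in>?B. x \<in> B \<and> B \<subseteq> U"
      using a e by (intro bexI[of _ "ball a (1 / real (Suc n))"]) auto
  qed auto
  moreover have "countable ?B" using A by simp
  ultimately show "\<exists>B :: fvec set set. countable B \<and> open = generate_topology B"
    using topological_basis_imp_subbasis by blast
qed


section \<open>Hausdorff distance, Hausdorff measure, ambient isotopy\<close>

definition hausdorff_dist :: "fvec set \<Rightarrow> fvec set \<Rightarrow> real" where
  "hausdorff_dist A B = max (SUP a\<in>A. infdist a B) (SUP b\<in>B. infdist b A)"

definition hausdorff_content :: "nat \<Rightarrow> real \<Rightarrow> fvec set \<Rightarrow> ennreal" where
  "hausdorff_content d \<delta> A =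
     (INF U\<in>{U :: nat \<Rightarrow> fvec set. A \<subseteq> (\<Union>i. U i) \<and> (\<forall>i. bounded (U i) \<and> diameter (U i) \<le> \<delta>)}.
        \<Sum>i. ennreal (unit_ball_vol (real d) * (diameter (U i) / 2) ^ d))"

definition hausdorff_outer :: "nat \<Rightarrow> fvec set \<Rightarrow> ennreal" where
  "hausdorff_outer d A = (SUP \<delta>\<in>{0<..}. hausdorff_content d \<delta> A)"

text \<open>
  The factor \<open>unit_ball_vol\<close> makes this agree with the Riemannian volume on \<open>d\<close>-dimensional
  submanifolds.  The outer measure is countably additive on the Borel sets by Caratheodory's criterion.
\<close>
definition hausdorff_measure :: "nat \<Rightarrow> fvec measure" where
  "hausdorff_measure d = measure_of UNIV (sets borel) (hausdorff_outer d)"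

definition ambient_isotopic :: "nat \<Rightarrow> fvec set \<Rightarrow> fvec set \<Rightarrow> bool" where
  "ambient_isotopic D A B \<longleftrightarrow>
     (\<exists>g. homotopic_with (homeomorphic_map (top_of_set (Rn D)) (top_of_set (Rn D)))
            (top_of_set (Rn D)) (top_of_set (Rn D)) (\<lambda>x. x) g \<and> g ` A = B)"


section \<open>Submanifolds and reach\<close>

text \<open>Maps of class \<open>C\<^sup>k\<close> on a relatively open subset \<open>U\<close> of \<open>Rn d\<close>.  Derivatives are taken within
  \<open>U\<close>, so they are determined exactly on \<open>Rn d\<close>.\<close>

primrec Ck_on :: "nat \<Rightarrow> nat \<Rightarrow> (fvec \<Rightarrow> fvec) \<Rightarrow> fvec set \<Rightarrow> bool" where
  "Ck_on 0 d f U \<longleftrightarrow> continuous_on U f"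
| "Ck_on (Suc k) d f U \<longleftrightarrow>
     (\<exists>f'. (\<forall>x\<in>U. (f has_derivative f' x) (at x within U)) \<and>
           (\<forall>v\<in>Rn d. Ck_on k d (\<lambda>x. f' x v) U))"

text \<open>Embedded \<open>d\<close>-dimensional \<open>C\<^sup>k\<close> submanifolds of \<open>\<real>\<^sup>D\<close> without boundary, by local
  parametrisations; \<open>k = \<infinity>\<close> gives the smooth ones.\<close>

definition submanifold :: "enat \<Rightarrow> nat \<Rightarrow> nat \<Rightarrow> fvec set \<Rightarrow> bool" where
  "submanifold k D d M \<longleftrightarrow> M \<subseteq> Rn D \<and>
     (\<forall>p\<in>M. \<exists>U \<phi> \<psi>.
        openin (top_of_set (Rn d)) U \<and> p \<in> \<phi> ` U \<and> openin (top_of_set M) (\<phi> ` U) \<and>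
        homeomorphism U (\<phi> ` U) \<phi> \<psi> \<and>
        (\<forall>j. enat j \<le> k \<longrightarrow> Ck_on j d \<phi> U) \<and>
        (\<forall>x\<in>U. \<exists>A. (\<phi> has_derivative A) (at x within U) \<and> inj_on A (Rn d)))"

text \<open>Tangent vectors as velocities of curves in \<open>M\<close>.\<close>

definition tangent_space :: "fvec set \<Rightarrow> fvec \<Rightarrow> fvec set" where
  "tangent_space M p =
     {v. \<exists>\<gamma> :: real \<Rightarrow> fvec. (\<forall>t\<in>{-1<..<1}. \<gamma> t \<in> M) \<and> \<gamma> 0 = p \<and>
           (\<gamma> has_vector_derivative v) (at 0)}"

definition medial_axis :: "nat \<Rightarrow> fvec set \<Rightarrow> fvec set" where
  "medial_axis D M =
     {x \<in> Rn D. \<exists>a\<in>M. \<exists>b\<in>M. a \<noteq> b \<and> dist x a = infdist x M \<and> dist x b = infdist x M}"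

text \<open>The value is \<open>\<infinity>\<close> if the medial axis is empty.\<close>

definition reach :: "nat \<Rightarrow> fvec set \<Rightarrow> ereal" where
  "reach D M = (INF p\<in>M. INF z\<in>medial_axis D M. ereal (dist p z))"

definition manifold_class :: "enat \<Rightarrow> nat \<Rightarrow> nat \<Rightarrow> real \<Rightarrow> fvec set set" where
  "manifold_class k D d \<rho> =
     {M. submanifold k D d M \<and> M \<noteq> {} \<and> compact M \<and> connected M \<and> ereal \<rho> \<le> reach D M}"


section \<open>Statistical models\<close>

definition volume_measure :: "nat \<Rightarrow> fvec set \<Rightarrow> fvec measure" where
  "volume_measure d M = density (hausdorff_measure d) (indicator M)"

definition density_model :: "nat \<Rightarrow> real \<Rightarrow> real \<Rightarrow> fvec set \<Rightarrow> fvec measure set" where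
  "density_model d fmin fmax M =
     {P. prob_space P \<and>
         (\<exists>f\<in>borel_measurable borel. (\<forall>x\<in>M. fmin \<le> f x \<and> f x \<le> fmax) \<and>
            P = density (volume_measure d M) (\<lambda>x. ennreal (f x)))}"

definition clean_model ::
  "enat \<Rightarrow> nat \<Rightarrow> nat \<Rightarrow> real \<Rightarrow> real \<Rightarrow> real \<Rightarrow> fvec measure set" where
  "clean_model k D d fmin fmax \<rho> = (\<Union>M\<in>manifold_class k D d \<rho>. density_model d fmin fmax M)"

definition measure_support :: "fvec measure \<Rightarrow> fvec set" where
  "measure_support P = {x. \<forall>U. open U \<and> x \<in> U \<longrightarrow> emeasure P U > 0}"

text \<open>Pairs of a law of \<open>Y + Z\<close> and an associated submanifold; \<open>\<mu>\<close> is the joint law of \<open>(Y, Z)\<close>.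
  A law can arise from several \<open>Y\<close>, so the submanifold is not a function of the law.\<close>

definition noisy_model ::
  "enat \<Rightarrow> nat \<Rightarrow> nat \<Rightarrow> real \<Rightarrow> real \<Rightarrow> real \<Rightarrow> real \<Rightarrow> (fvec measure \<times> fvec set) set" where
  "noisy_model k D d fmin fmax \<rho> \<sigma> =
     {(Q, M). \<exists>\<mu>. prob_space \<mu> \<and> sets \<mu> = sets (borel \<Otimes>\<^sub>M borel) \<and>
        distr \<mu> borel fst \<in> clean_model k D d fmin fmax \<rho> \<and>
        M = measure_support (distr \<mu> borel fst) \<and>
        (AE (y, z) in \<mu>. z \<in> Rn D \<and> norm z \<le> \<sigma>) \<and>
        Q = distr \<mu> borel (\<lambda>(y, z). y + z)}"


section \<open>Inner probability and upper expectation\<close>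

text \<open>
  No measurability of the weight assignment or of the choices made by the estimator is available,
  so probabilities and expectations are taken in the lower, respectively upper, sense.
\<close>

definition inner_prob :: "'a measure \<Rightarrow> 'a set \<Rightarrow> real" where
  "inner_prob N A = (SUP B\<in>{B \<in> sets N. B \<subseteq> A}. measure N B)"

definition upper_expectation :: "'a measure \<Rightarrow> ('a \<Rightarrow> ennreal) \<Rightarrow> ennreal" where
  "upper_expectation N f =
     (INF g\<in>{g \<in> borel_measurable N. \<forall>x\<in>space N. f x \<le> g x}. \<integral>\<^sup>+x. g x \<partial>N)"

lemma (in prob_space) inner_prob_measurable:
  assumes "A \<in> sets M" shows "inner_prob M A = prob A"
  unfolding inner_prob_def using assms
  by (intro cSup_eq_maximum) (auto intro: finite_measure_mono)

lemma upper_expectation_measurable: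
  assumes "f \<in> borel_measurable N" shows "upper_expectation N f = (\<integral>\<^sup>+x. f x \<partial>N)"
  unfolding upper_expectation_def using assms
  by (intro antisym INF_greatest) (auto intro!: INF_lower nn_integral_mono)


section \<open>Weighted tangential Delaunay complexes\<close>

definition wdist2 :: "(fvec \<Rightarrow> real) \<Rightarrow> fvec \<Rightarrow> fvec \<Rightarrow> real" where
  "wdist2 \<omega> x p = (dist x p)\<^sup>2 - (\<omega> p)\<^sup>2"

definition vor_cell :: "nat \<Rightarrow> (fvec \<Rightarrow> real) \<Rightarrow> fvec set \<Rightarrow> fvec \<Rightarrow> fvec set" where
  "vor_cell D \<omega> P p = {x \<in> Rn D. \<forall>q\<in>P. wdist2 \<omega> x p \<le> wdist2 \<omega> x q}"

definition vor_face :: "nat \<Rightarrow> (fvec \<Rightarrow> real) \<Rightarrow> fvec set \<Rightarrow> fvec set \<Rightarrow> fvec set" where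
  "vor_face D \<omega> P \<tau> = (\<Inter>p\<in>\<tau>. vor_cell D \<omega> P p)"

definition delaunay :: "nat \<Rightarrow> (fvec \<Rightarrow> real) \<Rightarrow> fvec set \<Rightarrow> fvec set set" where
  "delaunay D \<omega> P = {\<tau>. \<tau> \<noteq> {} \<and> \<tau> \<subseteq> P \<and> vor_face D \<omega> P \<tau> \<noteq> {}}"

definition restricted_simplices ::
  "nat \<Rightarrow> (fvec \<Rightarrow> real) \<Rightarrow> fvec set \<Rightarrow> (fvec \<Rightarrow> fvec set) \<Rightarrow> fvec set set" where
  "restricted_simplices D \<omega> P T =
     {\<tau> \<in> delaunay D \<omega> P. vor_face D \<omega> P \<tau> \<inter> (\<Union>p\<in>\<tau>. (+) p ` T p) \<noteq> {}}"

text \<open>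
  A face of a restricted simplex need not satisfy the intersection condition itself, so the
  subcomplex consists of the restricted simplices together with their faces.  This does not change the
  underlying set (\<open>underlying_restricted_delaunay\<close>).
\<close>
definition restricted_delaunay ::
  "nat \<Rightarrow> (fvec \<Rightarrow> real) \<Rightarrow> fvec set \<Rightarrow> (fvec \<Rightarrow> fvec set) \<Rightarrow> fvec set set" where
  "restricted_delaunay D \<omega> P T =
     {\<tau>. \<tau> \<noteq> {} \<and> (\<exists>\<tau>'\<in>restricted_simplices D \<omega> P T. \<tau> \<subseteq> \<tau>')}"

definition underlying :: "fvec set set \<Rightarrow> fvec set" where
  "underlying K = (\<Union>\<tau>\<in>K. convex hull \<tau>)"

lemma underlying_restricted_delaunay:
  "underlying (restricted_delaunay D \<omega> P T) = underlying (restricted_simplices D \<omega> P T)"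
proof
  show "underlying (restricted_delaunay D \<omega> P T) \<subseteq> underlying (restricted_simplices D \<omega> P T)"
    unfolding underlying_def restricted_delaunay_def using hull_mono by fast
  show "underlying (restricted_simplices D \<omega> P T) \<subseteq> underlying (restricted_delaunay D \<omega> P T)"
  proof -
    have "restricted_simplices D \<omega> P T \<subseteq> restricted_delaunay D \<omega> P T"
      by (auto simp: restricted_delaunay_def restricted_simplices_def delaunay_def)
    then show ?thesis unfolding underlying_def by (rule UN_mono) simp
  qed
qed

definition abstract_complex :: "'a set set \<Rightarrow> bool" where
  "abstract_complex K \<longleftrightarrow>
     finite K \<and> (\<forall>\<tau>\<in>K. finite \<tau> \<and> \<tau> \<noteq> {} \<and> (\<forall>\<tau>'. \<tau>' \<subseteq> \<tau> \<and> \<tau>' \<noteq> {} \<longrightarrow> \<tau>' \<in> K))"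

text \<open>Weight assignments depend on the ambient dimension, on \<open>P\<close> and on the family \<open>T\<close> indexed by
  \<open>P\<close>, which is why \<open>T\<close> is restricted to \<open>P\<close>.\<close>

type_synonym weight_assignment = "nat \<Rightarrow> fvec set \<Rightarrow> (fvec \<Rightarrow> fvec set) \<Rightarrow> fvec \<Rightarrow> real"

definition tdc ::
  "weight_assignment \<Rightarrow> nat \<Rightarrow> fvec set \<Rightarrow> (fvec \<Rightarrow> fvec set) \<Rightarrow> fvec set set" where
  "tdc \<omega> D P T = restricted_delaunay D (\<omega> D P (restrict T P)) P T"

text \<open>\<open>(\<epsilon>, \<eta>)\<close>-nets.  \<open>P\<close> must be nonempty because \<open>infdist x {} = 0\<close>.\<close>

definition net :: "real \<Rightarrow> real \<Rightarrow> fvec set \<Rightarrow> fvec set \<Rightarrow> bool" where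
  "net \<epsilon> \<eta> M P \<longleftrightarrow> finite P \<and> P \<noteq> {} \<and> P \<subseteq> M \<and>
     (\<forall>p\<in>P. \<forall>q\<in>P - {p}. \<epsilon> \<le> dist p q) \<and> (\<forall>x\<in>M. infdist x P \<le> \<eta>)"

definition boissonnat_ghosh :: "enat \<Rightarrow> nat \<Rightarrow> weight_assignment \<Rightarrow> bool" where
  "boissonnat_ghosh k d \<omega> \<longleftrightarrow>
     (\<forall>D P T. finite P \<longrightarrow> (\<forall>p\<in>P. 0 \<le> \<omega> D P T p)) \<and>
     (\<exists>\<epsilon>d>0. \<exists>Cd>0. \<forall>D>d. \<forall>\<rho>>0. \<forall>\<epsilon>>0. \<epsilon> \<le> \<epsilon>d * \<rho> \<longrightarrow>
        (\<forall>M\<in>manifold_class k D d \<rho>. \<forall>P. net \<epsilon> (2 * \<epsilon>) M P \<longrightarrow>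
           hausdorff_dist M (underlying (tdc \<omega> D P (tangent_space M))) \<le> Cd * \<epsilon>\<^sup>2 / \<rho> \<and>
           ambient_isotopic D M (underlying (tdc \<omega> D P (tangent_space M)))))"


section \<open>The estimator\<close>

text \<open>A sample is a function \<open>x\<close> on \<open>{1..n}\<close>.\<close>

definition neighbours :: "nat \<Rightarrow> (nat \<Rightarrow> fvec) \<Rightarrow> real \<Rightarrow> nat \<Rightarrow> nat set" where
  "neighbours n x h j = {i \<in> {1..n} - {j}. x i \<in> cball (x j) h}"

definition local_mean :: "nat \<Rightarrow> (nat \<Rightarrow> fvec) \<Rightarrow> real \<Rightarrow> nat \<Rightarrow> fvec" where
  "local_mean n x h j =
     (1 / real (card (neighbours n x h j))) *\<^sub>R (\<Sum>i\<in>neighbours n x h j. x i)"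

text \<open>The local covariance matrix as a linear operator: the matrix \<open>u u\<^sup>t\<close> maps \<open>v\<close> to \<open>(u \<bullet> v) u\<close>.\<close>

definition local_cov :: "nat \<Rightarrow> (nat \<Rightarrow> fvec) \<Rightarrow> real \<Rightarrow> nat \<Rightarrow> fvec \<Rightarrow> fvec" where
  "local_cov n x h j v =
     (1 / (real n - 1)) *\<^sub>R
       (\<Sum>i\<in>neighbours n x h j.
          inner (x i - local_mean n x h j) v *\<^sub>R (x i - local_mean n x h j))"

text \<open>Spans of \<open>d\<close> eigenvectors of the symmetric operator \<open>A\<close> on \<open>Rn D\<close> associated with its \<open>d\<close>
  largest eigenvalues, which are counted with multiplicity.  Such a span is not unique when the
  \<open>d\<close>-th and \<open>(d+1)\<close>-st eigenvalues agree.\<close>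

definition top_eigenspan :: "nat \<Rightarrow> nat \<Rightarrow> (fvec \<Rightarrow> fvec) \<Rightarrow> fvec set \<Rightarrow> bool" where
  "top_eigenspan D d A S \<longleftrightarrow>
     (\<exists>(u :: nat \<Rightarrow> fvec) (l :: nat \<Rightarrow> real).
        (\<forall>i<D. u i \<in> Rn D \<and> A (u i) = l i *\<^sub>R u i) \<and>
        (\<forall>i<D. \<forall>j<D. inner (u i) (u j) = (if i = j then 1 else 0)) \<and>
        (\<forall>i j. i \<le> j \<and> j < D \<longrightarrow> l j \<le> l i) \<and>
        S = span (u ` {..<d}))"

inductive farthest_point_run :: "fvec set \<Rightarrow> real \<Rightarrow> fvec set \<Rightarrow> bool" for X \<epsilon> where
  start: "p \<in> X \<Longrightarrow> farthest_point_run X \<epsilon> {p}"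
| step: "farthest_point_run X \<epsilon> Q \<Longrightarrow> (\<exists>p\<in>X. infdist p Q > \<epsilon>) \<Longrightarrow> q \<in> X \<Longrightarrow>
         (\<forall>p\<in>X. infdist p Q \<le> infdist q Q) \<Longrightarrow> farthest_point_run X \<epsilon> (insert q Q)"

definition farthest_point_output :: "fvec set \<Rightarrow> real \<Rightarrow> fvec set \<Rightarrow> bool" where
  "farthest_point_output X \<epsilon> Y \<longleftrightarrow> farthest_point_run X \<epsilon> Y \<and> (\<forall>p\<in>X. infdist p Y \<le> \<epsilon>)"

definition bandwidth :: "real \<Rightarrow> nat \<Rightarrow> nat \<Rightarrow> real" where
  "bandwidth c1 d n = (c1 * (ln (real n) / (real n - 1))) powr (1 / real d)"

definition net_scale :: "real \<Rightarrow> real \<Rightarrow> real \<Rightarrow> real \<Rightarrow> real" where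
  "net_scale c2 \<rho> \<sigma> h = c2 * max h (\<rho> * \<sigma> / h)"

text \<open>\<open>tdc_estimate \<omega> D d c1 c2 \<rho> \<sigma> n x K\<close>: the complex \<open>K\<close> is a possible value of the estimator on
  the sample \<open>x\<close>.  The choices left open by the construction are the initial point and the ties in
  the farthest point sampling, and the eigenvectors in case of multiple eigenvalues.\<close>

definition tdc_estimate ::
  "weight_assignment \<Rightarrow> nat \<Rightarrow> nat \<Rightarrow> real \<Rightarrow> real \<Rightarrow> real \<Rightarrow> real \<Rightarrow> nat \<Rightarrow> (nat \<Rightarrow> fvec) \<Rightarrow>
     fvec set set \<Rightarrow> bool" where
  "tdc_estimate \<omega> D d c1 c2 \<rho> \<sigma> n x K \<longleftrightarrow>
     (\<exists>h \<epsilon> Y T. h = bandwidth c1 d n \<and> \<epsilon> = net_scale c2 \<rho> \<sigma> h \<and>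
        farthest_point_output (x ` {1..n}) \<epsilon> Y \<and>
        (\<forall>p\<in>Y. \<exists>j\<in>{1..n}. x j = p \<and> top_eigenspan D d (local_cov n x h j) (T p)) \<and>
        K = tdc \<omega> D Y T)"

end

theory Submission
  imports Defs
begin

text \<open>
  With high probability every ball of radius \<open>h / 10\<close> centred on \<open>M\<close> contains about \<open>n * h ^ d\<close> sample
  points.  On such a sample the local covariance at a point has \<open>d\<close> eigenvalues of order \<open>h\<^sup>2\<close> along the
  tangent space, while the normal components of the sample are of order \<open>\<sigma> + h\<^sup>2 / \<rho>\<close>; hence the
  estimated tangent spaces deviate by an angle of order \<open>\<sigma> / h + h / \<rho>\<close>.

  The guarantee for the weight assignment concerns noise-free nets with exact tangent spaces.  It is
  applied to another manifold: adding to the identity a sum of bumps with disjoint supports, one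
  affine displacement of size \<open>\<sigma>\<close> and slope \<open>\<theta>\<close> for each point of the \<open>\<epsilon>\<close>-separated net, gives a
  smooth diffeomorphism \<open>\<Phi>\<close>, isotopic to the identity, such that \<open>\<Phi> ` M\<close> passes through the sampled
  points with the estimated tangent spaces.  Its second-order part is of order
  \<open>\<sigma> / \<epsilon>\<^sup>2 + \<theta> / \<epsilon> \<le> 1 / \<rho>\<close>, and by Federer's characterisation of the reach through
  \<open>norm (q - a - oproj T (q - a)) \<le> (norm (q - a))\<^sup>2 / (2 * \<rho>)\<close>, the image keeps a reach of at least \<open>\<rho> / 4\<close>.
\<close>

section \<open>Linear algebra: projections, bases and angles between finite-dimensional
  subspaces\<close>

section \<open>Orthogonal projections onto finite-dimensional subspaces\<close>

text \<open>The weights are an arbitrary function of the net and the spaces. No continuity is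
  assumed, so the complex on estimated data cannot be compared with the complex on nearby exact
  data; hence the manifold is moved instead of the data. Controlling the second-order part explains
  the scale \<open>\<epsilon> = c2 * max h (\<rho> * \<sigma> / h)\<close>. Both entries of the
  maximum bound \<epsilon> from below. Their product gives \<sigma> \<le> \<epsilon>^2 / (c2^2
  \<rho>), their sum \<sigma>/h + h/\<rho> \<le> 2 \<epsilon> / (c2 \<rho>), so
  \<sigma>/\<epsilon>^2 and \<theta>/\<epsilon> fall below any given fraction of 1/\<rho> once c2 is
  large. The regularity \<open>k\<close> may be 1, so there is no second fundamental form and
  curvature enters only through quadratic bounds on secants; it may also be \<infinity>, so the
  bumps have to be smooth. Constants must not involve the ambient dimension, so volumes and packings
  are estimated through the \<open>d\<close> tangential coordinates alone.\<close>

definition onb :: "'a::real_inner set \<Rightarrow> 'a set \<Rightarrow> bool" where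
  "onb B T \<longleftrightarrow> finite B \<and> pairwise orthogonal B \<and> (\<forall>b\<in>B. norm b = 1) \<and> span B = T"

text \<open>The ambient inner product space is infinite-dimensional and incomplete, so projections
  and closedness have to come from a finite spanning set.\<close>

definition fin_subspace :: "'a::real_vector set \<Rightarrow> bool" where
  "fin_subspace T \<longleftrightarrow> (\<exists>B. finite B \<and> span B = T)"

lemma fin_subspace_imp_subspace: "fin_subspace T \<Longrightarrow> subspace T"
  by (auto simp: fin_subspace_def)

lemma fin_subspace_onb:
  fixes T :: "'a::real_inner set"
  assumes "fin_subspace T"
  obtains B where "onb B T"
proof -
  obtain C where C: "finite C" "span C = T" using assms by (auto simp: fin_subspace_def)
  obtain E where E: "finite E" "span E = T" "pairwise orthogonal E"
    using basis_orthogonal[OF C(1)] C by auto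
  let ?c = "\<lambda>x::'a. inverse (norm x)"
  let ?E = "E - {0}"
  have "span ((\<lambda>x. ?c x *\<^sub>R x) ` ?E) = span ?E"
    using E by (intro span_image_scale) auto
  also have "\<dots> = T" using E by (simp add: span_delete_0)
  finally have s: "span ((\<lambda>x. ?c x *\<^sub>R x) ` ?E) = T" .
  have "pairwise orthogonal ((\<lambda>x. ?c x *\<^sub>R x) ` ?E)"
    using E(3) by (auto simp: pairwise_def orthogonal_def)
  then have "onb ((\<lambda>x. ?c x *\<^sub>R x) ` ?E) T"
    using E s by (auto simp: onb_def)
  then show ?thesis by (rule that)
qed

lemma onb_inner: "onb B T \<Longrightarrow> b \<in> B \<Longrightarrow> c \<in> B \<Longrightarrow> inner b c = (if b = c then 1 else 0)"
  by (auto simp: onb_def pairwise_def orthogonal_def dot_square_norm)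

lemma onb_finite: "onb B T \<Longrightarrow> finite B"
  by (simp add: onb_def)

lemma onb_subset: "onb B T \<Longrightarrow> B \<subseteq> T"
  by (auto simp: onb_def span_base)

lemma onb_independent: "onb B T \<Longrightarrow> independent B"
  by (rule pairwise_orthogonal_independent) (auto simp: onb_def)

lemma onb_card: "onb B T \<Longrightarrow> card B = dim T"
  using onb_independent[of B T] by (auto simp: onb_def dim_eq_card_independent)

lemma onb_fin_subspace: "onb B T \<Longrightarrow> fin_subspace T"
  by (auto simp: onb_def fin_subspace_def)

text \<open>On a \<open>fin_subspace\<close> the choice of basis is immaterial:
  \<open>oproj_eqI\<close> characterises the value by orthogonality.\<close>

definition oproj :: "'a::real_inner set \<Rightarrow> 'a \<Rightarrow> 'a" where
  "oproj T x = (\<Sum>b\<in>(SOME B. onb B T). inner x b *\<^sub>R b)"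

context
  fixes T :: "'a::real_inner set"
  assumes T: "fin_subspace T"
begin

lemma onb_some: "onb (SOME B. onb B T) T"
  using fin_subspace_onb[OF T] by (metis someI_ex)

lemma oproj_in: "oproj T x \<in> T"
  unfolding oproj_def using onb_some
  by (metis (no_types, lifting) onb_def span_base span_scale span_sum)

lemma oproj_perp: assumes "t \<in> T" shows "inner (x - oproj T x) t = 0"
proof -
  define B where "B = (SOME B. onb B T)"
  have B: "onb B T" unfolding B_def by (rule onb_some)
  have "t \<in> span B" using B assms by (simp add: onb_def)
  then show ?thesis
  proof (induction rule: span_induct)
    case base show ?case by (auto simp: subspace_def inner_add_right)
  next
    case (step b)
    have "inner (oproj T x) b = (\<Sum>c\<in>B. inner x c * inner c b)"
      by (simp add: oproj_def B_def[symmetric] inner_sum_left)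
    also have "\<dots> = (\<Sum>c\<in>B. if c = b then inner x b else 0)"
      using onb_inner[OF B] step by (intro sum.cong) auto
    also have "\<dots> = inner x b" using step onb_finite[OF B] by simp
    finally show ?case by (simp add: inner_diff_left)
  qed
qed

lemma oproj_perp': "t \<in> T \<Longrightarrow> inner t (x - oproj T x) = 0"
  using oproj_perp by (simp add: inner_commute)

lemma oproj_eqI: assumes "y \<in> T" "\<And>t. t \<in> T \<Longrightarrow> inner (x - y) t = 0" shows "oproj T x = y"
proof -
  have "oproj T x - y \<in> T"
    using assms(1) oproj_in fin_subspace_imp_subspace[OF T] by (simp add: subspace_diff)
  then have "inner (x - oproj T x) (oproj T x - y) = 0" "inner (x - y) (oproj T x - y) = 0"
    using oproj_perp assms by auto
  then have "inner (oproj T x - y) (oproj T x - y) = 0"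
    by (simp add: inner_diff_left)
  then show ?thesis by simp
qed

lemma oproj_id: "x \<in> T \<Longrightarrow> oproj T x = x"
  by (rule oproj_eqI) auto

lemma oproj_oproj [simp]: "oproj T (oproj T x) = oproj T x"
  by (rule oproj_id) (rule oproj_in)

lemma linear_oproj: "linear (oproj T)"
proof (rule linearI)
  fix x y show "oproj T (x + y) = oproj T x + oproj T y"
    using oproj_perp[of _ x] oproj_perp[of _ y]
    by (intro oproj_eqI)
      (auto simp: oproj_in fin_subspace_imp_subspace[OF T] subspace_add inner_add_left inner_diff_left)
next
  fix r x show "oproj T (r *\<^sub>R x) = r *\<^sub>R oproj T x"
    using oproj_perp[of _ x]
    by (intro oproj_eqI)
      (auto simp: oproj_in fin_subspace_imp_subspace[OF T] subspace_scale inner_diff_left)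
qed

lemma norm_oproj_pyth: "(norm x)\<^sup>2 = (norm (oproj T x))\<^sup>2 + (norm (x - oproj T x))\<^sup>2"
proof -
  have "inner (oproj T x) (x - oproj T x) = 0" by (rule oproj_perp'[OF oproj_in])
  then show ?thesis
    using norm_add_Pythagorean[of "oproj T x" "x - oproj T x"] by (simp add: orthogonal_def)
qed

lemma norm_oproj_le: "norm (oproj T x) \<le> norm x"
  using norm_oproj_pyth[of x] by (metis le_add_same_cancel1 norm_ge_zero power2_le_imp_le zero_le_power2)

lemma norm_minus_oproj_le: "norm (x - oproj T x) \<le> norm x"
  using norm_oproj_pyth[of x] by (metis le_add_same_cancel2 norm_ge_zero power2_le_imp_le zero_le_power2)

lemma bounded_linear_oproj: "bounded_linear (oproj T)"
  using linear_oproj norm_oproj_le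
  by (intro bounded_linear_intro[of _ 1]) (auto simp: linear_add linear_scale)

lemma norm_minus_oproj_min: assumes "t \<in> T" shows "norm (x - oproj T x) \<le> norm (x - t)"
proof -
  have "oproj T (x - t) = oproj T x - t"
    using assms by (simp add: linear_diff[OF linear_oproj] oproj_id)
  then show ?thesis using norm_minus_oproj_le[of "x - t"] by simp
qed

lemma oproj_adjoint: "inner (oproj T x) y = inner x (oproj T y)"
proof -
  have "inner (oproj T x) (y - oproj T y) = 0" "inner (x - oproj T x) (oproj T y) = 0"
    by (auto simp: oproj_perp oproj_perp' oproj_in)
  then show ?thesis by (simp add: inner_diff_left inner_diff_right)
qed

lemma closed_fin_subspace: "closed T"
proof -
  have "T = {x. oproj T x = x}" proof (intro set_eqI iffI)
    fix x assume "x \<in> {x. oproj T x = x}"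
    then show "x \<in> T" using oproj_in[of x] by simp
  qed (simp add: oproj_id)
  moreover have "closed {x. oproj T x = x}"
    by (intro closed_Collect_eq bounded_linear.continuous_on[OF bounded_linear_oproj] continuous_on_id)
  ultimately show ?thesis by simp
qed

end

lemma onb_expand:
  assumes "onb B T" "x \<in> T" shows "x = (\<Sum>b\<in>B. inner x b *\<^sub>R b)"
proof -
  have T: "fin_subspace T" using assms onb_fin_subspace by blast
  have "oproj T x = (\<Sum>b\<in>B. inner x b *\<^sub>R b)"
  proof (rule oproj_eqI[OF T])
    show "(\<Sum>b\<in>B. inner x b *\<^sub>R b) \<in> T"
      using assms(1) by (metis (no_types, lifting) onb_def span_base span_scale span_sum)
    fix t assume "t \<in> T"
    then have "t \<in> span B" using assms(1) by (simp add: onb_def)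
    then show "inner (x - (\<Sum>b\<in>B. inner x b *\<^sub>R b)) t = 0"
    proof (induction rule: span_induct)
      case base show ?case by (auto simp: subspace_def inner_add_right)
    next
      case (step b)
      have "(\<Sum>c\<in>B. inner x c * inner c b) = (\<Sum>c\<in>B. if c = b then inner x b else 0)"
        using onb_inner[OF assms(1)] step by (intro sum.cong) auto
      also have "\<dots> = inner x b" using step onb_finite[OF assms(1)] by simp
      finally show ?case by (simp add: inner_diff_left inner_sum_left)
    qed
  qed
  then show ?thesis using oproj_id[OF T assms(2)] by simp
qed

text \<open>A vector of \<open>T\<close> outside the image would extend the image of a basis of
  \<open>S\<close> to an independent set with one element more than \<open>dim T\<close>.\<close>

lemma linear_inj_eq_dim_onto:
  fixes S :: "'a::real_inner set" and T :: "'b::real_inner set"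
  assumes "fin_subspace S" "fin_subspace T" "linear f" "inj_on f S" "f ` S \<subseteq> T" "dim S = dim T"
  shows "f ` S = T"
proof (rule antisym[OF assms(5)], rule ccontr)
  assume "\<not> T \<subseteq> f ` S"
  then obtain w where w: "w \<in> T" "w \<notin> f ` S" by blast
  obtain B where B: "onb B S" using fin_subspace_onb[OF assms(1)] .
  obtain C where C: "onb C T" using fin_subspace_onb[OF assms(2)] .
  have sp: "span B = S" using B by (simp add: onb_def)
  have i: "independent (f ` B)"
    using linear_independent_injective_image[OF assms(3) onb_independent[OF B]] assms(4) sp by simp
  have "span (f ` B) = f ` S" using linear_span_image[OF assms(3)] sp by metis
  then have w': "w \<notin> span (f ` B)" using w by simp
  then have "independent (insert w (f ` B))" using i by (simp add: independent_insert)
  moreover have "insert w (f ` B) \<subseteq> span C"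
    using w assms(5) onb_subset[OF B] C by (auto simp: onb_def)
  ultimately have "card (insert w (f ` B)) \<le> card C"
    using independent_span_bound[OF onb_finite[OF C]] by blast
  moreover have "card (insert w (f ` B)) = Suc (card B)"
  proof -
    have "w \<notin> f ` B" using w' span_superset[of "f ` B"] by blast
    moreover have "card (f ` B) = card B"
      using assms(4) onb_subset[OF B] by (meson card_image inj_on_subset)
    ultimately show ?thesis using onb_finite[OF B] by simp
  qed
  ultimately show False using onb_card[OF B] onb_card[OF C] assms(6) by simp
qed

lemma fin_subspace_eq_dim:
  fixes S T :: "'a::real_inner set"
  assumes "fin_subspace S" "fin_subspace T" "S \<subseteq> T" "dim S = dim T" shows "S = T"
  using linear_inj_eq_dim_onto[of S T "\<lambda>x. x"] assms by (auto simp: linear_iff)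

lemma linear_inj_onI:
  assumes "linear f" "subspace S" "\<And>x. x \<in> S \<Longrightarrow> f x = 0 \<Longrightarrow> x = 0"
  shows "inj_on f S"
proof (rule inj_onI)
  fix x y assume "x \<in> S" "y \<in> S" "f x = f y"
  then have "f (x - y) = 0" "x - y \<in> S"
    using assms by (auto simp: linear_diff subspace_diff)
  then show "x = y" using assms(3)[of "x - y"] by simp
qed

text \<open>\<kappa> bounds the sine of the largest principal angle, that is, the one-sided gap from
  \<open>S\<close> to \<open>T\<close>.\<close>

definition sub_angle :: "'a::real_inner set \<Rightarrow> 'a set \<Rightarrow> real \<Rightarrow> bool" where
  "sub_angle S T \<kappa> \<longleftrightarrow> (\<forall>v\<in>S. norm (v - oproj T v) \<le> \<kappa> * norm v)"

lemma sub_angle_onto: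
  assumes "fin_subspace S" "fin_subspace T" "dim S = dim T" "\<kappa> < 1" "sub_angle S T \<kappa>"
  shows "oproj T ` S = T" "inj_on (oproj T) S"
proof -
  show i: "inj_on (oproj T) S"
  proof (rule linear_inj_onI[OF linear_oproj[OF assms(2)] fin_subspace_imp_subspace[OF assms(1)]])
    fix x assume "x \<in> S" "oproj T x = 0"
    then have "norm x \<le> \<kappa> * norm x" using assms(5) by (auto simp: sub_angle_def)
    then have "(1 - \<kappa>) * norm x \<le> 0" by (simp add: algebra_simps)
    then show "x = 0" using assms(4) by (simp add: mult_le_0_iff)
  qed
  show "oproj T ` S = T"
    by (rule linear_inj_eq_dim_onto[OF assms(1,2) linear_oproj[OF assms(2)] i _ assms(3)])
      (auto simp: oproj_in assms(2))
qed

text \<open>Equal dimensions make every \<open>w\<close> in \<open>T\<close> a projection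
  \<open>oproj T v\<close> with \<open>v\<close> in \<open>S\<close>. Then (norm w)^2 = inner w v =
  inner (oproj S w) v, and Cauchy-Schwarz together with the bound of norm v by norm w shows that
  \<open>oproj S w\<close> keeps at least the fraction 1 - \<kappa>^2 of the squared length of
  \<open>w\<close>.\<close>

lemma sub_angle_sym:
  assumes S: "fin_subspace S" and T: "fin_subspace T" and "dim S = dim T" "0 \<le> \<kappa>" "\<kappa> < 1" "sub_angle S T \<kappa>"
  shows "sub_angle T S \<kappa>"
  unfolding sub_angle_def
proof
  fix w assume w: "w \<in> T"
  obtain v where v: "v \<in> S" "w = oproj T v"
    using sub_angle_onto(1)[OF S T assms(3,5,6)] w by blast
  show "norm (w - oproj S w) \<le> \<kappa> * norm w"
  proof (cases "v = 0")
    case True then show ?thesis using v by (simp add: linear_0[OF linear_oproj[OF T]] linear_0[OF linear_oproj[OF S]])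
  next
    case False
    have wv: "inner w v = (norm w)\<^sup>2"
      using oproj_perp[OF T oproj_in[OF T, of v], of v] v
      by (simp add: inner_diff_left dot_square_norm[symmetric] inner_commute[of v] oproj_oproj[OF T])
    have "inner w v = inner (oproj S w) v"
      using oproj_perp[OF S v(1), of w] by (simp add: inner_diff_left)
    also have "\<dots> \<le> norm (oproj S w) * norm v" by (rule norm_cauchy_schwarz)
    finally have 1: "(norm w)\<^sup>2 \<le> norm (oproj S w) * norm v" using wv by simp
    have "(norm v)\<^sup>2 = (norm w)\<^sup>2 + (norm (v - w))\<^sup>2"
      using norm_oproj_pyth[OF T, of v] v by simp
    moreover have "(norm (v - w))\<^sup>2 \<le> \<kappa>\<^sup>2 * (norm v)\<^sup>2"
    proof -
      have "norm (v - w) \<le> \<kappa> * norm v" using assms(6) v by (auto simp: sub_angle_def)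
      then have "(norm (v - w))\<^sup>2 \<le> (\<kappa> * norm v)\<^sup>2" by (intro power_mono) auto
      then show ?thesis by (simp add: power_mult_distrib)
    qed
    ultimately have 2: "(1 - \<kappa>\<^sup>2) * (norm v)\<^sup>2 \<le> (norm w)\<^sup>2" by (simp add: algebra_simps)
    have "((norm w)\<^sup>2)\<^sup>2 \<le> (norm (oproj S w) * norm v)\<^sup>2" using 1 by (intro power_mono) auto
    then have 3: "(norm w)\<^sup>2 * (norm w)\<^sup>2 \<le> (norm (oproj S w))\<^sup>2 * (norm v)\<^sup>2"
      unfolding power_mult_distrib by (simp add: power2_eq_square)
    have "(1 - \<kappa>\<^sup>2) * (norm v)\<^sup>2 * (norm w)\<^sup>2 \<le> (norm w)\<^sup>2 * (norm w)\<^sup>2"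
      using 2 by (intro mult_right_mono) auto
    with 3 have "(norm v)\<^sup>2 * ((1 - \<kappa>\<^sup>2) * (norm w)\<^sup>2) \<le> (norm v)\<^sup>2 * (norm (oproj S w))\<^sup>2"
      by (simp add: algebra_simps)
    then have 4: "(1 - \<kappa>\<^sup>2) * (norm w)\<^sup>2 \<le> (norm (oproj S w))\<^sup>2"
      using False by simp
    have "(norm (w - oproj S w))\<^sup>2 = (norm w)\<^sup>2 - (norm (oproj S w))\<^sup>2"
      using norm_oproj_pyth[OF S, of w] by simp
    also have "\<dots> \<le> (\<kappa> * norm w)\<^sup>2" using 4 by (simp add: power_mult_distrib left_diff_distrib)
    finally show ?thesis by (rule power2_le_imp_le) (simp add: assms(4))
  qed
qed

lemma sub_angle_trans:
  assumes S: "fin_subspace S" and T: "fin_subspace T" and U: "fin_subspace U"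
    and "sub_angle S T \<kappa>" "sub_angle T U \<mu>" "0 \<le> \<mu>"
  shows "sub_angle S U (\<kappa> + \<mu>)"
  unfolding sub_angle_def
proof
  fix v assume v: "v \<in> S"
  have "norm (v - oproj U v) \<le> norm (v - oproj U (oproj T v))"
    by (rule norm_minus_oproj_min[OF U oproj_in[OF U]])
  also have "\<dots> \<le> norm (v - oproj T v) + norm (oproj T v - oproj U (oproj T v))"
    by (rule norm_diff_triangle_ineq[of v "oproj T v" "oproj T v", simplified])
  also have "\<dots> \<le> \<kappa> * norm v + \<mu> * norm (oproj T v)"
    using assms(4,5) v oproj_in[OF T] by (intro add_mono) (auto simp: sub_angle_def)
  also have "\<dots> \<le> \<kappa> * norm v + \<mu> * norm v"
    using norm_oproj_le[OF T] assms(6) by (intro add_left_mono mult_left_mono) auto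
  finally show "norm (v - oproj U v) \<le> (\<kappa> + \<mu>) * norm v" by (simp add: algebra_simps)
qed

lemma sub_angle_mono: "sub_angle S T \<kappa> \<Longrightarrow> \<kappa> \<le> \<mu> \<Longrightarrow> sub_angle S T \<mu>"
  unfolding sub_angle_def by (meson mult_right_mono norm_ge_zero order_trans)

text \<open>Otherwise projection onto \<open>span U\<close> would embed \<open>T\<close> in a space
  of smaller dimension. This supplies the test vector for the min-max bound on eigenvalues.\<close>

lemma ex_nonzero_orthogonal:
  fixes T :: "'a::real_inner set"
  assumes T: "fin_subspace T" and U: "finite U" "card U < dim T"
  shows "\<exists>t\<in>T. t \<noteq> 0 \<and> (\<forall>u\<in>U. inner t u = 0)"
proof (rule ccontr)
  assume "\<not> ?thesis"
  then have n: "\<And>t. t \<in> T \<Longrightarrow> (\<forall>u\<in>U. inner t u = 0) \<Longrightarrow> t = 0" by blast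
  have V: "fin_subspace (span U)" using U by (auto simp: fin_subspace_def)
  obtain B where B: "onb B T" using fin_subspace_onb[OF T] .
  have "inj_on (oproj (span U)) T"
  proof (rule linear_inj_onI[OF linear_oproj[OF V] fin_subspace_imp_subspace[OF T]])
    fix x assume "x \<in> T" "oproj (span U) x = 0"
    then show "x = 0" using n[of x] oproj_perp[OF V, of _ x] by (auto simp: span_base)
  qed
  then have inj: "inj_on (oproj (span U)) (span B)" using B by (simp add: onb_def)
  then have "independent (oproj (span U) ` B)"
    using linear_independent_injective_image[OF linear_oproj[OF V] onb_independent[OF B]] by simp
  then have "card (oproj (span U) ` B) \<le> card U"
    using independent_span_bound[OF U(1)] oproj_in[OF V] by blast
  moreover have "card (oproj (span U) ` B) = card B"
    using inj span_superset by (meson card_image inj_on_subset)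
  ultimately show False using U onb_card[OF B] by simp
qed

text \<open>Each coefficient of \<open>v\<close> is bounded by \<open>norm v\<close> separately; the
  resulting factor \<open>card B\<close> becomes the factor \<open>d\<close> in the angle bound for
  the estimated tangent spaces.\<close>

lemma sub_angle_onb:
  assumes S: "fin_subspace S" and T: "fin_subspace T" and B: "onb B S" "\<And>b. b \<in> B \<Longrightarrow> norm (b - oproj T b) \<le> \<kappa>"
    and "0 \<le> \<kappa>"
  shows "sub_angle S T (real (card B) * \<kappa>)"
  unfolding sub_angle_def
proof
  fix v assume v: "v \<in> S"
  have e: "v = (\<Sum>b\<in>B. inner v b *\<^sub>R b)" by (rule onb_expand[OF B(1) v])
  have "v - oproj T v = (\<Sum>b\<in>B. inner v b *\<^sub>R (b - oproj T b))"
    by (subst (1 2) e) (simp add: linear_sum[OF linear_oproj[OF T]] linear_scale[OF linear_oproj[OF T]]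
        sum_subtractf scaleR_diff_right)
  also have "norm \<dots> \<le> (\<Sum>b\<in>B. norm v * \<kappa>)"
  proof (rule sum_norm_le)
    fix b assume b: "b \<in> B"
    have "\<bar>inner v b\<bar> \<le> norm v * norm b" by (rule Cauchy_Schwarz_ineq2)
    also have "norm b = 1" using B(1) b by (simp add: onb_def)
    finally show "norm (inner v b *\<^sub>R (b - oproj T b)) \<le> norm v * \<kappa>"
      using B(2)[OF b] by (auto intro!: mult_mono)
  qed
  finally show "norm (v - oproj T v) \<le> real (card B) * \<kappa> * norm v" by (simp add: algebra_simps)
qed


section \<open>The spaces \<open>Rn D\<close>\<close>

lemma coord_eq_inner: "coord x i = inner x (unit_fvec i)"
  by (subst inner_commute, subst inner_fvec_superset[of "{i}"]) auto

lemma onb_Rn: "onb (unit_fvec ` {..<D}) (Rn D)"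
  by (auto simp: onb_def span_unit_fvec pairwise_def orthogonal_def inner_unit_fvec norm_eq_sqrt_inner)

lemma fin_subspace_Rn: "fin_subspace (Rn D)"
  by (rule onb_fin_subspace[OF onb_Rn])

lemma closed_Rn: "closed (Rn D)"
  by (rule closed_fin_subspace[OF fin_subspace_Rn])

lemma Rn_diff: "x \<in> Rn D \<Longrightarrow> y \<in> Rn D \<Longrightarrow> x - y \<in> Rn D"
  and Rn_add: "x \<in> Rn D \<Longrightarrow> y \<in> Rn D \<Longrightarrow> x + y \<in> Rn D"
  and Rn_scale: "x \<in> Rn D \<Longrightarrow> c *\<^sub>R x \<in> Rn D"
  and Rn_zero: "0 \<in> Rn D"
  using subspace_Rn[of D] by (auto simp: subspace_def subspace_diff)

lemma coord_le_norm: "\<bar>coord x i\<bar> \<le> norm x"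
  using Cauchy_Schwarz_ineq2[of x "unit_fvec i"]
  by (simp add: coord_eq_inner[symmetric] norm_eq_sqrt_inner[of "unit_fvec i"] inner_unit_fvec)

text \<open>Closed bounded sets of the whole sequence space need not be compact; compactness is
  gained one coordinate at a time, through the image of a product with an interval.\<close>

lemma compact_Rn_box: "compact {x \<in> Rn D. \<forall>i<D. \<bar>coord x i\<bar> \<le> r}"
proof (induction D)
  case 0
  have "{x \<in> Rn 0. \<forall>i<0. \<bar>coord x i\<bar> \<le> r} = {0}"
    by (auto simp: Rn_def intro: fvec_eqI)
  then show ?case by simp
next
  case (Suc D)
  let ?K = "{x \<in> Rn D. \<forall>i<D. \<bar>coord x i\<bar> \<le> r}"
  let ?f = "\<lambda>(x, t). x + t *\<^sub>R unit_fvec D"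
  have "compact (?f ` (?K \<times> {-r..r}))"
    by (intro compact_continuous_image compact_Times Suc compact_Icc)
      (auto simp: case_prod_unfold intro!: continuous_intros)
  moreover have "{x \<in> Rn (Suc D). \<forall>i<Suc D. \<bar>coord x i\<bar> \<le> r} = ?f ` (?K \<times> {-r..r})" (is "?A = ?B")
  proof
    show "?A \<subseteq> ?B"
    proof
      fix x assume x: "x \<in> ?A"
      then have "x - coord x D *\<^sub>R unit_fvec D \<in> ?K" "coord x D \<in> {-r..r}"
        by (auto simp: Rn_def abs_le_iff le_Suc_eq dest!: spec[of _ D])
      then show "x \<in> ?B" by (intro image_eqI[of _ _ "(x - coord x D *\<^sub>R unit_fvec D, coord x D)"]) auto
    qed
    show "?B \<subseteq> ?A" by (auto simp: Rn_def less_Suc_eq)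
  qed
  ultimately show ?case by simp
qed

lemma compact_Rn_bounded:
  assumes "closed S" "bounded S" "S \<subseteq> Rn D" shows "compact S"
proof -
  obtain r where r: "\<And>x. x \<in> S \<Longrightarrow> norm x \<le> r" using assms(2) by (auto simp: bounded_iff)
  have "S = S \<inter> {x \<in> Rn D. \<forall>i<D. \<bar>coord x i\<bar> \<le> r}"
    using r assms(3) coord_le_norm order_trans by blast
  then show ?thesis using closed_Int_compact[OF assms(1) compact_Rn_box, of D r] by simp
qed

lemma compact_Rn_cball: "compact (cball x r \<inter> Rn D)"
  by (rule compact_Rn_bounded[of _ D]) (auto intro: closed_Int closed_Rn)

section \<open>Tangent spaces of embedded C1 submanifolds, by secants, curves and charts\<close>

section \<open>Tangent spaces\<close>

text \<open>Tangency without charts: the secants of \<open>M\<close> at \<open>a\<close> make a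
  vanishing angle with \<open>T\<close>. The lemmas \<open>normal_bound\<close> and
  \<open>federer\<close> see tangency only in this form.\<close>

definition tangent_approx :: "'a::real_inner set \<Rightarrow> 'a set \<Rightarrow> 'a \<Rightarrow> bool" where
  "tangent_approx M T a \<longleftrightarrow>
     (\<forall>e>0. \<exists>\<delta>>0. \<forall>q\<in>M. dist q a < \<delta> \<longrightarrow> norm ((q - a) - oproj T (q - a)) \<le> e * norm (q - a))"

lemma relopen_line:
  assumes "openin (top_of_set (Rn d)) U" "x \<in> U" "v \<in> Rn d"
  obtains \<tau> where "\<tau> > 0" "\<And>t. \<bar>t\<bar> < \<tau> \<Longrightarrow> x + t *\<^sub>R v \<in> U"
proof -
  obtain e where e: "e > 0" "ball x e \<inter> Rn d \<subseteq> U"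
    using assms(1,2) by (auto simp: openin_contains_ball)
  have x: "x \<in> Rn d" using assms(1,2) openin_imp_subset by blast
  show ?thesis
  proof (rule that[of "e / (norm v + 1)"])
    show "0 < e / (norm v + 1)" using e by (simp add: add_nonneg_pos)
    fix t :: real assume t: "\<bar>t\<bar> < e / (norm v + 1)"
    have "\<bar>t\<bar> * norm v \<le> \<bar>t\<bar> * (norm v + 1)" by (intro mult_left_mono) auto
    also have "\<dots> < e" using t by (simp add: pos_less_divide_eq add_nonneg_pos)
    finally have "x + t *\<^sub>R v \<in> ball x e" by (simp add: dist_norm)
    then show "x + t *\<^sub>R v \<in> U" using e x assms(3) Rn_add Rn_scale by blast
  qed
qed

text \<open>A subset of \<open>Rn d\<close> has empty interior in the ambient space, so derivatives
  within it are handled along lines with direction in \<open>Rn d\<close>, where the one-variable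
  theory applies.\<close>

lemma has_derivative_line:
  fixes f :: "fvec \<Rightarrow> 'b::real_normed_vector"
  assumes U: "openin (top_of_set (Rn d)) U" "x \<in> U" "v \<in> Rn d"
    and f: "(f has_derivative A) (at x within U)"
  shows "((\<lambda>t. f (x + t *\<^sub>R v)) has_vector_derivative A v) (at 0)"
proof -
  obtain \<tau> where \<tau>: "\<tau> > 0" "\<And>t. \<bar>t\<bar> < \<tau> \<Longrightarrow> x + t *\<^sub>R v \<in> U"
    using relopen_line[OF U] by blast
  let ?I = "{-\<tau><..<\<tau>}"
  let ?g = "\<lambda>t::real. x + t *\<^sub>R v"
  have g: "(?g has_derivative (\<lambda>t. t *\<^sub>R v)) (at 0 within ?I)"
    by (auto intro!: derivative_eq_intros)
  have sub: "?g ` ?I \<subseteq> U" using \<tau>(2) by auto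
  have "(f has_derivative A) (at (?g 0) within ?g ` ?I)"
    using has_derivative_subset[OF f sub] by simp
  from has_derivative_in_compose[OF g this]
  have "((\<lambda>t. f (?g t)) has_derivative (\<lambda>t. A (t *\<^sub>R v))) (at 0 within ?I)" .
  moreover have "at (0::real) within ?I = at 0" using \<tau>(1) by (intro at_within_open) auto
  moreover have "(\<lambda>t. A (t *\<^sub>R v)) = (\<lambda>t. t *\<^sub>R A v)"
    using has_derivative_linear[OF f] by (simp add: linear_scale)
  ultimately show ?thesis by (simp add: has_vector_derivative_def)
qed

lemma has_derivative_relopen_unique:
  fixes f :: "fvec \<Rightarrow> 'b::real_normed_vector"
  assumes U: "openin (top_of_set (Rn d)) U" "x \<in> U" "v \<in> Rn d"
    and f: "(f has_derivative A) (at x within U)" "(f has_derivative B) (at x within U)"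
  shows "A v = B v"
  using has_derivative_line[OF U f(1)] has_derivative_line[OF U f(2)]
  by (rule vector_derivative_unique_at)

lemma inj_linear_lower_bound:
  fixes A :: "fvec \<Rightarrow> 'b::real_normed_vector"
  assumes "bounded_linear A" "inj_on A (Rn d)"
  obtains c where "c > 0" "\<And>v. v \<in> Rn d \<Longrightarrow> c * norm v \<le> norm (A v)"
proof -
  interpret bounded_linear A by (rule assms(1))
  let ?S = "{v \<in> Rn d. norm v = 1}"
  have "closed ({v. norm v = 1} \<inter> Rn d)"
    by (intro closed_Int closed_Rn closed_Collect_eq continuous_intros)
  moreover have "?S = {v. norm v = 1} \<inter> Rn d" by auto
  ultimately have S: "compact ?S"
    by (intro compact_Rn_bounded[of _ d]) (auto intro!: boundedI[of _ 1])
  show ?thesis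
  proof (cases "?S = {}")
    \<comment> \<open>An empty unit sphere means that \<open>Rn d\<close> is the zero space, and any
      constant works.\<close>
    case True
    have *: "v = 0" if "v \<in> Rn d" for v
    proof (rule ccontr)
      assume "v \<noteq> 0"
      then have "(1 / norm v) *\<^sub>R v \<in> ?S" using that by (auto intro: Rn_scale)
      then show False using True by blast
    qed
    show ?thesis by (intro that[of 1]) (auto dest: *)
  next
    case False
    obtain u where u: "u \<in> ?S" "\<And>v. v \<in> ?S \<Longrightarrow> norm (A u) \<le> norm (A v)"
      using continuous_attains_inf[OF S False continuous_on_norm[OF continuous_on[OF continuous_on_id]]]
      by blast
    have "A u \<noteq> 0"
    proof
      assume "A u = 0"
      then have "u = 0" using inj_onD[OF assms(2), of u 0] u(1) Rn_zero by (simp add: zero)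
      then show False using u(1) by simp
    qed
    moreover have "norm (A u) * norm v \<le> norm (A v)" if v: "v \<in> Rn d" for v
    proof (cases "v = 0")
      case False
      then have "(1 / norm v) *\<^sub>R v \<in> ?S" using v by (auto intro: Rn_scale)
      then have "norm (A u) \<le> norm (A ((1 / norm v) *\<^sub>R v))" by (rule u(2))
      then show ?thesis using False by (simp add: scaleR field_simps)
    qed simp
    ultimately show ?thesis by (intro that[of "norm (A u)"]) auto
  qed
qed

lemma has_vector_derivative_tendsto_0:
  assumes "(\<gamma> has_vector_derivative v) (at 0)"
  shows "((\<lambda>t. (\<gamma> t - \<gamma> 0) /\<^sub>R t) \<longlongrightarrow> v) (at 0)"
proof -
  have "((\<lambda>h. norm (\<gamma> h - \<gamma> 0 - h *\<^sub>R v) / norm h) \<longlongrightarrow> 0) (at 0)"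
    using assms by (simp add: has_vector_derivative_def has_derivative_at)
  then have "((\<lambda>h. norm ((\<gamma> h - \<gamma> 0) /\<^sub>R h - v)) \<longlongrightarrow> 0) (at 0)"
  proof (rule Lim_transform_eventually)
    show "\<forall>\<^sub>F h in at 0. norm (\<gamma> h - \<gamma> 0 - h *\<^sub>R v) / norm h = norm ((\<gamma> h - \<gamma> 0) /\<^sub>R h - v)"
      unfolding eventually_at
    proof (intro exI[of _ 1] conjI ballI impI)
      fix h :: real assume "h \<noteq> 0 \<and> dist h 0 < 1"
      then have "(\<gamma> h - \<gamma> 0) /\<^sub>R h - v = (\<gamma> h - \<gamma> 0 - h *\<^sub>R v) /\<^sub>R h"
        by (simp add: scaleR_diff_right)
      then show "norm (\<gamma> h - \<gamma> 0 - h *\<^sub>R v) / norm h = norm ((\<gamma> h - \<gamma> 0) /\<^sub>R h - v)"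
        by (simp add: divide_inverse)
    qed simp
  qed
  then show ?thesis by (simp add: tendsto_norm_zero_iff LIM_zero_iff)
qed

text \<open>The secant inequality passes to the limit of the difference quotients for every
  \<open>e\<close>, so the normal part of the velocity is zero.\<close>

lemma tangent_approx_curve:
  fixes M :: "fvec set"
  assumes T: "fin_subspace T" and M: "tangent_approx M T a" and v: "v \<in> tangent_space M a"
  shows "v \<in> T"
proof -
  obtain \<gamma> :: "real \<Rightarrow> fvec" where \<gamma>: "\<And>t. t \<in> {-1<..<1} \<Longrightarrow> \<gamma> t \<in> M" "\<gamma> 0 = a"
    "(\<gamma> has_vector_derivative v) (at 0)"
    using v unfolding tangent_space_def mem_Collect_eq by metis
  let ?w = "\<lambda>t. (\<gamma> t - a) /\<^sub>R t"
  interpret P: bounded_linear "oproj T" by (rule bounded_linear_oproj[OF T])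
  have w: "(?w \<longlongrightarrow> v) (at 0)"
    using has_vector_derivative_tendsto_0[OF \<gamma>(3)] \<gamma>(2) by simp
  have *: "norm (v - oproj T v) \<le> e * norm v" if e: "e > 0" for e
  proof -
    obtain \<delta> where \<delta>: "\<delta> > 0" "\<And>q. q \<in> M \<Longrightarrow> dist q a < \<delta> \<Longrightarrow> norm ((q - a) - oproj T (q - a)) \<le> e * norm (q - a)"
      using M e unfolding tangent_approx_def by meson
    have "(\<gamma> \<longlongrightarrow> a) (at 0)"
      using has_vector_derivative_continuous[OF \<gamma>(3)] \<gamma>(2) by (simp add: continuous_within)
    then have "eventually (\<lambda>t. dist (\<gamma> t) a < \<delta>) (at 0)" using \<delta>(1) tendstoD by blast
    moreover have "eventually (\<lambda>t::real. t \<in> {-1<..<1}) (at 0)"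
      by (rule eventually_at_in_open') auto
    ultimately have ev: "eventually (\<lambda>t. norm (?w t - oproj T (?w t)) \<le> e * norm (?w t)) (at 0)"
    proof eventually_elim
      case (elim t)
      have "norm ((\<gamma> t - a) - oproj T (\<gamma> t - a)) \<le> e * norm (\<gamma> t - a)"
        using \<delta>(2)[of "\<gamma> t"] \<gamma>(1) elim by auto
      then have "inverse \<bar>t\<bar> * norm ((\<gamma> t - a) - oproj T (\<gamma> t - a)) \<le> inverse \<bar>t\<bar> * (e * norm (\<gamma> t - a))"
        by (intro mult_left_mono) auto
      moreover have "?w t - oproj T (?w t) = ((\<gamma> t - a) - oproj T (\<gamma> t - a)) /\<^sub>R t"
        by (simp add: P.scaleR P.diff scaleR_diff_right)
      ultimately show ?case by (simp add: mult.left_commute)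
    qed
    show ?thesis
      by (rule tendsto_le[OF trivial_limit_at _ _ ev]; intro tendsto_intros w P.tendsto)
  qed
  have "norm (v - oproj T v) \<le> 0"
  proof (rule field_le_epsilon)
    fix e :: real assume e: "e > 0"
    have "norm (v - oproj T v) \<le> e / (norm v + 1) * norm v"
      using e by (intro *) (simp add: add_nonneg_pos)
    also have "\<dots> \<le> e" using e by (simp add: pos_divide_le_eq add_nonneg_pos distrib_left)
    finally show "norm (v - oproj T v) \<le> 0 + e" by simp
  qed
  then have "v = oproj T v" by simp
  then show ?thesis using oproj_in[OF T] by metis
qed

definition chart :: "nat \<Rightarrow> fvec set \<Rightarrow> fvec set \<Rightarrow> (fvec \<Rightarrow> fvec) \<Rightarrow> (fvec \<Rightarrow> fvec) \<Rightarrow> (fvec \<Rightarrow> fvec \<Rightarrow> fvec) \<Rightarrow> bool" where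
  "chart d M U \<phi> \<psi> \<phi>' \<longleftrightarrow>
     openin (top_of_set (Rn d)) U \<and> openin (top_of_set M) (\<phi> ` U) \<and>
     homeomorphism U (\<phi> ` U) \<phi> \<psi> \<and> (\<forall>x\<in>U. (\<phi> has_derivative \<phi>' x) (at x within U)) \<and>
     (\<forall>v\<in>Rn d. continuous_on U (\<lambda>x. \<phi>' x v)) \<and> (\<forall>x\<in>U. inj_on (\<phi>' x) (Rn d))"

lemma submanifold_chart:
  assumes "submanifold k D d M" "1 \<le> k" "p \<in> M"
  obtains U \<phi> \<psi> \<phi>' where "p \<in> \<phi> ` U" "chart d M U \<phi> \<psi> \<phi>'"
proof -
  obtain U \<phi> \<psi> where U: "openin (top_of_set (Rn d)) U" "p \<in> \<phi> ` U" "openin (top_of_set M) (\<phi> ` U)"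
    "homeomorphism U (\<phi> ` U) \<phi> \<psi>" "\<And>j. enat j \<le> k \<Longrightarrow> Ck_on j d \<phi> U"
    "\<And>x. x \<in> U \<Longrightarrow> \<exists>A. (\<phi> has_derivative A) (at x within U) \<and> inj_on A (Rn d)"
    using assms(1,3) unfolding submanifold_def by metis
  have "Ck_on (Suc 0) d \<phi> U" using U(5)[of 1] assms(2) by (simp add: one_enat_def)
  then obtain \<phi>' where \<phi>': "\<And>x. x \<in> U \<Longrightarrow> (\<phi> has_derivative \<phi>' x) (at x within U)"
    "\<And>v. v \<in> Rn d \<Longrightarrow> continuous_on U (\<lambda>x. \<phi>' x v)" by auto
  have "inj_on (\<phi>' x) (Rn d)" if x: "x \<in> U" for x
  proof -
    obtain A where A: "(\<phi> has_derivative A) (at x within U)" "inj_on A (Rn d)" using U(6)[OF x] by blast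
    have "A v = \<phi>' x v" if "v \<in> Rn d" for v
      by (rule has_derivative_relopen_unique[OF U(1) x that A(1) \<phi>'(1)[OF x]])
    then show ?thesis using A(2) by (simp cong: inj_on_cong)
  qed
  then have "chart d M U \<phi> \<psi> \<phi>'" using U \<phi>' by (simp add: chart_def)
  then show ?thesis using that U(2) by blast
qed

lemma chart_near:
  assumes c: "chart d M U \<phi> \<psi> \<phi>'" and x: "x \<in> U" and "\<eta> > 0"
  obtains \<delta> where "\<delta> > 0" "\<And>q. q \<in> M \<Longrightarrow> dist q (\<phi> x) < \<delta> \<Longrightarrow> \<exists>y\<in>U. q = \<phi> y \<and> dist y x < \<eta>"
proof -
  have h: "homeomorphism U (\<phi> ` U) \<phi> \<psi>" and o: "openin (top_of_set M) (\<phi> ` U)"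
    using c by (auto simp: chart_def)
  obtain e where e: "e > 0" "ball (\<phi> x) e \<inter> M \<subseteq> \<phi> ` U"
    using o x by (auto simp: openin_contains_ball)
  have "continuous_on (\<phi> ` U) \<psi>" using h by (simp add: homeomorphism_def)
  then obtain \<delta> where \<delta>: "\<delta> > 0" "\<And>q. q \<in> \<phi> ` U \<Longrightarrow> dist q (\<phi> x) < \<delta> \<Longrightarrow> dist (\<psi> q) (\<psi> (\<phi> x)) < \<eta>"
    using x \<open>\<eta> > 0\<close> unfolding continuous_on_iff by blast
  show ?thesis
  proof (rule that[of "min e \<delta>"])
    show "0 < min e \<delta>" using e \<delta> by simp
    fix q assume q: "q \<in> M" "dist q (\<phi> x) < min e \<delta>"
    then have "q \<in> \<phi> ` U" using e by (auto simp: dist_commute)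
    then obtain y where y: "y \<in> U" "q = \<phi> y" by blast
    moreover have "\<psi> (\<phi> y) = y" "\<psi> (\<phi> x) = x" using h x y by (auto simp: homeomorphism_def)
    ultimately show "\<exists>y\<in>U. q = \<phi> y \<and> dist y x < \<eta>" using \<delta>(2)[of q] q by auto
  qed
qed

lemma chart_fin_subspace:
  assumes c: "chart d M U \<phi> \<psi> \<phi>'" and x: "x \<in> U"
  shows "fin_subspace (\<phi>' x ` Rn d)" "dim (\<phi>' x ` Rn d) = d"
proof -
  have bl: "bounded_linear (\<phi>' x)" and inj: "inj_on (\<phi>' x) (Rn d)"
    using c x by (auto simp: chart_def intro: has_derivative_bounded_linear)
  then have l: "linear (\<phi>' x)" by (simp add: bounded_linear.linear)
  have s: "span (\<phi>' x ` unit_fvec ` {..<d}) = \<phi>' x ` Rn d"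
    using linear_span_image[OF l] span_unit_fvec by metis
  then show "fin_subspace (\<phi>' x ` Rn d)"
    unfolding fin_subspace_def by (intro exI[of _ "\<phi>' x ` unit_fvec ` {..<d}"]) simp
  have "independent (\<phi>' x ` unit_fvec ` {..<d})"
    using linear_independent_injective_image[OF l independent_unit_fvec] inj span_unit_fvec by simp
  then have "dim (\<phi>' x ` Rn d) = card (\<phi>' x ` unit_fvec ` {..<d})"
    using s dim_span_eq_card_independent by (metis (no_types))
  also have "\<dots> = d"
  proof -
    have "unit_fvec ` {..<d} \<subseteq> Rn d" by auto
    then have "card (\<phi>' x ` unit_fvec ` {..<d}) = card (unit_fvec ` {..<d})"
      using inj by (meson card_image inj_on_subset)
    then show ?thesis by (simp add: card_image inj_on_subset[OF inj_unit_fvec])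
  qed
  finally show "dim (\<phi>' x ` Rn d) = d" .
qed

lemma chart_tangent_approx:
  assumes c: "chart d M U \<phi> \<psi> \<phi>'" and x: "x \<in> U"
  shows "tangent_approx M (\<phi>' x ` Rn d) (\<phi> x)"
  unfolding tangent_approx_def
proof (intro allI impI)
  fix e :: real assume e: "e > 0"
  let ?T = "\<phi>' x ` Rn d"
  have T: "fin_subspace ?T" by (rule chart_fin_subspace[OF c x])
  have U: "openin (top_of_set (Rn d)) U" using c by (simp add: chart_def)
  have der: "(\<phi> has_derivative \<phi>' x) (at x within U)" and inj: "inj_on (\<phi>' x) (Rn d)"
    using c x by (auto simp: chart_def)
  obtain m where m: "m > 0" "\<And>v. v \<in> Rn d \<Longrightarrow> m * norm v \<le> norm (\<phi>' x v)"
    using inj_linear_lower_bound[OF has_derivative_bounded_linear[OF der] inj] by blast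
  \<comment> \<open>The first entry leaves the lower bound \<open>m / 2\<close> for secants after
    the remainder is absorbed; the second then makes the remainder at most the fraction
    \<open>e\<close> of the secant.\<close>
  define \<kappa> where "\<kappa> = min (m / 2) (e * m / 2)"
  have \<kappa>: "\<kappa> > 0" "\<kappa> \<le> m / 2" "\<kappa> \<le> e * m / 2" using m(1) e by (auto simp: \<kappa>_def)
  obtain \<eta> where \<eta>: "\<eta> > 0"
    "\<And>y. y \<in> U \<Longrightarrow> norm (y - x) < \<eta> \<Longrightarrow> norm (\<phi> y - \<phi> x - \<phi>' x (y - x)) \<le> \<kappa> * norm (y - x)"
    using der \<kappa>(1) unfolding has_derivative_within_alt by meson
  obtain \<delta> where \<delta>: "\<delta> > 0" "\<And>q. q \<in> M \<Longrightarrow> dist q (\<phi> x) < \<delta> \<Longrightarrow> \<exists>y\<in>U. q = \<phi> y \<and> dist y x < \<eta>"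
    using chart_near[OF c x \<eta>(1)] by blast
  show "\<exists>\<delta>>0. \<forall>q\<in>M. dist q (\<phi> x) < \<delta> \<longrightarrow>
      norm (q - \<phi> x - oproj ?T (q - \<phi> x)) \<le> e * norm (q - \<phi> x)"
  proof (intro exI[of _ \<delta>] conjI ballI impI)
    fix q assume "q \<in> M" "dist q (\<phi> x) < \<delta>"
    then obtain y where y: "y \<in> U" "q = \<phi> y" "norm (y - x) < \<eta>"
      using \<delta>(2) by (auto simp: dist_norm)
    have "U \<subseteq> Rn d" using U by (rule openin_imp_subset)
    then have yx: "y - x \<in> Rn d" using x y by (intro Rn_diff) auto
    have 1: "norm (q - \<phi> x - \<phi>' x (y - x)) \<le> \<kappa> * norm (y - x)" using \<eta>(2)[of y] y by simp
    have "m * norm (y - x) \<le> norm (\<phi>' x (y - x))" by (rule m(2)[OF yx])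
    also have "\<dots> \<le> norm (q - \<phi> x) + norm (q - \<phi> x - \<phi>' x (y - x))"
      using norm_triangle_ineq4[of "q - \<phi> x" "q - \<phi> x - \<phi>' x (y - x)"] by simp
    finally have "m * norm (y - x) \<le> norm (q - \<phi> x) + \<kappa> * norm (y - x)" using 1 by simp
    moreover have "\<kappa> * norm (y - x) \<le> m / 2 * norm (y - x)" using \<kappa> by (intro mult_right_mono) auto
    ultimately have 2: "m / 2 * norm (y - x) \<le> norm (q - \<phi> x)" by simp
    have "norm (q - \<phi> x - oproj ?T (q - \<phi> x)) \<le> norm (q - \<phi> x - \<phi>' x (y - x))"
      using yx by (intro norm_minus_oproj_min[OF T]) auto
    also have "\<dots> \<le> \<kappa> * norm (y - x)" by (rule 1)
    also have "\<dots> \<le> e * m / 2 * norm (y - x)" using \<kappa> by (intro mult_right_mono) auto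
    also have "\<dots> = e * (m / 2 * norm (y - x))" by simp
    also have "\<dots> \<le> e * norm (q - \<phi> x)" using 2 e by (intro mult_left_mono) auto
    finally show "norm (q - \<phi> x - oproj ?T (q - \<phi> x)) \<le> e * norm (q - \<phi> x)" .
  qed (rule \<delta>(1))
qed

lemma chart_tangent_space:
  assumes c: "chart d M U \<phi> \<psi> \<phi>'" and x: "x \<in> U"
  shows "tangent_space M (\<phi> x) = \<phi>' x ` Rn d"
proof
  show "tangent_space M (\<phi> x) \<subseteq> \<phi>' x ` Rn d"
    using tangent_approx_curve[OF chart_fin_subspace(1)[OF c x] chart_tangent_approx[OF c x]] by blast
  show "\<phi>' x ` Rn d \<subseteq> tangent_space M (\<phi> x)"
  proof
    fix w assume "w \<in> \<phi>' x ` Rn d"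
    then obtain v where v: "v \<in> Rn d" "w = \<phi>' x v" by blast
    have U: "openin (top_of_set (Rn d)) U" and o: "openin (top_of_set M) (\<phi> ` U)"
      and der: "(\<phi> has_derivative \<phi>' x) (at x within U)" using c x by (auto simp: chart_def)
    obtain \<tau> where \<tau>: "\<tau> > 0" "\<And>t. \<bar>t\<bar> < \<tau> \<Longrightarrow> x + t *\<^sub>R v \<in> U"
      using relopen_line[OF U x v(1)] by blast
    have M: "\<phi> ` U \<subseteq> M" using o openin_imp_subset by blast
    \<comment> \<open>\<open>tangent_space\<close> asks for a curve on the whole interval (-1, 1),
      so the line is replaced by the base point where it might leave \<open>U\<close>.\<close>
    define \<gamma> where "\<gamma> t = (if \<bar>t\<bar> < \<tau> then \<phi> (x + t *\<^sub>R v) else \<phi> x)" for t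
    have "((\<lambda>t. \<phi> (x + t *\<^sub>R v)) has_vector_derivative w) (at 0)"
      using has_derivative_line[OF U x v(1) der] v by simp
    then have "(\<gamma> has_vector_derivative w) (at 0)"
      by (rule has_vector_derivative_transform_within_open[of _ _ _ "{-\<tau><..<\<tau>}"])
        (use \<tau>(1) in \<open>auto simp: \<gamma>_def\<close>)
    moreover have "\<gamma> t \<in> M" for t using \<tau> x M by (auto simp: \<gamma>_def)
    moreover have "\<gamma> 0 = \<phi> x" using \<tau>(1) by (simp add: \<gamma>_def)
    ultimately show "w \<in> tangent_space M (\<phi> x)" unfolding tangent_space_def by blast
  qed
qed

context
  fixes k :: enat and D d :: nat and M :: "fvec set"
  assumes M: "submanifold k D d M" and k: "1 \<le> k"
begin

lemma submanifold_subset: "M \<subseteq> Rn D"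
  using M by (simp add: submanifold_def)

lemma submanifold_tangent:
  assumes "a \<in> M"
  shows "fin_subspace (tangent_space M a)" "dim (tangent_space M a) = d" "tangent_approx M (tangent_space M a) a"
proof -
  obtain U \<phi> \<psi> \<phi>' where c: "a \<in> \<phi> ` U" "chart d M U \<phi> \<psi> \<phi>'"
    by (rule submanifold_chart[OF M k assms])
  then obtain x where x: "x \<in> U" "a = \<phi> x" by blast
  show "fin_subspace (tangent_space M a)" "dim (tangent_space M a) = d" "tangent_approx M (tangent_space M a) a"
    using chart_tangent_space[OF c(2) x(1)] chart_fin_subspace[OF c(2) x(1)]
      chart_tangent_approx[OF c(2) x(1)] x(2) by simp_all
qed

lemma tangent_space_subset: assumes "a \<in> M" shows "tangent_space M a \<subseteq> Rn D"
proof
  fix v assume "v \<in> tangent_space M a"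
  then obtain \<gamma> :: "real \<Rightarrow> fvec" where \<gamma>: "\<And>t. t \<in> {-1<..<1} \<Longrightarrow> \<gamma> t \<in> M" "\<gamma> 0 = a"
    "(\<gamma> has_vector_derivative v) (at 0)"
    unfolding tangent_space_def mem_Collect_eq by metis
  have "((\<lambda>t. (\<gamma> t - a) /\<^sub>R t) \<longlongrightarrow> v) (at 0)"
    using has_vector_derivative_tendsto_0[OF \<gamma>(3)] \<gamma>(2) by simp
  moreover have "eventually (\<lambda>t. (\<gamma> t - a) /\<^sub>R t \<in> Rn D) (at 0)"
  proof -
    have "eventually (\<lambda>t::real. t \<in> {-1<..<1}) (at 0)"
      by (rule eventually_at_in_open') auto
    then show ?thesis
      by eventually_elim (meson \<gamma>(1) assms submanifold_subset Rn_diff Rn_scale subsetD)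
  qed
  ultimately show "v \<in> Rn D"
    using Lim_in_closed_set[OF closed_Rn, of "\<lambda>t. (\<gamma> t - a) /\<^sub>R t" D "at 0" v] trivial_limit_at by blast
qed

text \<open>A basis vector at \<open>a\<close> is some \<open>\<phi>' x w\<close>; nearby,
  \<open>\<phi>' y w\<close> is tangent at \<open>\<phi> y\<close> and close to it. Finitely many
  basis vectors give a common radius, which depends on \<open>M\<close> and on the point.\<close>

lemma tangent_space_continuous:
  assumes "a \<in> M" "e > 0"
  shows "\<exists>\<delta>>0. \<forall>m\<in>M. dist m a < \<delta> \<longrightarrow> sub_angle (tangent_space M a) (tangent_space M m) e"
proof -
  obtain U \<phi> \<psi> \<phi>' where c: "a \<in> \<phi> ` U" "chart d M U \<phi> \<psi> \<phi>'"
    by (rule submanifold_chart[OF M k assms(1)])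
  then obtain x where x: "x \<in> U" "a = \<phi> x" by blast
  have Ta: "fin_subspace (tangent_space M a)" by (rule submanifold_tangent[OF assms(1)])
  obtain B where B: "onb B (tangent_space M a)" using fin_subspace_onb[OF Ta] .
  let ?e = "e / (real (card B) + 1)"
  have e: "?e > 0" using assms(2) by simp
  have "\<forall>b\<in>B. \<exists>\<eta>>0. \<forall>y\<in>U. dist y x < \<eta> \<longrightarrow> norm (b - oproj (tangent_space M (\<phi> y)) b) \<le> ?e"
  proof
    fix b assume "b \<in> B"
    then have "b \<in> \<phi>' x ` Rn d"
      using onb_subset[OF B] chart_tangent_space[OF c(2) x(1)] x(2) by auto
    then obtain w where w: "w \<in> Rn d" "b = \<phi>' x w" by blast
    have "continuous_on U (\<lambda>y. \<phi>' y w)" using c(2) w by (simp add: chart_def)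
    then obtain \<eta> where \<eta>: "\<eta> > 0" "\<And>y. y \<in> U \<Longrightarrow> dist y x < \<eta> \<Longrightarrow> dist (\<phi>' y w) (\<phi>' x w) < ?e"
      using x(1) e unfolding continuous_on_iff by blast
    have "norm (b - oproj (tangent_space M (\<phi> y)) b) \<le> ?e" if y: "y \<in> U" "dist y x < \<eta>" for y
    proof -
      have "norm (b - oproj (tangent_space M (\<phi> y)) b) \<le> norm (b - \<phi>' y w)"
        using chart_tangent_space[OF c(2) y(1)] chart_fin_subspace[OF c(2) y(1)] w(1)
        by (intro norm_minus_oproj_min) auto
      also have "\<dots> \<le> ?e" using \<eta>(2)[OF y] w(2) by (simp add: dist_norm norm_minus_commute)
      finally show ?thesis .
    qed
    then show "\<exists>\<eta>>0. \<forall>y\<in>U. dist y x < \<eta> \<longrightarrow> norm (b - oproj (tangent_space M (\<phi> y)) b) \<le> ?e"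
      using \<eta>(1) by blast
  qed
  then obtain \<eta> where \<eta>: "\<And>b. b \<in> B \<Longrightarrow> \<eta> b > 0"
    "\<And>b y. b \<in> B \<Longrightarrow> y \<in> U \<Longrightarrow> dist y x < \<eta> b \<Longrightarrow> norm (b - oproj (tangent_space M (\<phi> y)) b) \<le> ?e"
    by metis
  define \<eta>0 where "\<eta>0 = Min (insert 1 (\<eta> ` B))"
  have fB: "finite B" using B by (rule onb_finite)
  have \<eta>0: "\<eta>0 > 0" "\<And>b. b \<in> B \<Longrightarrow> \<eta>0 \<le> \<eta> b" using fB \<eta>(1) by (auto simp: \<eta>0_def)
  obtain \<delta> where \<delta>: "\<delta> > 0" "\<And>q. q \<in> M \<Longrightarrow> dist q (\<phi> x) < \<delta> \<Longrightarrow> \<exists>y\<in>U. q = \<phi> y \<and> dist y x < \<eta>0"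
    using chart_near[OF c(2) x(1) \<eta>0(1)] by blast
  show ?thesis
  proof (intro exI[of _ \<delta>] conjI ballI impI)
    fix m assume m: "m \<in> M" "dist m a < \<delta>"
    obtain y where y: "y \<in> U" "m = \<phi> y" "dist y x < \<eta>0" using \<delta>(2) m x(2) by blast
    have "sub_angle (tangent_space M a) (tangent_space M m) (real (card B) * ?e)"
    proof (rule sub_angle_onb[OF Ta submanifold_tangent(1)[OF m(1)] B])
      fix b assume b: "b \<in> B"
      show "norm (b - oproj (tangent_space M m) b) \<le> ?e"
        using \<eta>(2)[OF b y(1)] y \<eta>0(2)[OF b] by auto
    qed (use e in simp)
    then show "sub_angle (tangent_space M a) (tangent_space M m) e"
      by (rule sub_angle_mono) (use assms(2) in \<open>simp add: field_simps\<close>)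
  qed (rule \<delta>(1))
qed

end

section \<open>Positive reach: Federer's inequality and its converse\<close>

section \<open>Positive reach\<close>

lemma compact_nearest:
  fixes M :: "'a::metric_space set"
  assumes "compact M" "M \<noteq> {}"
  obtains a where "a \<in> M" "infdist z M = dist z a"
proof -
  obtain a where a: "a \<in> M" "\<And>b. b \<in> M \<Longrightarrow> dist z a \<le> dist z b"
    using continuous_attains_inf[OF assms continuous_on_dist[OF continuous_on_const continuous_on_id]]
    by blast
  have "infdist z M = dist z a"
  proof (rule antisym)
    show "infdist z M \<le> dist z a" by (rule infdist_le[OF a(1)])
    show "dist z a \<le> infdist z M" unfolding infdist_def using assms(2) a by (auto intro!: cINF_greatest)
  qed
  then show ?thesis using that a(1) by blast
qed

lemma infdist_geI: "A \<noteq> {} \<Longrightarrow> (\<And>a. a \<in> A \<Longrightarrow> r \<le> dist x a) \<Longrightarrow> r \<le> infdist x A"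
  unfolding infdist_def by (auto intro!: cINF_greatest)

lemma norm_sq_add: "(norm (x + y :: 'a::real_inner))\<^sup>2 = (norm x)\<^sup>2 + 2 * inner x y + (norm y)\<^sup>2"
  by (simp add: power2_norm_eq_inner inner_add_left inner_add_right inner_commute)

lemma norm_sq_diff: "(norm (x - y :: 'a::real_inner))\<^sup>2 = (norm x)\<^sup>2 - 2 * inner x y + (norm y)\<^sup>2"
  by (simp add: power2_norm_eq_inner inner_diff_left inner_diff_right inner_commute)

lemma reach_unique_nearest:
  assumes "ereal \<rho> \<le> reach D M" "z \<in> Rn D" "infdist z M < \<rho>" "a \<in> M" "b \<in> M"
    "dist z a = infdist z M" "dist z b = infdist z M"
  shows "a = b"
proof (rule ccontr)
  assume "a \<noteq> b"
  then have "z \<in> medial_axis D M" using assms by (auto simp: medial_axis_def)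
  then have "reach D M \<le> ereal (dist a z)" unfolding reach_def using assms(4)
    by (intro INF_lower2[OF assms(4)] INF_lower2[of z]) auto
  then have "ereal \<rho> \<le> ereal (dist a z)" using assms(1) order_trans by blast
  then show False using assms(3,6) by (simp add: dist_commute)
qed

text \<open>The metric content of a reach bound; no differentiable structure is assumed
  here.\<close>

locale unique_nearest =
  fixes D :: nat and M :: "fvec set" and \<rho> :: real
  assumes compact: "compact M" and nonempty: "M \<noteq> {}" and subset: "M \<subseteq> Rn D"
    and unique: "\<And>z a b. z \<in> Rn D \<Longrightarrow> infdist z M < \<rho> \<Longrightarrow> a \<in> M \<Longrightarrow> b \<in> M \<Longrightarrow>
      dist z a = infdist z M \<Longrightarrow> dist z b = infdist z M \<Longrightarrow> a = b"
begin

text \<open>Moving away from \<open>a\<close> gains distance at almost unit speed from the points of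
  \<open>M\<close> that lie roughly in the direction of \<open>a\<close>. The other points form a
  compact set that contains no nearest point of \<open>x\<close>, by uniqueness, so they are farther
  by a fixed amount and do not interfere for small \<eta>.\<close>

lemma infdist_slope:
  assumes x: "x \<in> Rn D" and a: "a \<in> M" "dist x a = infdist x M" and r: "0 < infdist x M" "infdist x M < \<rho>"
    and \<kappa>: "0 < \<kappa>" "\<kappa> < 1"
  obtains \<eta>0 where "\<eta>0 > 0"
    "\<And>\<eta>. 0 < \<eta> \<Longrightarrow> \<eta> < \<eta>0 \<Longrightarrow> infdist x M + (1 - \<kappa>) * \<eta> \<le> infdist (x + \<eta> *\<^sub>R ((x - a) /\<^sub>R infdist x M)) M"
proof -
  define r where "r = infdist x M"
  define u where "u = (x - a) /\<^sub>R r"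
  have r0: "r > 0" using r by (simp add: r_def)
  have xa: "norm (x - a) = r" using a by (simp add: r_def dist_norm)
  have nu: "norm u = 1" using r0 xa by (simp add: u_def)
  have ua: "inner u (x - a) = r"
    using r0 xa by (simp add: u_def dot_square_norm power2_eq_square)
  \<comment> \<open>The point \<open>a\<close> is not in this set, since
    \<open>inner u (x - a)\<close> has the full value \<open>r\<close>.\<close>
  let ?K = "M \<inter> {q. inner u (x - q) \<le> (1 - \<kappa>) * r}"
  have K: "compact ?K" by (intro compact_Int_closed compact closed_Collect_le continuous_intros)
  have big: "r + (1 - \<kappa>) * \<eta> \<le> dist (x + \<eta> *\<^sub>R u) q" if q: "q \<in> M" "q \<notin> ?K" and \<eta>: "0 < \<eta>" for q \<eta>
  proof -
    have q1: "(1 - \<kappa>) * r \<le> inner u (x - q)" using q by auto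
    have q2: "r \<le> norm (x - q)" using infdist_le[OF q(1), of x] by (simp add: r_def dist_norm)
    have "(norm (x + \<eta> *\<^sub>R u - q))\<^sup>2 = (norm ((x - q) + \<eta> *\<^sub>R u))\<^sup>2" by (simp add: algebra_simps)
    also have "\<dots> = (norm (x - q))\<^sup>2 + 2 * \<eta> * inner u (x - q) + \<eta>\<^sup>2"
      by (subst norm_sq_add) (simp add: nu inner_commute)
    also have "\<dots> \<ge> r\<^sup>2 + 2 * \<eta> * ((1 - \<kappa>) * r) + \<eta>\<^sup>2"
      using q1 q2 \<eta> r0 by (intro add_mono mult_left_mono power_mono) auto
    also have "r\<^sup>2 + 2 * \<eta> * ((1 - \<kappa>) * r) + \<eta>\<^sup>2 \<ge> (r + (1 - \<kappa>) * \<eta>)\<^sup>2"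
    proof -
      have "((1 - \<kappa>) * \<eta>)\<^sup>2 \<le> \<eta>\<^sup>2"
        using \<kappa> \<eta> by (intro power_mono) (auto simp: mult_le_cancel_right1)
      moreover have "(r + (1 - \<kappa>) * \<eta>)\<^sup>2 = r\<^sup>2 + 2 * \<eta> * ((1 - \<kappa>) * r) + ((1 - \<kappa>) * \<eta>)\<^sup>2"
        by (simp add: power2_sum)
      ultimately show ?thesis by simp
    qed
    finally have "(r + (1 - \<kappa>) * \<eta>)\<^sup>2 \<le> (norm (x + \<eta> *\<^sub>R u - q))\<^sup>2" .
    then show ?thesis unfolding dist_norm by (rule power2_le_imp_le) simp
  qed
  have "\<exists>\<eta>0>0. \<forall>\<eta>. 0 < \<eta> \<and> \<eta> < \<eta>0 \<longrightarrow> (\<forall>q\<in>?K. r + (1 - \<kappa>) * \<eta> \<le> dist (x + \<eta> *\<^sub>R u) q)"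
  proof (cases "?K = {}")
    case True then show ?thesis by (auto intro!: exI[of _ 1])
  next
    case False
    obtain q0 where q0: "q0 \<in> ?K" "\<And>q. q \<in> ?K \<Longrightarrow> dist x q0 \<le> dist x q"
      using continuous_attains_inf[OF K False continuous_on_dist[OF continuous_on_const continuous_on_id]]
      by blast
    have "dist x q0 \<noteq> r"
    proof
      assume "dist x q0 = r"
      then have "q0 = a" using unique[OF x, of q0 a] q0(1) a r by (auto simp: r_def)
      then have "r \<le> (1 - \<kappa>) * r" using q0(1) ua by auto
      then show False using \<kappa> r0 by (simp add: algebra_simps mult_le_0_iff)
    qed
    moreover have "r \<le> dist x q0" using q0(1) infdist_le[of q0 M x] by (simp add: r_def)
    ultimately have g: "r < dist x q0" by simp
    show ?thesis
    proof (intro exI[of _ "(dist x q0 - r) / 2"] conjI allI impI ballI)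
      show "0 < (dist x q0 - r) / 2" using g by simp
      fix \<eta> q assume \<eta>: "0 < \<eta> \<and> \<eta> < (dist x q0 - r) / 2" and q: "q \<in> ?K"
      have "dist x q \<le> dist (x + \<eta> *\<^sub>R u) q + \<eta>"
        using dist_triangle[of x q "x + \<eta> *\<^sub>R u"] \<eta> nu by (simp add: dist_norm)
      moreover have "(1 - \<kappa>) * \<eta> \<le> \<eta>" using \<kappa> \<eta> by (simp add: mult_le_cancel_right1)
      ultimately show "r + (1 - \<kappa>) * \<eta> \<le> dist (x + \<eta> *\<^sub>R u) q" using q0(2)[OF q] \<eta> by argo
    qed
  qed
  then obtain \<eta>0 where "\<eta>0 > 0" "\<And>\<eta> q. 0 < \<eta> \<Longrightarrow> \<eta> < \<eta>0 \<Longrightarrow> q \<in> ?K \<Longrightarrow> r + (1 - \<kappa>) * \<eta> \<le> dist (x + \<eta> *\<^sub>R u) q"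
    by blast
  then show ?thesis using big nonempty
    by (intro that[of \<eta>0] infdist_geI) (auto simp: u_def r_def)
qed

text \<open>A maximiser of \<open>infdist y M - (1 - \<kappa>) * dist y x\<close> on the ball lies on its boundary, since elsewhere
  moving away from the nearest point increases the distance to \<open>M\<close> at almost unit speed.\<close>

lemma infdist_ascend_aux:
  assumes x: "x \<in> Rn D" and r: "0 < infdist x M" and \<delta>: "0 < \<delta>" "infdist x M + \<delta> < \<rho>"
    and \<kappa>: "0 < \<kappa>" "\<kappa> < 1"
  obtains y where "y \<in> cball x \<delta> \<inter> Rn D" "infdist x M + (1 - \<kappa>) * \<delta> \<le> infdist y M"
proof -
  let ?B = "cball x \<delta> \<inter> Rn D"
  let ?F = "\<lambda>y. infdist y M - (1 - \<kappa>) * dist y x"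
  have "x \<in> ?B" using x \<delta>(1) by simp
  then have "?B \<noteq> {}" by blast
  moreover have "continuous_on ?B ?F" by (intro continuous_intros)
  ultimately obtain y where y: "y \<in> ?B" "\<And>z. z \<in> ?B \<Longrightarrow> ?F z \<le> ?F y"
    using continuous_attains_sup[OF compact_Rn_cball[of x \<delta> D]] by blast
  have F: "infdist x M \<le> ?F y" using y(2)[of x] x \<delta> by auto
  have y1: "infdist x M + (1 - \<kappa>) * dist y x \<le> infdist y M" using F by simp
  have "0 \<le> (1 - \<kappa>) * dist y x" using \<kappa> by simp
  then have r1: "0 < infdist y M" using y1 r by linarith
  have "infdist y M \<le> infdist x M + dist y x" by (rule infdist_triangle)
  then have r2: "infdist y M < \<rho>" using y(1) \<delta> by (simp add: dist_commute)
  have "dist y x = \<delta>"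
  proof (rule ccontr)
    assume "dist y x \<noteq> \<delta>"
    then have lt: "dist y x < \<delta>" using y(1) by (simp add: dist_commute)
    obtain b where b: "b \<in> M" "infdist y M = dist y b" using compact_nearest[OF compact nonempty] .
    let ?u = "(y - b) /\<^sub>R infdist y M"
    have nu: "norm ?u = 1" using b r1 by (simp add: dist_norm)
    \<comment> \<open>The slope is taken with \<open>\<kappa> / 2\<close>, so that the gain strictly
      exceeds the penalty \<open>(1 - \<kappa>) * \<eta>\<close>.\<close>
    obtain \<eta>0 where \<eta>0: "\<eta>0 > 0" "\<And>\<eta>. 0 < \<eta> \<Longrightarrow> \<eta> < \<eta>0 \<Longrightarrow> infdist y M + (1 - \<kappa> / 2) * \<eta> \<le> infdist (y + \<eta> *\<^sub>R ?u) M"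
      using infdist_slope[of y b "\<kappa> / 2"] y(1) b r1 r2 \<kappa> by auto
    define \<eta> where "\<eta> = min (\<eta>0 / 2) (\<delta> - dist y x)"
    have \<eta>: "0 < \<eta>" "\<eta> < \<eta>0" "\<eta> \<le> \<delta> - dist y x" using \<eta>0(1) lt by (auto simp: \<eta>_def)
    let ?z = "y + \<eta> *\<^sub>R ?u"
    have "norm (\<eta> *\<^sub>R ?u) = \<eta>" using \<eta>(1) norm_scaleR[of \<eta> ?u] unfolding nu by simp
    then have zx: "dist ?z x \<le> dist y x + \<eta>"
      using dist_triangle[of ?z x y] by (simp add: dist_norm)
    have "?u \<in> Rn D" using y(1) b(1) subset by (intro Rn_scale Rn_diff) auto
    then have "?z \<in> Rn D" using y(1) by (intro Rn_add Rn_scale[of ?u]) auto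
    then have "?z \<in> ?B" using zx \<eta>(3) by (simp add: dist_commute)
    then have "?F ?z \<le> ?F y" by (rule y(2))
    moreover have "infdist y M + (1 - \<kappa> / 2) * \<eta> \<le> infdist ?z M" by (rule \<eta>0(2)[OF \<eta>(1,2)])
    moreover have "(1 - \<kappa>) * dist ?z x \<le> (1 - \<kappa>) * (dist y x + \<eta>)"
      using zx \<kappa> by (intro mult_left_mono) auto
    ultimately have "(1 - \<kappa> / 2) * \<eta> \<le> (1 - \<kappa>) * \<eta>" by (simp add: algebra_simps)
    then show False using \<eta>(1) \<kappa> by simp
  qed
  then show ?thesis using that[of y] y(1) y1 by simp
qed

text \<open>Letting \<kappa> tend to 0, the maximal distance to \<open>M\<close> over the ball is at
  least \<open>infdist x M + \<delta>\<close>. The triangle inequality for \<open>a\<close>,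
  \<open>x\<close> and the maximiser is then an equality, which places the maximiser on the ray from
  \<open>a\<close> through \<open>x\<close>.\<close>

lemma infdist_ascend:
  assumes x: "x \<in> Rn D" and a: "a \<in> M" "dist x a = infdist x M" and r: "0 < infdist x M"
    and \<delta>: "0 < \<delta>" "infdist x M + \<delta> < \<rho>"
  shows "infdist (x + \<delta> *\<^sub>R ((x - a) /\<^sub>R infdist x M)) M = infdist x M + \<delta>"
proof -
  let ?B = "cball x \<delta> \<inter> Rn D" and ?r = "infdist x M"
  have "x \<in> ?B" using x \<delta>(1) by simp
  then have "?B \<noteq> {}" by blast
  moreover have "continuous_on ?B (\<lambda>z. infdist z M)" by (intro continuous_intros)
  ultimately obtain y where y: "y \<in> ?B" "\<And>z. z \<in> ?B \<Longrightarrow> infdist z M \<le> infdist y M"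
    using continuous_attains_sup[OF compact_Rn_cball[of x \<delta> D]] by blast
  have "?r + \<delta> \<le> infdist y M"
  proof (rule field_le_epsilon)
    fix e :: real assume e: "e > 0"
    define \<kappa> where "\<kappa> = min (1/2) (e / \<delta>)"
    have \<kappa>: "0 < \<kappa>" "\<kappa> < 1" "\<kappa> * \<delta> \<le> e" using e \<delta>
      by (auto simp: \<kappa>_def min_def field_simps)
    obtain z where z: "z \<in> ?B" "?r + (1 - \<kappa>) * \<delta> \<le> infdist z M"
      using infdist_ascend_aux[OF x r \<delta> \<kappa>(1,2)] .
    then show "?r + \<delta> \<le> infdist y M + e" using y(2)[OF z(1)] \<kappa>(3) by (simp add: algebra_simps)
  qed
  also have "infdist y M \<le> norm (y - a)" using infdist_le[OF a(1), of y] by (simp add: dist_norm)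
  finally have 1: "?r + \<delta> \<le> norm (y - a)" .
  have xa: "norm (x - a) = ?r" using a by (simp add: dist_norm)
  have yx: "norm (y - x) \<le> \<delta>" using y(1) by (auto simp: dist_norm norm_minus_commute)
  have "norm (y - a) \<le> norm (y - x) + norm (x - a)" using norm_triangle_ineq[of "y - x" "x - a"] by simp
  then have eq: "norm (y - x) = \<delta>" "norm ((y - x) + (x - a)) = norm (y - x) + norm (x - a)"
    using 1 xa yx by auto
  then have "\<delta> *\<^sub>R (x - a) = ?r *\<^sub>R (y - x)" using norm_triangle_eq xa by metis
  then have "inverse ?r *\<^sub>R (\<delta> *\<^sub>R (x - a)) = y - x" using r by simp
  then have yeq: "y = x + \<delta> *\<^sub>R ((x - a) /\<^sub>R ?r)" by (simp add: mult.commute)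
  have "infdist y M \<le> ?r + \<delta>" using infdist_triangle[of y M x] yx by (simp add: dist_norm)
  then show ?thesis using \<open>?r + \<delta> \<le> infdist y M\<close> yeq by simp
qed

text \<open>By \<open>infdist_ascend\<close> the open ball of radius \<open>s\<close> that touches
  \<open>M\<close> at \<open>a\<close> in the direction of \<open>x - a\<close> misses
  \<open>M\<close>, for every \<open>s\<close> between \<open>infdist x M\<close> and \<rho>.
  Expanding the squared distance from its centre to \<open>q\<close> gives the bound for
  \<open>s\<close>, and \<open>s\<close> tends to \<rho>.\<close>

lemma normal_ball:
  assumes x: "x \<in> Rn D" and a: "a \<in> M" "dist x a = infdist x M" and r: "infdist x M < \<rho>"
    and q: "q \<in> M"
  shows "2 * \<rho> * inner (q - a) (x - a) \<le> norm (x - a) * (norm (q - a))\<^sup>2"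
proof (cases "x = a")
  case False
  let ?r = "infdist x M"
  have r0: "?r > 0" using a False by (metis zero_less_dist_iff)
  define u where "u = (x - a) /\<^sub>R ?r"
  have xa: "x - a = ?r *\<^sub>R u" using r0 by (simp add: u_def)
  have nu: "norm u = 1" using a r0 by (simp add: u_def dist_norm)
  have s: "s * (2 * inner (q - a) u) \<le> (norm (q - a))\<^sup>2" if s: "?r < s" "s < \<rho>" for s
  proof -
    have "infdist (x + (s - ?r) *\<^sub>R u) M = s"
      using infdist_ascend[OF x a r0, of "s - ?r"] s by (simp add: u_def)
    moreover have "x + (s - ?r) *\<^sub>R u = a + s *\<^sub>R u" using xa by (simp add: algebra_simps)
    ultimately have "s \<le> norm (a + s *\<^sub>R u - q)"
      using infdist_le[OF q, of "a + s *\<^sub>R u"] by (simp add: dist_norm)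
    also have "a + s *\<^sub>R u - q = s *\<^sub>R u - (q - a)" by simp
    finally have "s \<le> norm (s *\<^sub>R u - (q - a))" .
    then have "s\<^sup>2 \<le> (norm (s *\<^sub>R u - (q - a)))\<^sup>2" using s r0 by (intro power_mono) auto
    then show ?thesis by (simp add: norm_sq_diff nu inner_commute)
  qed
  have "\<rho> * (2 * inner (q - a) u) \<le> (norm (q - a))\<^sup>2"
  proof (cases "inner (q - a) u \<le> 0")
    case True
    then have "\<rho> * (2 * inner (q - a) u) \<le> 0" using r r0 by (intro mult_nonneg_nonpos) auto
    also have "\<dots> \<le> (norm (q - a))\<^sup>2" by simp
    finally show ?thesis .
  next
    case False
    then have p: "2 * inner (q - a) u > 0" by simp
    have "\<rho> \<le> (norm (q - a))\<^sup>2 / (2 * inner (q - a) u)"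
    proof (rule dense_le_bounded[OF r])
      fix w assume "?r < w" "w < \<rho>"
      then show "w \<le> (norm (q - a))\<^sup>2 / (2 * inner (q - a) u)"
        using s[of w] by (simp only: pos_le_divide_eq[OF p])
    qed
    then show ?thesis by (simp only: pos_le_divide_eq[OF p])
  qed
  then have "?r * (\<rho> * (2 * inner (q - a) u)) \<le> ?r * (norm (q - a))\<^sup>2" using r0 by (intro mult_left_mono) auto
  then show ?thesis using xa nu r0 by (simp add: mult_ac)
qed simp

text \<open>It is not known that \<open>a\<close> is the nearest point of
  \<open>a + t *\<^sub>R \<nu>\<close>. The nearest point \<open>q\<close> is however within
  \<open>2 * t * e\<close> of \<open>a\<close>, because secants at \<open>a\<close> are almost
  tangent. Applying \<open>normal_ball\<close> at \<open>q\<close> and dividing by \<open>t\<close>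
  gives the claim up to errors that vanish with \<open>e\<close>.\<close>

lemma normal_bound:
  assumes a: "a \<in> M" and T: "fin_subspace T" "tangent_approx M T a" and \<rho>: "\<rho> > 0"
    and \<nu>: "\<nu> \<in> Rn D" "norm \<nu> = 1" "\<And>t. t \<in> T \<Longrightarrow> inner \<nu> t = 0" and p: "p \<in> M"
  shows "2 * \<rho> * inner (p - a) \<nu> \<le> (norm (p - a))\<^sup>2"
proof -
  have aD: "a \<in> Rn D" using a subset by blast
  have main: "2 * \<rho> * inner (p - a) \<nu> \<le> (norm (p - a) + e)\<^sup>2 + 4 * \<rho> * e * (norm (p - a) + e) + 2 * \<rho> * e"
    if e: "0 < e" "e < 1/2" for e
  proof -
    obtain \<delta> where \<delta>: "\<delta> > 0" "\<And>q. q \<in> M \<Longrightarrow> dist q a < \<delta> \<Longrightarrow> norm ((q - a) - oproj T (q - a)) \<le> e * norm (q - a)"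
      using T(2) e(1) unfolding tangent_approx_def by meson
    \<comment> \<open>\<open>2 * t < \<delta>\<close> brings \<open>q\<close> into the range of the
      secant bound, \<open>t < \<rho>\<close> the centre into that of \<open>normal_ball\<close>,
      and \<open>t \<le> 1/2\<close> makes \<open>2 * t * e\<close> at most
      \<open>e\<close>.\<close>
    define t where "t = min (1/2) (min (\<delta> / 3) (\<rho> / 2))"
    have t: "0 < t" "t \<le> 1/2" "2 * t < \<delta>" "t < \<rho>" using \<delta>(1) \<rho> by (auto simp: t_def)
    let ?y = "a + t *\<^sub>R \<nu>"
    have y: "?y \<in> Rn D" using aD \<nu>(1) by (intro Rn_add Rn_scale) auto
    obtain q where q: "q \<in> M" "infdist ?y M = dist ?y q" using compact_nearest[OF compact nonempty] .
    have "infdist ?y M \<le> t" using infdist_le[OF a, of ?y] t(1) \<nu>(2) by (simp add: dist_norm)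
    then have yq: "norm (?y - q) \<le> t" using q(2) by (simp add: dist_norm)
    have qa2: "norm (q - a) \<le> 2 * t"
      using norm_triangle_ineq[of "q - ?y" "t *\<^sub>R \<nu>"] yq \<nu>(2) t(1) by (simp add: norm_minus_commute algebra_simps)
    then have ap: "norm ((q - a) - oproj T (q - a)) \<le> e * norm (q - a)"
      using \<delta>(2)[OF q(1)] t(3) by (simp add: dist_norm)
    have "inner (oproj T (q - a)) \<nu> = 0" using \<nu>(3)[OF oproj_in[OF T(1)]] by (simp add: inner_commute)
    then have "inner (q - a) \<nu> = inner ((q - a) - oproj T (q - a)) \<nu>" by (simp add: inner_diff_left)
    also have "\<dots> \<le> norm ((q - a) - oproj T (q - a)) * norm \<nu>" by (rule norm_cauchy_schwarz)
    finally have i: "inner (q - a) \<nu> \<le> e * norm (q - a)" using ap \<nu>(2) by simp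
    have "(norm (t *\<^sub>R \<nu> - (q - a)))\<^sup>2 \<le> t\<^sup>2"
      using yq t(1) by (intro power_mono) (simp_all add: algebra_simps)
    then have "(norm (q - a))\<^sup>2 \<le> 2 * t * inner (q - a) \<nu>"
      by (simp add: norm_sq_diff \<nu>(2) inner_commute)
    also have "\<dots> \<le> 2 * t * (e * norm (q - a))" using i t(1) by (intro mult_left_mono) auto
    finally have "norm (q - a) * norm (q - a) \<le> norm (q - a) * (2 * t * e)"
      by (simp add: power2_eq_square mult_ac)
    then have qa: "norm (q - a) \<le> 2 * t * e"
      using t(1) e(1) by (cases "q = a") (auto simp: mult_le_cancel_left)
    have "2 * t * e \<le> 1 * e" using t e by (intro mult_right_mono) auto
    then have qae: "norm (q - a) \<le> e" using qa by simp
    have nb: "2 * \<rho> * inner (p - q) (?y - q) \<le> norm (?y - q) * (norm (p - q))\<^sup>2"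
      using normal_ball[OF y q(1) q(2)[symmetric] _ p] \<open>infdist ?y M \<le> t\<close> t(4) by simp
    have "inner (p - q) (?y - q) = t * inner (p - q) \<nu> - inner (p - q) (q - a)"
      by (simp add: inner_diff_right inner_add_right)
    then have 3: "2 * \<rho> * (t * inner (p - q) \<nu>) - 2 * \<rho> * inner (p - q) (q - a) \<le> norm (?y - q) * (norm (p - q))\<^sup>2"
      using nb by (simp add: right_diff_distrib)
    have "inner (p - q) (q - a) \<le> norm (p - q) * (2 * t * e)"
      using norm_cauchy_schwarz[of "p - q" "q - a"] mult_left_mono[OF qa, of "norm (p - q)"] by simp
    then have 4: "2 * \<rho> * inner (p - q) (q - a) \<le> 2 * \<rho> * (norm (p - q) * (2 * t * e))"
      using \<rho> by (intro mult_left_mono) auto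
    have "norm (?y - q) * (norm (p - q))\<^sup>2 \<le> t * (norm (p - q))\<^sup>2"
      using yq by (intro mult_right_mono) auto
    with 3 4 have "2 * \<rho> * (t * inner (p - q) \<nu>) \<le> t * (norm (p - q))\<^sup>2 + 2 * \<rho> * (norm (p - q) * (2 * t * e))"
      by linarith
    then have "t * (2 * \<rho> * inner (p - q) \<nu>) \<le> t * ((norm (p - q))\<^sup>2 + 4 * \<rho> * e * norm (p - q))"
      by (simp add: algebra_simps)
    then have 2: "2 * \<rho> * inner (p - q) \<nu> \<le> (norm (p - q))\<^sup>2 + 4 * \<rho> * e * norm (p - q)"
      using t(1) by simp
    have pq: "norm (p - q) \<le> norm (p - a) + e"
      using norm_triangle_ineq4[of "p - a" "q - a"] qae by simp
    have "inner (p - a) \<nu> = inner (p - q) \<nu> + inner (q - a) \<nu>" by (simp add: inner_diff_left)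
    also have "inner (q - a) \<nu> \<le> e" using norm_cauchy_schwarz[of "q - a" \<nu>] qae \<nu>(2) by simp
    finally have "2 * \<rho> * inner (p - a) \<nu> \<le> 2 * \<rho> * (inner (p - q) \<nu> + e)"
      using \<rho> by (intro mult_left_mono) auto
    also have "\<dots> = 2 * \<rho> * inner (p - q) \<nu> + 2 * \<rho> * e" by (simp add: algebra_simps)
    also have "\<dots> \<le> ((norm (p - q))\<^sup>2 + 4 * \<rho> * e * norm (p - q)) + 2 * \<rho> * e" using 2 by simp
    also have "\<dots> \<le> ((norm (p - a) + e)\<^sup>2 + 4 * \<rho> * e * (norm (p - a) + e)) + 2 * \<rho> * e"
      using pq \<rho> e by (intro add_mono power_mono mult_left_mono) auto
    finally show ?thesis .
  qed
  let ?f = "\<lambda>e. (norm (p - a) + e)\<^sup>2 + 4 * \<rho> * e * (norm (p - a) + e) + 2 * \<rho> * e"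
  have "(?f \<longlongrightarrow> ?f 0) (at_right 0)" by (intro tendsto_intros)
  moreover have "eventually (\<lambda>e. 2 * \<rho> * inner (p - a) \<nu> \<le> ?f e) (at_right 0)"
    unfolding eventually_at_right_field using main by (intro exI[of _ "1/2"]) auto
  ultimately have "2 * \<rho> * inner (p - a) \<nu> \<le> ?f 0"
    by (rule tendsto_lowerbound) simp
  then show ?thesis by simp
qed

lemma federer:
  assumes a: "a \<in> M" and T: "fin_subspace T" "tangent_approx M T a" "T \<subseteq> Rn D" and \<rho>: "\<rho> > 0" and p: "p \<in> M"
  shows "norm ((p - a) - oproj T (p - a)) \<le> (norm (p - a))\<^sup>2 / (2 * \<rho>)"
proof -
  let ?w = "(p - a) - oproj T (p - a)"
  show ?thesis
  proof (cases "?w = 0")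
    case False
    let ?\<nu> = "?w /\<^sub>R norm ?w"
    have "?\<nu> \<in> Rn D" using a p subset T(3) oproj_in[OF T(1)] by (intro Rn_scale Rn_diff) auto
    moreover have "norm ?\<nu> = 1" using False by simp
    moreover have "inner ?\<nu> t = 0" if "t \<in> T" for t using oproj_perp[OF T(1) that] by simp
    ultimately have 1: "2 * \<rho> * inner (p - a) ?\<nu> \<le> (norm (p - a))\<^sup>2"
      using normal_bound[OF a T(1,2) \<rho> _ _ _ p] by blast
    have "inner (oproj T (p - a)) ?w = 0" by (rule oproj_perp'[OF T(1) oproj_in[OF T(1)]])
    then have "inner (p - a) ?w = inner ?w ?w"
      by (simp add: inner_diff_left)
    then have "inner (p - a) ?\<nu> = norm ?w" using False by (simp add: dot_square_norm power2_eq_square)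
    then show ?thesis using 1 \<rho> by (simp add: pos_le_divide_eq mult_ac)
  qed (use \<rho> in simp)
qed

end

lemma tangent_critical:
  fixes g :: "fvec \<Rightarrow> real"
  assumes v: "v \<in> tangent_space M m" and g: "(g has_derivative g') (at m)"
    and min: "\<delta> > 0" "\<And>q. q \<in> M \<Longrightarrow> dist q m < \<delta> \<Longrightarrow> g m \<le> g q"
  shows "g' v = 0"
proof -
  obtain \<gamma> :: "real \<Rightarrow> fvec" where \<gamma>: "\<And>t. t \<in> {-1<..<1} \<Longrightarrow> \<gamma> t \<in> M" "\<gamma> 0 = m"
    "(\<gamma> has_vector_derivative v) (at 0)"
    using v unfolding tangent_space_def mem_Collect_eq by metis
  have "((\<lambda>t. g (\<gamma> t)) has_derivative (\<lambda>t. g' (t *\<^sub>R v))) (at 0)"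
    using has_derivative_compose[of \<gamma> "\<lambda>t. t *\<^sub>R v" 0 UNIV g g'] \<gamma>(2,3) g
    by (simp add: has_vector_derivative_def)
  moreover have "(\<lambda>t. g' (t *\<^sub>R v)) = (\<lambda>t. t * g' v)"
    using has_derivative_linear[OF g] by (simp add: linear_scale)
  ultimately have d: "DERIV (\<lambda>t. g (\<gamma> t)) 0 :> g' v"
    by (simp add: has_field_derivative_def mult.commute[of _ "g' v"])
  have "(\<gamma> \<longlongrightarrow> \<gamma> 0) (at 0)"
    using has_vector_derivative_continuous[OF \<gamma>(3)] by (simp add: continuous_within)
  then obtain \<tau> where \<tau>: "\<tau> > 0" "\<And>t. t \<noteq> 0 \<Longrightarrow> \<bar>t\<bar> < \<tau> \<Longrightarrow> dist (\<gamma> t) m < \<delta>"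
    using min(1) \<gamma>(2) unfolding tendsto_iff eventually_at by (auto simp: dist_norm)
  show ?thesis
  proof (rule DERIV_local_min[OF d, of "min \<tau> 1"])
    show "\<forall>y. \<bar>0 - y\<bar> < min \<tau> 1 \<longrightarrow> g (\<gamma> 0) \<le> g (\<gamma> y)"
    proof (intro allI impI)
      fix t :: real assume t: "\<bar>0 - t\<bar> < min \<tau> 1"
      then have "\<gamma> t \<in> M" by (intro \<gamma>(1)) auto
      moreover have "dist (\<gamma> t) m < \<delta>" using \<tau>(2)[of t] t \<gamma>(2) min(1) by (cases "t = 0") auto
      ultimately show "g (\<gamma> 0) \<le> g (\<gamma> t)" using min(2) \<gamma>(2) by simp
    qed
  qed (use \<tau> in simp)
qed

lemma has_derivative_dist_sq:
  "((\<lambda>x. (norm (x - z :: 'a::real_inner))\<^sup>2) has_derivative (\<lambda>v. 2 * inner (m - z) v)) (at m)"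
proof -
  have "((\<lambda>x. inner (x - z) (x - z)) has_derivative (\<lambda>v. inner (m - z) v + inner v (m - z))) (at m)"
    by (rule derivative_eq_intros refl | simp)+
  moreover have "(\<lambda>v. inner (m - z) v + inner v (m - z)) = (\<lambda>v. 2 * inner (m - z) v)"
    by (simp add: fun_eq_iff inner_commute[of _ "m - z"])
  ultimately show ?thesis by (simp only: power2_norm_eq_inner)
qed

lemma nearest_perp:
  assumes a: "a \<in> M" "dist z a = infdist z M" and v: "v \<in> tangent_space M a"
  shows "inner (z - a) v = 0"
proof -
  have "2 * inner (a - z) v = 0"
  proof (rule tangent_critical[OF v has_derivative_dist_sq])
    fix q assume "q \<in> M"
    then have "dist z a \<le> dist z q" using a by (simp add: infdist_le)
    then show "(norm (a - z))\<^sup>2 \<le> (norm (q - z))\<^sup>2"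
      by (intro power_mono) (auto simp: dist_norm norm_minus_commute)
  qed (rule zero_less_one)
  then show ?thesis by (simp add: inner_diff_left)
qed

text \<open>Let \<open>a\<close> and \<open>b\<close> be two nearest points of \<open>z\<close> at
  distance r. Equal distances give (norm (b - a))^2 = 2 inner (b - a) (z - a), and as
  \<open>z - a\<close> is normal at \<open>a\<close>, only the normal part of \<open>b - a\<close>
  counts; its quadratic bound yields 1 \<le> r / \<rho>.\<close>

lemma reach_geI:
  assumes \<rho>: "\<rho> > 0"
    and T: "\<And>a. a \<in> M \<Longrightarrow> fin_subspace (T a)" "\<And>a. a \<in> M \<Longrightarrow> T a \<subseteq> tangent_space M a"
    and F: "\<And>a b. a \<in> M \<Longrightarrow> b \<in> M \<Longrightarrow> norm ((b - a) - oproj (T a) (b - a)) \<le> (norm (b - a))\<^sup>2 / (2 * \<rho>)"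
  shows "ereal \<rho> \<le> reach D M"
  unfolding reach_def
proof (intro INF_greatest)
  fix p z assume p: "p \<in> M" and "z \<in> medial_axis D M"
  then obtain a b where ab: "a \<in> M" "b \<in> M" "a \<noteq> b" "dist z a = infdist z M" "dist z b = infdist z M"
    by (auto simp: medial_axis_def)
  let ?r = "infdist z M" and ?w = "(b - a) - oproj (T a) (b - a)"
  have "inner (oproj (T a) (b - a)) (z - a) = 0"
    using nearest_perp[OF ab(1,4)] oproj_in[OF T(1)[OF ab(1)]] T(2)[OF ab(1)] inner_commute by (metis subsetD)
  then have "inner (b - a) (z - a) = inner ?w (z - a)" by (simp add: inner_diff_left)
  also have "\<dots> \<le> norm ?w * norm (z - a)" by (rule norm_cauchy_schwarz)
  also have "norm (z - a) = ?r" using ab by (simp add: dist_norm)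
  also have "norm ?w * ?r \<le> (norm (b - a))\<^sup>2 / (2 * \<rho>) * ?r"
    by (intro mult_right_mono F ab infdist_nonneg)
  finally have 1: "inner (b - a) (z - a) \<le> (norm (b - a))\<^sup>2 / (2 * \<rho>) * ?r" .
  have "(norm ((z - a) - (b - a)))\<^sup>2 = (norm (z - a))\<^sup>2" using ab by (simp add: dist_norm)
  then have "(norm (b - a))\<^sup>2 = 2 * inner (b - a) (z - a)"
    unfolding norm_sq_diff[of "z - a" "b - a"] inner_commute[of "z - a"] by simp
  then have "(norm (b - a))\<^sup>2 \<le> (norm (b - a))\<^sup>2 * (?r / \<rho>)" using 1 \<rho> by simp
  moreover have "0 < (norm (b - a))\<^sup>2" using ab(3) by simp
  ultimately have "1 \<le> ?r / \<rho>" using mult_le_cancel_left_pos[of "(norm (b - a))\<^sup>2" 1 "?r / \<rho>"] by simp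
  then have "\<rho> \<le> ?r" using \<rho> by simp
  also have "?r \<le> dist p z" using infdist_le[OF p, of z] by (simp add: dist_commute)
  finally show "ereal \<rho> \<le> ereal (dist p z)" by simp
qed

section \<open>Manifolds of reach \<rho> at scales proportional to \<rho>: local graphs and
  variation of the tangent spaces\<close>

section \<open>Local geometry of manifolds of positive reach\<close>

locale reach_manifold =
  fixes k :: enat and D d :: nat and M :: "fvec set" and \<rho> :: real
  assumes M_class: "M \<in> manifold_class k D d \<rho>" and k: "1 \<le> k" and \<rho>: "0 < \<rho>"
begin

abbreviation T :: "fvec \<Rightarrow> fvec set" where "T \<equiv> tangent_space M"
abbreviation P :: "fvec \<Rightarrow> fvec \<Rightarrow> fvec" where "P a \<equiv> oproj (tangent_space M a)"

lemma submfd: "submanifold k D d M" and connected: "connected M"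
  using M_class by (auto simp: manifold_class_def)

sublocale unique_nearest D M \<rho>
proof
  show "compact M" "M \<noteq> {}" using M_class by (auto simp: manifold_class_def)
  show "M \<subseteq> Rn D" by (rule submanifold_subset[OF submfd k])
  show "a = b" if "z \<in> Rn D" "infdist z M < \<rho>" "a \<in> M" "b \<in> M"
    "dist z a = infdist z M" "dist z b = infdist z M" for z a b
    using reach_unique_nearest[of \<rho> D M z a b] that M_class by (auto simp: manifold_class_def)
qed

lemma in_Rn: "a \<in> M \<Longrightarrow> a \<in> Rn D"
  using subset by blast

lemma T_fin: "a \<in> M \<Longrightarrow> fin_subspace (T a)"
  and T_dim: "a \<in> M \<Longrightarrow> dim (T a) = d"
  and T_approx: "a \<in> M \<Longrightarrow> tangent_approx M (T a) a"
  and T_subset: "a \<in> M \<Longrightarrow> T a \<subseteq> Rn D"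
  using submanifold_tangent[OF submfd k] tangent_space_subset[OF submfd k] by auto

lemma normal_part: "a \<in> M \<Longrightarrow> q \<in> M \<Longrightarrow> norm ((q - a) - P a (q - a)) \<le> (norm (q - a))\<^sup>2 / (2 * \<rho>)"
  by (rule federer[OF _ T_fin T_approx T_subset \<rho>])

text \<open>A bound below 1 makes projection between the tangent spaces bijective; with 1/2,
  \<open>projection_lower_bound\<close> still retains a quarter of a secant.\<close>

definition tilt_bound :: "real \<Rightarrow> bool" where
  "tilt_bound \<delta> \<longleftrightarrow> (\<forall>a\<in>M. \<forall>m\<in>M. dist a m \<le> \<delta> \<longrightarrow> sub_angle (T a) (T m) (1/2))"

definition tilt_lipschitz :: "real \<Rightarrow> real \<Rightarrow> bool" where
  "tilt_lipschitz \<delta> L \<longleftrightarrow> (\<forall>a\<in>M. \<forall>m\<in>M. dist a m \<le> \<delta> \<longrightarrow> sub_angle (T a) (T m) (L * dist a m / \<rho>))"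

text \<open>A Lebesgue number for the cover by balls on which the tangent space stays within 1/4 of
  that at the centre. It depends on \<open>M\<close>, so it cannot serve as the final scale.\<close>

lemma tilt_bound_small: "\<exists>\<delta>>0. tilt_bound \<delta>"
proof -
  have "\<forall>a\<in>M. \<exists>\<delta>>0. \<forall>m\<in>M. dist m a < \<delta> \<longrightarrow> sub_angle (T a) (T m) (1/4)"
    using tangent_space_continuous[OF submfd k, of _ "1/4"] by auto
  then obtain \<delta> where \<delta>: "\<And>a. a \<in> M \<Longrightarrow> \<delta> a > 0"
    "\<And>a m. a \<in> M \<Longrightarrow> m \<in> M \<Longrightarrow> dist m a < \<delta> a \<Longrightarrow> sub_angle (T a) (T m) (1/4)" by metis
  have "M \<subseteq> \<Union>((\<lambda>a. ball a (\<delta> a)) ` M)" using \<delta>(1) by fastforce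
  then obtain e where e: "e > 0" "\<forall>x\<in>M. \<exists>G\<in>(\<lambda>a. ball a (\<delta> a)) ` M. ball x e \<subseteq> G"
    by (rule Heine_Borel_lemma[OF compact]) (use open_ball in blast)+
  have "tilt_bound (e / 2)"
    unfolding tilt_bound_def
  proof (intro ballI impI)
    fix x y assume xy: "x \<in> M" "y \<in> M" "dist x y \<le> e / 2"
    obtain a where a: "a \<in> M" "ball x e \<subseteq> ball a (\<delta> a)" using e(2) xy(1) by blast
    have "x \<in> ball x e" "y \<in> ball x e" using xy e(1) by auto
    then have "x \<in> ball a (\<delta> a)" "y \<in> ball a (\<delta> a)" using a(2) by blast+
    then have "dist x a < \<delta> a" "dist y a < \<delta> a" by (simp_all add: dist_commute)
    then have "sub_angle (T a) (T x) (1/4)" "sub_angle (T a) (T y) (1/4)" using \<delta>(2) a(1) xy by auto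
    then have "sub_angle (T x) (T a) (1/4)" "sub_angle (T a) (T y) (1/4)"
      using sub_angle_sym[OF T_fin[OF a(1)] T_fin[OF xy(1)], of "1/4"] T_dim a(1) xy by simp_all
    then have "sub_angle (T x) (T y) (1/4 + 1/4)"
      using sub_angle_trans[OF T_fin[OF xy(1)] T_fin[OF a(1)] T_fin[OF xy(2)], of "1/4" "1/4"] by simp
    then show "sub_angle (T x) (T y) (1/2)" by simp
  qed
  then show ?thesis using e(1) by (intro exI[of _ "e / 2"]) auto
qed

text \<open>A point of \<open>M\<close> above \<open>v\<close> is found as the minimiser of the distance from the projection to \<open>v\<close>:
  at an interior minimiser the gradient vanishes along the tangent space there, which projects
  onto \<open>T a\<close>.\<close>

lemma graph_point:
  assumes V: "tilt_bound \<delta>" and \<delta>: "0 < \<delta>" "\<delta> \<le> \<rho> / 2" and a: "a \<in> M" and v: "v \<in> T a" "norm v \<le> \<delta> / 4"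
  obtains q where "q \<in> M" "P a (q - a) = v" "norm (q - a) \<le> 4 / 3 * norm v"
proof -
  interpret P: bounded_linear "P a" by (rule bounded_linear_oproj[OF T_fin[OF a]])
  let ?K = "M \<inter> cball a \<delta>"
  let ?f = "\<lambda>m. norm (P a (m - a) - v)"
  have "a \<in> ?K" using a \<delta> by auto
  then have ne: "?K \<noteq> {}" by blast
  have co: "compact ?K" by (intro compact_Int_closed compact closed_cball)
  have "continuous_on ?K ?f" by (intro continuous_intros P.continuous_on)
  then obtain m where m: "m \<in> ?K" "\<And>q. q \<in> ?K \<Longrightarrow> ?f m \<le> ?f q"
    using continuous_attains_inf[OF co ne] by blast
  have mM: "m \<in> M" using m(1) by blast
  have fm: "?f m \<le> norm v" using m(2)[OF \<open>a \<in> ?K\<close>] by (simp add: P.zero)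
  have ma: "norm (m - a) \<le> \<delta>" using m(1) by (simp add: dist_norm norm_minus_commute)
  have np: "norm ((m - a) - P a (m - a)) \<le> norm (m - a) / 4"
  proof -
    have "norm ((m - a) - P a (m - a)) \<le> (norm (m - a))\<^sup>2 / (2 * \<rho>)" by (rule normal_part[OF a mM])
    also have "\<dots> \<le> norm (m - a) / 4"
    proof -
      have "norm (m - a) * norm (m - a) \<le> norm (m - a) * (\<rho> / 2)"
        using ma \<delta> by (intro mult_left_mono) auto
      then show ?thesis using \<rho> by (simp add: power2_eq_square pos_divide_le_eq)
    qed
    finally show ?thesis .
  qed
  \<comment> \<open>On the boundary the normal part, the residual and \<open>v\<close> would each
    have length at most \<open>\<delta> / 4\<close>, too little to add up to \<delta>.\<close>
  have "norm (m - a) < \<delta>"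
  proof (rule ccontr)
    assume "\<not> norm (m - a) < \<delta>"
    then have eq: "norm (m - a) = \<delta>" using ma by simp
    have "norm (m - a) \<le> norm ((m - a) - P a (m - a)) + ?f m + norm v"
      using norm_triangle_ineq[of "(m - a) - P a (m - a)" "P a (m - a)"]
        norm_triangle_ineq[of "P a (m - a) - v" v] by simp
    then show False using np fm v(2) eq \<delta>(1) by simp
  qed
  define g where "g x = (norm (P a x - (P a a + v)))\<^sup>2" for x
  have g: "(g has_derivative (\<lambda>w. 2 * inner (P a m - (P a a + v)) (P a w))) (at m)"
    unfolding g_def
    using has_derivative_compose[OF bounded_linear_imp_has_derivative[OF P.bounded_linear_axioms] has_derivative_dist_sq] .
  let ?y = "P a (m - a) - v"
  have crit: "inner ?y (P a w) = 0" if w: "w \<in> T m" for w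
  proof -
    have "2 * inner (P a m - (P a a + v)) (P a w) = 0"
    proof (rule tangent_critical[OF w g])
      show "0 < \<delta> - norm (m - a)" using \<open>norm (m - a) < \<delta>\<close> by simp
      fix q assume q: "q \<in> M" "dist q m < \<delta> - norm (m - a)"
      have "dist a q \<le> \<delta>" using dist_triangle[of a q m] q(2) by (simp add: dist_norm norm_minus_commute)
      then have "?f m \<le> ?f q" using q(1) by (intro m(2)) auto
      then show "g m \<le> g q" unfolding g_def by (intro power_mono) (auto simp: P.diff algebra_simps)
    qed
    then show ?thesis by (simp add: P.diff algebra_simps)
  qed
  have "sub_angle (T m) (T a) (1/2)" using V mM a ma by (auto simp: tilt_bound_def dist_norm)
  then have onto: "P a ` T m = T a"
    using sub_angle_onto(1)[OF T_fin[OF mM] T_fin[OF a], of "1/2"] T_dim a mM by simp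
  have "?y \<in> T a"
    using oproj_in[OF T_fin[OF a]] v(1) fin_subspace_imp_subspace[OF T_fin[OF a]] by (simp add: subspace_diff)
  then obtain w where "w \<in> T m" "?y = P a w" using onto by (metis imageE)
  then have "inner ?y ?y = 0" using crit by metis
  then have Pv: "P a (m - a) = v" by simp
  have "norm (m - a) \<le> norm ((m - a) - P a (m - a)) + norm v"
    using norm_triangle_ineq[of "(m - a) - P a (m - a)" "P a (m - a)"] Pv by simp
  then show ?thesis using that[OF mM Pv] np by simp
qed

text \<open>Scale \<open>v\<close> to the length of \<open>a - m\<close> and take the point
  \<open>q\<close> of \<open>M\<close> above it. The scaled vector differs from
  \<open>(q - m) - (a - m)\<close> by the normal part of \<open>q - a\<close>, and both secants at
  \<open>m\<close> are tangent at \<open>m\<close>, all up to quadratic errors.\<close>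

lemma tilt_lipschitzI:
  assumes V: "tilt_bound \<delta>" and \<delta>: "0 < \<delta>" "\<delta> \<le> \<rho> / 2"
  shows "tilt_lipschitz (\<delta> / 4) 5"
  unfolding tilt_lipschitz_def sub_angle_def
proof (intro ballI impI)
  fix a m v assume a: "a \<in> M" and m: "m \<in> M" and am: "dist a m \<le> \<delta> / 4" and v: "v \<in> T a"
  interpret P: bounded_linear "P m" by (rule bounded_linear_oproj[OF T_fin[OF m]])
  show "norm (v - P m v) \<le> 5 * dist a m / \<rho> * norm v"
  proof (cases "a = m \<or> v = 0")
    case True then show ?thesis using oproj_id[OF T_fin[OF a] v] by (auto simp: P.zero)
  next
    case False
    define t where "t = norm (a - m)"
    have t: "t > 0" using False by (simp add: t_def)
    define c where "c = t / norm v"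
    have c: "c > 0" using t False by (simp add: c_def)
    have w: "c *\<^sub>R v \<in> T a" "norm (c *\<^sub>R v) = t"
      using v fin_subspace_imp_subspace[OF T_fin[OF a]] c t False by (auto simp: subspace_scale c_def)
    obtain q where q: "q \<in> M" "P a (q - a) = c *\<^sub>R v" "norm (q - a) \<le> 4 / 3 * t"
      using graph_point[OF V \<delta> a w(1)] w(2) am by (auto simp: t_def dist_norm)
    have qm: "norm (q - m) \<le> 7 / 3 * t"
      using norm_triangle_ineq[of "q - a" "a - m"] q(3) by (simp add: t_def)
    have 1: "norm ((q - a) - c *\<^sub>R v) \<le> (4 / 3 * t)\<^sup>2 / (2 * \<rho>)"
      using order_trans[OF normal_part[OF a q(1)] divide_right_mono[OF power_mono[OF q(3)]]] q(2) \<rho> by simp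
    have 2: "norm ((q - m) - P m (q - m)) \<le> (7 / 3 * t)\<^sup>2 / (2 * \<rho>)"
      using order_trans[OF normal_part[OF m q(1)] divide_right_mono[OF power_mono[OF qm]]] \<rho> by simp
    have 3: "norm ((a - m) - P m (a - m)) \<le> t\<^sup>2 / (2 * \<rho>)"
      using normal_part[OF m a] by (simp add: t_def)
    have "norm (c *\<^sub>R v - P m (c *\<^sub>R v)) \<le> norm (c *\<^sub>R v - (P m (q - m) - P m (a - m)))"
      using oproj_in[OF T_fin[OF m]] fin_subspace_imp_subspace[OF T_fin[OF m]]
      by (intro norm_minus_oproj_min[OF T_fin[OF m]]) (simp add: subspace_diff)
    also have "c *\<^sub>R v - (P m (q - m) - P m (a - m)) =
        ((q - m) - P m (q - m)) - ((a - m) - P m (a - m)) - ((q - a) - c *\<^sub>R v)" by simp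
    also have "norm \<dots> \<le> norm ((q - m) - P m (q - m)) + norm ((a - m) - P m (a - m)) + norm ((q - a) - c *\<^sub>R v)"
      by (intro order_trans[OF norm_triangle_ineq4] add_mono norm_triangle_ineq4 order_refl)
    also have "\<dots> \<le> (7 / 3 * t)\<^sup>2 / (2 * \<rho>) + t\<^sup>2 / (2 * \<rho>) + (4 / 3 * t)\<^sup>2 / (2 * \<rho>)"
      using 1 2 3 by linarith
    \<comment> \<open>The three terms add up to 37/9 times t^2 / \<rho>.\<close>
    also have "\<dots> \<le> 5 * t / \<rho> * t" using \<rho> t by (simp add: field_simps power2_eq_square)
    finally have "c * norm (v - P m v) \<le> 5 * t / \<rho> * t"
      using c by (simp add: P.scaleR scaleR_diff_right[symmetric])
    also have "\<dots> = c * (5 * t / \<rho> * norm v)" using False by (simp add: c_def)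
    finally show ?thesis using c unfolding mult_le_cancel_left_pos[OF c] by (simp add: t_def dist_norm)
  qed
qed

text \<open>The nearest point \<open>q\<close> of the midpoint \<open>z\<close> is very close to it.
  With r the distance from \<open>z\<close> to \<open>q\<close>, the inner products of
  \<open>a - q\<close> and \<open>m - q\<close> with \<open>z - q\<close> add up to 2 r^2; as
  \<open>z - q\<close> is normal at \<open>q\<close>, the quadratic bound on normal parts makes r of
  order t^2 / \<rho>, where t is the distance of \<open>a\<close> and \<open>m\<close>.\<close>

lemma midpoint_projection:
  assumes a: "a \<in> M" and m: "m \<in> M" and am: "dist a m \<le> \<rho> / 10"
  obtains q where "q \<in> M" "dist a q \<le> 31 / 60 * dist a m" "dist q m \<le> 31 / 60 * dist a m"
proof -
  define z where "z = midpoint a m"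
  define t where "t = dist a m"
  obtain q where q: "q \<in> M" "infdist z M = dist z q" using compact_nearest[OF compact nonempty] .
  define r where "r = norm (z - q)"
  have az: "dist a z = t / 2" "dist m z = t / 2" unfolding z_def t_def by (auto simp: dist_midpoint)
  have rt: "r \<le> t / 2" using infdist_le[OF a, of z] q(2) az by (simp add: r_def dist_norm norm_minus_commute)
  have i: "inner (b - q) (z - q) \<le> (norm (b - q))\<^sup>2 / (2 * \<rho>) * r" if b: "b \<in> M" for b
  proof -
    have "inner (z - q) (P q (b - q)) = 0"
      using nearest_perp[OF q(1) q(2)[symmetric]] oproj_in[OF T_fin[OF q(1)]] by blast
    then have "inner (b - q) (z - q) = inner ((b - q) - P q (b - q)) (z - q)"
      unfolding inner_diff_left[of "b - q" "P q (b - q)"] inner_commute[of "P q (b - q)"] by simp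
    also have "\<dots> \<le> norm ((b - q) - P q (b - q)) * r" unfolding r_def by (rule norm_cauchy_schwarz)
    also have "\<dots> \<le> (norm (b - q))\<^sup>2 / (2 * \<rho>) * r"
      by (intro mult_right_mono normal_part q(1) b) (simp add: r_def)
    finally show ?thesis .
  qed
  have eqa: "a - q = (z - q) + (a - m) /\<^sub>R 2" and eqm: "m - q = (z - q) - (a - m) /\<^sub>R 2"
    by (auto simp: z_def midpoint_def algebra_simps scaleR_left_distrib[symmetric] scaleR_2[symmetric])
  have par: "(norm (w + h))\<^sup>2 + (norm (w - h))\<^sup>2 = 2 * (norm w)\<^sup>2 + 2 * (norm h)\<^sup>2" for w h :: fvec
    by (simp add: norm_sq_add norm_sq_diff)
  have "norm ((a - m) /\<^sub>R 2) = t / 2" by (simp add: t_def dist_norm)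
  then have sq: "(norm (a - q))\<^sup>2 + (norm (m - q))\<^sup>2 = 2 * r\<^sup>2 + t\<^sup>2 / 2"
    unfolding eqa eqm par r_def by (simp add: power_divide)
  have "inner (w + h) w + inner (w - h) w = 2 * (norm w)\<^sup>2" for w h :: fvec
    by (simp add: inner_add_left inner_diff_left power2_norm_eq_inner)
  then have "inner (a - q) (z - q) + inner (m - q) (z - q) = 2 * r\<^sup>2"
    unfolding eqa eqm r_def by blast
  then have "2 * r\<^sup>2 \<le> (norm (a - q))\<^sup>2 / (2 * \<rho>) * r + (norm (m - q))\<^sup>2 / (2 * \<rho>) * r"
    using i[OF a] i[OF m] by simp
  also have "\<dots> = ((norm (a - q))\<^sup>2 + (norm (m - q))\<^sup>2) / (2 * \<rho>) * r"
    by (simp add: add_divide_distrib distrib_right)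
  also have "\<dots> = (2 * r\<^sup>2 + t\<^sup>2 / 2) / (2 * \<rho>) * r" by (simp only: sq)
  finally have "r * (2 * r) \<le> r * ((2 * r\<^sup>2 + t\<^sup>2 / 2) / (2 * \<rho>))" by (simp add: power2_eq_square mult_ac)
  moreover have "r \<ge> 0" by (simp add: r_def)
  ultimately have rr: "r = 0 \<or> 2 * r \<le> (2 * r\<^sup>2 + t\<^sup>2 / 2) / (2 * \<rho>)"
    by (metis mult_le_cancel_left_pos order_le_less)
  have t0: "t \<ge> 0" "t \<le> \<rho> / 10" using am by (auto simp: t_def)
  \<comment> \<open>Added to half the distance this is the factor 30/60 + 1/60 of the
    conclusion.\<close>
  have "r \<le> t / 60"
  proof (cases "r = 0")
    case False
    then have "4 * \<rho> * r \<le> 2 * r\<^sup>2 + t\<^sup>2 / 2" using rr \<rho> by (simp add: pos_le_divide_eq mult_ac)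
    moreover have "2 * r\<^sup>2 \<le> 2 * (r * (\<rho> / 20))"
      using rt t0 \<open>r \<ge> 0\<close> unfolding power2_eq_square by (intro mult_left_mono) auto
    moreover have "t\<^sup>2 \<le> t * (\<rho> / 10)" using t0 unfolding power2_eq_square by (intro mult_left_mono) auto
    ultimately have "\<rho> * (39 / 10 * r) \<le> \<rho> * (t / 20)" by (simp add: algebra_simps)
    then have "39 / 10 * r \<le> t / 20" using \<rho> by (simp only: mult_le_cancel_left_pos)
    then show ?thesis using t0 \<open>r \<ge> 0\<close> by simp
  qed (use t0 in simp)
  then have "dist a q \<le> 31 / 60 * t" "dist q m \<le> 31 / 60 * t"
    using dist_triangle[of a q z] dist_triangle[of q m z] az
    by (auto simp: r_def dist_norm norm_minus_commute)
  then show ?thesis using that[OF q(1)] by (simp add: t_def)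
qed

text \<open>The angles to the projected midpoint add up. Two legs of 31/60 give the factor 31/30,
  and 19/10 is admissible because 19/10 times 31/60 is below 1.\<close>

lemma tilt_lipschitz_double:
  assumes U: "tilt_lipschitz \<delta> L" and L: "0 \<le> L"
  shows "tilt_lipschitz (min (19 / 10 * \<delta>) (\<rho> / 20)) (31 / 30 * L)"
  unfolding tilt_lipschitz_def
proof (intro ballI impI)
  fix a m assume a: "a \<in> M" and m: "m \<in> M" and am: "dist a m \<le> min (19 / 10 * \<delta>) (\<rho> / 20)"
  obtain q where q: "q \<in> M" "dist a q \<le> 31 / 60 * dist a m" "dist q m \<le> 31 / 60 * dist a m"
    using midpoint_projection[OF a m] am \<rho> by auto
  have "0 \<le> dist a m" "dist a m \<le> 19 / 10 * \<delta>" using am by auto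
  then have "dist a q \<le> \<delta>" "dist q m \<le> \<delta>" using q(2,3) by linarith+
  then have "sub_angle (T a) (T q) (L * dist a q / \<rho>)" "sub_angle (T q) (T m) (L * dist q m / \<rho>)"
    using U a m q(1) by (auto simp: tilt_lipschitz_def)
  then have s: "sub_angle (T a) (T m) (L * dist a q / \<rho> + L * dist q m / \<rho>)"
    using L \<rho> by (intro sub_angle_trans[OF T_fin T_fin T_fin]) (auto simp: a q m)
  have "L * (dist a q + dist q m) \<le> L * (31 / 30 * dist a m)" using q L by (intro mult_left_mono) auto
  then have "L * (dist a q + dist q m) / \<rho> \<le> L * (31 / 30 * dist a m) / \<rho>"
    using \<rho> by (intro divide_right_mono) auto
  then have "L * dist a q / \<rho> + L * dist q m / \<rho> \<le> 31 / 30 * L * dist a m / \<rho>"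
    by (simp add: add_divide_distrib distrib_left mult_ac)
  then show "sub_angle (T a) (T m) (31 / 30 * L * dist a m / \<rho>)" by (rule sub_angle_mono[OF s])
qed

text \<open>Bootstrapping in the scale: a qualitative tilt bound at scale \<open>\<delta>\<close> gives a Lipschitz bound for the tilt
  at scale \<open>\<delta> / 4\<close>, which passes through midpoints to larger scales and yields the qualitative bound at
  scale \<open>1.7 * \<delta>\<close>.  So the scale can be raised to \<open>\<rho> / 20\<close>, whatever scale continuity provides.\<close>

lemma tilt_bound_step:
  assumes V: "tilt_bound \<delta>" and \<delta>: "0 < \<delta>" "\<delta> \<le> \<rho> / 20"
  shows "tilt_bound (min (17 / 10 * \<delta>) (\<rho> / 20))"
  unfolding tilt_bound_def
proof (intro ballI impI)
  have "tilt_lipschitz (\<delta> / 4) 5" by (rule tilt_lipschitzI[OF V]) (use \<delta> \<rho> in auto)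
  \<comment> \<open>Three midpoint steps: (19/10)^3 / 4 exceeds 17/10, and 5 (31/30)^3 is below 6,
    so that at distance \<rho>/20 the angle stays below 1/2.\<close>
  then have U: "tilt_lipschitz (min (19 / 10 * (min (19 / 10 * (min (19 / 10 * (\<delta> / 4)) (\<rho> / 20))) (\<rho> / 20))) (\<rho> / 20))
      (31 / 30 * (31 / 30 * (31 / 30 * 5)))"
    by (intro tilt_lipschitz_double) auto
  fix a m assume a: "a \<in> M" and m: "m \<in> M" and am: "dist a m \<le> min (17 / 10 * \<delta>) (\<rho> / 20)"
  have "dist a m \<le> min (19 / 10 * (min (19 / 10 * (min (19 / 10 * (\<delta> / 4)) (\<rho> / 20))) (\<rho> / 20))) (\<rho> / 20)"
  proof -
    have "dist a m \<le> 17 / 10 * \<delta>" "dist a m \<le> \<rho> / 20" using am by auto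
    then show ?thesis using \<rho> \<delta> by (auto simp: min_def)
  qed
  then have "sub_angle (T a) (T m) (31 / 30 * (31 / 30 * (31 / 30 * 5)) * dist a m / \<rho>)"
    using U a m unfolding tilt_lipschitz_def by blast
  then show "sub_angle (T a) (T m) (1/2)"
    by (rule sub_angle_mono) (use am \<rho> in \<open>simp add: pos_divide_le_eq\<close>)
qed

text \<open>Each step restores the same bound 1/2, so the number of steps, which depends on
  \<open>M\<close>, leaves no trace in the result.\<close>

lemma tilt_bound: "tilt_bound (\<rho> / 20)"
proof -
  obtain \<delta>0 where \<delta>0: "\<delta>0 > 0" "tilt_bound \<delta>0" using tilt_bound_small by blast
  have *: "tilt_bound (min ((17 / 10) ^ n * \<delta>0) (\<rho> / 20))" for n
  proof (induction n)
    case 0 show ?case using \<delta>0(2) by (auto simp: tilt_bound_def)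
  next
    case (Suc n)
    have "tilt_bound (min (17 / 10 * min ((17 / 10) ^ n * \<delta>0) (\<rho> / 20)) (\<rho> / 20))"
      using \<delta>0(1) \<rho> by (intro tilt_bound_step Suc) auto
    moreover have "min (17 / 10 * min x (\<rho> / 20)) (\<rho> / 20) = min (17 / 10 * x) (\<rho> / 20)" for x
      using \<rho> by (auto simp: min_def)
    ultimately show ?case by (simp add: mult.assoc)
  qed
  obtain n where "\<rho> / 20 / \<delta>0 < (17 / 10 :: real) ^ n" using real_arch_pow[of "17/10" "\<rho> / 20 / \<delta>0"] by auto
  then have "\<rho> / 20 \<le> (17 / 10) ^ n * \<delta>0" using \<delta>0(1) by (simp add: pos_divide_less_eq)
  then show ?thesis using *[of n] by (simp add: min_absorb2)
qed

lemma tilt: "a \<in> M \<Longrightarrow> m \<in> M \<Longrightarrow> dist a m \<le> \<rho> / 20 \<Longrightarrow> sub_angle (T a) (T m) (1/2)"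
  using tilt_bound by (auto simp: tilt_bound_def)

lemma point_above:
  assumes "a \<in> M" "v \<in> T a" "norm v \<le> \<rho> / 80"
  obtains q where "q \<in> M" "P a (q - a) = v" "norm (q - a) \<le> 4 / 3 * norm v"
  by (rule graph_point[OF tilt_bound _ _ assms(1,2)]) (use \<rho> assms(3) in auto)

text \<open>A secant from \<open>a\<close> to \<open>b\<close> loses at most 1/4 of its length to
  the normal space at \<open>a\<close> and 1/2 to the tilt between \<open>a\<close> and
  \<open>x\<close>; a quarter remains.\<close>

lemma projection_lower_bound:
  assumes x: "x \<in> M" and a: "a \<in> M" "dist x a \<le> \<rho> / 20" and b: "b \<in> M" "dist x b \<le> \<rho> / 20"
  shows "dist a b \<le> 4 * norm (P x (b - a))"
proof -
  have ba: "norm (b - a) \<le> \<rho> / 10"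
    using dist_triangle2[of a b x] a b by (simp add: dist_norm norm_minus_commute)
  have "norm ((b - a) - P x (b - a)) \<le> norm ((b - a) - P x (P a (b - a)))"
    by (rule norm_minus_oproj_min[OF T_fin[OF x] oproj_in[OF T_fin[OF x]]])
  also have "\<dots> \<le> norm ((b - a) - P a (b - a)) + norm (P a (b - a) - P x (P a (b - a)))"
    by (rule norm_diff_triangle_ineq[of "b - a" "P a (b - a)" "P a (b - a)", simplified])
  also have "norm ((b - a) - P a (b - a)) \<le> (norm (b - a))\<^sup>2 / (2 * \<rho>)" by (rule normal_part[OF a(1) b(1)])
  also have "\<dots> \<le> norm (b - a) / 4"
  proof -
    have "norm (b - a) * norm (b - a) \<le> norm (b - a) * (\<rho> / 2)" using ba \<rho> by (intro mult_left_mono) auto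
    then show ?thesis using \<rho> by (simp add: power2_eq_square pos_divide_le_eq)
  qed
  also have "norm (P a (b - a) - P x (P a (b - a))) \<le> 1 / 2 * norm (P a (b - a))"
    using tilt[OF a(1) x] a(2) oproj_in[OF T_fin[OF a(1)]] by (simp add: sub_angle_def dist_commute)
  also have "norm (P a (b - a)) \<le> norm (b - a)" by (rule norm_oproj_le[OF T_fin[OF a(1)]])
  finally have "norm ((b - a) - P x (b - a)) \<le> norm (b - a) / 4 + 1 / 2 * norm (b - a)" by simp
  then show ?thesis
    using norm_triangle_ineq[of "(b - a) - P x (b - a)" "P x (b - a)"] by (simp add: dist_norm norm_minus_commute)
qed

end

section \<open>Hausdorff measure: additivity on Borel sets, and two-sided bounds through
  \<open>d\<close> coordinates\<close>

section \<open>Hausdorff measure\<close>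

lemma outer_measure_spaceD:
  assumes f: "outer_measure_space (Pow UNIV) f"
  shows "f {} = 0" "A \<subseteq> B \<Longrightarrow> f A \<le> f B" "f (\<Union>i. C i) \<le> (\<Sum>i. f (C i))" "f (A \<union> B) \<le> f A + f B"
proof -
  show mono: "A \<subseteq> B \<Longrightarrow> f A \<le> f B" for A B
    using f by (auto simp: outer_measure_space_def increasing_def)
  show "f {} = 0" using f by (simp add: outer_measure_space_def positive_def)
  \<comment> \<open>Countable subadditivity is only postulated for disjoint families.\<close>
  have "f (\<Union>i. disjointed C i) \<le> (\<Sum>i. f (disjointed C i))"
    using f disjoint_family_disjointed[of C] by (auto simp: outer_measure_space_def countably_subadditive_def)
  also have "\<dots> \<le> (\<Sum>i. f (C i))"
    by (intro suminf_le summableI mono disjointed_subset)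
  finally show "f (\<Union>i. C i) \<le> (\<Sum>i. f (C i))" by (simp add: UN_disjointed_eq)
  have "f (A \<union> (B - A)) \<le> f A + f (B - A)"
    using f ring_of_sets.countably_subadditive_subadditive[of UNIV "Pow UNIV" f]
      sigma_algebra_Pow[of "UNIV :: 'a set"]
    by (intro subadditiveD[of "Pow UNIV"])
      (auto simp: outer_measure_space_def sigma_algebra_def algebra_def)
  also have "\<dots> \<le> f A + f B" by (intro add_left_mono mono) auto
  finally show "f (A \<union> B) \<le> f A + f B" by simp
qed

text \<open>Caratheodory's criterion: for an outer measure that is additive on sets at positive distance,
  the layers \<open>R k\<close> around a closed set have finite total mass, because layers of equal parity
  are at positive distance.\<close>

lemma metric_outer_closed:
  fixes f :: "'a::metric_space set \<Rightarrow> ennreal"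
  assumes f: "outer_measure_space (Pow UNIV) f"
    and add: "\<And>A B \<eta>. 0 < \<eta> \<Longrightarrow> (\<And>a b. a \<in> A \<Longrightarrow> b \<in> B \<Longrightarrow> \<eta> \<le> dist a b) \<Longrightarrow> f A + f B \<le> f (A \<union> B)"
    and F: "closed F" "F \<noteq> {}"
  shows "f (X \<inter> F) + f (X - F) \<le> f X"
proof (cases "f X = \<top>")
  case False
  note mono = outer_measure_spaceD(2)[OF f] and f0 = outer_measure_spaceD(1)[OF f]
    and sub = outer_measure_spaceD(3)[OF f] and sub2 = outer_measure_spaceD(4)[OF f]
  define G where "G n = {x \<in> X. 1 / (real n + 1) \<le> infdist x F}" for n :: nat
  define R where "R k = {x \<in> X. 1 / (real k + 2) \<le> infdist x F \<and> infdist x F < 1 / (real k + 1)}" for k :: nat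
  have sep: "infdist x F - infdist y F \<le> dist x y" for x y
    using infdist_triangle[of x F y] by simp
  have dec: "X - F \<subseteq> G n \<union> (\<Union>k. R (k + n))" for n
  proof
    fix x assume x: "x \<in> X - F"
    let ?i = "infdist x F"
    have i0: "0 < ?i" using x F in_closed_iff_infdist_zero[OF F, of x] infdist_nonneg[of x F] by auto
    show "x \<in> G n \<union> (\<Union>k. R (k + n))"
    proof (cases "1 / (real n + 1) \<le> ?i")
      case True then show ?thesis using x by (simp add: G_def)
    next
      case False
      obtain m where m: "1 / (real m + 2) \<le> ?i"
      proof -
        obtain m where "inverse (real (Suc m)) < ?i" using reals_Archimedean[OF i0] by blast
        moreover have "1 / (real m + 2) \<le> inverse (real (Suc m))" by (simp add: field_simps)
        ultimately show ?thesis using that[of m] by linarith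
      qed
      define N where "N = (LEAST m. 1 / (real m + 2) \<le> ?i)"
      have N: "1 / (real N + 2) \<le> ?i" unfolding N_def by (rule LeastI[of _ m]) (rule m)
      have lt1: "?i < 1 / (real n + 1)" using False by simp
      have "?i < 1 / (real N + 1)"
      proof (cases N)
        case 0
        have "1 / (real n + 1) \<le> 1" by simp
        then show ?thesis using order.strict_trans2[OF lt1] 0 by simp
      next
        case (Suc N')
        then have "\<not> 1 / (real N' + 2) \<le> ?i" using not_less_Least[of N' "\<lambda>m. 1 / (real m + 2) \<le> ?i"]
          by (simp add: N_def[symmetric])
        then show ?thesis using Suc by (simp add: add.commute)
      qed
      moreover have "n \<le> N"
      proof -
        have "1 / (real N + 2) < 1 / (real n + 1)" using N lt1 by simp
        then have "real n + 1 < real N + 2" by (simp add: field_simps)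
        then show ?thesis by simp
      qed
      ultimately have "x \<in> R (N - n + n)" using N x by (simp add: R_def)
      then show ?thesis by blast
    qed
  qed
  \<comment> \<open>With k = 2 m + p, earlier layers of the same parity have distance at least 1/k
    to \<open>F\<close> and the new one less than 1/(k + 1); the gap is the width of the skipped
    layer.\<close>
  have par: "(\<Sum>j<m. f (R (2 * j + p))) \<le> f (\<Union>j<m. R (2 * j + p))" for m p
  proof (induction m)
    case (Suc m)
    have "f (\<Union>j<m. R (2 * j + p)) + f (R (2 * m + p)) \<le> f ((\<Union>j<m. R (2 * j + p)) \<union> R (2 * m + p))"
    proof (rule add)
      have "0 < 1 / (a + 1) - 1 / (a + 2)" if "0 \<le> a" for a :: real
        using that by (simp add: divide_strict_left_mono)
      then show "0 < 1 / (real (2 * m + p) + 1) - 1 / (real (2 * m + p) + 2)" by simp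
      fix a b assume a: "a \<in> (\<Union>j<m. R (2 * j + p))" and b: "b \<in> R (2 * m + p)"
      then obtain j where j: "j < m" "1 / (real (2 * j + p) + 2) \<le> infdist a F" by (auto simp: R_def)
      have "1 / (real (2 * m + p)) \<le> 1 / (real (2 * j + p) + 2)"
        using j(1) by (intro divide_left_mono) auto
      moreover have "1 / (real (2 * m + p)) - 1 / (real (2 * m + p) + 1) \<ge> 1 / (real (2 * m + p) + 1) - 1 / (real (2 * m + p) + 2)"
      proof -
        have "1 / a - 1 / (a + 1) \<ge> 1 / (a + 1) - 1 / (a + 2)" if "0 < a" for a :: real
        proof -
          have "1 / a - 1 / (a + 1) = 1 / (a * (a + 1))" "1 / (a + 1) - 1 / (a + 2) = 1 / ((a + 1) * (a + 2))"
            using that by (simp_all add: field_simps)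
          moreover have "a * (a + 1) \<le> (a + 1) * (a + 2)" using that by (simp add: algebra_simps)
          ultimately show ?thesis using that by (simp add: frac_le)
        qed
        then show ?thesis using j(1) by simp
      qed
      moreover have "infdist b F < 1 / (real (2 * m + p) + 1)" using b by (simp add: R_def)
      ultimately show "1 / (real (2 * m + p) + 1) - 1 / (real (2 * m + p) + 2) \<le> dist a b"
        using sep[of a b] j(2) by linarith
    qed
    moreover have "(\<Union>j<m. R (2 * j + p)) \<union> R (2 * m + p) = (\<Union>j<Suc m. R (2 * j + p))"
      by (auto simp: less_Suc_eq)
    ultimately have "f (\<Union>j<m. R (2 * j + p)) + f (R (2 * m + p)) \<le> f (\<Union>j<Suc m. R (2 * j + p))" by simp
    then show ?case unfolding sum.lessThan_Suc by (rule order_trans[OF add_right_mono[OF Suc.IH]])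
  qed (simp add: f0)
  have RX: "R k \<subseteq> X" for k by (auto simp: R_def)
  have even_odd: "(\<Sum>k<2 * m. g k) = (\<Sum>j<m. g (2 * j + 0)) + (\<Sum>j<m. g (2 * j + 1))" for g :: "nat \<Rightarrow> ennreal" and m
    by (induction m) (simp_all add: ac_simps)
  have part: "(\<Sum>k<n. f (R k)) \<le> f X + f X" for n
  proof -
    have "(\<Sum>k<n. f (R k)) \<le> (\<Sum>k<2 * n. f (R k))" by (intro sum_mono2) auto
    also have "\<dots> \<le> f (\<Union>j<n. R (2 * j + 0)) + f (\<Union>j<n. R (2 * j + 1))"
      unfolding even_odd by (intro add_mono par)
    also have "\<dots> \<le> f X + f X" using RX by (intro add_mono mono) auto
    finally show ?thesis .
  qed
  have fin: "(\<Sum>k. f (R k)) < \<top>"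
  proof -
    have "(\<Sum>k. f (R k)) \<le> f X + f X" by (rule suminf_le_const[OF summableI part])
    also have "\<dots> < \<top>" using False by (simp add: less_top)
    finally show ?thesis .
  qed
  show ?thesis
  \<comment> \<open>Cut off the layers from some \<open>n\<close> on, whose total mass is at most
    \<open>e\<close>; what remains of \<open>X - F\<close> has positive distance from
    \<open>F\<close>.\<close>
  proof (rule ennreal_le_epsilon)
    fix e :: real assume e: "0 < e"
    have "(\<lambda>n. \<Sum>k<n. f (R k)) \<longlonglongrightarrow> (\<Sum>k. f (R k))" by (rule summable_LIMSEQ[OF summableI])
    moreover have "(\<Sum>k. f (R k)) < (\<Sum>k. f (R k)) + ennreal e" using fin e by simp
    ultimately have "(\<lambda>n. (\<Sum>k<n. f (R k)) + ennreal e) \<longlonglongrightarrow> (\<Sum>k. f (R k)) + ennreal e"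
      by (intro tendsto_intros)
    then have "eventually (\<lambda>n. (\<Sum>k. f (R k)) < (\<Sum>k<n. f (R k)) + ennreal e) sequentially"
      using \<open>(\<Sum>k. f (R k)) < (\<Sum>k. f (R k)) + ennreal e\<close> order_tendstoD(1) by blast
    then obtain n where n: "(\<Sum>k. f (R k)) < (\<Sum>k<n. f (R k)) + ennreal e"
      by (auto simp: eventually_sequentially)
    have "(\<Sum>k. f (R k)) = (\<Sum>k. f (R (k + n))) + (\<Sum>k<n. f (R k))"
      by (rule suminf_offset[OF summableI])
    then have "(\<Sum>k<n. f (R k)) + (\<Sum>k. f (R (k + n))) \<le> (\<Sum>k<n. f (R k)) + ennreal e"
      using n by (auto simp: add.commute[of "\<Sum>k. f (R (k + n))"] intro: less_imp_le)
    moreover have "(\<Sum>k<n. f (R k)) \<noteq> \<top>" using part[of n] False by (metis ennreal_add_eq_top neq_top_trans)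
    ultimately have tail: "(\<Sum>k. f (R (k + n))) \<le> ennreal e"
      by (simp add: ennreal_add_left_cancel_le)
    have "f (X - F) \<le> f (G n \<union> (\<Union>k. R (k + n)))" by (rule mono[OF dec])
    also have "\<dots> \<le> f (G n) + f (\<Union>k. R (k + n))" by (rule sub2)
    also have "\<dots> \<le> f (G n) + ennreal e" using sub[of "\<lambda>k. R (k + n)"] tail by (intro add_left_mono) auto
    finally have "f (X \<inter> F) + f (X - F) \<le> f (X \<inter> F) + f (G n) + ennreal e"
      by (simp add: add.assoc add_left_mono)
    also have "f (X \<inter> F) + f (G n) \<le> f ((X \<inter> F) \<union> G n)"
    proof (rule add)
      show "0 < 1 / (real n + 1)" by simp
      fix a b assume "a \<in> X \<inter> F" "b \<in> G n"
      then show "1 / (real n + 1) \<le> dist a b"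
        using infdist_le[of a F b] by (auto simp: G_def dist_commute)
    qed
    also have "\<dots> \<le> f X" by (rule mono) (auto simp: G_def)
    finally show "f (X \<inter> F) + f (X - F) \<le> f X + ennreal e" by (simp add: add_right_mono)
  qed
qed simp

text \<open>\<open>measure_of\<close> yields the zero measure unless its set function is a measure
  on the given sets; this is what makes \<open>hausdorff_measure\<close> agree with the outer
  measure on Borel sets.\<close>

lemma metric_outer_borel:
  fixes f :: "'a::metric_space set \<Rightarrow> ennreal"
  assumes f: "outer_measure_space (Pow UNIV) f"
    and add: "\<And>A B \<eta>. 0 < \<eta> \<Longrightarrow> (\<And>a b. a \<in> A \<Longrightarrow> b \<in> B \<Longrightarrow> \<eta> \<le> dist a b) \<Longrightarrow> f A + f B \<le> f (A \<union> B)"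
  shows "measure_space UNIV (sets borel) f"
proof -
  interpret sigma_algebra UNIV "Pow UNIV :: 'a set set" by (rule sigma_algebra_Pow)
  let ?L = "lambda_system UNIV (Pow UNIV) f"
  have ms: "measure_space UNIV ?L f" by (rule caratheodory_lemma[OF f])
  note f0 = outer_measure_spaceD(1)[OF f] and sub2 = outer_measure_spaceD(4)[OF f]
  have cl: "F \<in> ?L" if "closed F" for F
  proof -
    have "f (X \<inter> F) + f (X - F) = f X" for X
    proof (rule antisym)
      show "f (X \<inter> F) + f (X - F) \<le> f X"
        using metric_outer_closed[OF f add that] f0 by (cases "F = {}") auto
      have "X \<inter> F \<union> (X - F) = X" by blast
      then show "f X \<le> f (X \<inter> F) + f (X - F)" using sub2[of "X \<inter> F" "X - F"] by simp
    qed
    moreover have "(UNIV - F) \<inter> X = X - F" for X by blast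
    ultimately show ?thesis by (auto simp: lambda_system_def Int_commute[of F])
  qed
  interpret L: sigma_algebra UNIV ?L using ms by (simp add: measure_space_def)
  have sub: "sets borel \<subseteq> ?L"
    unfolding sets_borel
  proof (rule L.sigma_sets_subset, safe)
    fix S :: "'a set" assume "open S"
    then have "- S \<in> ?L" by (intro cl) auto
    then show "S \<in> ?L" using L.compl_sets[of "- S"] by (simp add: Compl_eq_Diff_UNIV double_diff)
  qed
  have "countably_additive (sets borel) f"
    using ms sub unfolding measure_space_def countably_additive_def by (meson subset_trans subsetD)
  moreover have "positive (sets borel) f" using f0 by (simp add: positive_def)
  moreover have "sigma_algebra UNIV (sets borel :: 'a set set)" using sets.sigma_algebra_axioms[of borel] by simp
  ultimately show ?thesis by (simp add: measure_space_def)
qed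

context
  fixes d :: nat
  assumes d: "1 \<le> d"
begin

text \<open>The value \<open>\<top>\<close> on inadmissible sets turns the infimum over restricted
  covers into one over all covers.\<close>

definition cover_weight :: "real \<Rightarrow> fvec set \<Rightarrow> ennreal" where
  "cover_weight \<delta> U = (if bounded U \<and> diameter U \<le> \<delta>
     then ennreal (unit_ball_vol (real d) * (diameter U / 2) ^ d) else \<top>)"

lemma increasing_cover_weight: "increasing (Pow UNIV) (cover_weight \<delta>)"
    unfolding increasing_def
  proof (intro ballI impI)
    fix A B :: "fvec set" assume AB: "A \<subseteq> B"
    show "cover_weight \<delta> A \<le> cover_weight \<delta> B"
    proof (cases "bounded B \<and> diameter B \<le> \<delta>")
      case True
      then have "bounded A" "diameter A \<le> diameter B"
        using AB bounded_subset diameter_subset by auto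
      moreover have "0 \<le> diameter A" by (rule diameter_ge_0[OF \<open>bounded A\<close>])
      ultimately show ?thesis using True
        by (auto simp: cover_weight_def intro!: ennreal_leI mult_left_mono power_mono)
    next
      case False
      then have "cover_weight \<delta> B = \<top>" by (auto simp: cover_weight_def)
      then show ?thesis by simp
    qed
  qed

text \<open>The right-hand side takes disjoint covers only; since the weight is monotone, a cover
  can be made disjoint without increasing its sum.\<close>

lemma hausdorff_content_outer_measure:
  assumes "0 < \<delta>" shows "hausdorff_content d \<delta> = outer_measure (Pow UNIV) (cover_weight \<delta>)"
proof (rule ext, rule antisym)
  interpret sigma_algebra UNIV "Pow UNIV :: fvec set set" by (rule sigma_algebra_Pow)
  \<comment> \<open>This is where d \<ge> 1 enters: the empty set has diameter 0, and
    \<open>0 ^ 0\<close> would be 1.\<close>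
  have pos: "positive (Pow UNIV) (cover_weight \<delta>)"
    using assms d by (simp add: positive_def cover_weight_def power_0_left)
  note inc = increasing_cover_weight
  fix A
  show "outer_measure (Pow UNIV) (cover_weight \<delta>) A \<le> hausdorff_content d \<delta> A"
    unfolding hausdorff_content_def
  proof (rule INF_greatest)
    fix U :: "nat \<Rightarrow> fvec set"
    assume U: "U \<in> {U. A \<subseteq> (\<Union>i. U i) \<and> (\<forall>i. bounded (U i) \<and> diameter (U i) \<le> \<delta>)}"
    have "outer_measure (Pow UNIV) (cover_weight \<delta>) A \<le> (\<Sum>i. cover_weight \<delta> (U i))"
      using U by (intro outer_measure_le[OF pos inc]) auto
    also have "\<dots> = (\<Sum>i. ennreal (unit_ball_vol (real d) * (diameter (U i) / 2) ^ d))"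
      using U by (simp add: cover_weight_def)
    finally show "outer_measure (Pow UNIV) (cover_weight \<delta>) A \<le> (\<Sum>i. ennreal (unit_ball_vol (real d) * (diameter (U i) / 2) ^ d))" .
  qed
  show "hausdorff_content d \<delta> A \<le> outer_measure (Pow UNIV) (cover_weight \<delta>) A"
    unfolding outer_measure_def
  proof (rule INF_greatest)
    fix U :: "nat \<Rightarrow> fvec set"
    assume U: "U \<in> {U. range U \<subseteq> Pow UNIV \<and> disjoint_family U \<and> A \<subseteq> (\<Union>i. U i)}"
    show "hausdorff_content d \<delta> A \<le> (\<Sum>i. cover_weight \<delta> (U i))"
    proof (cases "\<forall>i. bounded (U i) \<and> diameter (U i) \<le> \<delta>")
      case True
      then have "(\<Sum>i. cover_weight \<delta> (U i)) = (\<Sum>i. ennreal (unit_ball_vol (real d) * (diameter (U i) / 2) ^ d))"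
        by (simp add: cover_weight_def)
      then show ?thesis unfolding hausdorff_content_def using U True
        by (intro INF_lower2[of U]) auto
    next
      case False
      then obtain i where "\<not> (bounded (U i) \<and> diameter (U i) \<le> \<delta>)" by blast
      then have "cover_weight \<delta> (U i) = \<top>" unfolding cover_weight_def by (rule if_not_P)
      moreover have "cover_weight \<delta> (U i) \<le> (\<Sum>i. cover_weight \<delta> (U i))"
        using sum_le_suminf[OF summableI, of "{i}" "\<lambda>i. cover_weight \<delta> (U i)"] by simp
      ultimately have "(\<Sum>i. cover_weight \<delta> (U i)) = \<top>" by (simp add: top_unique)
      then show ?thesis by simp
    qed
  qed
qed

lemma hausdorff_content_space:
  assumes "0 < \<delta>" shows "outer_measure_space (Pow UNIV) (hausdorff_content d \<delta>)"
proof -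
  interpret sigma_algebra UNIV "Pow UNIV :: fvec set set" by (rule sigma_algebra_Pow)
  have pos: "positive (Pow UNIV) (cover_weight \<delta>)"
    using assms d by (simp add: positive_def cover_weight_def power_0_left)
  note inc = increasing_cover_weight
  show ?thesis
    unfolding outer_measure_space_def hausdorff_content_outer_measure[OF assms]
    using pos inc by (intro conjI positive_outer_measure increasing_outer_measure countably_subadditive_outer_measure)
qed

lemma hausdorff_content_antimono:
  assumes "\<delta> \<le> \<delta>'" shows "hausdorff_content d \<delta>' A \<le> hausdorff_content d \<delta> A"
  unfolding hausdorff_content_def using assms by (intro INF_superset_mono) (auto intro: order_trans)

lemma hausdorff_content_le_outer: "0 < \<delta> \<Longrightarrow> hausdorff_content d \<delta> A \<le> hausdorff_outer d A"
  unfolding hausdorff_outer_def by (auto intro: SUP_upper)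

lemma hausdorff_outer_space: "outer_measure_space (Pow UNIV) (hausdorff_outer d)"
  unfolding outer_measure_space_def
proof (intro conjI)
  have c: "positive (Pow UNIV) (hausdorff_content d \<delta>)" "increasing (Pow UNIV) (hausdorff_content d \<delta>)"
    "countably_subadditive (Pow UNIV) (hausdorff_content d \<delta>)" if "0 < \<delta>" for \<delta>
    using hausdorff_content_space[OF that] by (auto simp: outer_measure_space_def)
  show "positive (Pow UNIV) (hausdorff_outer d)"
    unfolding positive_def hausdorff_outer_def using c(1)
    by (auto simp: positive_def intro!: SUP_eq_const)
  show "increasing (Pow UNIV) (hausdorff_outer d)"
    unfolding increasing_def hausdorff_outer_def using c(2)
    by (auto simp: increasing_def intro!: SUP_subset_mono)
  show "countably_subadditive (Pow UNIV) (hausdorff_outer d)"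
    unfolding countably_subadditive_def
  proof (intro allI impI)
    fix A :: "nat \<Rightarrow> fvec set"
    show "hausdorff_outer d (\<Union>i. A i) \<le> (\<Sum>i. hausdorff_outer d (A i))"
      unfolding hausdorff_outer_def[of d "\<Union>i. A i"]
    proof (rule SUP_least)
      fix \<delta> :: real assume \<delta>: "\<delta> \<in> {0<..}"
      have "hausdorff_content d \<delta> (\<Union>i. A i) \<le> (\<Sum>i. hausdorff_content d \<delta> (A i))"
        using \<delta> by (intro outer_measure_spaceD(3) hausdorff_content_space) auto
      also have "\<dots> \<le> (\<Sum>i. hausdorff_outer d (A i))"
        using \<delta> by (intro suminf_le summableI hausdorff_content_le_outer) auto
      finally show "hausdorff_content d \<delta> (\<Union>i. A i) \<le> (\<Sum>i. hausdorff_outer d (A i))" .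
    qed
  qed
qed

text \<open>A set of diameter at most \<delta> cannot meet both \<open>A\<close> and
  \<open>B\<close>, so a cover of the union splits into covers of the two parts.\<close>

lemma hausdorff_content_additive:
  assumes \<delta>: "0 < \<delta>" "\<delta> < \<eta>" and sep: "\<And>a b. a \<in> A \<Longrightarrow> b \<in> B \<Longrightarrow> \<eta> \<le> dist a b"
  shows "hausdorff_content d \<delta> A + hausdorff_content d \<delta> B \<le> hausdorff_content d \<delta> (A \<union> B)"
  unfolding hausdorff_content_def[of d \<delta> "A \<union> B"]
proof (rule INF_greatest)
  fix U :: "nat \<Rightarrow> fvec set"
  assume "U \<in> {U. A \<union> B \<subseteq> (\<Union>i. U i) \<and> (\<forall>i. bounded (U i) \<and> diameter (U i) \<le> \<delta>)}"
  then have U: "A \<union> B \<subseteq> (\<Union>i. U i)" "\<And>i. bounded (U i)" "\<And>i. diameter (U i) \<le> \<delta>" by auto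
  let ?w = "\<lambda>S :: fvec set. ennreal (unit_ball_vol (real d) * (diameter S / 2) ^ d)"
  have w0: "?w {} = 0" using d by (simp add: power_0_left)
  define V where "V i = (if U i \<inter> A = {} then {} else U i)" for i
  define W where "W i = (if U i \<inter> A = {} then U i else {})" for i
  have "hausdorff_content d \<delta> A \<le> (\<Sum>i. ?w (V i))"
    unfolding hausdorff_content_def using U \<delta>(1) by (intro INF_lower) (fastforce simp: V_def)
  moreover have "hausdorff_content d \<delta> B \<le> (\<Sum>i. ?w (W i))"
    unfolding hausdorff_content_def
  proof (intro INF_lower CollectI conjI allI)
    show "B \<subseteq> (\<Union>i. W i)"
    proof
      fix b assume b: "b \<in> B"
      then obtain i where i: "b \<in> U i" using U(1) by blast
      have "U i \<inter> A = {}"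
      proof (rule ccontr)
        assume "U i \<inter> A \<noteq> {}"
        then obtain a where a: "a \<in> U i" "a \<in> A" by blast
        have "dist a b \<le> \<delta>" using diameter_bounded_bound[OF U(2) a(1) i] U(3)[of i] by simp
        then show False using sep[OF a(2) b] \<delta>(2) by simp
      qed
      then show "b \<in> (\<Union>i. W i)" using i by (auto simp: W_def)
    qed
    show "bounded (W i)" "diameter (W i) \<le> \<delta>" for i using U \<delta>(1) by (auto simp: W_def)
  qed
  ultimately have "hausdorff_content d \<delta> A + hausdorff_content d \<delta> B \<le> (\<Sum>i. ?w (V i)) + (\<Sum>i. ?w (W i))"
    by (rule add_mono)
  also have "\<dots> = (\<Sum>i. ?w (V i) + ?w (W i))" by (rule suminf_add[OF summableI summableI])
  also have "\<dots> = (\<Sum>i. ?w (U i))" by (rule suminf_cong) (use w0 in \<open>auto simp: V_def W_def simp del: diameter_empty\<close>)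
  finally show "hausdorff_content d \<delta> A + hausdorff_content d \<delta> B \<le> (\<Sum>i. ?w (U i))" .
qed

text \<open>Both contents are evaluated at a common scale below the separation, which can only
  increase them.\<close>

lemma hausdorff_outer_additive:
  assumes \<eta>: "0 < \<eta>" and sep: "\<And>a b. a \<in> A \<Longrightarrow> b \<in> B \<Longrightarrow> \<eta> \<le> dist a b"
  shows "hausdorff_outer d A + hausdorff_outer d B \<le> hausdorff_outer d (A \<union> B)"
proof -
  have *: "hausdorff_content d \<delta> A + hausdorff_content d \<delta>' B \<le> hausdorff_outer d (A \<union> B)"
    if "0 < \<delta>" "0 < \<delta>'" for \<delta> \<delta>'
  proof -
    let ?m = "min (min \<delta> \<delta>') (\<eta> / 2)"
    have m: "0 < ?m" "?m < \<eta>" using that \<eta> by auto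
    have "hausdorff_content d \<delta> A + hausdorff_content d \<delta>' B \<le> hausdorff_content d ?m A + hausdorff_content d ?m B"
      by (intro add_mono hausdorff_content_antimono) auto
    also have "\<dots> \<le> hausdorff_content d ?m (A \<union> B)" by (rule hausdorff_content_additive[OF m sep])
    also have "\<dots> \<le> hausdorff_outer d (A \<union> B)" by (rule hausdorff_content_le_outer[OF m(1)])
    finally show ?thesis .
  qed
  have ne: "{0<..} \<noteq> ({} :: real set)" by (auto intro: exI[of _ 1])
  show ?thesis
    unfolding hausdorff_outer_def[of d A] hausdorff_outer_def[of d B]
      ennreal_SUP_add_left[OF ne, symmetric] ennreal_SUP_add_right[OF ne]
    using * by (intro SUP_least) auto
qed

lemma sets_hausdorff_measure [simp, measurable_cong]: "sets (hausdorff_measure d) = sets borel"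
  and space_hausdorff_measure [simp]: "space (hausdorff_measure d) = UNIV"
  using sets.space_closed[of "borel :: fvec measure"] sets.sigma_sets_eq[of "borel :: fvec measure"]
  by (auto simp: hausdorff_measure_def sets_measure_of_conv space_measure_of_conv)

lemma emeasure_hausdorff_measure:
  assumes "A \<in> sets borel" shows "emeasure (hausdorff_measure d) A = hausdorff_outer d A"
proof -
  have "measure_space UNIV (sets borel) (hausdorff_outer d)"
    by (rule metric_outer_borel[OF hausdorff_outer_space hausdorff_outer_additive])
  then have "countably_additive (sets borel) (hausdorff_outer d)" "positive (sets borel) (hausdorff_outer d)"
    by (auto simp: measure_space_def)
  then show ?thesis
    using assms by (subst emeasure_measure_of[OF hausdorff_measure_def]) auto
qed

text \<open>The coordinates \<open>inner (x - a) (b i)\<close> are 1-Lipschitz, so each covering set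
  is carried into a cube whose half-side is its diameter. These cubes cover the cube of half-side
  \<open>s\<close>, and comparing Lebesgue measures bounds the sum for every cover, already at scale
  1.\<close>

lemma hausdorff_outer_lower:
  fixes b :: "nat \<Rightarrow> fvec"
  assumes b: "\<And>i. i < d \<Longrightarrow> norm (b i) = 1" and s: "0 \<le> s"
    and S: "\<And>c. (\<And>i. i < d \<Longrightarrow> \<bar>c i\<bar> \<le> s) \<Longrightarrow> \<exists>x\<in>S. \<forall>i<d. inner (x - a) (b i) = c i"
  shows "ennreal (unit_ball_vol (real d) * (s / 2) ^ d) \<le> hausdorff_outer d S"
proof -
  interpret product_sigma_finite "\<lambda>_::nat. lborel :: real measure" ..
  let ?L = "PiM {..<d} (\<lambda>_. lborel :: real measure)"
  have box: "emeasure ?L (PiE {..<d} (\<lambda>i. {y i - r..y i + r})) = ennreal ((2 * r) ^ d)" if "0 \<le> r" for y r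
    using that by (subst emeasure_PiM) (auto simp: ennreal_power prod_constant)
  let ?v = "unit_ball_vol (real d)"
  have "ennreal (?v * (s / 2) ^ d) \<le> hausdorff_content d 1 S"
    unfolding hausdorff_content_def
  proof (rule INF_greatest)
    fix U :: "nat \<Rightarrow> fvec set"
    assume "U \<in> {U. S \<subseteq> (\<Union>i. U i) \<and> (\<forall>i. bounded (U i) \<and> diameter (U i) \<le> 1)}"
    then have U: "S \<subseteq> (\<Union>i. U i)" "\<And>i. bounded (U i)" by auto
    define z where "z j = (SOME x. x \<in> U j)" for j
    define Q where "Q j = (if U j = {} then {} else PiE {..<d} (\<lambda>i. {inner (z j - a) (b i) - diameter (U j)..inner (z j - a) (b i) + diameter (U j)}))" for j
    have Qm: "Q j \<in> sets ?L" for j by (auto simp: Q_def intro!: sets_PiM_I_finite)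
    have dn: "0 \<le> diameter (U j)" for j by (rule diameter_ge_0[OF U(2)])
    have Qe: "emeasure ?L (Q j) \<le> ennreal ((2 * diameter (U j)) ^ d)" for j
      using box[OF dn] by (auto simp: Q_def)
    have "PiE {..<d} (\<lambda>i. {0 - s..0 + s}) \<subseteq> (\<Union>j. Q j)"
    proof
      fix c assume c: "c \<in> PiE {..<d} (\<lambda>i. {0 - s..0 + s})"
      then have "\<bar>c i\<bar> \<le> s" if "i < d" for i using that by (auto simp: PiE_iff abs_le_iff dest!: bspec[of _ _ i])
      then obtain x where x: "x \<in> S" "\<And>i. i < d \<Longrightarrow> inner (x - a) (b i) = c i" using S by blast
      then obtain j where j: "x \<in> U j" using U(1) by blast
      have zj: "z j \<in> U j" unfolding z_def using j by (rule someI)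
      have "c i \<in> {inner (z j - a) (b i) - diameter (U j)..inner (z j - a) (b i) + diameter (U j)}" if i: "i < d" for i
      proof -
        have "c i - inner (z j - a) (b i) = inner (x - z j) (b i)"
          using x(2)[OF i] by (simp add: inner_diff_left)
        also have "\<bar>\<dots>\<bar> \<le> norm (x - z j) * norm (b i)" by (rule Cauchy_Schwarz_ineq2)
        finally have "\<bar>c i - inner (z j - a) (b i)\<bar> \<le> diameter (U j)"
          using diameter_bounded_bound[OF U(2) j zj] b[OF i] by (simp add: dist_norm)
        then show ?thesis by (auto simp: abs_le_iff)
      qed
      then have "c \<in> Q j" using c j by (auto simp: Q_def PiE_iff)
      then show "c \<in> (\<Union>j. Q j)" by blast
    qed
    then have "emeasure ?L (PiE {..<d} (\<lambda>i. {0 - s..0 + s})) \<le> emeasure ?L (\<Union>j. Q j)"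
      using Qm by (intro emeasure_mono) auto
    also have "\<dots> \<le> (\<Sum>j. emeasure ?L (Q j))" using Qm by (intro emeasure_subadditive_countably) auto
    also have "\<dots> \<le> (\<Sum>j. ennreal ((2 * diameter (U j)) ^ d))" by (intro suminf_le summableI Qe)
    finally have 1: "ennreal ((2 * s) ^ d) \<le> (\<Sum>j. ennreal ((2 * diameter (U j)) ^ d))" using box[OF s, of "\<lambda>_. 0"] by simp
    have v: "0 \<le> ?v / 4 ^ d" by simp
    have conv: "ennreal (?v * (r / 2) ^ d) = ennreal (?v / 4 ^ d) * ennreal ((2 * r) ^ d)" if "0 \<le> r" for r
    proof -
      have "(r / 2) ^ d = ((2 * r) * (1 / 4)) ^ d" by simp
      also have "\<dots> = (2 * r) ^ d / 4 ^ d" by (simp only: power_mult_distrib power_one_over) simp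
      finally have "?v * (r / 2) ^ d = ?v / 4 ^ d * (2 * r) ^ d" by simp
      then show ?thesis using that v by (simp only: ennreal_mult zero_le_power mult_nonneg_nonneg zero_le_numeral)
    qed
    have "ennreal (?v * (s / 2) ^ d) = ennreal (?v / 4 ^ d) * ennreal ((2 * s) ^ d)" by (rule conv[OF s])
    also have "\<dots> \<le> ennreal (?v / 4 ^ d) * (\<Sum>j. ennreal ((2 * diameter (U j)) ^ d))" by (rule mult_left_mono[OF 1]) simp
    also have "\<dots> = (\<Sum>j. ennreal (?v * (diameter (U j) / 2) ^ d))"
      unfolding ennreal_suminf_cmult[symmetric] using conv[OF dn] by simp
    finally show "ennreal (?v * (s / 2) ^ d) \<le> (\<Sum>j. ennreal (?v * (diameter (U j) / 2) ^ d))" .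
  qed
  also have "\<dots> \<le> hausdorff_outer d S" by (rule hausdorff_content_le_outer) simp
  finally show ?thesis .
qed

text \<open>Points are sorted by the cell of a grid of mesh \<open>2 * s / N\<close> that contains
  their coordinates. By the hypothesis on \<open>L\<close>, points of one cell are at distance at
  most \<open>2 * L * s / N\<close>, which is at most \<delta> for large \<open>N\<close>.\<close>

lemma hausdorff_outer_upper:
  fixes b :: "nat \<Rightarrow> fvec"
  assumes s: "0 < s" and S: "\<And>x i. x \<in> S \<Longrightarrow> i < d \<Longrightarrow> \<bar>inner (x - a) (b i)\<bar> \<le> s"
    and L: "0 < L" "\<And>x y r. x \<in> S \<Longrightarrow> y \<in> S \<Longrightarrow> (\<And>i. i < d \<Longrightarrow> \<bar>inner (x - y) (b i)\<bar> \<le> r) \<Longrightarrow> dist x y \<le> L * r"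
  shows "hausdorff_outer d S \<le> ennreal (unit_ball_vol (real d) * (2 * L * s) ^ d)"
  unfolding hausdorff_outer_def
proof (rule SUP_least)
  fix \<delta> :: real assume "\<delta> \<in> {0<..}"
  then have \<delta>: "0 < \<delta>" by simp
  let ?v = "unit_ball_vol (real d)"
  obtain N0 :: nat where N0: "2 * L * s / \<delta> < real N0" using reals_Archimedean2 by blast
  define N where "N = Suc N0"
  have N: "0 < real N" "2 * L * s / \<delta> < real N" using N0 by (auto simp: N_def)
  then have N\<delta>: "2 * L * s / real N \<le> \<delta>" using \<delta> by (simp add: field_simps)
  \<comment> \<open>A coordinate equal to \<open>s\<close> falls into cell \<open>N\<close>, so
    there are \<open>N + 1\<close> cells in each direction.\<close>
  define q where "q = (\<lambda>x. \<lambda>i\<in>{..<d}. nat \<lfloor>(inner (x - a) (b i) + s) * real N / (2 * s)\<rfloor>)"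
  let ?I = "PiE {..<d} (\<lambda>_. {..N})"
  define C where "C c = {x \<in> S. q x = c}" for c
  have fI: "finite ?I" by (intro finite_PiE) auto
  have cI: "card ?I = (N + 1) ^ d" by (simp add: card_PiE prod_constant)
  obtain e where e: "bij_betw e {0..<(N + 1) ^ d} ?I" using ex_bij_betw_nat_finite[OF fI] cI by auto
  define U where "U j = (if j < (N + 1) ^ d then C (e j) else {})" for j
  have nn: "0 \<le> (inner (x - a) (b i) + s) * real N / (2 * s)" and
    up: "(inner (x - a) (b i) + s) * real N / (2 * s) \<le> real N" if "x \<in> S" "i < d" for x i
  proof -
    have ab: "0 \<le> inner (x - a) (b i) + s" "inner (x - a) (b i) + s \<le> 2 * s" using S[OF that] by (auto simp: abs_le_iff)
    show "0 \<le> (inner (x - a) (b i) + s) * real N / (2 * s)" using ab s N by simp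
    have "(inner (x - a) (b i) + s) * real N \<le> 2 * s * real N" using ab N by (intro mult_right_mono) auto
    then show "(inner (x - a) (b i) + s) * real N / (2 * s) \<le> real N" using s by (simp add: pos_divide_le_eq mult_ac)
  qed
  have qI: "q x \<in> ?I" if "x \<in> S" for x
  proof -
    have "nat \<lfloor>y\<rfloor> \<le> N" if "y \<le> real N" for y using that by linarith
    then show ?thesis using up[OF that] by (auto simp: q_def)
  qed
  have cell: "dist x y \<le> 2 * L * s / real N" if xy: "x \<in> C c" "y \<in> C c" for x y c
  proof -
    have "dist x y \<le> L * (2 * s / real N)"
    proof (rule L(2))
      show xS: "x \<in> S" and yS: "y \<in> S" using xy by (auto simp: C_def)
      fix i assume i: "i < d"
      have "q x i = q y i" using xy by (simp add: C_def)
      then have "nat \<lfloor>(inner (x - a) (b i) + s) * real N / (2 * s)\<rfloor> = nat \<lfloor>(inner (y - a) (b i) + s) * real N / (2 * s)\<rfloor>"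
        using i by (simp add: q_def)
      then have "\<lfloor>(inner (x - a) (b i) + s) * real N / (2 * s)\<rfloor> = \<lfloor>(inner (y - a) (b i) + s) * real N / (2 * s)\<rfloor>"
        using nn[OF xS i] nn[OF yS i] by (simp add: eq_nat_nat_iff)
      then have "\<bar>(inner (x - a) (b i) + s) * real N / (2 * s) - (inner (y - a) (b i) + s) * real N / (2 * s)\<bar> < 1"
        by linarith
      moreover have "(inner (x - a) (b i) + s) * real N / (2 * s) - (inner (y - a) (b i) + s) * real N / (2 * s)
          = inner (x - y) (b i) * (real N / (2 * s))"
        by (simp add: inner_diff_left diff_divide_distrib[symmetric] left_diff_distrib[symmetric])
      ultimately have "\<bar>inner (x - y) (b i)\<bar> * (real N / (2 * s)) \<le> 1" using s by (simp add: abs_mult)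
      then show "\<bar>inner (x - y) (b i)\<bar> \<le> 2 * s / real N" using s N by (simp add: field_simps)
    qed
    then show ?thesis by (simp add: mult_ac)
  qed
  have bd: "bounded (C c)" for c
    unfolding bounded_any_center[of "C c" "SOME x. x \<in> C c"]
    using cell[of "SOME x. x \<in> C c" c] by (metis someI_ex)
  have di: "diameter (C c) \<le> 2 * L * s / real N" for c
    using cell N s L by (intro diameter_le) (auto simp: dist_norm[symmetric])
  have Ucov: "S \<subseteq> (\<Union>j. U j)"
  proof
    fix x assume x: "x \<in> S"
    then obtain j where "j \<in> {0..<(N + 1) ^ d}" "e j = q x" using qI e unfolding bij_betw_def by (metis imageE)
    then have "x \<in> U j" using x by (simp add: U_def C_def)
    then show "x \<in> (\<Union>j. U j)" by blast
  qed
  have Ub: "bounded (U j)" "diameter (U j) \<le> \<delta>" for j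
    using bd di[of "e j"] N\<delta> \<delta> by (auto simp: U_def)
  let ?w = "\<lambda>S :: fvec set. ennreal (?v * (diameter S / 2) ^ d)"
  have "hausdorff_content d \<delta> S \<le> (\<Sum>j. ?w (U j))"
    unfolding hausdorff_content_def using Ucov Ub by (intro INF_lower) auto
  also have "\<dots> = (\<Sum>j<(N + 1) ^ d. ?w (U j))"
    using d by (intro suminf_finite) (auto simp: U_def power_0_left)
  also have "\<dots> \<le> (\<Sum>j<(N + 1) ^ d. ennreal (?v * (L * s / real N) ^ d))"
  proof (intro sum_mono ennreal_leI mult_left_mono power_mono)
    fix j assume "j \<in> {..<(N + 1) ^ d}"
    then show "diameter (U j) / 2 \<le> L * s / real N" using di[of "e j"] by (simp add: U_def mult_ac)
    show "0 \<le> diameter (U j) / 2" using diameter_ge_0[OF Ub(1)] by simp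
  qed simp
  also have "\<dots> = ennreal (real ((N + 1) ^ d) * (?v * (L * s / real N) ^ d))"
    using s L N by (simp add: ennreal_mult ennreal_of_nat_eq_real_of_nat)
  also have "\<dots> \<le> ennreal (?v * (2 * L * s) ^ d)"
  proof (rule ennreal_leI)
    have "real (N + 1) * (L * s / real N) \<le> 2 * L * s"
      using N s L by (simp add: N_def field_simps)
    then have "(real (N + 1) * (L * s / real N)) ^ d \<le> (2 * L * s) ^ d"
      using N s L by (intro power_mono) auto
    then have "?v * (real (N + 1) * (L * s / real N)) ^ d \<le> ?v * (2 * L * s) ^ d"
      by (intro mult_left_mono) auto
    then show "real ((N + 1) ^ d) * (?v * (L * s / real N) ^ d) \<le> ?v * (2 * L * s) ^ d"
      unfolding power_mult_distrib[of "real (N + 1)"] of_nat_power by (simp only: mult.left_commute)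
  qed
  finally show "hausdorff_content d \<delta> S \<le> ennreal (?v * (2 * L * s) ^ d)" .
qed

end

section \<open>Volume, packing and diameter bounds for laws on manifolds of positive reach\<close>

section \<open>Volume of balls\<close>

lemma fin_subspace_frame:
  fixes T :: "'a::real_inner set"
  assumes T: "fin_subspace T" "dim T = d"
  obtains b :: "nat \<Rightarrow> 'a" where "\<And>i. i < d \<Longrightarrow> b i \<in> T" "\<And>i. i < d \<Longrightarrow> norm (b i) = 1"
    "\<And>i j. i < d \<Longrightarrow> j < d \<Longrightarrow> inner (b i) (b j) = (if i = j then 1 else 0)"
    "\<And>x. oproj T x = (\<Sum>i<d. inner x (b i) *\<^sub>R b i)"
proof -
  obtain B where B: "onb B T" using fin_subspace_onb[OF T(1)] .
  have "card B = d" using onb_card[OF B] T(2) by simp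
  then obtain b where b: "bij_betw b {..<d} B"
    using ex_bij_betw_nat_finite[OF onb_finite[OF B]] by (auto simp: atLeast0LessThan)
  have bB: "b i \<in> B" if "i < d" for i using b that by (auto simp: bij_betw_def)
  show ?thesis
  proof (rule that[of b])
    show "b i \<in> T" "norm (b i) = 1" if "i < d" for i
      using bB[OF that] onb_subset[OF B] B by (auto simp: onb_def)
    show "inner (b i) (b j) = (if i = j then 1 else 0)" if "i < d" "j < d" for i j
      using onb_inner[OF B bB bB] b that by (auto simp: bij_betw_def inj_on_eq_iff)
    fix x
    have "oproj T x = (\<Sum>c\<in>B. inner (oproj T x) c *\<^sub>R c)"
      by (rule onb_expand[OF B oproj_in[OF T(1)]])
    also have "\<dots> = (\<Sum>c\<in>B. inner x c *\<^sub>R c)"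
      using oproj_adjoint[OF T(1)] oproj_id[OF T(1)] onb_subset[OF B] by (intro sum.cong) auto
    also have "\<dots> = (\<Sum>i<d. inner x (b i) *\<^sub>R b i)"
      using sum.reindex_bij_betw[OF b, of "\<lambda>c. inner x c *\<^sub>R c"] by simp
    finally show "oproj T x = (\<Sum>i<d. inner x (b i) *\<^sub>R b i)" .
  qed
qed

text \<open>This constant comes from \<open>hausdorff_outer_lower\<close> with
  \<open>s = r / (2 * d)\<close>, and \<open>vol_upper\<close> from
  \<open>hausdorff_outer_upper\<close> with \<open>L = 4 * d\<close>. They are not sharp, but free
  of \<open>D\<close> and of the manifold.\<close>

definition vol_lower :: "nat \<Rightarrow> real" where
  "vol_lower d = unit_ball_vol (real d) / (4 * real d) ^ d"

definition vol_upper :: "nat \<Rightarrow> real" where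
  "vol_upper d = unit_ball_vol (real d) * (8 * real d) ^ d"

lemma vol_lower_pos: "1 \<le> d \<Longrightarrow> 0 < vol_lower d"
  and vol_upper_pos: "1 \<le> d \<Longrightarrow> 0 < vol_upper d"
  by (auto simp: vol_lower_def vol_upper_def)

context reach_manifold
begin

lemma M_borel: "M \<in> sets borel"
  using compact by (simp add: borel_closed compact_imp_closed)

lemma hausdorff_ball_lower:
  assumes d: "1 \<le> d" and a: "a \<in> M" and r: "0 < r" "r \<le> \<rho> / 40"
  shows "ennreal (vol_lower d * r ^ d) \<le> hausdorff_outer d (M \<inter> ball a r)"
proof -
  obtain b where b: "\<And>i. i < d \<Longrightarrow> b i \<in> T a" "\<And>i. i < d \<Longrightarrow> norm (b i) = 1"
    "\<And>i j. i < d \<Longrightarrow> j < d \<Longrightarrow> inner (b i) (b j) = (if i = j then 1 else 0)"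
    "\<And>x. P a x = (\<Sum>i<d. inner x (b i) *\<^sub>R b i)"
    using fin_subspace_frame[OF T_fin[OF a] T_dim[OF a]] by blast
  \<comment> \<open>Coordinates up to \<open>s\<close> sum to a tangent vector of length at most
    \<open>r / 2\<close>, whose point on \<open>M\<close> is within \<open>2 / 3 * r\<close> of
    \<open>a\<close>.\<close>
  define s where "s = r / (2 * real d)"
  have "vol_lower d * r ^ d = unit_ball_vol (real d) * (s / 2) ^ d"
    by (simp add: vol_lower_def s_def power_divide)
  also have "ennreal \<dots> \<le> hausdorff_outer d (M \<inter> ball a r)"
  proof (rule hausdorff_outer_lower[OF d b(2)])
    show "0 \<le> s" using r by (simp add: s_def)
    fix c :: "nat \<Rightarrow> real" assume c: "\<And>i. i < d \<Longrightarrow> \<bar>c i\<bar> \<le> s"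
    define v where "v = (\<Sum>i<d. c i *\<^sub>R b i)"
    have vT: "v \<in> T a" unfolding v_def
      using b(1) fin_subspace_imp_subspace[OF T_fin[OF a]] by (intro subspace_sum subspace_scale) auto
    have "norm v \<le> (\<Sum>i<d. s)" unfolding v_def
      by (rule sum_norm_le) (use b(2) c in simp)
    also have "\<dots> = r / 2" using d by (simp add: s_def)
    finally have nv: "norm v \<le> r / 2" .
    obtain q where q: "q \<in> M" "P a (q - a) = v" "norm (q - a) \<le> 4 / 3 * norm v"
      using point_above[OF a vT] nv r by auto
    have "q \<in> M \<inter> ball a r" using q nv r by (auto simp: dist_norm norm_minus_commute)
    moreover have "inner (q - a) (b i) = c i" if i: "i < d" for i
    proof -
      have "inner (q - a) (b i) = inner (q - a) (P a (b i))" using oproj_id[OF T_fin[OF a] b(1)[OF i]] by simp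
      also have "\<dots> = inner v (b i)" using oproj_adjoint[OF T_fin[OF a], of "q - a" "b i"] q(2) by simp
      also have "\<dots> = (\<Sum>j<d. c j * inner (b j) (b i))" by (simp add: v_def inner_sum_left)
      also have "\<dots> = (\<Sum>j<d. if j = i then c i else 0)" using b(3) i by (intro sum.cong) auto
      finally show ?thesis using i by simp
    qed
    ultimately show "\<exists>x\<in>M \<inter> ball a r. \<forall>i<d. inner (x - a) (b i) = c i" by blast
  qed
  finally show ?thesis .
qed

text \<open>By \<open>projection_lower_bound\<close> the \<open>d\<close> tangential coordinates at
  \<open>a\<close> control all distances in the ball.\<close>

lemma hausdorff_ball_upper:
  assumes d: "1 \<le> d" and a: "a \<in> M" and r: "0 < r" "r \<le> \<rho> / 20"
  shows "hausdorff_outer d (M \<inter> cball a r) \<le> ennreal (vol_upper d * r ^ d)"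
proof -
  obtain b where b: "\<And>i. i < d \<Longrightarrow> b i \<in> T a" "\<And>i. i < d \<Longrightarrow> norm (b i) = 1"
    "\<And>i j. i < d \<Longrightarrow> j < d \<Longrightarrow> inner (b i) (b j) = (if i = j then 1 else 0)"
    "\<And>x. P a x = (\<Sum>i<d. inner x (b i) *\<^sub>R b i)"
    using fin_subspace_frame[OF T_fin[OF a] T_dim[OF a]] by blast
  have "hausdorff_outer d (M \<inter> cball a r) \<le> ennreal (unit_ball_vol (real d) * (2 * (4 * real d) * r) ^ d)"
  proof (rule hausdorff_outer_upper[OF d r(1)])
    show "\<bar>inner (x - a) (b i)\<bar> \<le> r" if "x \<in> M \<inter> cball a r" "i < d" for x i
      using Cauchy_Schwarz_ineq2[of "x - a" "b i"] b(2)[OF that(2)] that(1) by (simp add: dist_norm norm_minus_commute)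
    show "0 < 4 * real d" using d by simp
    fix x y t assume xy: "x \<in> M \<inter> cball a r" "y \<in> M \<inter> cball a r" and t: "\<And>i. i < d \<Longrightarrow> \<bar>inner (x - y) (b i)\<bar> \<le> t"
    have "norm (P a (x - y)) \<le> (\<Sum>i<d. t)" unfolding b(4)
      by (rule sum_norm_le) (use b(2) t in simp)
    moreover have "dist y x \<le> 4 * norm (P a (x - y))"
      using xy r by (intro projection_lower_bound[OF a]) auto
    ultimately show "dist x y \<le> 4 * real d * t" by (simp add: dist_commute)
  qed
  also have "unit_ball_vol (real d) * (2 * (4 * real d) * r) ^ d = vol_upper d * r ^ d"
    by (simp add: vol_upper_def power_mult_distrib)
  finally show ?thesis .
qed

end

section \<open>Laws on manifolds\<close>

locale manifold_law = reach_manifold +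
  fixes fmin fmax :: real and Q0 :: "fvec measure"
  assumes d: "1 \<le> d" and fmin: "0 < fmin" and fmax: "fmin \<le> fmax" and Q0: "Q0 \<in> density_model d fmin fmax M"
begin

lemma prob_Q0: "prob_space Q0" and sets_Q0 [simp, measurable_cong]: "sets Q0 = sets borel"
  using Q0 by (auto simp: density_model_def volume_measure_def sets_hausdorff_measure[OF d])

lemma emeasure_Q0:
  assumes A: "A \<in> sets borel"
  shows "ennreal fmin * hausdorff_outer d (M \<inter> A) \<le> emeasure Q0 A"
    "emeasure Q0 A \<le> ennreal fmax * hausdorff_outer d (M \<inter> A)"
proof -
  note [measurable_cong] = sets_hausdorff_measure[OF d]
  note [measurable] = A M_borel
  obtain f where f [measurable]: "f \<in> borel_measurable borel" and fb: "\<And>x. x \<in> M \<Longrightarrow> fmin \<le> f x \<and> f x \<le> fmax"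
    and Q: "Q0 = density (volume_measure d M) (\<lambda>x. ennreal (f x))"
    using Q0 by (auto simp: density_model_def)
  have MA: "M \<inter> A \<in> sets (hausdorff_measure d)" by measurable
  have "emeasure Q0 A = (\<integral>\<^sup>+x. ennreal (f x) * indicator A x \<partial>volume_measure d M)"
    unfolding Q by (rule emeasure_density) (auto simp: volume_measure_def)
  also have "\<dots> = (\<integral>\<^sup>+x. indicator M x * (ennreal (f x) * indicator A x) \<partial>hausdorff_measure d)"
    unfolding volume_measure_def by (rule nn_integral_density) auto
  finally have eq: "emeasure Q0 A = (\<integral>\<^sup>+x. indicator M x * (ennreal (f x) * indicator A x) \<partial>hausdorff_measure d)" .
  have H: "emeasure (hausdorff_measure d) (M \<inter> A) = hausdorff_outer d (M \<inter> A)"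
    by (rule emeasure_hausdorff_measure[OF d]) measurable
  have "ennreal fmin * hausdorff_outer d (M \<inter> A) = (\<integral>\<^sup>+x. ennreal fmin * indicator (M \<inter> A) x \<partial>hausdorff_measure d)"
    using MA by (simp add: nn_integral_cmult_indicator H)
  also have "\<dots> \<le> emeasure Q0 A"
    unfolding eq using fb by (intro nn_integral_mono) (auto simp: indicator_def intro!: ennreal_leI)
  finally show "ennreal fmin * hausdorff_outer d (M \<inter> A) \<le> emeasure Q0 A" .
  have "emeasure Q0 A \<le> (\<integral>\<^sup>+x. ennreal fmax * indicator (M \<inter> A) x \<partial>hausdorff_measure d)"
    unfolding eq using fb by (intro nn_integral_mono) (auto simp: indicator_def intro!: ennreal_leI)
  also have "\<dots> = ennreal fmax * hausdorff_outer d (M \<inter> A)"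
    using MA by (simp add: nn_integral_cmult_indicator H)
  finally show "emeasure Q0 A \<le> ennreal fmax * hausdorff_outer d (M \<inter> A)" .
qed

lemma measure_ball_lower:
  assumes "a \<in> M" "0 < r" "r \<le> \<rho> / 40"
  shows "fmin * vol_lower d * r ^ d \<le> measure Q0 (ball a r)"
proof -
  interpret prob_space Q0 by (rule prob_Q0)
  have "ennreal (fmin * vol_lower d * r ^ d) = ennreal fmin * ennreal (vol_lower d * r ^ d)"
    using fmin vol_lower_pos[OF d] assms by (subst ennreal_mult[symmetric]) (auto simp: mult.assoc)
  also have "\<dots> \<le> ennreal fmin * hausdorff_outer d (M \<inter> ball a r)"
    by (intro mult_left_mono hausdorff_ball_lower d assms) auto
  also have "\<dots> \<le> emeasure Q0 (ball a r)" by (rule emeasure_Q0) auto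
  finally show ?thesis by (simp add: emeasure_eq_measure)
qed

lemma measure_cball_upper:
  assumes "a \<in> M" "0 < r" "r \<le> \<rho> / 20"
  shows "measure Q0 (cball a r) \<le> fmax * vol_upper d * r ^ d"
proof -
  interpret prob_space Q0 by (rule prob_Q0)
  have "emeasure Q0 (cball a r) \<le> ennreal fmax * hausdorff_outer d (M \<inter> cball a r)" by (rule emeasure_Q0) auto
  also have "\<dots> \<le> ennreal fmax * ennreal (vol_upper d * r ^ d)"
    by (intro mult_left_mono hausdorff_ball_upper d assms) auto
  also have "\<dots> = ennreal (fmax * vol_upper d * r ^ d)"
    using fmin fmax vol_upper_pos[OF d] assms by (subst ennreal_mult[symmetric]) (auto simp: mult.assoc)
  finally show ?thesis using fmin fmax vol_upper_pos[OF d] assms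
    by (subst (asm) emeasure_eq_measure, subst (asm) ennreal_le_iff) auto
qed

lemma emeasure_Q0_compl: "emeasure Q0 (- M) = 0"
proof -
  have "emeasure Q0 (- M) \<le> ennreal fmax * hausdorff_outer d (M \<inter> - M)"
    using M_borel by (intro emeasure_Q0) auto
  then show ?thesis using outer_measure_spaceD(1)[OF hausdorff_outer_space[OF d]] by simp
qed

lemma AE_Q0: "AE x in Q0. x \<in> M"
proof (rule AE_I)
  show "{x \<in> space Q0. x \<notin> M} \<subseteq> - M" by auto
  show "- M \<in> sets Q0" using M_borel by auto
qed (rule emeasure_Q0_compl)

text \<open>The model only names the support of the law of \<open>Y\<close>; this identifies it with
  the manifold that carries the density.\<close>

lemma measure_support_Q0: "measure_support Q0 = M"
proof (rule antisym)
  show "measure_support Q0 \<subseteq> M"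
  proof
    fix x assume x: "x \<in> measure_support Q0"
    show "x \<in> M"
    proof (rule ccontr)
      assume "x \<notin> M"
      then have "emeasure Q0 (- M) > 0"
        using x open_Compl[OF compact_imp_closed[OF compact]] unfolding measure_support_def by blast
      then show False using emeasure_Q0_compl by simp
    qed
  qed
  show "M \<subseteq> measure_support Q0"
    unfolding measure_support_def
  proof safe
    fix x U assume x: "x \<in> M" and U: "open U" "x \<in> U"
    interpret prob_space Q0 by (rule prob_Q0)
    obtain e where e: "e > 0" "ball x e \<subseteq> U" using U openE by blast
    define r where "r = min e (\<rho> / 40)"
    have r: "0 < r" "r \<le> \<rho> / 40" "r \<le> e" using e \<rho> by (auto simp: r_def)
    have "0 < fmin * vol_lower d * r ^ d" using fmin vol_lower_pos[OF d] r by simp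
    also have "\<dots> \<le> measure Q0 (ball x r)" by (rule measure_ball_lower[OF x r(1,2)])
    finally have "0 < emeasure Q0 (ball x r)" by (simp add: emeasure_eq_measure)
    also have "\<dots> \<le> emeasure Q0 U" using e r U by (intro emeasure_mono) auto
    finally show "0 < emeasure Q0 U" .
  qed
qed

text \<open>The balls of radius \<open>s\<close> about the points are disjoint, each has mass at
  least \<open>fmin * vol_lower d * s ^ d\<close>, and the total mass is 1.\<close>

lemma packing:
  assumes Z: "finite Z" "Z \<subseteq> M" and sep: "\<And>x y. x \<in> Z \<Longrightarrow> y \<in> Z \<Longrightarrow> x \<noteq> y \<Longrightarrow> 2 * s \<le> dist x y"
    and s: "0 < s" "s \<le> \<rho> / 40"
  shows "real (card Z) * (fmin * vol_lower d * s ^ d) \<le> 1"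
proof -
  interpret prob_space Q0 by (rule prob_Q0)
  have "disjoint_family_on (\<lambda>z. ball z s) Z"
    unfolding disjoint_family_on_def
  proof (intro ballI impI, rule ccontr)
    fix x y assume xy: "x \<in> Z" "y \<in> Z" "x \<noteq> y" "ball x s \<inter> ball y s \<noteq> {}"
    then obtain w where "dist x w < s" "dist y w < s" by auto
    then show False using sep[OF xy(1-3)] dist_triangle2[of x y w] by simp
  qed
  then have "measure Q0 (\<Union>z\<in>Z. ball z s) = (\<Sum>z\<in>Z. measure Q0 (ball z s))"
    using Z by (intro finite_measure_finite_Union) auto
  moreover have "(\<Sum>z\<in>Z. fmin * vol_lower d * s ^ d) \<le> (\<Sum>z\<in>Z. measure Q0 (ball z s))"
    using Z s by (intro sum_mono measure_ball_lower) auto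
  ultimately show ?thesis using prob_le_1[of "\<Union>z\<in>Z. ball z s"] by simp
qed

text \<open>A separated subset of maximal cardinality is a net, and \<open>packing\<close> bounds
  the cardinality.\<close>

lemma ex_net:
  assumes s: "0 < s" "s \<le> \<rho> / 40"
  obtains Z where "finite Z" "Z \<subseteq> M" "\<And>x. x \<in> M \<Longrightarrow> \<exists>z\<in>Z. dist x z < 2 * s"
    "real (card Z) * (fmin * vol_lower d * s ^ d) \<le> 1"
proof -
  let ?P = "\<lambda>Z. finite Z \<and> Z \<subseteq> M \<and> (\<forall>x\<in>Z. \<forall>y\<in>Z. x \<noteq> y \<longrightarrow> 2 * s \<le> dist x y)"
  let ?K = "fmin * vol_lower d * s ^ d"
  have K: "0 < ?K" using fmin vol_lower_pos[OF d] s by simp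
  have pk: "real (card Z) * ?K \<le> 1" if "?P Z" for Z using packing[of Z s] that s by blast
  have bd: "card Z < Suc (nat \<lfloor>1 / ?K\<rfloor>)" if "?P Z" for Z
  proof -
    have "real (card Z) \<le> 1 / ?K" using pk[OF that] K by (simp add: pos_le_divide_eq)
    then show ?thesis by linarith
  qed
  obtain Z where Z: "?P Z" "\<And>Y. ?P Y \<Longrightarrow> card Y \<le> card Z"
  proof -
    have "?P {}" by simp
    moreover have "\<forall>Y. ?P Y \<longrightarrow> card Y < Suc (nat \<lfloor>1 / ?K\<rfloor>)" by (intro allI impI bd)
    ultimately have "\<exists>Z. ?P Z \<and> (\<forall>Y. ?P Y \<longrightarrow> card Y \<le> card Z)" by (rule Lattices_Big.ex_has_greatest_nat)
    then show ?thesis by (elim exE conjE) (rule that, simp, simp)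
  qed
  have "\<exists>z\<in>Z. dist x z < 2 * s" if x: "x \<in> M" for x
  proof (rule ccontr)
    assume n: "\<not> ?thesis"
    then have far: "\<And>z. z \<in> Z \<Longrightarrow> 2 * s \<le> dist x z" by (meson not_le)
    then have "x \<notin> Z" using s by force
    moreover have "?P (insert x Z)" using Z(1) x far by (auto simp: dist_commute)
    ultimately show False using Z(2)[of "insert x Z"] Z(1) by simp
  qed
  then show ?thesis using that[of Z] Z(1) pk[OF Z(1)] by blast
qed

text \<open>Connectedness supplies a point of \<open>M\<close> at every multiple of \<rho>/20 as
  distance from \<open>a\<close>, up to \<open>dist a b\<close>. These points are
  \<rho>/20-separated, so \<open>packing\<close> limits their number.\<close>

lemma diam_bound:
  assumes a: "a \<in> M" and b: "b \<in> M"
  shows "dist a b \<le> \<rho> / 20 / (fmin * vol_lower d * (\<rho> / 40) ^ d)"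
proof -
  let ?K = "fmin * vol_lower d * (\<rho> / 40) ^ d"
  have K: "0 < ?K" using fmin vol_lower_pos[OF d] \<rho> by simp
  define N where "N = nat \<lfloor>dist a b / (\<rho> / 20)\<rfloor>"
  have N: "real N * (\<rho> / 20) \<le> dist a b" "dist a b < (real N + 1) * (\<rho> / 20)"
  proof -
    have "0 \<le> dist a b / (\<rho> / 20)" using \<rho> by simp
    then have "real N \<le> dist a b / (\<rho> / 20)" "dist a b / (\<rho> / 20) < real N + 1" unfolding N_def by linarith+
    then show "real N * (\<rho> / 20) \<le> dist a b" "dist a b < (real N + 1) * (\<rho> / 20)"
      using \<rho> by (simp_all add: pos_le_divide_eq pos_divide_less_eq)
  qed
  have "\<exists>p\<in>M. dist a p = real i * (\<rho> / 20)" if "i \<le> N" for i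
  proof -
    have "connected (dist a ` M)" by (intro connected_continuous_image connected continuous_intros)
    moreover have "dist a a \<in> dist a ` M" "dist a b \<in> dist a ` M" using a b by blast+
    moreover have "0 \<le> real i * (\<rho> / 20)" "real i * (\<rho> / 20) \<le> dist a b"
    proof -
      have "real i * (\<rho> / 20) \<le> real N * (\<rho> / 20)" using that \<rho> by (intro mult_right_mono) auto
      then show "real i * (\<rho> / 20) \<le> dist a b" using N(1) by linarith
    qed (use \<rho> in simp)
    ultimately have "real i * (\<rho> / 20) \<in> dist a ` M"
      using connectedD_interval[of "dist a ` M" "dist a a" "dist a b"] by simp
    then show ?thesis by auto
  qed
  then obtain p where p: "\<And>i. i \<le> N \<Longrightarrow> p i \<in> M" "\<And>i. i \<le> N \<Longrightarrow> dist a (p i) = real i * (\<rho> / 20)" by metis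
  have sep: "\<rho> / 20 \<le> dist (p i) (p j)" if "i \<le> N" "j \<le> N" "i \<noteq> j" for i j
  proof -
    have "\<bar>dist a (p i) - dist a (p j)\<bar> \<le> dist (p i) (p j)"
      using dist_triangle[of a "p i" "p j"] dist_triangle[of a "p j" "p i"] by (auto simp: dist_commute)
    moreover have "\<bar>dist a (p i) - dist a (p j)\<bar> = \<bar>real i - real j\<bar> * (\<rho> / 20)"
      unfolding p(2)[OF that(1)] p(2)[OF that(2)] left_diff_distrib[symmetric] abs_mult using \<rho> by simp
    moreover have "1 \<le> \<bar>real i - real j\<bar>" using that(3) by linarith
    then have "1 * (\<rho> / 20) \<le> \<bar>real i - real j\<bar> * (\<rho> / 20)" using \<rho> by (intro mult_right_mono) auto
    ultimately show ?thesis by simp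
  qed
  have inj: "inj_on p {..N}"
  proof (rule inj_onI, rule ccontr)
    fix i j assume "i \<in> {..N}" "j \<in> {..N}" "p i = p j" "i \<noteq> j"
    then show False using sep[of i j] \<rho> by simp
  qed
  have "real (card (p ` {..N})) * ?K \<le> 1"
    using p(1) sep \<rho> by (intro packing) auto
  then have "(real N + 1) * ?K \<le> 1" using card_image[OF inj] by (simp add: add.commute)
  then have "real N + 1 \<le> 1 / ?K" using K by (simp add: pos_le_divide_eq)
  then have "(real N + 1) * (\<rho> / 20) \<le> 1 / ?K * (\<rho> / 20)" using \<rho> by (intro mult_right_mono) auto
  then have "(real N + 1) * (\<rho> / 20) \<le> \<rho> / 20 / ?K" by (simp only: times_divide_eq_left mult_1)
  then show ?thesis using N(2) by linarith
qed

end

locale noisy_law = manifold_law +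
  fixes \<sigma> :: real and \<mu> :: "(fvec \<times> fvec) measure" and Q :: "fvec measure"
  assumes prob_\<mu>: "prob_space \<mu>" and sets_\<mu> [measurable_cong]: "sets \<mu> = sets (borel \<Otimes>\<^sub>M borel)"
    and Q0_\<mu>: "Q0 = distr \<mu> borel fst" and noise: "AE (y, z) in \<mu>. z \<in> Rn D \<and> norm z \<le> \<sigma>"
    and Q_\<mu>: "Q = distr \<mu> borel (\<lambda>(y, z). y + z)" and \<sigma>: "0 \<le> \<sigma>"
begin

lemma add_measurable [measurable]: "(\<lambda>(y, z). y + z :: fvec) \<in> measurable \<mu> borel"
  by measurable

lemma fst_measurable' [measurable]: "fst \<in> measurable \<mu> borel"
  by measurable

lemma sets_Q [simp, measurable_cong]: "sets Q = sets borel" and space_Q [simp]: "space Q = UNIV"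
  by (auto simp: Q_\<mu>)

lemma prob_Q: "prob_space Q"
  unfolding Q_\<mu> by (rule prob_space.prob_space_distr[OF prob_\<mu> add_measurable])

lemma AE_\<mu>: "AE p in \<mu>. fst p \<in> M \<and> snd p \<in> Rn D \<and> norm (snd p) \<le> \<sigma>"
proof -
  have "AE p in \<mu>. fst p \<in> M"
    using AE_Q0 M_borel unfolding Q0_\<mu> by (subst (asm) AE_distr_iff) auto
  then show ?thesis using noise by eventually_elim auto
qed

lemma AE_Q: "AE x in Q. x \<in> Rn D \<and> infdist x M \<le> \<sigma>"
proof -
  have "closed ({x. infdist x M \<le> \<sigma>} \<inter> Rn D)"
    by (intro closed_Int closed_Rn closed_Collect_le continuous_intros)
  then have "{x. infdist x M \<le> \<sigma>} \<inter> Rn D \<in> sets borel" by (rule borel_closed)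
  then have m: "{x \<in> space borel. x \<in> Rn D \<and> infdist x M \<le> \<sigma>} \<in> sets borel"
    by (simp add: Int_def conj_commute)
  show ?thesis
    unfolding Q_\<mu> AE_distr_iff[OF add_measurable m]
    using AE_\<mu>
  proof eventually_elim
    case (elim p)
    have "infdist (fst p + snd p) M \<le> dist (fst p + snd p) (fst p)" using elim by (intro infdist_le) auto
    then show ?case using elim in_Rn Rn_add by (auto simp: split_beta dist_norm)
  qed
qed

lemma measure_Q: "A \<in> sets borel \<Longrightarrow> measure Q A = measure \<mu> {p \<in> space \<mu>. fst p + snd p \<in> A}"
  unfolding Q_\<mu> by (subst measure_distr[OF add_measurable]) (auto intro!: arg_cong[of _ _ "measure \<mu>"])

lemma measure_Q0: "A \<in> sets borel \<Longrightarrow> measure Q0 A = measure \<mu> {p \<in> space \<mu>. fst p \<in> A}"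
  unfolding Q0_\<mu> by (subst measure_distr[OF fst_measurable']) (auto intro!: arg_cong[of _ _ "measure \<mu>"])

text \<open>If \<open>Y\<close> lies within \<open>r - \<sigma>\<close> of \<open>a\<close>, then
  \<open>Y + Z\<close> lies within \<open>r\<close>.\<close>

lemma measure_Q_ball_lower:
  assumes a: "a \<in> M" and r: "\<sigma> < r" "r - \<sigma> \<le> \<rho> / 40"
  shows "fmin * vol_lower d * (r - \<sigma>) ^ d \<le> measure Q (ball a r)"
proof -
  interpret prob_space \<mu> by (rule prob_\<mu>)
  have [measurable]: "ball a r \<in> sets borel" "cball a r \<in> sets borel" "ball a (r - \<sigma>) \<in> sets borel" "cball a (r + \<sigma>) \<in> sets borel"
    by auto
  have "fmin * vol_lower d * (r - \<sigma>) ^ d \<le> measure Q0 (ball a (r - \<sigma>))"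
    by (rule measure_ball_lower[OF a]) (use r in auto)
  also have "\<dots> \<le> measure Q (ball a r)"
    unfolding measure_Q0[OF borel_open[OF open_ball]] measure_Q[OF borel_open[OF open_ball]]
  proof (rule finite_measure_mono_AE)
    show "AE p in \<mu>. p \<in> {p \<in> space \<mu>. fst p \<in> ball a (r - \<sigma>)} \<longrightarrow> p \<in> {p \<in> space \<mu>. fst p + snd p \<in> ball a r}"
      using AE_\<mu>
    proof eventually_elim
      case (elim p)
      then show ?case using dist_triangle[of a "fst p + snd p" "fst p"] by (auto simp: dist_norm)
    qed
  qed measurable
  finally show ?thesis .
qed

lemma measure_Q_cball_upper:
  assumes a: "a \<in> M" and r: "0 < r" "r + \<sigma> \<le> \<rho> / 20"
  shows "measure Q (cball a r) \<le> fmax * vol_upper d * (r + \<sigma>) ^ d"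
proof -
  interpret prob_space \<mu> by (rule prob_\<mu>)
  have [measurable]: "ball a r \<in> sets borel" "cball a r \<in> sets borel" "ball a (r - \<sigma>) \<in> sets borel" "cball a (r + \<sigma>) \<in> sets borel"
    by auto
  have "measure Q (cball a r) \<le> measure Q0 (cball a (r + \<sigma>))"
    unfolding measure_Q0[OF borel_closed[OF closed_cball]] measure_Q[OF borel_closed[OF closed_cball]]
  proof (rule finite_measure_mono_AE)
    show "AE p in \<mu>. p \<in> {p \<in> space \<mu>. fst p + snd p \<in> cball a r} \<longrightarrow> p \<in> {p \<in> space \<mu>. fst p \<in> cball a (r + \<sigma>)}"
      using AE_\<mu>
    proof eventually_elim
      case (elim p)
      then show ?case using dist_triangle[of a "fst p" "fst p + snd p"] by (auto simp: dist_norm)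
    qed
  qed measurable
  also have "\<dots> \<le> fmax * vol_upper d * (r + \<sigma>) ^ d"
    by (rule measure_cball_upper[OF a]) (use r \<sigma> in auto)
  finally show ?thesis .
qed

end

lemma noisy_modelE:
  assumes QM: "(Q, M) \<in> noisy_model k D d fmin fmax \<rho> \<sigma>"
    and "1 \<le> k" "1 \<le> d" "0 < fmin" "fmin \<le> fmax" "0 < \<rho>" "0 \<le> \<sigma>"
  obtains Q0 \<mu> where "noisy_law k D d M \<rho> fmin fmax Q0 \<sigma> \<mu> Q"
proof -
  obtain \<mu> where \<mu>: "prob_space \<mu>" "sets \<mu> = sets (borel \<Otimes>\<^sub>M borel)"
    "distr \<mu> borel fst \<in> clean_model k D d fmin fmax \<rho>" "M = measure_support (distr \<mu> borel fst)"
    "AE (y, z) in \<mu>. z \<in> Rn D \<and> norm z \<le> \<sigma>" "Q = distr \<mu> borel (\<lambda>(y, z). y + z)"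
    using QM by (auto simp: noisy_model_def)
  obtain N where N: "N \<in> manifold_class k D d \<rho>" "distr \<mu> borel fst \<in> density_model d fmin fmax N"
    using \<mu>(3) by (auto simp: clean_model_def)
  interpret manifold_law k D d N \<rho> fmin fmax "distr \<mu> borel fst"
    by unfold_locales (fact N assms)+
  have "N = M" using measure_support_Q0 \<mu>(4) by simp
  have "noisy_law k D d N \<rho> fmin fmax (distr \<mu> borel fst) \<sigma> \<mu> Q"
    by (intro noisy_law.intro manifold_law_axioms noisy_law_axioms.intro refl) (fact \<mu> assms)+
  then show ?thesis using that \<open>N = M\<close> by simp
qed

section \<open>Tangent spaces estimated from local covariances\<close>

section \<open>Local principal component analysis\<close>

context reach_manifold
begin

lemma eigenbasis_expand:
  assumes u: "\<And>i. i < D \<Longrightarrow> u i \<in> Rn D"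
    "\<And>i j. i < D \<Longrightarrow> j < D \<Longrightarrow> inner (u i) (u j) = (if i = j then 1 else 0)" and t: "t \<in> Rn D"
  shows "t = (\<Sum>i<D. inner t (u i) *\<^sub>R u i)"
proof -
  have inj: "inj_on u {..<D}" using u(2) by (intro inj_onI) (metis lessThan_iff zero_neq_one)
  have B: "onb (u ` {..<D}) (span (u ` {..<D}))"
    using u(2) by (auto simp: onb_def pairwise_def orthogonal_def norm_eq_sqrt_inner)
  have "span (u ` {..<D}) = Rn D"
  proof (rule fin_subspace_eq_dim[OF onb_fin_subspace[OF B] fin_subspace_Rn])
    show "span (u ` {..<D}) \<subseteq> Rn D" using u(1) by (intro span_minimal subspace_Rn) auto
    show "dim (span (u ` {..<D})) = dim (Rn D)"
      using onb_card[OF B] card_image[OF inj] by (simp add: dim_Rn)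
  qed
  then have "t = (\<Sum>b\<in>u ` {..<D}. inner t b *\<^sub>R b)" using onb_expand[OF B] t by simp
  also have "\<dots> = (\<Sum>i<D. inner t (u i) *\<^sub>R u i)" by (simp add: sum.reindex[OF inj])
  finally show ?thesis .
qed

lemma inner_local_cov:
  "inner (local_cov n x h j v) w = (1 / (real n - 1)) *
     (\<Sum>i\<in>neighbours n x h j. inner (x i - local_mean n x h j) v * inner (x i - local_mean n x h j) w)"
  by (simp add: local_cov_def inner_sum_left)

lemma linear_local_cov: "linear (local_cov n x h j)"
  by (rule linearI)
    (simp_all add: local_cov_def inner_add_right scaleR_add_left sum.distrib scaleR_right_distrib
      scaleR_sum_right mult.left_commute)

text \<open>A mean inherits any bound on its terms. The linear map \<open>f\<close> is later the
  identity, for distances, and the normal component, for the error from curvature and noise.\<close>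

lemma local_mean_deviation:
  fixes f :: "fvec \<Rightarrow> fvec"
  assumes f: "linear f" and N: "neighbours n x h j \<noteq> {}"
    and bd: "\<And>i. i \<in> neighbours n x h j \<Longrightarrow> norm (f (x i - c)) \<le> B"
  shows "norm (f (local_mean n x h j - c)) \<le> B"
proof -
  let ?N = "neighbours n x h j"
  have fin: "finite ?N" by (simp add: neighbours_def)
  have c0: "real (card ?N) > 0" using N fin by (simp add: card_gt_0_iff)
  have eq: "local_mean n x h j - c = (1 / real (card ?N)) *\<^sub>R (\<Sum>i\<in>?N. x i - c)"
    using c0 by (simp add: local_mean_def sum_subtractf scaleR_diff_right sum_constant_scaleR)
  have "norm (f (local_mean n x h j - c)) = norm (\<Sum>i\<in>?N. f (x i - c)) / real (card ?N)"
    unfolding eq linear_scale[OF f] linear_sum[OF f] by simp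
  also have "\<dots> \<le> (\<Sum>i\<in>?N. B) / real (card ?N)"
    by (intro divide_right_mono sum_norm_le bd) auto
  also have "\<dots> = B" using c0 by simp
  finally show ?thesis .
qed

text \<open>The argument avoids spectral gaps. Unit tangent vectors have variance at least
  \<open>lam\<close>, so by min-max the \<open>d\<close> largest eigenvalues are at least
  \<open>lam\<close>. Pairing the eigenvalue equation of \<open>u i\<close> with the normal part w
  of \<open>u i\<close> bounds \<open>lam\<close> times (norm w)^2 by the covariance of
  \<open>u i\<close> and w, in which every term carries the small factor 2 \<eta> from the normal
  components of the sample.\<close>

lemma pca_tangent:
  fixes x y :: "nat \<Rightarrow> fvec"
  assumes h: "0 < h" "h \<le> \<rho> / 100" and \<sigma>: "0 \<le> \<sigma>" "\<sigma> \<le> h / 100"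
    and y: "\<And>i. i \<in> {1..n} \<Longrightarrow> y i \<in> M" "\<And>i. i \<in> {1..n} \<Longrightarrow> dist (x i) (y i) \<le> \<sigma>"
    and n: "2 \<le> n" and j: "j \<in> {1..n}" and d: "1 \<le> d" "d < D"
    and low: "\<And>a. a \<in> M \<Longrightarrow> cl \<le> real (card {i \<in> {1..n}. x i \<in> ball a (h / 10)})" and cl: "0 < cl"
    and up: "\<And>a. a \<in> M \<Longrightarrow> real (card {i \<in> {1..n}. x i \<in> cball a (2 * h)}) \<le> cu"
    and S: "top_eigenspan D d (local_cov n x h j) S"
  shows "fin_subspace S" "dim S = d" "S \<subseteq> Rn D"
    "sub_angle S (T (y j)) (real d * (25 * (cu / cl) * (\<sigma> / h + h / \<rho>)))"
proof -
  define m where "m = y j"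
  define N where "N = neighbours n x h j"
  define mean where "mean = local_mean n x h j"
  let ?A = "local_cov n x h j"
  have m: "m \<in> M" unfolding m_def by (rule y(1)[OF j])
  have xm: "dist (x j) m \<le> \<sigma>" unfolding m_def by (rule y(2)[OF j])
  have finN: "finite N" by (simp add: N_def neighbours_def)
  obtain u l where u: "\<And>i. i < D \<Longrightarrow> u i \<in> Rn D" "\<And>i. i < D \<Longrightarrow> ?A (u i) = l i *\<^sub>R u i"
    "\<And>i j. i < D \<Longrightarrow> j < D \<Longrightarrow> inner (u i) (u j) = (if i = j then 1 else 0)"
    and l: "\<And>i j. i \<le> j \<Longrightarrow> j < D \<Longrightarrow> l j \<le> l i" and Su: "S = span (u ` {..<d})"
    using S unfolding top_eigenspan_def by (elim exE conjE) (rule that, (blast | simp)+)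
  have inj: "inj_on u {..<d}" using u(3) d by (intro inj_onI) (metis less_trans lessThan_iff zero_neq_one)
  have B: "onb (u ` {..<d}) S"
    using u(3) d by (auto simp: onb_def Su pairwise_def orthogonal_def norm_eq_sqrt_inner)
  show fS: "fin_subspace S" by (rule onb_fin_subspace[OF B])
  show "dim S = d" using onb_card[OF B] card_image[OF inj] by simp
  show "S \<subseteq> Rn D" unfolding Su using u(1) d by (intro span_minimal subspace_Rn) auto
  \<comment> \<open>The counts are controlled only for balls centred on \<open>M\<close>, hence the
    larger ball about \<open>m\<close>.\<close>
  have Nnear: "x i \<in> cball m (2 * h)" if "i \<in> N" for i
    using that dist_triangle[of m "x i" "x j"] xm \<sigma> h by (auto simp: N_def neighbours_def dist_commute)
  have cardN: "real (card N) \<le> cu"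
  proof -
    have "card N \<le> card {i \<in> {1..n}. x i \<in> cball m (2 * h)}"
      using Nnear by (intro card_mono) (auto simp: N_def neighbours_def)
    then show ?thesis using up[OF m] by simp
  qed
  \<comment> \<open>The witnesses lie in a ball of radius \<open>h / 10\<close> about the point of
    \<open>M\<close> above \<open>(h / 2) *\<^sub>R v\<close>, which leaves the margin h/2 -
    h/10.\<close>
  have side: "\<exists>I\<subseteq>N. cl \<le> real (card I) \<and> (\<forall>i\<in>I. 2 / 5 * h \<le> inner (x i - m) v)"
    if v: "v \<in> T m" "norm v = 1" for v
  proof -
    have sv: "(h / 2) *\<^sub>R v \<in> T m"
      using v fin_subspace_imp_subspace[OF T_fin[OF m]] by (simp add: subspace_scale)
    have nv: "norm ((h / 2) *\<^sub>R v) = h / 2" using v h by simp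
    obtain a where a: "a \<in> M" "P m (a - m) = (h / 2) *\<^sub>R v" "norm (a - m) \<le> 4 / 3 * (h / 2)"
      using point_above[OF m sv] nv h by auto
    let ?I = "{i \<in> {1..n}. x i \<in> ball a (h / 10)}"
    have am: "h / 2 \<le> norm (a - m)" using norm_oproj_le[OF T_fin[OF m], of "a - m"] a(2) nv by simp
    have av: "inner (a - m) v = h / 2"
    proof -
      have "inner (a - m) v = inner (P m (a - m)) v"
        using oproj_adjoint[OF T_fin[OF m], of "a - m" v] oproj_id[OF T_fin[OF m] v(1)] by simp
      then show ?thesis using a(2) v(2) by (simp add: dot_square_norm)
    qed
    have "?I \<subseteq> N"
    proof
      fix i assume i: "i \<in> ?I"
      \<comment> \<open>\<open>neighbours\<close> excludes the index \<open>j\<close> itself, so the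
        witnesses must avoid it.\<close>
      have "i \<noteq> j"
      proof
        assume "i = j"
        then have "dist a m < h / 10 + \<sigma>" using i xm dist_triangle[of a m "x j"] by auto
        then show False using am \<sigma> h by (simp add: dist_norm)
      qed
      moreover have "dist (x j) (x i) \<le> h"
        using dist_triangle[of "x j" "x i" m] dist_triangle[of m "x i" a] xm a(3) i \<sigma> h
        by (auto simp: dist_norm norm_minus_commute)
      ultimately show "i \<in> N" using i by (auto simp: N_def neighbours_def)
    qed
    moreover have "2 / 5 * h \<le> inner (x i - m) v" if i: "i \<in> ?I" for i
    proof -
      have "\<bar>inner (x i - a) v\<bar> \<le> norm (x i - a) * norm v" by (rule Cauchy_Schwarz_ineq2)
      also have "\<dots> \<le> h / 10" using i v by (simp add: dist_norm norm_minus_commute)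
      finally have "- (h / 10) \<le> inner (x i - a) v" by (simp add: abs_le_iff)
      moreover have "inner (x i - m) v = inner (x i - a) v + inner (a - m) v" by (simp add: inner_diff_left)
      ultimately show ?thesis using av by simp
    qed
    ultimately show ?thesis using low[OF a(1)] by blast
  qed
  have N0: "N \<noteq> {}"
  proof -
    obtain t where t: "t \<in> T m" "t \<noteq> 0"
      using ex_nonzero_orthogonal[OF T_fin[OF m], of "{}"] T_dim[OF m] d by auto
    have "(1 / norm t) *\<^sub>R t \<in> T m" "norm ((1 / norm t) *\<^sub>R t) = 1"
      using t fin_subspace_imp_subspace[OF T_fin[OF m]] by (simp_all add: subspace_scale)
    from side[OF this] obtain I where "I \<subseteq> N" "cl \<le> real (card I)" by blast
    then show ?thesis using cl by auto
  qed
  define lam where "lam = 1 / (real n - 1) * (cl * (2 / 5 * h)\<^sup>2)"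
  have n1: "0 < 1 / (real n - 1)" using n by simp
  have lam0: "0 < lam" unfolding lam_def using n1 cl h by (intro mult_pos_pos) auto
  have varu: "lam \<le> inner (?A v) v" if v: "v \<in> T m" "norm v = 1" for v
  proof -
    \<comment> \<open>The position of the mean is unknown; the witnesses are taken on the side of
      \<open>m\<close> opposite to it.\<close>
    have key: "\<exists>I\<subseteq>N. cl \<le> real (card I) \<and> (\<forall>i\<in>I. 2 / 5 * h \<le> \<bar>inner (x i - mean) v\<bar>)"
    proof (cases "inner (mean - m) v \<le> 0")
      case True
      obtain I where I: "I \<subseteq> N" "cl \<le> real (card I)" "\<And>i. i \<in> I \<Longrightarrow> 2 / 5 * h \<le> inner (x i - m) v"
        using side[OF v] by blast
      have "2 / 5 * h \<le> \<bar>inner (x i - mean) v\<bar>" if "i \<in> I" for i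
        using I(3)[OF that] True unfolding inner_diff_left by linarith
      then show ?thesis using I by blast
    next
      case False
      have "- v \<in> T m" using v fin_subspace_imp_subspace[OF T_fin[OF m]] by (simp add: subspace_neg)
      then obtain I where I: "I \<subseteq> N" "cl \<le> real (card I)" "\<And>i. i \<in> I \<Longrightarrow> 2 / 5 * h \<le> inner (x i - m) (- v)"
        using side[of "- v"] v by auto
      have "2 / 5 * h \<le> \<bar>inner (x i - mean) v\<bar>" if "i \<in> I" for i
        using I(3)[OF that] False unfolding inner_diff_left inner_minus_right by linarith
      then show ?thesis using I by blast
    qed
    then obtain I where I: "I \<subseteq> N" "cl \<le> real (card I)" "\<And>i. i \<in> I \<Longrightarrow> 2 / 5 * h \<le> \<bar>inner (x i - mean) v\<bar>" by blast
    have "cl * (2 / 5 * h)\<^sup>2 \<le> real (card I) * (2 / 5 * h)\<^sup>2" using I(2) by (intro mult_right_mono) auto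
    also have "\<dots> = (\<Sum>i\<in>I. (2 / 5 * h)\<^sup>2)" by simp
    also have "\<dots> \<le> (\<Sum>i\<in>I. (inner (x i - mean) v)\<^sup>2)"
    proof (rule sum_mono)
      fix i assume "i \<in> I"
      then have "(2 / 5 * h)\<^sup>2 \<le> \<bar>inner (x i - mean) v\<bar>\<^sup>2" using I(3) h by (intro power_mono) auto
      then show "(2 / 5 * h)\<^sup>2 \<le> (inner (x i - mean) v)\<^sup>2" by simp
    qed
    also have "\<dots> \<le> (\<Sum>i\<in>N. (inner (x i - mean) v)\<^sup>2)" using I(1) finN by (intro sum_mono2) auto
    finally show ?thesis
      using n1 unfolding lam_def inner_local_cov by (intro mult_left_mono) (auto simp: power2_eq_square N_def mean_def)
  qed
  have lbig: "lam \<le> l i" if "i < d" for i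
  proof -
    \<comment> \<open>Min-max: a unit tangent vector orthogonal to the first \<open>d - 1\<close>
      eigenvectors has variance at most the \<open>d\<close>-th eigenvalue, which is
      \<open>l (d - 1)\<close>.\<close>
    have "card (u ` {..<d - 1}) < dim (T m)"
      using card_image_le[of "{..<d - 1}" u] T_dim[OF m] d by simp
    then obtain t where t: "t \<in> T m" "t \<noteq> 0" "\<And>i. i < d - 1 \<Longrightarrow> inner t (u i) = 0"
      using ex_nonzero_orthogonal[OF T_fin[OF m], of "u ` {..<d - 1}"] by auto
    define v where "v = (1 / norm t) *\<^sub>R t"
    have v: "v \<in> T m" "norm v = 1" and vu: "\<And>i. i < d - 1 \<Longrightarrow> inner v (u i) = 0"
      using t fin_subspace_imp_subspace[OF T_fin[OF m]] by (auto simp: v_def subspace_scale)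
    have e: "v = (\<Sum>i<D. inner v (u i) *\<^sub>R u i)"
      by (rule eigenbasis_expand[OF u(1,3)]) (use v T_subset[OF m] in auto)
    have s1: "(\<Sum>i<D. (inner v (u i))\<^sup>2) = 1"
    proof -
      have "inner v v = inner v (\<Sum>i<D. inner v (u i) *\<^sub>R u i)" using e by simp
      also have "\<dots> = (\<Sum>i<D. (inner v (u i))\<^sup>2)" by (simp add: inner_sum_right power2_eq_square)
      finally show ?thesis using v(2) by (simp add: dot_square_norm)
    qed
    have "?A v = (\<Sum>i<D. inner v (u i) *\<^sub>R ?A (u i))"
      by (subst e) (simp add: linear_sum[OF linear_local_cov] linear_scale[OF linear_local_cov])
    also have "\<dots> = (\<Sum>i<D. (inner v (u i) * l i) *\<^sub>R u i)" using u(2) by (intro sum.cong) auto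
    finally have "inner (?A v) v = (\<Sum>i<D. l i * (inner v (u i))\<^sup>2)"
      by (simp add: inner_sum_left power2_eq_square inner_commute[of _ v] inner_sum_right mult_ac)
    also have "\<dots> \<le> (\<Sum>i<D. l (d - 1) * (inner v (u i))\<^sup>2)"
    proof (rule sum_mono)
      fix i assume i: "i \<in> {..<D}"
      show "l i * (inner v (u i))\<^sup>2 \<le> l (d - 1) * (inner v (u i))\<^sup>2"
        using vu[of i] l[of "d - 1" i] i by (cases "i < d - 1") (auto intro!: mult_right_mono)
    qed
    also have "\<dots> = l (d - 1)" using s1 by (simp add: sum_distrib_left[symmetric])
    finally have "lam \<le> l (d - 1)" using varu[OF v] by simp
    also have "\<dots> \<le> l i" using that d by (intro l) auto
    finally show ?thesis .
  qed
  let ?n = "\<lambda>z. z - P m z"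
  have linn: "linear ?n" using linear_oproj[OF T_fin[OF m]] by (intro linear_compose_sub linear_ident)
  \<comment> \<open>Noise plus a bound for the deviation of \<open>M\<close> from its tangent space
    within distance \<open>11 / 10 * h\<close>.\<close>
  define \<eta> where "\<eta> = \<sigma> + h\<^sup>2 / \<rho>"
  have \<eta>0: "0 \<le> \<eta>" using \<sigma> \<rho> by (simp add: \<eta>_def)
  have nx: "norm (?n (x i - m)) \<le> \<eta>" if i: "i \<in> N" for i
  proof -
    have i1: "i \<in> {1..n}" using i by (auto simp: N_def neighbours_def)
    have "dist (x j) (x i) \<le> h" using i by (auto simp: N_def neighbours_def)
    then have ym: "norm (y i - m) \<le> 11 / 10 * h"
      using dist_triangle[of "y i" m "x i"] dist_triangle[of "x i" m "x j"] y(2)[OF i1] xm \<sigma>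
      by (simp add: dist_norm norm_minus_commute)
    have "?n (x i - m) = ?n (x i - y i) + ?n (y i - m)"
      using linear_add[OF linn, of "x i - y i" "y i - m"] by simp
    then have "norm (?n (x i - m)) \<le> norm (?n (x i - y i)) + norm (?n (y i - m))"
      by (metis norm_triangle_ineq)
    also have "norm (?n (x i - y i)) \<le> \<sigma>"
      using norm_minus_oproj_le[OF T_fin[OF m], of "x i - y i"] y(2)[OF i1] by (simp add: dist_norm)
    also have "norm (?n (y i - m)) \<le> (norm (y i - m))\<^sup>2 / (2 * \<rho>)" by (rule normal_part[OF m y(1)[OF i1]])
    also have "\<dots> \<le> (11 / 10 * h)\<^sup>2 / (2 * \<rho>)" using ym \<rho> by (intro divide_right_mono power_mono) auto
    also have "\<dots> \<le> h\<^sup>2 / \<rho>" using \<rho> by (simp add: power2_eq_square field_simps)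
    finally show ?thesis by (simp add: \<eta>_def)
  qed
  have nmean: "norm (?n (mean - m)) \<le> \<eta>"
    unfolding mean_def using local_mean_deviation[OF linn, of n x h j m \<eta>] N0 nx by (simp add: N_def)
  have na: "norm (?n (x i - mean)) \<le> 2 * \<eta>" if i: "i \<in> N" for i
  proof -
    have "?n (x i - mean) = ?n (x i - m) - ?n (mean - m)"
      using linear_diff[OF linn, of "x i - m" "mean - m"] by simp
    then have "norm (?n (x i - mean)) \<le> norm (?n (x i - m)) + norm (?n (mean - m))"
      by (metis norm_triangle_ineq4)
    then show ?thesis using nx[OF i] nmean by simp
  qed
  have xmean: "norm (x i - mean) \<le> 2 * h" if i: "i \<in> N" for i
  proof -
    have "norm (mean - x j) \<le> h"
      unfolding mean_def
    proof (rule local_mean_deviation[OF linear_ident])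
      show "neighbours n x h j \<noteq> {}" using N0 by (simp add: N_def)
      show "norm (x i - x j) \<le> h" if "i \<in> neighbours n x h j" for i
        using that by (simp add: neighbours_def dist_norm norm_minus_commute)
    qed
    moreover have "norm (x i - x j) \<le> h" using i by (simp add: N_def neighbours_def dist_norm norm_minus_commute)
    ultimately show ?thesis using norm_triangle_ineq4[of "x i - x j" "mean - x j"] by simp
  qed
  have main: "norm (?n (u i)) \<le> 25 * (cu / cl) * (\<sigma> / h + h / \<rho>)" if i: "i < d" for i
  proof -
    let ?w = "?n (u i)"
    have iD: "i < D" using i d by simp
    have nu: "norm (u i) = 1" using u(3)[OF iD iD] by (simp add: norm_eq_sqrt_inner)
    have "inner (P m (u i)) ?w = 0" by (rule oproj_perp'[OF T_fin[OF m] oproj_in[OF T_fin[OF m]]])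
    then have uw: "inner (u i) ?w = (norm ?w)\<^sup>2"
      unfolding power2_norm_eq_inner using inner_diff_left[of "u i" "P m (u i)" ?w] by linarith
    have term_le: "inner (x k - mean) (u i) * inner (x k - mean) ?w \<le> 2 * h * (2 * \<eta> * norm ?w)" if k: "k \<in> N" for k
    proof -
      have "inner (P m (x k - mean)) ?w = 0" by (rule oproj_perp'[OF T_fin[OF m] oproj_in[OF T_fin[OF m]]])
      then have "inner (x k - mean) ?w = inner (?n (x k - mean)) ?w"
        using inner_diff_left[of "x k - mean" "P m (x k - mean)" ?w] by linarith
      then have "\<bar>inner (x k - mean) ?w\<bar> \<le> norm (?n (x k - mean)) * norm ?w" using Cauchy_Schwarz_ineq2 by metis
      also have "\<dots> \<le> 2 * \<eta> * norm ?w" by (intro mult_right_mono na k) auto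
      finally have 1: "\<bar>inner (x k - mean) ?w\<bar> \<le> 2 * \<eta> * norm ?w" .
      have 2: "\<bar>inner (x k - mean) (u i)\<bar> \<le> 2 * h"
        using Cauchy_Schwarz_ineq2[of "x k - mean" "u i"] xmean[OF k] nu by simp
      have "inner (x k - mean) (u i) * inner (x k - mean) ?w \<le> \<bar>inner (x k - mean) (u i)\<bar> * \<bar>inner (x k - mean) ?w\<bar>"
        by (simp add: abs_mult[symmetric])
      also have "\<dots> \<le> 2 * h * (2 * \<eta> * norm ?w)" using 1 2 h by (intro mult_mono) auto
      finally show ?thesis .
    qed
    have "lam * (norm ?w)\<^sup>2 \<le> l i * (norm ?w)\<^sup>2" by (intro mult_right_mono lbig i) auto
    also have "\<dots> = inner (?A (u i)) ?w" using u(2)[OF iD] uw by simp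
    also have "\<dots> = 1 / (real n - 1) * (\<Sum>k\<in>N. inner (x k - mean) (u i) * inner (x k - mean) ?w)"
      unfolding inner_local_cov by (simp add: N_def mean_def)
    also have "\<dots> \<le> 1 / (real n - 1) * (\<Sum>k\<in>N. 2 * h * (2 * \<eta> * norm ?w))"
      using n1 by (intro mult_left_mono sum_mono term_le) auto
    also have "\<dots> = 1 / (real n - 1) * (real (card N) * (2 * h * (2 * \<eta> * norm ?w)))" by simp
    also have "\<dots> \<le> 1 / (real n - 1) * (cu * (2 * h * (2 * \<eta> * norm ?w)))"
      using n1 h \<eta>0 by (intro mult_left_mono mult_right_mono cardN) auto
    finally have "1 / (real n - 1) * (cl * (2 / 5 * h)\<^sup>2 * (norm ?w)\<^sup>2) \<le> 1 / (real n - 1) * (cu * (2 * h * (2 * \<eta> * norm ?w)))"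
      unfolding lam_def by (simp only: mult.assoc)
    then have "cl * (2 / 5 * h)\<^sup>2 * (norm ?w)\<^sup>2 \<le> cu * (2 * h * (2 * \<eta> * norm ?w))"
      using n1 mult_le_cancel_left_pos by blast
    then have "norm ?w * (4 / 25 * cl * h\<^sup>2 * norm ?w) \<le> norm ?w * (4 * cu * h * \<eta>)"
      by (simp add: power2_eq_square mult_ac)
    then have "4 / 25 * cl * h\<^sup>2 * norm ?w \<le> 4 * cu * h * \<eta> \<or> norm ?w = 0"
      using mult_le_cancel_left_pos[of "norm ?w"] norm_ge_zero[of ?w] by (metis order_le_less)
    moreover have cu0: "0 \<le> cu" using cardN by linarith
    ultimately have "4 / 25 * cl * h\<^sup>2 * norm ?w \<le> 4 * cu * h * \<eta>" using h \<eta>0 by auto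
    then have "norm ?w \<le> 4 * cu * h * \<eta> / (4 / 25 * cl * h\<^sup>2)"
      using cl h by (simp add: pos_le_divide_eq mult.commute)
    also have "\<dots> = 25 * (cu / cl) * (\<eta> / h)" using h by (simp add: power2_eq_square)
    also have "\<eta> / h = \<sigma> / h + h / \<rho>" using h by (simp add: \<eta>_def add_divide_distrib power2_eq_square)
    finally show ?thesis .
  qed
  have cu0: "0 \<le> cu" using cardN by linarith
  have "sub_angle S (T m) (real (card (u ` {..<d})) * (25 * (cu / cl) * (\<sigma> / h + h / \<rho>)))"
    using main cu0 cl h \<sigma> \<rho> by (intro sub_angle_onb[OF fS T_fin[OF m] B]) auto
  then show "sub_angle S (T (y j)) (real d * (25 * (cu / cl) * (\<sigma> / h + h / \<rho>)))"
    using card_image[OF inj] by (simp add: m_def)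
qed

end

section \<open>Smooth maps, bumps and localised displacements\<close>

section \<open>Calculus of \<open>C\<^sup>k\<close> maps\<close>

text \<open>\<open>Ck_on\<close> with an arbitrary codomain, so that the scalar factors of a product are covered.\<close>

primrec Ck_map :: "nat \<Rightarrow> nat \<Rightarrow> (fvec \<Rightarrow> 'b::real_normed_vector) \<Rightarrow> fvec set \<Rightarrow> bool" where
  "Ck_map 0 d f U \<longleftrightarrow> continuous_on U f"
| "Ck_map (Suc k) d f U \<longleftrightarrow>
     (\<exists>f'. (\<forall>x\<in>U. (f has_derivative f' x) (at x within U)) \<and> (\<forall>v\<in>Rn d. Ck_map k d (\<lambda>x. f' x v) U))"

lemma Ck_on_eq_Ck_map: "Ck_on k d f U \<longleftrightarrow> Ck_map k d f U"
  by (induction k arbitrary: f) simp_all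

lemma Ck_map_SucD:
  "Ck_map (Suc k) d f U \<Longrightarrow>
     \<exists>f'. (\<forall>x\<in>U. (f has_derivative f' x) (at x within U)) \<and> (\<forall>v\<in>Rn d. Ck_map k d (\<lambda>x. f' x v) U)"
  by simp

lemma Ck_map_SucI:
  assumes "\<And>x. x \<in> U \<Longrightarrow> (f has_derivative f' x) (at x within U)"
    "\<And>v. v \<in> Rn d \<Longrightarrow> Ck_map k d (\<lambda>x. f' x v) U"
  shows "Ck_map (Suc k) d f U"
  unfolding Ck_map.simps using assms by (intro exI[of _ f']) blast

lemma Ck_map_Suc_imp: "Ck_map (Suc k) d f U \<Longrightarrow> Ck_map k d f U"
proof (induction k arbitrary: f)
  case 0
  then obtain f' where "\<And>x. x \<in> U \<Longrightarrow> (f has_derivative f' x) (at x within U)" by auto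
  then show ?case by (auto simp: continuous_on_eq_continuous_within intro: has_derivative_continuous)
next
  case (Suc k)
  obtain f' where f': "\<And>x. x \<in> U \<Longrightarrow> (f has_derivative f' x) (at x within U)"
    "\<And>v. v \<in> Rn d \<Longrightarrow> Ck_map (Suc k) d (\<lambda>x. f' x v) U" using Ck_map_SucD[OF Suc.prems] by blast
  show ?case by (rule Ck_map_SucI[OF f'(1) Suc.IH[OF f'(2)]])
qed

lemma Ck_map_const: "Ck_map k d (\<lambda>x. c) U"
proof (induction k arbitrary: c)
  case (Suc k)
  show ?case by (rule Ck_map_SucI[of _ _ "\<lambda>_ _. 0", OF has_derivative_const Suc])
qed simp

lemma Ck_map_add: "Ck_map k d f U \<Longrightarrow> Ck_map k d g U \<Longrightarrow> Ck_map k d (\<lambda>x. f x + g x) U"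
proof (induction k arbitrary: f g)
  case 0 then show ?case by (simp add: continuous_on_add)
next
  case (Suc k)
  obtain f' where f': "\<And>x. x \<in> U \<Longrightarrow> (f has_derivative f' x) (at x within U)"
    "\<And>v. v \<in> Rn d \<Longrightarrow> Ck_map k d (\<lambda>x. f' x v) U" using Ck_map_SucD[OF Suc.prems(1)] by blast
  obtain g' where g': "\<And>x. x \<in> U \<Longrightarrow> (g has_derivative g' x) (at x within U)"
    "\<And>v. v \<in> Rn d \<Longrightarrow> Ck_map k d (\<lambda>x. g' x v) U" using Ck_map_SucD[OF Suc.prems(2)] by blast
  show ?case
    by (rule Ck_map_SucI[OF has_derivative_add[OF f'(1) g'(1)] Suc.IH[OF f'(2) g'(2)]])
qed

lemma Ck_map_sum: "(\<And>i. i \<in> I \<Longrightarrow> Ck_map k d (f i) U) \<Longrightarrow> Ck_map k d (\<lambda>x. \<Sum>i\<in>I. f i x) U"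
  by (induction I rule: infinite_finite_induct) (auto intro: Ck_map_const Ck_map_add)

lemma Ck_map_linear:
  assumes L: "bounded_linear L" shows "Ck_map k d f U \<Longrightarrow> Ck_map k d (\<lambda>x. L (f x)) U"
proof (induction k arbitrary: f)
  case 0 then show ?case using bounded_linear.continuous_on[OF L] by simp
next
  case (Suc k)
  obtain f' where f': "\<And>x. x \<in> U \<Longrightarrow> (f has_derivative f' x) (at x within U)"
    "\<And>v. v \<in> Rn d \<Longrightarrow> Ck_map k d (\<lambda>x. f' x v) U" using Ck_map_SucD[OF Suc.prems] by blast
  show ?case
    by (rule Ck_map_SucI[OF bounded_linear.has_derivative[OF L f'(1)] Suc.IH[OF f'(2)]])
qed

lemma Ck_map_bilinear:
  assumes B: "bounded_bilinear B"
  shows "Ck_map k d f U \<Longrightarrow> Ck_map k d g U \<Longrightarrow> Ck_map k d (\<lambda>x. B (f x) (g x)) U"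
proof (induction k arbitrary: f g)
  case 0 then show ?case using bounded_bilinear.continuous_on[OF B] by simp
next
  case (Suc k)
  obtain f' where f': "\<And>x. x \<in> U \<Longrightarrow> (f has_derivative f' x) (at x within U)"
    "\<And>v. v \<in> Rn d \<Longrightarrow> Ck_map k d (\<lambda>x. f' x v) U" using Ck_map_SucD[OF Suc.prems(1)] by blast
  obtain g' where g': "\<And>x. x \<in> U \<Longrightarrow> (g has_derivative g' x) (at x within U)"
    "\<And>v. v \<in> Rn d \<Longrightarrow> Ck_map k d (\<lambda>x. g' x v) U" using Ck_map_SucD[OF Suc.prems(2)] by blast
  show ?case
    by (rule Ck_map_SucI[OF bounded_bilinear.FDERIV[OF B f'(1) g'(1)]], assumption, assumption)
      (intro Ck_map_add Suc.IH Ck_map_Suc_imp[OF Suc.prems(1)] Ck_map_Suc_imp[OF Suc.prems(2)] f'(2) g'(2))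
qed

text \<open>All derivatives of the outer function are given at once as a sequence, because the
  induction passes from \<open>G i\<close> to \<open>G (Suc i)\<close>.\<close>

lemma Ck_map_compose_real:
  fixes G :: "nat \<Rightarrow> real \<Rightarrow> real"
  assumes G: "\<And>i x. (G i has_real_derivative G (Suc i) x) (at x)"
  shows "Ck_map k d f U \<Longrightarrow> Ck_map k d (\<lambda>x. G i (f x)) U"
proof (induction k arbitrary: i f)
  case 0
  have "continuous_on UNIV (G i)" using G by (intro DERIV_continuous_on) auto
  then show ?case using 0 by (simp add: continuous_on_compose2)
next
  case (Suc k)
  obtain f' where f': "\<And>x. x \<in> U \<Longrightarrow> (f has_derivative f' x) (at x within U)"
    "\<And>v. v \<in> Rn d \<Longrightarrow> Ck_map k d (\<lambda>x. f' x v) U" using Ck_map_SucD[OF Suc.prems] by blast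
  show ?case
  proof (rule Ck_map_SucI)
    show "((\<lambda>x. G i (f x)) has_derivative (\<lambda>v. G (Suc i) (f x) * f' x v)) (at x within U)" if "x \<in> U" for x
      using has_derivative_compose[OF f'(1)[OF that] G[unfolded has_field_derivative_def]] .
    show "Ck_map k d (\<lambda>x. G (Suc i) (f x) * f' x v) U" if "v \<in> Rn d" for v
      by (rule Ck_map_bilinear[OF bounded_bilinear_mult Suc.IH[OF Ck_map_Suc_imp[OF Suc.prems]] f'(2)[OF that]])
  qed
qed


section \<open>A smooth bump function\<close>

text \<open>The functions p(1/x) exp(-1/x), extended by 0 to x \<le> 0, are closed under
  differentiation, and \<open>flat_pderiv\<close> gives the new polynomial. One derivative formula
  thus covers all orders.\<close>

definition flat :: "real poly \<Rightarrow> real \<Rightarrow> real" where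
  "flat p x = (if x \<le> 0 then 0 else poly p (inverse x) * exp (- inverse x))"

definition flat_pderiv :: "real poly \<Rightarrow> real poly" where
  "flat_pderiv p = [:0, 0, 1:] * (p - pderiv p)"

lemma poly_times_exp_tendsto_0: "((\<lambda>t::real. t ^ k * poly p t * exp (- t)) \<longlongrightarrow> 0) at_top"
proof (induction p arbitrary: k)
  case (pCons a p)
  have "((\<lambda>t::real. a * (t ^ k / exp t) + t ^ Suc k * poly p t * exp (- t)) \<longlongrightarrow> a * 0 + 0) at_top"
    by (intro tendsto_intros tendsto_power_div_exp_0 pCons)
  then show ?case by (simp add: exp_minus divide_inverse algebra_simps)
qed simp

lemma DERIV_flat: "(flat p has_real_derivative flat (flat_pderiv p) x) (at x)"
proof -
  consider "x < 0" | "x = 0" | "x > 0" by linarith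
  then show ?thesis
  proof cases
    case 1
    have "((\<lambda>_. 0) has_real_derivative 0) (at x)" by simp
    then have "(flat p has_real_derivative 0) (at x)"
      by (rule has_field_derivative_transform_within_open[where S = "{..<0}"]) (use 1 in \<open>auto simp: flat_def\<close>)
    then show ?thesis using 1 by (simp add: flat_def)
  next
    case 2
    have "((\<lambda>h. poly (pCons 0 p) (inverse h) * exp (- inverse h)) \<longlongrightarrow> 0) (at_right (0::real))"
      using filterlim_compose[OF poly_times_exp_tendsto_0[of 0 "pCons 0 p"] filterlim_inverse_at_top_right] by simp
    then have "((\<lambda>h. flat p h / h) \<longlongrightarrow> 0) (at_right 0)"
      by (rule Lim_transform_eventually)
        (auto simp: eventually_at_right_field flat_def divide_inverse intro!: exI[of _ 1])
    moreover have "((\<lambda>h. flat p h / h) \<longlongrightarrow> 0) (at_left 0)"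
      by (rule Lim_transform_eventually[OF tendsto_const])
        (auto simp: eventually_at_left_field flat_def intro!: exI[of _ "-1"])
    ultimately have "((\<lambda>h. flat p h / h) \<longlongrightarrow> 0) (at 0)" by (simp add: filterlim_at_split)
    then show ?thesis using 2 by (simp add: DERIV_def flat_def)
  next
    case 3
    have "((\<lambda>x. poly p (inverse x) * exp (- inverse x)) has_real_derivative
        (poly (pderiv p) (inverse x) * (- (inverse x * inverse x))) * exp (- inverse x)
        + exp (- inverse x) * (inverse x * inverse x) * poly p (inverse x)) (at x)"
      using 3 by (auto intro!: derivative_eq_intros DERIV_chain2[OF poly_DERIV] simp: power2_eq_square)
    then have "(flat p has_real_derivative
        (poly (pderiv p) (inverse x) * (- (inverse x * inverse x))) * exp (- inverse x)
        + exp (- inverse x) * (inverse x * inverse x) * poly p (inverse x)) (at x)"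
      by (rule has_field_derivative_transform_within_open[where S = "{0<..}"]) (use 3 in \<open>auto simp: flat_def\<close>)
    then show ?thesis using 3 by (simp add: flat_def flat_pderiv_def algebra_simps)
  qed
qed

text \<open>The \<open>i\<close>-th derivative of exp(1 - 1/(1 - 9 s)), extended by 0 to s \<ge>
  1/9. For s = (norm (x - m) / \<epsilon>)^2 the support has radius \<epsilon>/3.\<close>

definition bump :: "nat \<Rightarrow> real \<Rightarrow> real" where
  "bump i s = exp 1 * (-9) ^ i * flat ((flat_pderiv ^^ i) 1) (1 - 9 * s)"

lemma DERIV_bump: "(bump i has_real_derivative bump (Suc i) s) (at s)"
  unfolding bump_def
  by (rule derivative_eq_intros DERIV_chain2[OF DERIV_flat] refl | simp)+

lemma bump_0 [simp]: "bump 0 0 = 1"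
  by (simp add: bump_def flat_def exp_minus)

lemma bump_outside: "1 / 9 \<le> s \<Longrightarrow> bump i s = 0"
  by (simp add: bump_def flat_def)

lemma continuous_on_bump: "continuous_on S (bump i)"
  using DERIV_bump by (intro DERIV_continuous_on) (auto intro: has_field_derivative_at_within)

text \<open>Orders 0, 1 and 2 enter the bounds on the value, the derivative and the second-order
  remainder of a displacement.\<close>

lemma ex_bump_bound: "\<exists>K\<ge>1. \<forall>i\<le>2. \<forall>s\<ge>0. \<bar>bump i s\<bar> \<le> K"
proof -
  have "\<exists>B. \<forall>s\<ge>0. \<bar>bump i s\<bar> \<le> B" for i
  proof -
    have "compact (bump i ` {0..1})" by (intro compact_continuous_image continuous_on_bump compact_Icc)
    then obtain B where B: "\<And>s. s \<in> {0..1} \<Longrightarrow> \<bar>bump i s\<bar> \<le> B"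
      using compact_imp_bounded by (fastforce simp: bounded_iff)
    then have "0 \<le> B" using B[of 0] by fastforce
    then have "\<bar>bump i s\<bar> \<le> B" if "0 \<le> s" for s
      using B[of s] bump_outside[of s i] that by (cases "s \<le> 1") auto
    then show ?thesis by blast
  qed
  then obtain B where B: "\<And>i s. 0 \<le> s \<Longrightarrow> \<bar>bump i s\<bar> \<le> B i" by metis
  have "\<bar>bump i s\<bar> \<le> max 1 (Max (B ` {..2}))" if "i \<le> 2" "0 \<le> s" for i s
    using order_trans[OF B[OF that(2), of i], of "Max (B ` {..2})"] that(1) by (auto intro!: max.coboundedI2 Max_ge)
  then show ?thesis by (intro exI[of _ "max 1 (Max (B ` {..2}))"]) auto
qed

definition bump_bound :: real where
  "bump_bound = (SOME K. K \<ge> 1 \<and> (\<forall>i\<le>2. \<forall>s\<ge>0. \<bar>bump i s\<bar> \<le> K))"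

lemma bump_bound: "1 \<le> bump_bound" "i \<le> 2 \<Longrightarrow> 0 \<le> s \<Longrightarrow> \<bar>bump i s\<bar> \<le> bump_bound"
  using someI_ex[OF ex_bump_bound] unfolding bump_bound_def[symmetric] by auto


section \<open>Localised displacement fields\<close>

text \<open>Written in the squared distance, which is smooth at the centre. For linear
  \<open>A\<close> the field has value \<open>c\<close> and derivative \<open>A\<close> at
  \<open>m\<close>.\<close>

definition bump_field :: "real \<Rightarrow> fvec \<Rightarrow> fvec \<Rightarrow> (fvec \<Rightarrow> fvec) \<Rightarrow> fvec \<Rightarrow> fvec" where
  "bump_field \<epsilon> m c A x = bump 0 ((norm (x - m))\<^sup>2 / \<epsilon>\<^sup>2) *\<^sub>R (c + A (x - m))"

definition bump_field_deriv :: "real \<Rightarrow> fvec \<Rightarrow> fvec \<Rightarrow> (fvec \<Rightarrow> fvec) \<Rightarrow> fvec \<Rightarrow> fvec \<Rightarrow> fvec" where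
  "bump_field_deriv \<epsilon> m c A x v =
     bump 0 ((norm (x - m))\<^sup>2 / \<epsilon>\<^sup>2) *\<^sub>R A v +
     (bump 1 ((norm (x - m))\<^sup>2 / \<epsilon>\<^sup>2) * (2 * inner (x - m) v / \<epsilon>\<^sup>2)) *\<^sub>R (c + A (x - m))"

lemma bump_field_outside:
  assumes "0 < \<epsilon>" "\<epsilon> / 3 \<le> dist x m"
  shows "bump_field \<epsilon> m c A x = 0" "bump_field_deriv \<epsilon> m c A x v = 0" "bump i ((norm (x - m))\<^sup>2 / \<epsilon>\<^sup>2) = 0"
proof -
  have "(\<epsilon> / 3)\<^sup>2 \<le> (norm (x - m))\<^sup>2" using assms by (intro power_mono) (auto simp: dist_norm)
  then have "1 / 9 \<le> (norm (x - m))\<^sup>2 / \<epsilon>\<^sup>2" using assms(1) by (simp add: power_divide pos_le_divide_eq)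
  then show "bump_field \<epsilon> m c A x = 0" "bump_field_deriv \<epsilon> m c A x v = 0" "bump i ((norm (x - m))\<^sup>2 / \<epsilon>\<^sup>2) = 0"
    by (simp_all add: bump_field_def bump_field_deriv_def bump_outside)
qed

locale bump_data =
  fixes \<epsilon> \<sigma> \<theta> :: real and m c :: fvec and A :: "fvec \<Rightarrow> fvec"
  assumes \<epsilon>: "0 < \<epsilon>" and \<sigma>: "0 \<le> \<sigma>" and \<theta>: "0 \<le> \<theta>" and A: "linear A"
    and c_le: "norm c \<le> \<sigma>" and A_le: "\<And>v. norm (A v) \<le> \<theta> * norm v"
begin

lemma bounded_linear_A: "bounded_linear A"
  by (rule bounded_linear_intro[of _ \<theta>]) (auto simp: linear_add[OF A] linear_scale[OF A] A_le mult.commute)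

lemma has_derivative_bump_field:
  "(bump_field \<epsilon> m c A has_derivative bump_field_deriv \<epsilon> m c A x) (at x)"
proof -
  have s: "((\<lambda>x. (norm (x - m))\<^sup>2 / \<epsilon>\<^sup>2) has_derivative (\<lambda>v. 2 * inner (x - m) v / \<epsilon>\<^sup>2)) (at x)"
    using has_derivative_dist_sq[of m x] by (rule bounded_linear.has_derivative[OF bounded_linear_divide])
  have b: "((\<lambda>x. bump 0 ((norm (x - m))\<^sup>2 / \<epsilon>\<^sup>2)) has_derivative
      (\<lambda>v. bump 1 ((norm (x - m))\<^sup>2 / \<epsilon>\<^sup>2) * (2 * inner (x - m) v / \<epsilon>\<^sup>2))) (at x)"
    using has_derivative_compose[OF s DERIV_bump[of 0, unfolded has_field_derivative_def]] by simp
  have a: "((\<lambda>x. c + A (x - m)) has_derivative A) (at x)"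
  proof -
    have "((\<lambda>x. x - m) has_derivative (\<lambda>v. v)) (at x)" by (auto intro!: derivative_eq_intros)
    from has_derivative_add[OF has_derivative_const bounded_linear.has_derivative[OF bounded_linear_A this]]
    show ?thesis by simp
  qed
  show ?thesis
    unfolding bump_field_def[abs_def] bump_field_deriv_def[abs_def]
    by (rule has_derivative_scaleR[OF b a])
qed

lemma affine_le:
  assumes "dist x m \<le> \<epsilon> / 3" shows "norm (c + A (x - m)) \<le> \<sigma> + \<theta> * \<epsilon>"
proof -
  have "norm (c + A (x - m)) \<le> norm c + norm (A (x - m))" by (rule norm_triangle_ineq)
  also have "\<dots> \<le> \<sigma> + \<theta> * norm (x - m)" using c_le A_le by (intro add_mono) auto
  also have "\<dots> \<le> \<sigma> + \<theta> * \<epsilon>" using assms \<theta> \<epsilon> by (intro add_left_mono mult_left_mono) (auto simp: dist_norm)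
  finally show ?thesis .
qed

lemma norm_bump_field: "norm (bump_field \<epsilon> m c A x) \<le> bump_bound * (\<sigma> + \<theta> * \<epsilon>)"
proof (cases "dist x m \<le> \<epsilon> / 3")
  case True
  have "\<bar>bump 0 ((norm (x - m))\<^sup>2 / \<epsilon>\<^sup>2)\<bar> * norm (c + A (x - m)) \<le> bump_bound * (\<sigma> + \<theta> * \<epsilon>)"
    by (intro mult_mono bump_bound affine_le True) (use bump_bound(1) in auto)
  then show ?thesis by (simp add: bump_field_def)
next
  case False
  then have "bump_field \<epsilon> m c A x = 0" using bump_field_outside(1)[OF \<epsilon>] by simp
  then show ?thesis using bump_bound(1) \<sigma> \<theta> \<epsilon> by simp
qed

lemma norm_bump_field_deriv: "norm (bump_field_deriv \<epsilon> m c A x v) \<le> 2 * bump_bound * (\<sigma> / \<epsilon> + \<theta>) * norm v"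
proof (cases "dist x m \<le> \<epsilon> / 3")
  case True
  let ?s = "(norm (x - m))\<^sup>2 / \<epsilon>\<^sup>2" and ?K = bump_bound
  have K: "0 \<le> ?K" using bump_bound(1) by simp
  have "\<bar>inner (x - m) v\<bar> \<le> norm (x - m) * norm v" by (rule Cauchy_Schwarz_ineq2)
  also have "\<dots> \<le> \<epsilon> / 3 * norm v" using True by (intro mult_right_mono) (auto simp: dist_norm)
  finally have "2 * \<bar>inner (x - m) v\<bar> / \<epsilon>\<^sup>2 \<le> 2 * (\<epsilon> / 3 * norm v) / \<epsilon>\<^sup>2"
    by (intro divide_right_mono mult_left_mono) auto
  then have "\<bar>2 * inner (x - m) v / \<epsilon>\<^sup>2\<bar> \<le> 2 * (\<epsilon> / 3 * norm v) / \<epsilon>\<^sup>2"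
    by (simp add: abs_mult)
  also have "\<dots> \<le> norm v / \<epsilon>" using \<epsilon> by (simp add: power2_eq_square field_simps)
  finally have i: "\<bar>2 * inner (x - m) v / \<epsilon>\<^sup>2\<bar> \<le> norm v / \<epsilon>" .
  have "norm (bump_field_deriv \<epsilon> m c A x v) \<le> \<bar>bump 0 ?s\<bar> * norm (A v) +
      (\<bar>bump 1 ?s\<bar> * \<bar>2 * inner (x - m) v / \<epsilon>\<^sup>2\<bar>) * norm (c + A (x - m))"
    unfolding bump_field_deriv_def by (rule order_trans[OF norm_triangle_ineq]) (simp add: abs_mult)
  also have "\<dots> \<le> ?K * (\<theta> * norm v) + (?K * (norm v / \<epsilon>)) * (\<sigma> + \<theta> * \<epsilon>)"
    using K \<epsilon> by (intro add_mono mult_mono bump_bound A_le i affine_le True mult_nonneg_nonneg) auto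
  also have "\<dots> = ?K * (\<sigma> / \<epsilon> + 2 * \<theta>) * norm v" using \<epsilon> by (simp add: field_simps)
  also have "\<dots> \<le> 2 * ?K * (\<sigma> / \<epsilon> + \<theta>) * norm v"
  proof -
    have "0 \<le> \<sigma> / \<epsilon>" using \<sigma> \<epsilon> by simp
    then have "\<sigma> / \<epsilon> + 2 * \<theta> \<le> 2 * (\<sigma> / \<epsilon> + \<theta>)" by argo
    then have "?K * (\<sigma> / \<epsilon> + 2 * \<theta>) * norm v \<le> ?K * (2 * (\<sigma> / \<epsilon> + \<theta>)) * norm v"
      using K by (intro mult_right_mono mult_left_mono) auto
    then show ?thesis by (simp add: mult_ac)
  qed
  finally show ?thesis .
next
  case False
  then have "bump_field_deriv \<epsilon> m c A x v = 0" using bump_field_outside(2)[OF \<epsilon>] by simp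
  then show ?thesis using bump_bound(1) \<sigma> \<theta> \<epsilon> by simp
qed

lemma bump_field_lipschitz:
  "norm (bump_field \<epsilon> m c A y - bump_field \<epsilon> m c A x) \<le> 2 * bump_bound * (\<sigma> / \<epsilon> + \<theta>) * norm (y - x)"
proof -
  have "norm (bump_field \<epsilon> m c A y - bump_field \<epsilon> m c A x) \<le> 2 * bump_bound * (\<sigma> / \<epsilon> + \<theta>) * norm (y - x)"
  proof (rule differentiable_bound[OF convex_UNIV])
    show "(bump_field \<epsilon> m c A has_derivative bump_field_deriv \<epsilon> m c A z) (at z within UNIV)" for z
      using has_derivative_bump_field by simp
    show "onorm (bump_field_deriv \<epsilon> m c A z) \<le> 2 * bump_bound * (\<sigma> / \<epsilon> + \<theta>)" for z
      using norm_bump_field_deriv[of z] bump_bound(1) \<sigma> \<epsilon> \<theta> by (intro onorm_bound) auto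
  qed auto
  then show ?thesis .
qed

text \<open>Tested against \<open>w\<close>, the field along the segment is a real function
  \<open>f\<close> of \<open>t\<close> with derivatives \<open>f1\<close> and \<open>f2\<close>, to
  which the Lagrange form of the remainder applies.\<close>

lemma bump_field_taylor_inner:
  "\<bar>inner (bump_field \<epsilon> m c A (x + v) - bump_field \<epsilon> m c A x - bump_field_deriv \<epsilon> m c A x v) w\<bar>
     \<le> 2 * bump_bound * (\<sigma> / \<epsilon>\<^sup>2 + \<theta> / \<epsilon>) * (norm v)\<^sup>2 * norm w"
proof -
  define z where "z t = x - m + t *\<^sub>R v" for t :: real
  define s where "s t = (norm (z t))\<^sup>2 / \<epsilon>\<^sup>2" for t
  define s1 where "s1 t = 2 * inner (z t) v / \<epsilon>\<^sup>2" for t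
  define s2 where "s2 = 2 * inner v v / \<epsilon>\<^sup>2"
  define l where "l t = inner (c + A (z t)) w" for t
  define l1 where "l1 = inner (A v) w"
  define f where "f t = bump 0 (s t) * l t" for t
  define f1 where "f1 t = bump 1 (s t) * s1 t * l t + bump 0 (s t) * l1" for t
  define f2 where "f2 t = (bump 2 (s t) * (s1 t)\<^sup>2 + bump 1 (s t) * s2) * l t + 2 * (bump 1 (s t) * s1 t * l1)" for t
  have dz: "(z has_vector_derivative v) (at t)" for t
    unfolding z_def by (auto intro!: derivative_eq_intros)
  have s_eq: "s t = (inner (x - m) (x - m) + 2 * t * inner (x - m) v + t\<^sup>2 * inner v v) / \<epsilon>\<^sup>2" for t
    unfolding s_def z_def norm_sq_add[of "x - m" "t *\<^sub>R v"] by (simp add: dot_square_norm power_mult_distrib)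
  have ds: "(s has_real_derivative s1 t) (at t)" for t
  proof -
    have "((\<lambda>t. (inner (x - m) (x - m) + 2 * t * inner (x - m) v + t\<^sup>2 * inner v v) / \<epsilon>\<^sup>2) has_real_derivative
        (2 * inner (x - m) v + 2 * t * inner v v) / \<epsilon>\<^sup>2) (at t)"
      by (intro DERIV_cdivide) (auto intro!: derivative_eq_intros)
    moreover have "s = (\<lambda>t. (inner (x - m) (x - m) + 2 * t * inner (x - m) v + t\<^sup>2 * inner v v) / \<epsilon>\<^sup>2)"
      using s_eq by blast
    ultimately show ?thesis by (simp add: s1_def z_def inner_add_left algebra_simps)
  qed
  have ds1: "(s1 has_real_derivative s2) (at t)" for t
    unfolding s1_def z_def s2_def inner_add_left inner_scaleR_left
    by (intro DERIV_cdivide) (auto intro!: derivative_eq_intros)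
  have dl: "(l has_real_derivative l1) (at t)" for t
    unfolding l_def z_def l1_def linear_add[OF A] linear_scale[OF A] inner_add_left inner_scaleR_left
    by (auto intro!: derivative_eq_intros)
  have db: "((\<lambda>t. bump i (s t)) has_real_derivative bump (Suc i) (s t) * s1 t) (at t)" for i t
    by (rule DERIV_chain2[OF DERIV_bump ds])
  have df: "(f has_real_derivative f1 t) (at t)" for t
    unfolding f_def f1_def using DERIV_mult[OF db[of 0] dl] by (simp add: mult_ac add.commute)
  have df1: "(f1 has_real_derivative f2 t) (at t)" for t
  proof -
    have "(f1 has_real_derivative (bump 2 (s t) * s1 t * s1 t + s2 * bump 1 (s t)) * l t + l1 * (bump 1 (s t) * s1 t)
        + bump 1 (s t) * s1 t * l1) (at t)"
      unfolding f1_def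
      using DERIV_add[OF DERIV_mult[OF DERIV_mult[OF db[of 1] ds1] dl] DERIV_cmult_right[OF db[of 0], of l1]]
      by (simp add: numeral_2_eq_2)
    then show ?thesis by (simp add: f2_def power2_eq_square algebra_simps)
  qed
  have f2: "\<bar>f2 t\<bar> \<le> 4 * bump_bound * (\<sigma> / \<epsilon>\<^sup>2 + \<theta> / \<epsilon>) * (norm v)\<^sup>2 * norm w" for t
  proof (cases "norm (z t) \<le> \<epsilon> / 3")
    case True
    let ?K = bump_bound
    have K: "0 \<le> ?K" using bump_bound(1) by simp
    have s0: "0 \<le> s t" by (simp add: s_def)
    have "\<bar>inner (z t) v\<bar> \<le> norm (z t) * norm v" by (rule Cauchy_Schwarz_ineq2)
    also have "\<dots> \<le> \<epsilon> / 3 * norm v" using True by (intro mult_right_mono) auto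
    finally have "2 * \<bar>inner (z t) v\<bar> / \<epsilon>\<^sup>2 \<le> 2 * (\<epsilon> / 3 * norm v) / \<epsilon>\<^sup>2"
      by (intro divide_right_mono mult_left_mono) auto
    then have "\<bar>s1 t\<bar> \<le> 2 * (\<epsilon> / 3 * norm v) / \<epsilon>\<^sup>2"
      unfolding s1_def by (simp add: abs_mult)
    also have "\<dots> = 2 / 3 * (norm v / \<epsilon>)" using \<epsilon> by (simp add: power2_eq_square)
    finally have 1: "\<bar>s1 t\<bar> \<le> 2 / 3 * (norm v / \<epsilon>)" .
    have 2: "\<bar>s2\<bar> = 2 * (norm v / \<epsilon>)\<^sup>2" by (simp add: s2_def dot_square_norm power_divide abs_mult)
    have "\<bar>l t\<bar> \<le> norm (c + A (z t)) * norm w" unfolding l_def by (rule Cauchy_Schwarz_ineq2)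
    also have "\<dots> \<le> (\<sigma> + \<theta> * \<epsilon>) * norm w"
      using affine_le[of "m + z t"] True by (intro mult_right_mono) (auto simp: dist_norm)
    finally have 3: "\<bar>l t\<bar> \<le> (\<sigma> + \<theta> * \<epsilon>) * norm w" .
    have "\<bar>l1\<bar> \<le> norm (A v) * norm w" unfolding l1_def by (rule Cauchy_Schwarz_ineq2)
    also have "\<dots> \<le> \<theta> * norm v * norm w" by (intro mult_right_mono A_le) auto
    finally have 4: "\<bar>l1\<bar> \<le> \<theta> * norm v * norm w" .
    have 5: "(s1 t)\<^sup>2 \<le> (2 / 3 * (norm v / \<epsilon>))\<^sup>2" using power_mono[OF 1 abs_ge_zero, of 2] by simp
    have "\<bar>bump 2 (s t) * (s1 t)\<^sup>2 + bump 1 (s t) * s2\<bar> \<le> \<bar>bump 2 (s t)\<bar> * (s1 t)\<^sup>2 + \<bar>bump 1 (s t)\<bar> * \<bar>s2\<bar>"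
      by (rule order_trans[OF abs_triangle_ineq]) (simp add: abs_mult)
    also have "\<dots> \<le> ?K * (2 / 3 * (norm v / \<epsilon>))\<^sup>2 + ?K * (2 * (norm v / \<epsilon>)\<^sup>2)"
      unfolding 2 using K by (intro add_mono mult_mono bump_bound s0 5) auto
    also have "\<dots> = ?K * (22 / 9 * (norm v / \<epsilon>)\<^sup>2)" unfolding power_mult_distrib by (simp add: power2_eq_square algebra_simps)
    finally have 6: "\<bar>bump 2 (s t) * (s1 t)\<^sup>2 + bump 1 (s t) * s2\<bar> \<le> ?K * (22 / 9 * (norm v / \<epsilon>)\<^sup>2)" .
    have 7: "\<bar>bump 1 (s t) * s1 t * l1\<bar> \<le> ?K * (2 / 3 * (norm v / \<epsilon>)) * (\<theta> * norm v * norm w)"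
      unfolding abs_mult using K \<epsilon> \<theta> by (intro mult_mono bump_bound s0 1 4) auto
    have "\<bar>f2 t\<bar> \<le> \<bar>bump 2 (s t) * (s1 t)\<^sup>2 + bump 1 (s t) * s2\<bar> * \<bar>l t\<bar> + 2 * \<bar>bump 1 (s t) * s1 t * l1\<bar>"
      unfolding f2_def by (rule order_trans[OF abs_triangle_ineq]) (simp add: abs_mult)
    also have "\<dots> \<le> ?K * (22 / 9 * (norm v / \<epsilon>)\<^sup>2) * ((\<sigma> + \<theta> * \<epsilon>) * norm w)
        + 2 * (?K * (2 / 3 * (norm v / \<epsilon>)) * (\<theta> * norm v * norm w))"
      using K \<sigma> \<theta> \<epsilon> by (intro add_mono mult_mono 6 7 3) auto
    \<comment> \<open>22/9 = 4/9 + 2 comes from the two terms that multiply \<open>l t\<close>, and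
      34/9 = 22/9 + 4/3 adds the mixed term. Both are rounded up to 4, and the remainder
      \<open>f2 t / 2\<close> halves this.\<close>
    also have "\<dots> = ?K * (22 / 9 * (\<sigma> / \<epsilon>\<^sup>2) + 34 / 9 * (\<theta> / \<epsilon>)) * (norm v)\<^sup>2 * norm w"
      using \<epsilon> by (simp add: power2_eq_square field_simps)
    also have "\<dots> \<le> ?K * (4 * (\<sigma> / \<epsilon>\<^sup>2 + \<theta> / \<epsilon>)) * (norm v)\<^sup>2 * norm w"
    proof -
      have "0 \<le> \<sigma> / \<epsilon>\<^sup>2" "0 \<le> \<theta> / \<epsilon>" using \<sigma> \<theta> \<epsilon> by auto
      then have "22 / 9 * (\<sigma> / \<epsilon>\<^sup>2) + 34 / 9 * (\<theta> / \<epsilon>) \<le> 4 * (\<sigma> / \<epsilon>\<^sup>2 + \<theta> / \<epsilon>)" by argo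
      then show ?thesis using K by (intro mult_right_mono mult_left_mono) auto
    qed
    finally show ?thesis by (simp add: mult_ac)
  next
    case False
    then have "bump i (s t) = 0" for i
      using bump_field_outside(3)[OF \<epsilon>, of "m + z t" m i] by (simp add: s_def dist_norm)
    then show ?thesis using bump_bound(1) \<sigma> \<theta> \<epsilon> by (simp add: f2_def)
  qed
  have "\<exists>t. 0 < t \<and> t < 1 \<and> f 1 = f 0 + f1 0 * 1 + f2 t / 2 * 1\<^sup>2"
  proof -
    have "\<exists>t. 0 < t \<and> t < 1 \<and> f 1 = (\<Sum>k<2. (if k = 0 then f else if k = 1 then f1 else f2) 0 / fact k * 1 ^ k) + (if (2::nat) = 0 then f else if (2::nat) = 1 then f1 else f2) t / fact 2 * 1 ^ 2"
      by (rule Maclaurin[of 1 2 "\<lambda>k. if k = 0 then f else if k = 1 then f1 else f2"])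
        (auto simp: df df1 less_2_cases_iff)
    then show ?thesis by (simp add: numeral_2_eq_2)
  qed
  then obtain t where t: "f 1 = f 0 + f1 0 + f2 t / 2" by auto
  have e1: "f 1 = inner (bump_field \<epsilon> m c A (x + v)) w" "f 0 = inner (bump_field \<epsilon> m c A x) w"
    by (simp_all add: f_def s_def z_def l_def bump_field_def algebra_simps)
  have e2: "f1 0 = inner (bump_field_deriv \<epsilon> m c A x v) w"
    by (simp add: f1_def s_def s1_def z_def l_def l1_def bump_field_deriv_def inner_add_left)
  have "inner (bump_field \<epsilon> m c A (x + v) - bump_field \<epsilon> m c A x - bump_field_deriv \<epsilon> m c A x v) w = f2 t / 2"
    using t e1 e2 by (simp add: inner_diff_left)
  then show ?thesis using f2[of t] by simp
qed

text \<open>The remainder is tested against itself.\<close>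

lemma bump_field_taylor:
  "norm (bump_field \<epsilon> m c A y - bump_field \<epsilon> m c A x - bump_field_deriv \<epsilon> m c A x (y - x))
     \<le> 2 * bump_bound * (\<sigma> / \<epsilon>\<^sup>2 + \<theta> / \<epsilon>) * (norm (y - x))\<^sup>2"
proof -
  let ?r = "bump_field \<epsilon> m c A y - bump_field \<epsilon> m c A x - bump_field_deriv \<epsilon> m c A x (y - x)"
  let ?B = "2 * bump_bound * (\<sigma> / \<epsilon>\<^sup>2 + \<theta> / \<epsilon>) * (norm (y - x))\<^sup>2"
  have B: "0 \<le> ?B" using bump_bound(1) \<sigma> \<theta> \<epsilon> by simp
  have "\<bar>inner ?r ?r\<bar> \<le> ?B * norm ?r" using bump_field_taylor_inner[of x "y - x" ?r] by simp
  then have "norm ?r * norm ?r \<le> norm ?r * ?B" by (simp add: dot_square_norm power2_eq_square mult.commute)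
  then show ?thesis using B by (cases "?r = 0") (auto simp: mult_le_cancel_left)
qed

lemma Ck_map_bump_field:
  assumes f: "Ck_map k d f U" shows "Ck_map k d (\<lambda>x. bump_field \<epsilon> m c A (f x)) U"
proof -
  have f': "Ck_map k d (\<lambda>x. f x + (- m)) U" by (rule Ck_map_add[OF f Ck_map_const])
  have "Ck_map k d (\<lambda>x. inner (f x + (- m)) (f x + (- m)) * (1 / \<epsilon>\<^sup>2)) U"
    by (rule Ck_map_bilinear[OF bounded_bilinear_mult Ck_map_bilinear[OF bounded_bilinear_inner f' f'] Ck_map_const])
  then have b: "Ck_map k d (\<lambda>x. bump 0 (inner (f x + (- m)) (f x + (- m)) * (1 / \<epsilon>\<^sup>2))) U"
    by (rule Ck_map_compose_real[where G = bump, OF DERIV_bump])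
  have a: "Ck_map k d (\<lambda>x. c + A (f x + (- m))) U"
    by (rule Ck_map_add[OF Ck_map_const Ck_map_linear[OF bounded_linear_A f']])
  show ?thesis
    using Ck_map_bilinear[OF bounded_bilinear_scaleR b a]
    by (simp add: bump_field_def power2_norm_eq_inner)
qed

end

section \<open>Ambient isotopies and manifolds moved by small displacements\<close>

section \<open>Ambient isotopies\<close>

lemma homeomorphic_map_top_of_setI:
  assumes "continuous_on S f" "f ` S = S" "continuous_on S g" "\<And>x. x \<in> S \<Longrightarrow> g (f x) = x"
  shows "homeomorphic_map (top_of_set S) (top_of_set S) f"
proof -
  have "g ` S \<subseteq> S" using assms(2,4) by (metis image_subset_iff imageE)
  moreover have "f (g y) = y" if "y \<in> S" for y using assms(2,4) that by (metis imageE)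
  ultimately have "homeomorphic_maps (top_of_set S) (top_of_set S) f g"
    using assms by (auto simp: homeomorphic_maps_def continuous_map_in_subtopology)
  then show ?thesis using homeomorphic_map_maps by blast
qed

text \<open>The two isotopies run at the same time, as \<open>h2 (t, h1 (t, x))\<close>, instead of
  one after the other; every stage is a composition of homeomorphisms.\<close>

lemma ambient_isotopic_trans:
  assumes "ambient_isotopic D A B" "ambient_isotopic D B C" shows "ambient_isotopic D A C"
proof -
  let ?R = "top_of_set (Rn D)" and ?I = "top_of_set {0..1::real}"
  let ?P = "homeomorphic_map ?R ?R"
  obtain g1 where g1: "homotopic_with ?P ?R ?R (\<lambda>x. x) g1" "g1 ` A = B"
    using assms(1) by (auto simp: ambient_isotopic_def)
  obtain g2 where g2: "homotopic_with ?P ?R ?R (\<lambda>x. x) g2" "g2 ` B = C"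
    using assms(2) by (auto simp: ambient_isotopic_def)
  obtain h1 where h1: "continuous_map (prod_topology ?I ?R) ?R h1" "\<And>x. h1 (0, x) = x" "\<And>x. h1 (1, x) = g1 x"
    "\<And>t. t \<in> {0..1} \<Longrightarrow> ?P (\<lambda>x. h1 (t, x))"
    using g1(1) unfolding homotopic_with_def by auto
  obtain h2 where h2: "continuous_map (prod_topology ?I ?R) ?R h2" "\<And>x. h2 (0, x) = x" "\<And>x. h2 (1, x) = g2 x"
    "\<And>t. t \<in> {0..1} \<Longrightarrow> ?P (\<lambda>x. h2 (t, x))"
    using g2(1) unfolding homotopic_with_def by auto
  define h where "h = (\<lambda>p. h2 (fst p, h1 p))"
  have "continuous_map (prod_topology ?I ?R) (prod_topology ?I ?R) (\<lambda>p. (fst p, h1 p))"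
    by (intro continuous_map_pairedI continuous_map_fst h1(1))
  then have "continuous_map (prod_topology ?I ?R) ?R h"
    unfolding h_def using continuous_map_compose[OF _ h2(1), unfolded o_def] by blast
  moreover have "?P (\<lambda>x. h (t, x))" if "t \<in> {0..1}" for t
    using homeomorphic_map_compose[OF h1(4)[OF that] h2(4)[OF that]] by (simp add: h_def o_def)
  ultimately have "homotopic_with ?P ?R ?R (\<lambda>x. x) (g2 \<circ> g1)"
    unfolding homotopic_with_def using h1(2,3) h2(2,3) by (intro exI[of _ h]) (simp add: h_def)
  moreover have "(g2 \<circ> g1) ` A = C" using g1(2) g2(2) by (metis image_comp)
  ultimately show ?thesis unfolding ambient_isotopic_def by blast
qed

text \<open>Preimages of \<open>y\<close> are the fixed points of the contraction
  \<open>\<lambda>x. y - \<Psi> x\<close>. The whole space is incomplete, so Banach's theorem is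
  applied on \<open>cball y B \<inter> Rn D\<close>, which is compact and, by the bound on \<Psi>,
  invariant.\<close>

lemma contraction_perturbation_homeomorphic:
  fixes \<Psi> :: "fvec \<Rightarrow> fvec"
  assumes lip: "\<And>x y. norm (\<Psi> y - \<Psi> x) \<le> c * norm (y - x)" and c: "0 \<le> c" "c < 1"
    and Rn: "\<And>x. x \<in> Rn D \<Longrightarrow> \<Psi> x \<in> Rn D" and bdd: "\<And>x. norm (\<Psi> x) \<le> B"
  shows "homeomorphic_map (top_of_set (Rn D)) (top_of_set (Rn D)) (\<lambda>x. x + \<Psi> x)"
proof -
  let ?f = "\<lambda>x. x + \<Psi> x"
  have expand: "(1 - c) * norm (y - x) \<le> norm (?f y - ?f x)" for x y
  proof -
    have "norm (y - x) \<le> norm (?f y - ?f x) + norm (\<Psi> y - \<Psi> x)"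
      using norm_triangle_ineq4[of "?f y - ?f x" "\<Psi> y - \<Psi> x"] by simp
    then show ?thesis using lip[of y x] by (simp add: algebra_simps)
  qed
  have inj: "x = y" if "?f x = ?f y" for x y
    using expand[of y x] that c by (simp add: mult_le_0_iff)
  have lipf: "norm (?f y - ?f x) \<le> 2 * norm (y - x)" for x y
  proof -
    have "norm (?f y - ?f x) \<le> norm (y - x) + norm (\<Psi> y - \<Psi> x)"
      using norm_triangle_ineq[of "y - x" "\<Psi> y - \<Psi> x"] by (simp add: algebra_simps)
    also have "\<dots> \<le> norm (y - x) + 1 * norm (y - x)"
      using lip[of y x] mult_right_mono[of c 1 "norm (y - x)"] c by simp
    finally show ?thesis by simp
  qed
  have surj: "\<exists>x\<in>Rn D. ?f x = y" if y: "y \<in> Rn D" for y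
  proof -
    let ?S = "cball y B \<inter> Rn D"
    have B: "0 \<le> B" using order_trans[OF norm_ge_zero bdd[of 0]] .
    have "\<exists>!x. x \<in> ?S \<and> y - \<Psi> x = x"
    proof (rule Banach_fix[OF compact_imp_complete[OF compact_Rn_cball]])
      have "y \<in> ?S" using y B by simp
      then show "?S \<noteq> {}" by blast
      show "(\<lambda>x. y - \<Psi> x) ` ?S \<subseteq> ?S" using bdd y Rn by (auto simp: dist_norm intro!: Rn_diff)
      show "0 \<le> c" "c < 1" by (fact c)+
      fix x z assume "x \<in> ?S" "z \<in> ?S"
      show "dist (y - \<Psi> x) (y - \<Psi> z) \<le> c * dist x z"
        using lip[of z x] by (simp add: dist_norm norm_minus_commute)
    qed
    then obtain x where "x \<in> ?S" "y - \<Psi> x = x" by blast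
    then have "?f x = y" by (metis diff_add_cancel)
    then show ?thesis using \<open>x \<in> ?S\<close> by blast
  qed
  define g where "g y = (SOME x. ?f x = y)" for y
  have gf: "g (?f x) = x" for x unfolding g_def by (rule some_equality) (auto dest: inj)
  have fg: "?f (g y) = y" if "y \<in> Rn D" for y using surj[OF that] gf by metis
  show ?thesis
  proof (rule homeomorphic_map_top_of_setI[of _ _ g])
    show "continuous_on (Rn D) ?f"
      by (rule lipschitz_on_continuous_on[of 2], rule lipschitz_onI) (use lipf in \<open>simp_all add: dist_norm\<close>)
    show "?f ` Rn D = Rn D" using surj Rn by (auto intro: Rn_add)
    show "g (?f x) = x" if "x \<in> Rn D" for x by (rule gf)
    show "continuous_on (Rn D) g"
    proof (rule lipschitz_on_continuous_on[of "1 / (1 - c)"], rule lipschitz_onI)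
      fix x y assume "x \<in> Rn D" "y \<in> Rn D"
      then have "(1 - c) * dist (g x) (g y) \<le> dist x y" using expand[of "g x" "g y"] fg by (simp add: dist_norm)
      then show "dist (g x) (g y) \<le> 1 / (1 - c) * dist x y" using c by (simp add: field_simps)
    qed (use c in simp)
  qed
qed

text \<open>Scaling \<Psi> by \<open>t\<close> in [0, 1] preserves the contraction constant and the
  bound, so the straight homotopy consists of homeomorphisms.\<close>

lemma ambient_isotopic_perturbation:
  fixes \<Psi> :: "fvec \<Rightarrow> fvec"
  assumes lip: "\<And>x y. norm (\<Psi> y - \<Psi> x) \<le> c * norm (y - x)" and c: "0 \<le> c" "c < 1"
    and Rn: "\<And>x. x \<in> Rn D \<Longrightarrow> \<Psi> x \<in> Rn D" and bdd: "\<And>x. norm (\<Psi> x) \<le> B"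
  shows "ambient_isotopic D A ((\<lambda>x. x + \<Psi> x) ` A)"
proof -
  let ?R = "top_of_set (Rn D)"
  let ?h = "\<lambda>p. snd p + fst p *\<^sub>R \<Psi> (snd p)"
  have cont: "continuous_on UNIV \<Psi>"
    by (rule lipschitz_on_continuous_on[of c], rule lipschitz_onI) (use lip c in \<open>simp_all add: dist_norm\<close>)
  have "continuous_on ({0..1} \<times> Rn D) ?h"
    by (intro continuous_intros continuous_on_compose2[OF cont]) auto
  moreover have "?h ` ({0..1} \<times> Rn D) \<subseteq> Rn D" by (auto intro!: Rn_add Rn_scale Rn)
  ultimately have "continuous_map (prod_topology (top_of_set {0..1::real}) ?R) ?R ?h"
    by (simp add: continuous_map_in_subtopology image_subset_iff_funcset)
  moreover have "homeomorphic_map ?R ?R (\<lambda>x. ?h (t, x))" if t: "t \<in> {0..1}" for t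
  proof -
    have "homeomorphic_map ?R ?R (\<lambda>x. x + t *\<^sub>R \<Psi> x)"
    proof (rule contraction_perturbation_homeomorphic[of "\<lambda>x. t *\<^sub>R \<Psi> x" c D B])
      show "norm (t *\<^sub>R \<Psi> y - t *\<^sub>R \<Psi> x) \<le> c * norm (y - x)" for x y
      proof -
        have "norm (t *\<^sub>R \<Psi> y - t *\<^sub>R \<Psi> x) = t * norm (\<Psi> y - \<Psi> x)"
          using t by (simp add: scaleR_diff_right[symmetric])
        also have "\<dots> \<le> 1 * norm (\<Psi> y - \<Psi> x)" using t by (intro mult_right_mono) auto
        finally show ?thesis using lip[of y x] by simp
      qed
      show "norm (t *\<^sub>R \<Psi> x) \<le> B" for x
        using bdd[of x] mult_right_mono[of t 1 "norm (\<Psi> x)"] t by simp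
    qed (use c Rn Rn_scale in auto)
    then show ?thesis by simp
  qed
  ultimately have "homotopic_with (homeomorphic_map ?R ?R) ?R ?R (\<lambda>x. x) (\<lambda>x. x + \<Psi> x)"
    unfolding homotopic_with_def by (intro exI[of _ ?h]) simp
  then show ?thesis unfolding ambient_isotopic_def by blast
qed


section \<open>Perturbed manifolds\<close>

locale perturbation = reach_manifold +
  fixes \<Psi> :: "fvec \<Rightarrow> fvec" and \<Psi>' :: "fvec \<Rightarrow> fvec \<Rightarrow> fvec" and B :: real
  assumes der: "\<And>x. (\<Psi> has_derivative \<Psi>' x) (at x)"
    and maps_Rn: "\<And>x. x \<in> Rn D \<Longrightarrow> \<Psi> x \<in> Rn D"
    and lip: "\<And>x y. norm (\<Psi> y - \<Psi> x) \<le> 1 / 10 * norm (y - x)"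
    and der_le: "\<And>x v. norm (\<Psi>' x v) \<le> 1 / 10 * norm v"
    and taylor: "\<And>x y. norm (\<Psi> y - \<Psi> x - \<Psi>' x (y - x)) \<le> (norm (y - x))\<^sup>2 / \<rho>"
    and bdd: "\<And>x. norm (\<Psi> x) \<le> B"
    and smooth: "\<And>j f U. Ck_map j d f U \<Longrightarrow> Ck_map j d (\<lambda>x. \<Psi> (f x)) U"
begin

definition \<Phi> :: "fvec \<Rightarrow> fvec" where "\<Phi> x = x + \<Psi> x"
definition \<Phi>' :: "fvec \<Rightarrow> fvec \<Rightarrow> fvec" where "\<Phi>' x v = v + \<Psi>' x v"

lemma has_derivative_\<Phi>: "(\<Phi> has_derivative \<Phi>' x) (at x within S)"
  unfolding \<Phi>_def[abs_def] \<Phi>'_def[abs_def]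
  by (intro has_derivative_add has_derivative_ident has_derivative_at_withinI[OF der])

lemma continuous_\<Phi>: "continuous_on S \<Phi>"
  using has_derivative_\<Phi> has_derivative_continuous_on by blast

lemma \<Phi>_expand: "9 / 10 * norm (y - x) \<le> norm (\<Phi> y - \<Phi> x)"
proof -
  have "norm (y - x) \<le> norm (\<Phi> y - \<Phi> x) + norm (\<Psi> y - \<Psi> x)"
    using norm_triangle_ineq4[of "\<Phi> y - \<Phi> x" "\<Psi> y - \<Psi> x"] by (simp add: \<Phi>_def)
  then show ?thesis using lip[of y x] by simp
qed

lemma inj_\<Phi>: "inj \<Phi>"
proof (rule injI)
  fix x y assume "\<Phi> x = \<Phi> y"
  then show "x = y" using \<Phi>_expand[of y x] by simp
qed

lemma linear_\<Phi>': "linear (\<Phi>' x)"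
  by (rule has_derivative_linear[OF has_derivative_\<Phi>[of x UNIV]])

lemma \<Phi>'_expand: "9 / 10 * norm v \<le> norm (\<Phi>' x v)"
  using norm_triangle_ineq4[of "\<Phi>' x v" "\<Psi>' x v"] der_le[of x v] by (simp add: \<Phi>'_def)

lemma ex_homeomorphism_\<Phi>: "\<exists>g. homeomorphism M (\<Phi> ` M) \<Phi> g"
  by (rule homeomorphism_compact[OF compact continuous_\<Phi> refl]) (rule inj_on_subset[OF inj_\<Phi>], simp)

lemma submanifold_image: "submanifold k D d (\<Phi> ` M)"
  unfolding submanifold_def
proof (intro conjI ballI)
  show "\<Phi> ` M \<subseteq> Rn D" using in_Rn maps_Rn by (auto simp: \<Phi>_def intro: Rn_add)
  obtain g where g: "homeomorphism M (\<Phi> ` M) \<Phi> g" using ex_homeomorphism_\<Phi> by blast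
  fix q assume "q \<in> \<Phi> ` M"
  then obtain p where p: "p \<in> M" "q = \<Phi> p" by blast
  obtain U \<phi> \<psi> where U: "openin (top_of_set (Rn d)) U" "p \<in> \<phi> ` U" "openin (top_of_set M) (\<phi> ` U)"
    "homeomorphism U (\<phi> ` U) \<phi> \<psi>" "\<And>j. enat j \<le> k \<Longrightarrow> Ck_on j d \<phi> U"
    "\<And>x. x \<in> U \<Longrightarrow> \<exists>A. (\<phi> has_derivative A) (at x within U) \<and> inj_on A (Rn d)"
    using submfd p(1) unfolding submanifold_def by metis
  have UM: "\<phi> ` U \<subseteq> M" using U(3) openin_imp_subset by blast
  show "\<exists>U \<phi> \<psi>. openin (top_of_set (Rn d)) U \<and> q \<in> \<phi> ` U \<and> openin (top_of_set (\<Phi> ` M)) (\<phi> ` U) \<and>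
        homeomorphism U (\<phi> ` U) \<phi> \<psi> \<and> (\<forall>j. enat j \<le> k \<longrightarrow> Ck_on j d \<phi> U) \<and>
        (\<forall>x\<in>U. \<exists>A. (\<phi> has_derivative A) (at x within U) \<and> inj_on A (Rn d))"
  proof (rule exI[of _ U], rule exI[of _ "\<lambda>x. \<Phi> (\<phi> x)"], rule exI[of _ "\<psi> \<circ> g"], intro conjI allI impI ballI)
    have im: "(\<lambda>x. \<Phi> (\<phi> x)) ` U = \<Phi> ` (\<phi> ` U)" by blast
    show "openin (top_of_set (Rn d)) U" by (rule U(1))
    show "q \<in> (\<lambda>x. \<Phi> (\<phi> x)) ` U" using p(2) U(2) by blast
    show "openin (top_of_set (\<Phi> ` M)) ((\<lambda>x. \<Phi> (\<phi> x)) ` U)"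
      unfolding im by (rule homeomorphism_imp_open_map[OF g U(3)])
    have "homeomorphism (\<phi> ` U) (\<Phi> ` (\<phi> ` U)) \<Phi> g"
      by (rule homeomorphism_of_subsets[OF g UM image_mono[OF UM] refl])
    from homeomorphism_compose[OF U(4) this]
    show "homeomorphism U ((\<lambda>x. \<Phi> (\<phi> x)) ` U) (\<lambda>x. \<Phi> (\<phi> x)) (\<psi> \<circ> g)"
      unfolding im by (simp add: o_def)
    show "Ck_on j d (\<lambda>x. \<Phi> (\<phi> x)) U" if "enat j \<le> k" for j
      using U(5)[OF that] unfolding Ck_on_eq_Ck_map \<Phi>_def by (intro Ck_map_add smooth)
    fix x assume x: "x \<in> U"
    obtain A where A: "(\<phi> has_derivative A) (at x within U)" "inj_on A (Rn d)" using U(6)[OF x] by blast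
    have "((\<lambda>x. \<Phi> (\<phi> x)) has_derivative (\<lambda>v. \<Phi>' (\<phi> x) (A v))) (at x within U)"
      by (rule has_derivative_compose[OF A(1) has_derivative_\<Phi>])
    moreover have "inj_on (\<lambda>v. \<Phi>' (\<phi> x) (A v)) (Rn d)"
    proof (rule inj_onI)
      fix v w assume vw: "v \<in> Rn d" "w \<in> Rn d" "\<Phi>' (\<phi> x) (A v) = \<Phi>' (\<phi> x) (A w)"
      have "A v = A w"
        using \<Phi>'_expand[of "A v - A w" "\<phi> x"] vw(3) by (simp add: linear_diff[OF linear_\<Phi>'])
      then show "v = w" using A(2) vw by (auto dest: inj_onD)
    qed
    ultimately show "\<exists>A. ((\<lambda>x. \<Phi> (\<phi> x)) has_derivative A) (at x within U) \<and> inj_on A (Rn d)" by blast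
  qed
qed

text \<open>Pushing curves forward gives one inclusion, and equality of dimensions the
  other.\<close>

lemma tangent_space_image:
  assumes a: "a \<in> M" shows "tangent_space (\<Phi> ` M) (\<Phi> a) = \<Phi>' a ` T a"
proof -
  have sub: "\<Phi>' a ` T a \<subseteq> tangent_space (\<Phi> ` M) (\<Phi> a)"
  proof
    fix w assume "w \<in> \<Phi>' a ` T a"
    then obtain v where v: "v \<in> T a" "w = \<Phi>' a v" by blast
    then obtain \<gamma> :: "real \<Rightarrow> fvec" where \<gamma>: "\<And>t. t \<in> {-1<..<1} \<Longrightarrow> \<gamma> t \<in> M" "\<gamma> 0 = a"
      "(\<gamma> has_vector_derivative v) (at 0)"
      unfolding tangent_space_def mem_Collect_eq by metis
    have "((\<lambda>t. \<Phi> (\<gamma> t)) has_derivative (\<lambda>t. \<Phi>' a (t *\<^sub>R v))) (at 0)"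
      using has_derivative_compose[of \<gamma> "\<lambda>t. t *\<^sub>R v" 0 UNIV \<Phi> "\<Phi>' a"] \<gamma>(2,3) has_derivative_\<Phi>[of a UNIV]
      by (simp add: has_vector_derivative_def)
    then have "((\<lambda>t. \<Phi> (\<gamma> t)) has_vector_derivative w) (at 0)"
      using v(2) by (simp add: has_vector_derivative_def linear_scale[OF linear_\<Phi>'])
    then show "w \<in> tangent_space (\<Phi> ` M) (\<Phi> a)"
      unfolding tangent_space_def using \<gamma> by (intro CollectI exI[of _ "\<lambda>t. \<Phi> (\<gamma> t)"]) auto
  qed
  have fs: "fin_subspace (tangent_space (\<Phi> ` M) (\<Phi> a))" "dim (tangent_space (\<Phi> ` M) (\<Phi> a)) = d"
    using submanifold_tangent[OF submanifold_image k] a by auto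
  obtain C where C: "onb C (T a)" using fin_subspace_onb[OF T_fin[OF a]] .
  have inj: "inj_on (\<Phi>' a) (T a)"
  proof (rule linear_inj_onI[OF linear_\<Phi>' fin_subspace_imp_subspace[OF T_fin[OF a]]])
    fix x assume "\<Phi>' a x = 0"
    then show "x = 0" using \<Phi>'_expand[of x a] by simp
  qed
  have "\<Phi>' a ` T a = tangent_space (\<Phi> ` M) (\<Phi> a)"
    by (rule linear_inj_eq_dim_onto[OF T_fin[OF a] fs(1) linear_\<Phi>' inj sub]) (simp add: fs(2) T_dim[OF a])
  then show ?thesis by simp
qed

text \<open>Compare \<open>\<Phi> b - \<Phi> a\<close> with the tangent vector
  \<open>\<Phi>' a (P a (b - a))\<close>: the difference consists of the normal part for
  \<open>M\<close>, the second-order remainder of \<Psi>, and the derivative of \<Psi> applied to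
  the normal part.\<close>

lemma normal_part_image:
  assumes a: "a \<in> M" and b: "b \<in> M"
  shows "norm ((\<Phi> b - \<Phi> a) - oproj (tangent_space (\<Phi> ` M) (\<Phi> a)) (\<Phi> b - \<Phi> a)) \<le> (norm (\<Phi> b - \<Phi> a))\<^sup>2 / (2 * (\<rho> / 4))"
proof -
  let ?T' = "tangent_space (\<Phi> ` M) (\<Phi> a)"
  have fs: "fin_subspace ?T'" using submanifold_tangent[OF submanifold_image k] a by auto
  let ?v = "b - a"
  let ?n = "norm ?v"
  have l: "linear (\<Psi>' a)" by (rule has_derivative_linear[OF der])
  have "\<Phi>' a (P a ?v) \<in> ?T'" unfolding tangent_space_image[OF a] using oproj_in[OF T_fin[OF a]] by blast
  then have "norm ((\<Phi> b - \<Phi> a) - oproj ?T' (\<Phi> b - \<Phi> a)) \<le> norm ((\<Phi> b - \<Phi> a) - \<Phi>' a (P a ?v))"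
    by (rule norm_minus_oproj_min[OF fs])
  also have "(\<Phi> b - \<Phi> a) - \<Phi>' a (P a ?v) = (?v - P a ?v) + (\<Psi> b - \<Psi> a - \<Psi>' a ?v) + \<Psi>' a (?v - P a ?v)"
    by (simp add: \<Phi>_def \<Phi>'_def linear_diff[OF l])
  also have "norm \<dots> \<le> norm (?v - P a ?v) + norm (\<Psi> b - \<Psi> a - \<Psi>' a ?v) + norm (\<Psi>' a (?v - P a ?v))"
    by (intro order_trans[OF norm_triangle_ineq] add_mono norm_triangle_ineq order_refl)
  also have "\<dots> \<le> ?n\<^sup>2 / (2 * \<rho>) + ?n\<^sup>2 / \<rho> + 1 / 10 * (?n\<^sup>2 / (2 * \<rho>))"
    using normal_part[OF a b] taylor[of b a] order_trans[OF der_le mult_left_mono[OF normal_part[OF a b]]]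
    by (intro add_mono) auto
  also have "\<dots> = 31 / 20 * (?n\<^sup>2 / \<rho>)" by (simp add: field_simps)
  \<comment> \<open>The reach \<rho>/4 comes from here: 31/20 is at most 2 (9/10)^2.\<close>
  also have "\<dots> \<le> 2 * ((norm (\<Phi> b - \<Phi> a))\<^sup>2 / \<rho>)"
  proof -
    have "(9 / 10 * ?n)\<^sup>2 \<le> (norm (\<Phi> b - \<Phi> a))\<^sup>2" by (intro power_mono \<Phi>_expand) auto
    then have "81 / 100 * ?n\<^sup>2 \<le> (norm (\<Phi> b - \<Phi> a))\<^sup>2"
      unfolding power_mult_distrib by (simp add: power2_eq_square)
    then have "31 / 20 * ?n\<^sup>2 \<le> 2 * (norm (\<Phi> b - \<Phi> a))\<^sup>2" using zero_le_power2[of ?n] by linarith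
    then have "31 / 20 * ?n\<^sup>2 / \<rho> \<le> 2 * (norm (\<Phi> b - \<Phi> a))\<^sup>2 / \<rho>" using \<rho> by (intro divide_right_mono) auto
    then show ?thesis by simp
  qed
  also have "\<dots> = (norm (\<Phi> b - \<Phi> a))\<^sup>2 / (2 * (\<rho> / 4))" by simp
  finally show ?thesis .
qed

lemma image_class: "\<Phi> ` M \<in> manifold_class k D d (\<rho> / 4)"
  unfolding manifold_class_def
proof (intro CollectI conjI)
  show "submanifold k D d (\<Phi> ` M)" by (rule submanifold_image)
  show "\<Phi> ` M \<noteq> {}" using nonempty by simp
  show "compact (\<Phi> ` M)" by (intro compact_continuous_image continuous_\<Phi> compact)
  show "connected (\<Phi> ` M)" by (intro connected_continuous_image continuous_\<Phi> connected)
  show "ereal (\<rho> / 4) \<le> reach D (\<Phi> ` M)"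
  proof (rule reach_geI[of _ _ "tangent_space (\<Phi> ` M)"])
    show "0 < \<rho> / 4" using \<rho> by simp
    show "fin_subspace (tangent_space (\<Phi> ` M) a)" if "a \<in> \<Phi> ` M" for a
      by (rule submanifold_tangent[OF submanifold_image k that])
    show "norm (b - a - oproj (tangent_space (\<Phi> ` M) a) (b - a)) \<le> (norm (b - a))\<^sup>2 / (2 * (\<rho> / 4))"
      if "a \<in> \<Phi> ` M" "b \<in> \<Phi> ` M" for a b
      using that normal_part_image by blast
  qed simp
qed

lemma isotopic_image: "ambient_isotopic D M (\<Phi> ` M)"
  using ambient_isotopic_perturbation[OF lip _ _ maps_Rn bdd, of M] by (simp add: \<Phi>_def[abs_def])

end


section \<open>Superposition of bumps with disjoint supports\<close>

locale bump_family =
  fixes I :: "'i set" and \<epsilon> \<sigma> \<theta> :: real and m c :: "'i \<Rightarrow> fvec" and A :: "'i \<Rightarrow> fvec \<Rightarrow> fvec"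
  assumes finite_I: "finite I" and data: "\<And>i. i \<in> I \<Longrightarrow> bump_data \<epsilon> \<sigma> \<theta> (c i) (A i)"
    and \<epsilon>: "0 < \<epsilon>" and \<sigma>: "0 \<le> \<sigma>" and \<theta>: "0 \<le> \<theta>"
    and separated: "\<And>i j. i \<in> I \<Longrightarrow> j \<in> I \<Longrightarrow> i \<noteq> j \<Longrightarrow> 2 * \<epsilon> / 3 \<le> dist (m i) (m j)"
begin

definition disp :: "fvec \<Rightarrow> fvec" where
  "disp x = (\<Sum>i\<in>I. bump_field \<epsilon> (m i) (c i) (A i) x)"

definition disp_deriv :: "fvec \<Rightarrow> fvec \<Rightarrow> fvec" where
  "disp_deriv x v = (\<Sum>i\<in>I. bump_field_deriv \<epsilon> (m i) (c i) (A i) x v)"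

lemma has_derivative_disp: "(disp has_derivative disp_deriv x) (at x)"
  unfolding disp_def[abs_def] disp_deriv_def[abs_def]
  by (rule has_derivative_sum[OF bump_data.has_derivative_bump_field[OF data]])

lemma active_card: "card {i \<in> I. dist x (m i) < \<epsilon> / 3} \<le> 1"
proof -
  have "i = j" if "i \<in> I" "dist x (m i) < \<epsilon> / 3" "j \<in> I" "dist x (m j) < \<epsilon> / 3" for i j
  proof (rule ccontr)
    assume "i \<noteq> j"
    then have "2 * \<epsilon> / 3 \<le> dist (m i) (m j)" using separated that by blast
    moreover have "dist (m i) (m j) < 2 * \<epsilon> / 3" using dist_triangle3[of "m i" "m j" x] that by simp
    ultimately show False by simp
  qed
  then show ?thesis using finite_I by (subst card_le_Suc0_iff_eq[unfolded One_nat_def[symmetric]]) auto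
qed

text \<open>At each of \<open>x\<close> and \<open>y\<close> at most one bump is active, so at most
  two summands survive and the bound is independent of the number of points.\<close>

lemma norm_sum_active:
  fixes g :: "'i \<Rightarrow> 'b::real_normed_vector"
  assumes "\<And>i. i \<in> I \<Longrightarrow> \<epsilon> / 3 \<le> dist x (m i) \<Longrightarrow> \<epsilon> / 3 \<le> dist y (m i) \<Longrightarrow> g i = 0"
    and "\<And>i. i \<in> I \<Longrightarrow> norm (g i) \<le> B" and "0 \<le> B"
  shows "norm (\<Sum>i\<in>I. g i) \<le> 2 * B"
proof -
  let ?X = "{i \<in> I. dist x (m i) < \<epsilon> / 3}" and ?Y = "{i \<in> I. dist y (m i) < \<epsilon> / 3}"
  have "(\<Sum>i\<in>I. g i) = (\<Sum>i\<in>?X \<union> ?Y. g i)"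
    using finite_I assms(1) by (intro sum.mono_neutral_right) (auto simp: not_less)
  also have "norm \<dots> \<le> (\<Sum>i\<in>?X \<union> ?Y. B)" using assms(2) by (intro sum_norm_le) auto
  also have "\<dots> = real (card (?X \<union> ?Y)) * B" by simp
  also have "\<dots> \<le> 2 * B"
  proof -
    have "card (?X \<union> ?Y) \<le> card ?X + card ?Y" by (rule card_Un_le)
    then have "card (?X \<union> ?Y) \<le> 2" using active_card[of x] active_card[of y] by linarith
    then have "real (card (?X \<union> ?Y)) \<le> 2" by simp
    then show ?thesis using assms(3) by (intro mult_right_mono) auto
  qed
  finally show ?thesis .
qed

lemma norm_disp: "norm (disp x) \<le> 2 * bump_bound * (\<sigma> + \<theta> * \<epsilon>)"
proof -
  have "norm (disp x) \<le> 2 * (bump_bound * (\<sigma> + \<theta> * \<epsilon>))"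
    unfolding disp_def
    by (rule norm_sum_active[of x x])
      (use bump_field_outside(1)[OF \<epsilon>] bump_data.norm_bump_field[OF data] bump_bound(1) \<sigma> \<theta> \<epsilon> in auto)
  then show ?thesis by simp
qed

lemma norm_disp_deriv: "norm (disp_deriv x v) \<le> 4 * bump_bound * (\<sigma> / \<epsilon> + \<theta>) * norm v"
proof -
  have "norm (disp_deriv x v) \<le> 2 * (2 * bump_bound * (\<sigma> / \<epsilon> + \<theta>) * norm v)"
    unfolding disp_deriv_def
    by (rule norm_sum_active[of x x])
      (use bump_field_outside(2)[OF \<epsilon>] bump_data.norm_bump_field_deriv[OF data] bump_bound(1) \<sigma> \<theta> \<epsilon> in auto)
  then show ?thesis by simp
qed

lemma disp_lipschitz: "norm (disp y - disp x) \<le> 4 * bump_bound * (\<sigma> / \<epsilon> + \<theta>) * norm (y - x)"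
proof -
  have "norm (disp y - disp x) \<le> 2 * (2 * bump_bound * (\<sigma> / \<epsilon> + \<theta>) * norm (y - x))"
    unfolding disp_def sum_subtractf[symmetric]
    by (rule norm_sum_active[of x y])
      (use bump_field_outside(1)[OF \<epsilon>] bump_data.bump_field_lipschitz[OF data] bump_bound(1) \<sigma> \<theta> \<epsilon> in auto)
  then show ?thesis by simp
qed

lemma disp_taylor:
  "norm (disp y - disp x - disp_deriv x (y - x)) \<le> 4 * bump_bound * (\<sigma> / \<epsilon>\<^sup>2 + \<theta> / \<epsilon>) * (norm (y - x))\<^sup>2"
proof -
  have "norm (disp y - disp x - disp_deriv x (y - x)) \<le> 2 * (2 * bump_bound * (\<sigma> / \<epsilon>\<^sup>2 + \<theta> / \<epsilon>) * (norm (y - x))\<^sup>2)"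
    unfolding disp_def disp_deriv_def sum_subtractf[symmetric]
    by (rule norm_sum_active[of x y])
      (use bump_field_outside(1,2)[OF \<epsilon>] bump_data.bump_field_taylor[OF data] bump_bound(1) \<sigma> \<theta> \<epsilon> in auto)
  then show ?thesis by simp
qed

lemma Ck_map_disp: "Ck_map k d f U \<Longrightarrow> Ck_map k d (\<lambda>x. disp (f x)) U"
  unfolding disp_def by (rule Ck_map_sum[OF bump_data.Ck_map_bump_field[OF data]])

text \<open>Each centre lies outside the other supports, so values and derivatives are interpolated
  exactly.\<close>

lemma disp_center:
  assumes i: "i \<in> I" shows "disp (m i) = c i" "disp_deriv (m i) v = A i v"
proof -
  have far: "\<epsilon> / 3 \<le> dist (m i) (m j)" if "j \<in> I - {i}" for j
    using separated[OF i, of j] that \<epsilon> by auto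
  have A0: "A i 0 = 0" using bump_data.A[OF data[OF i]] linear_0 by blast
  have "disp (m i) = bump_field \<epsilon> (m i) (c i) (A i) (m i)"
    unfolding disp_def using bump_field_outside(1)[OF \<epsilon> far]
    by (subst sum.remove[OF finite_I i]) (simp add: sum.neutral)
  then show "disp (m i) = c i" by (simp add: bump_field_def A0)
  have "disp_deriv (m i) v = bump_field_deriv \<epsilon> (m i) (c i) (A i) (m i) v"
    unfolding disp_deriv_def using bump_field_outside(2)[OF \<epsilon> far]
    by (subst sum.remove[OF finite_I i]) (simp add: sum.neutral)
  then show "disp_deriv (m i) v = A i v" by (simp add: bump_field_deriv_def)
qed

lemma disp_in_Rn:
  assumes "\<And>i. i \<in> I \<Longrightarrow> m i \<in> Rn D" "\<And>i. i \<in> I \<Longrightarrow> c i \<in> Rn D"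
    "\<And>i v. i \<in> I \<Longrightarrow> v \<in> Rn D \<Longrightarrow> A i v \<in> Rn D" and x: "x \<in> Rn D"
  shows "disp x \<in> Rn D"
  unfolding disp_def bump_field_def
  using assms by (intro subspace_sum[OF subspace_Rn] Rn_scale Rn_add assms(2,3) Rn_diff) auto

end

section \<open>Probability: counts in balls and typical samples\<close>

section \<open>Concentration of empirical counts\<close>

text \<open>The moment generating function of a binomial count: the exponential is a product over
  the coordinates, which integrates factor by factor.\<close>

lemma nn_integral_exp_count:
  fixes Q :: "'a measure" and t :: real
  assumes Q: "prob_space Q" and I: "finite I" and B [measurable]: "B \<in> sets Q"
  shows "(\<integral>\<^sup>+x. ennreal (exp (t * real (card {i \<in> I. x i \<in> B}))) \<partial>PiM I (\<lambda>_. Q))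
    = ennreal ((1 + measure Q B * (exp t - 1)) ^ card I)"
proof -
  interpret Q: prob_space Q by (rule Q)
  interpret PQ: product_prob_space "\<lambda>_. Q" I by unfold_locales
  let ?f = "\<lambda>y. ennreal (if y \<in> B then exp t else 1)"
  have e: "ennreal (exp (t * real (card {i \<in> I. x i \<in> B}))) = (\<Prod>i\<in>I. ?f (x i))" for x
  proof -
    have "exp (t * real (card {i \<in> I. x i \<in> B})) = (\<Prod>i\<in>{i \<in> I. x i \<in> B}. exp t)"
      by (simp add: exp_of_nat_mult[symmetric] mult.commute)
    also have "\<dots> = (\<Prod>i\<in>I. if x i \<in> B then exp t else 1)"
      using I by (simp add: prod.If_cases Int_def)
    finally show ?thesis by (simp add: prod_ennreal)
  qed
  have "(\<integral>\<^sup>+y. ?f y \<partial>Q) = (\<integral>\<^sup>+y. ennreal (exp t) * indicator B y + indicator (space Q - B) y \<partial>Q)"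
    by (intro nn_integral_cong) (auto simp: indicator_def)
  also have "\<dots> = ennreal (exp t) * emeasure Q B + emeasure Q (space Q - B)"
    by (subst nn_integral_add) (auto simp: nn_integral_cmult_indicator)
  also have "\<dots> = ennreal (exp t * measure Q B + (1 - measure Q B))"
    by (simp add: Q.emeasure_eq_measure Q.prob_compl ennreal_mult ennreal_plus)
  also have "exp t * measure Q B + (1 - measure Q B) = 1 + measure Q B * (exp t - 1)" by (simp add: algebra_simps)
  finally have i: "(\<integral>\<^sup>+y. ?f y \<partial>Q) = ennreal (1 + measure Q B * (exp t - 1))" .
  have nn: "0 \<le> 1 + measure Q B * (exp t - 1)"
  proof -
    have "0 \<le> exp t * measure Q B + (1 - measure Q B)" using Q.prob_le_1[of B] by (intro add_nonneg_nonneg) auto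
    then show ?thesis by (simp add: algebra_simps)
  qed
  show ?thesis
    unfolding e using I
    by (subst PQ.product_nn_integral_prod) (auto simp: i ennreal_power[OF nn] prod_constant)
qed

context
  fixes Q :: "'a measure" and I :: "'i set" and B :: "'a set"
  assumes Q: "prob_space Q" and I: "finite I" and B [measurable]: "B \<in> sets Q"
begin

lemma count_measurable [measurable]: "(\<lambda>x. real (card {i \<in> I. x i \<in> B})) \<in> borel_measurable (PiM I (\<lambda>_. Q))"
proof -
  have "real (card {i \<in> I. x i \<in> B}) = (\<Sum>i\<in>I. indicator B (x i))" for x
    using I by (simp add: indicator_def sum.If_cases Int_def)
  then show ?thesis by (simp only:) (intro borel_measurable_sum, measurable)
qed

text \<open>Chernoff's bound with parameter 1. For n = \<open>card I\<close> the moment factor is at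
  most exp(2 n p), because e - 1 \<le> 2.\<close>

lemma prob_count_large:
  assumes p: "measure Q B \<le> p"
  shows "measure (PiM I (\<lambda>_. Q)) {x \<in> space (PiM I (\<lambda>_. Q)). 4 * real (card I) * p \<le> real (card {i \<in> I. x i \<in> B})}
    \<le> exp (- (2 * real (card I) * p))"
proof -
  let ?N = "PiM I (\<lambda>_. Q)" and ?S = "\<lambda>x. real (card {i \<in> I. x i \<in> B})" and ?n = "real (card I)"
  interpret prob_space ?N by (rule prob_space_PiM[OF Q])
  have "emeasure ?N {x \<in> space ?N. 4 * ?n * p \<le> ?S x}
      \<le> ennreal (exp (- 1 * (4 * ?n * p))) * (\<integral>\<^sup>+x. ennreal (exp (1 * ?S x)) * indicator (space ?N) x \<partial>?N)"
    by (rule Chernoff_ineq_nn_integral_ge) auto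
  also have "(\<integral>\<^sup>+x. ennreal (exp (1 * ?S x)) * indicator (space ?N) x \<partial>?N) = (\<integral>\<^sup>+x. ennreal (exp (1 * ?S x)) \<partial>?N)"
    by (intro nn_integral_cong) simp
  also have "\<dots> = ennreal ((1 + measure Q B * (exp 1 - 1)) ^ card I)"
    by (rule nn_integral_exp_count[OF Q I B])
  also have "\<dots> \<le> ennreal (exp (2 * ?n * p))"
  proof (rule ennreal_leI)
    have "exp 1 - 1 \<le> (2::real)" using exp_le by simp
    then have "measure Q B * (exp 1 - 1) \<le> p * 2" using p by (intro mult_mono) (auto intro: order_trans[OF measure_nonneg p])
    then have "1 + measure Q B * (exp 1 - 1) \<le> exp (2 * p)" using exp_ge_add_one_self[of "2 * p"] by linarith
    then have "(1 + measure Q B * (exp 1 - 1)) ^ card I \<le> exp (2 * p) ^ card I"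
      by (intro power_mono) auto
    also have "\<dots> = exp (2 * ?n * p)" by (simp add: exp_of_nat_mult[symmetric] mult_ac)
    finally show "(1 + measure Q B * (exp 1 - 1)) ^ card I \<le> exp (2 * ?n * p)" .
  qed
  finally have "emeasure ?N {x \<in> space ?N. 4 * ?n * p \<le> ?S x} \<le> ennreal (exp (- 1 * (4 * ?n * p))) * ennreal (exp (2 * ?n * p))"
    by (simp add: mult_left_mono)
  also have "\<dots> = ennreal (exp (- (2 * ?n * p)))"
    by (simp add: ennreal_mult[symmetric] exp_add[symmetric])
  finally show ?thesis by (simp add: emeasure_eq_measure)
qed

text \<open>Chernoff's bound with parameter -1. Since 1 - exp(-1) \<ge> 1/2, the moment factor is at
  most exp(-n p / 2) for n = \<open>card I\<close>.\<close>

lemma prob_count_small: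
  assumes p: "p \<le> measure Q B"
  shows "measure (PiM I (\<lambda>_. Q)) {x \<in> space (PiM I (\<lambda>_. Q)). real (card {i \<in> I. x i \<in> B}) \<le> real (card I) * p / 4}
    \<le> exp (- (real (card I) * p / 4))"
proof -
  let ?N = "PiM I (\<lambda>_. Q)" and ?S = "\<lambda>x. real (card {i \<in> I. x i \<in> B})" and ?n = "real (card I)"
  interpret prob_space ?N by (rule prob_space_PiM[OF Q])
  have "emeasure ?N {x \<in> space ?N. ?S x \<le> ?n * p / 4}
      \<le> ennreal (exp (1 * (?n * p / 4))) * (\<integral>\<^sup>+x. ennreal (exp (- 1 * ?S x)) * indicator (space ?N) x \<partial>?N)"
    by (rule Chernoff_ineq_nn_integral_le) auto
  also have "(\<integral>\<^sup>+x. ennreal (exp (- 1 * ?S x)) * indicator (space ?N) x \<partial>?N) = (\<integral>\<^sup>+x. ennreal (exp (- 1 * ?S x)) \<partial>?N)"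
    by (intro nn_integral_cong) simp
  also have "\<dots> = ennreal ((1 + measure Q B * (exp (- 1) - 1)) ^ card I)"
    by (rule nn_integral_exp_count[OF Q I B])
  also have "\<dots> \<le> ennreal (exp (- (?n * p / 2)))"
  proof (rule ennreal_leI)
    have "2 \<le> exp (1::real)" using exp_ge_add_one_self[of 1] by simp
    then have e: "exp (- 1) \<le> (1 / 2 :: real)" by (simp add: exp_minus field_simps)
    have "measure Q B * (exp (- 1) - 1) \<le> measure Q B * (- (1 / 2))" using e by (intro mult_left_mono) auto
    then have "1 + measure Q B * (exp (- 1) - 1) \<le> exp (- (p / 2))" using exp_ge_add_one_self[of "- (p / 2)"] p by simp
    moreover have "0 \<le> 1 + measure Q B * (exp (- 1) - 1)"
    proof -
      have "measure Q B * (1 - exp (- 1)) \<le> 1 * 1"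
        using prob_space.prob_le_1[OF Q, of B] by (intro mult_mono) auto
      then show ?thesis by (simp add: right_diff_distrib)
    qed
    ultimately have "(1 + measure Q B * (exp (- 1) - 1)) ^ card I \<le> exp (- (p / 2)) ^ card I"
      by (intro power_mono) auto
    also have "\<dots> = exp (- (?n * p / 2))" by (simp add: exp_of_nat_mult[symmetric] mult_ac)
    finally show "(1 + measure Q B * (exp (- 1) - 1)) ^ card I \<le> exp (- (?n * p / 2))" .
  qed
  finally have "emeasure ?N {x \<in> space ?N. ?S x \<le> ?n * p / 4} \<le> ennreal (exp (1 * (?n * p / 4))) * ennreal (exp (- (?n * p / 2)))"
    by (simp add: mult_left_mono)
  also have "\<dots> = ennreal (exp (- (?n * p / 4)))"
    by (simp add: ennreal_mult[symmetric] exp_add[symmetric])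
  finally show ?thesis by (simp add: emeasure_eq_measure)
qed

end


section \<open>Typical samples\<close>

definition typical_sample ::
  "nat \<Rightarrow> fvec set \<Rightarrow> nat \<Rightarrow> real \<Rightarrow> real \<Rightarrow> real \<Rightarrow> real \<Rightarrow> (nat \<Rightarrow> fvec) \<Rightarrow> bool" where
  "typical_sample D M n \<sigma> h cl cu x \<longleftrightarrow>
     (\<forall>i\<in>{1..n}. x i \<in> Rn D \<and> infdist (x i) M \<le> \<sigma>) \<and>
     (\<forall>a\<in>M. cl \<le> real (card {i \<in> {1..n}. x i \<in> ball a (h / 10)})) \<and>
     (\<forall>a\<in>M. real (card {i \<in> {1..n}. x i \<in> cball a (2 * h)}) \<le> cu)"

context noisy_law
begin

definition near_samples :: "nat \<Rightarrow> (nat \<Rightarrow> fvec) set" where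
  "near_samples n = {x \<in> space (PiM {1..n} (\<lambda>_. Q)). \<forall>i\<in>{1..n}. x i \<in> Rn D \<and> infdist (x i) M \<le> \<sigma>}"

lemma near_samples_sets: "near_samples n \<in> sets (PiM {1..n} (\<lambda>_. Q))"
proof -
  have "closed ({x. infdist x M \<le> \<sigma>} \<inter> Rn D)"
    by (intro closed_Int closed_Rn closed_Collect_le continuous_intros)
  then have "{x. infdist x M \<le> \<sigma>} \<inter> Rn D \<in> sets borel" by (rule borel_closed)
  then have m: "{x. infdist x M \<le> \<sigma>} \<inter> Rn D \<in> sets Q" by simp
  have "near_samples n = {x \<in> space (PiM {1..n} (\<lambda>_. Q)). \<forall>i\<in>{1..n}. x i \<in> {x. infdist x M \<le> \<sigma>} \<inter> Rn D}"
    by (auto simp: near_samples_def)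
  also have "\<dots> \<in> sets (PiM {1..n} (\<lambda>_. Q))"
    using m by measurable
  finally show ?thesis .
qed

lemma prob_PiM: "prob_space (PiM {1..n} (\<lambda>_. Q))"
  by (rule prob_space_PiM[OF prob_Q])

lemma prob_near_samples: "measure (PiM {1..n} (\<lambda>_. Q)) (near_samples n) = 1"
proof -
  interpret N: prob_space "PiM {1..n} (\<lambda>_. Q)" by (rule prob_PiM)
  have "AE x in PiM {1..n} (\<lambda>_. Q). \<forall>i\<in>{1..n}. x i \<in> Rn D \<and> infdist (x i) M \<le> \<sigma>"
    by (intro AE_finite_allI AE_PiM_component prob_Q AE_Q) auto
  then have "AE x in PiM {1..n} (\<lambda>_. Q). x \<in> near_samples n"
    using AE_space by eventually_elim (simp add: near_samples_def)
  then show ?thesis using N.prob_eq_1[OF near_samples_sets] by simp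
qed

text \<open>The conditions range over all centres in \<open>M\<close>. They follow from conditions
  at the points of a finite net, with a smaller ball for the lower count and a larger one for the
  upper count; there a union bound applies and the event is measurable.\<close>

lemma prob_typical_sample:
  assumes h: "0 < h" "h \<le> \<rho> / 100" and \<sigma>h: "\<sigma> \<le> h / 100"
    and p0: "p0 = fmin * vol_lower d * (h / 25) ^ d" and p1: "p1 = fmax * vol_upper d * (4 * h) ^ d"
    and q: "16 * ln (real n) \<le> real n * p0" "16 * ln (real n) \<le> real n * p1" and n: "2 \<le> n"
    and K: "1 / (fmin * vol_lower d * (h / 40) ^ d) \<le> real n / 2"
  shows "\<exists>E\<in>sets (PiM {1..n} (\<lambda>_. Q)). E \<subseteq> near_samples n \<and>
      (\<forall>x\<in>E. typical_sample D M n \<sigma> h (real n * p0 / 4) (4 * real n * p1) x) \<and>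
      1 - 1 / real n ^ 3 \<le> measure (PiM {1..n} (\<lambda>_. Q)) E"
proof -
  let ?N = "PiM {1..n} (\<lambda>_. Q)"
  interpret N: prob_space ?N by (rule prob_PiM)
  \<comment> \<open>Every \<open>a\<close> in \<open>M\<close> is within h/20 of a net point, whose
    ball of radius h/20 lies in the ball of radius h/10 about \<open>a\<close>, and whose ball of
    radius 3 h contains that of radius 2 h about \<open>a\<close>.\<close>
  obtain Z where Z: "finite Z" "Z \<subseteq> M" "\<And>a. a \<in> M \<Longrightarrow> \<exists>z\<in>Z. dist a z < 2 * (h / 40)"
    "real (card Z) * (fmin * vol_lower d * (h / 40) ^ d) \<le> 1"
    using ex_net[of "h / 40"] h \<rho> by auto
  let ?low = "\<lambda>z. {x \<in> space ?N. real (card {i \<in> {1..n}. x i \<in> ball z (h / 20)}) \<le> real (card {1..n}) * p0 / 4}"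
  let ?up = "\<lambda>z. {x \<in> space ?N. 4 * real (card {1..n}) * p1 \<le> real (card {i \<in> {1..n}. x i \<in> cball z (3 * h)})}"
  have bs [measurable]: "ball z r \<in> sets Q" "cball z r \<in> sets Q" for z r by auto
  have [measurable]: "(\<lambda>x. real (card {i \<in> {1..n}. x i \<in> ball z r})) \<in> borel_measurable ?N"
    "(\<lambda>x. real (card {i \<in> {1..n}. x i \<in> cball z r})) \<in> borel_measurable ?N" for z r
    by (rule count_measurable[OF prob_Q]; simp)+
  have ms: "?low z \<in> sets ?N" "?up z \<in> sets ?N" for z by measurable
  have K0: "0 < fmin * vol_lower d * (h / 40) ^ d" using fmin vol_lower_pos[OF d] h by simp
  have cZ: "real (card Z) \<le> real n / 2"
    by (rule order_trans[OF _ K], unfold pos_le_divide_eq[OF K0], rule Z(4))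
  have n0: "0 < real n" using n by simp
  have e4: "exp (- (4 * ln (real n))) = 1 / real n ^ 4"
  proof -
    have "exp (real 4 * ln (real n)) = exp (ln (real n)) ^ 4" by (rule exp_of_nat_mult)
    then have "exp (4 * ln (real n)) = real n ^ 4" using n0 by simp
    then show ?thesis by (simp only: exp_minus inverse_eq_divide)
  qed
  have low: "measure ?N (?low z) \<le> 1 / real n ^ 4" if z: "z \<in> Z" for z
  proof -
    \<comment> \<open>The radius h/25 is h/20 - h/100, what is left after the noise.\<close>
    have "p0 \<le> fmin * vol_lower d * (h / 20 - \<sigma>) ^ d"
      unfolding p0 using fmin vol_lower_pos[OF d] h \<sigma>h by (intro mult_left_mono power_mono) auto
    also have "\<dots> \<le> measure Q (ball z (h / 20))"
      using z Z(2) h \<sigma>h \<sigma> by (intro measure_Q_ball_lower) auto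
    finally have "measure ?N (?low z) \<le> exp (- (real (card {1..n}) * p0 / 4))"
      by (rule prob_count_small[OF prob_Q finite_atLeastAtMost bs(1)])
    also have "\<dots> \<le> exp (- (4 * ln (real n)))" using q(1) by simp
    finally show ?thesis using e4 by simp
  qed
  have up: "measure ?N (?up z) \<le> 1 / real n ^ 4" if z: "z \<in> Z" for z
  proof -
    have "measure Q (cball z (3 * h)) \<le> fmax * vol_upper d * (3 * h + \<sigma>) ^ d"
      using z Z(2) h \<sigma>h \<sigma> by (intro measure_Q_cball_upper) auto
    also have "\<dots> \<le> p1"
      unfolding p1 using fmin fmax vol_upper_pos[OF d] h \<sigma>h \<sigma> by (intro mult_left_mono power_mono) auto
    finally have "measure ?N (?up z) \<le> exp (- (2 * real (card {1..n}) * p1))"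
      by (rule prob_count_large[OF prob_Q finite_atLeastAtMost bs(2)])
    also have "\<dots> \<le> exp (- (4 * ln (real n)))"
    proof -
      have "0 \<le> ln (real n)" using n by simp
      then have "4 * ln (real n) \<le> 2 * real n * p1" using q(2) by linarith
      then show ?thesis by simp
    qed
    finally show ?thesis using e4 by simp
  qed
  define Bad where "Bad = (\<Union>z\<in>Z. ?low z \<union> ?up z)"
  have Bad: "Bad \<in> sets ?N" unfolding Bad_def using Z(1) ms by (intro sets.finite_UN sets.Un) auto
  have "measure ?N Bad \<le> (\<Sum>z\<in>Z. measure ?N (?low z \<union> ?up z))"
    unfolding Bad_def using Z(1) ms by (intro N.finite_measure_subadditive_finite) auto
  also have "\<dots> \<le> (\<Sum>z\<in>Z. 2 / real n ^ 4)"
  proof (rule sum_mono)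
    fix z assume "z \<in> Z"
    then have "measure ?N (?low z) + measure ?N (?up z) \<le> 2 / real n ^ 4" using low up by fastforce
    then show "measure ?N (?low z \<union> ?up z) \<le> 2 / real n ^ 4"
      using measure_Un_le[OF ms(1)[of z] ms(2)[of z]] by linarith
  qed
  also have "\<dots> = real (card Z) * (2 / real n ^ 4)" by simp
  \<comment> \<open>At most n/2 centres, with two events of probability at most n^(-4) each.\<close>
  also have "\<dots> \<le> real n / 2 * (2 / real n ^ 4)" using cZ by (intro mult_right_mono) auto
  also have "\<dots> = 1 / real n ^ 3" using n0 by (simp add: power_numeral_reduce)
  finally have mB: "measure ?N Bad \<le> 1 / real n ^ 3" .
  define E where "E = near_samples n - Bad"
  have E: "E \<in> sets ?N" unfolding E_def using near_samples_sets Bad by auto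
  have "measure ?N (near_samples n) \<le> measure ?N (E \<union> Bad)"
    by (intro N.finite_measure_mono sets.Un E Bad) (auto simp: E_def)
  also have "\<dots> \<le> measure ?N E + measure ?N Bad" by (rule measure_Un_le[OF E Bad])
  finally have mE: "1 - 1 / real n ^ 3 \<le> measure ?N E" using mB prob_near_samples[of n] by linarith
  have "typical_sample D M n \<sigma> h (real n * p0 / 4) (4 * real n * p1) x" if x: "x \<in> E" for x
    unfolding typical_sample_def
  proof (intro conjI ballI)
    have xs: "x \<in> space ?N" using x by (simp add: E_def near_samples_def)
    show "x i \<in> Rn D" "infdist (x i) M \<le> \<sigma>" if "i \<in> {1..n}" for i
      using x that by (auto simp: E_def near_samples_def)
    fix a assume "a \<in> M"
    then obtain z where z: "z \<in> Z" "dist a z < h / 20" using Z(3)[of a] by auto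
    have nl: "x \<notin> ?low z" "x \<notin> ?up z" using x z(1) by (auto simp: E_def Bad_def)
    have "real n * p0 / 4 \<le> real (card {i \<in> {1..n}. x i \<in> ball z (h / 20)})" using nl(1) xs by auto
    also have "\<dots> \<le> real (card {i \<in> {1..n}. x i \<in> ball a (h / 10)})"
    proof -
      have "ball z (h / 20) \<subseteq> ball a (h / 10)"
      proof
        fix w assume "w \<in> ball z (h / 20)"
        then show "w \<in> ball a (h / 10)" using dist_triangle[of a w z] z(2) by simp
      qed
      then have "card {i \<in> {1..n}. x i \<in> ball z (h / 20)} \<le> card {i \<in> {1..n}. x i \<in> ball a (h / 10)}"
        by (intro card_mono) auto
      then show ?thesis by simp
    qed
    finally show "real n * p0 / 4 \<le> real (card {i \<in> {1..n}. x i \<in> ball a (h / 10)})" .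
    have "real (card {i \<in> {1..n}. x i \<in> cball a (2 * h)}) \<le> real (card {i \<in> {1..n}. x i \<in> cball z (3 * h)})"
    proof -
      have "cball a (2 * h) \<subseteq> cball z (3 * h)"
      proof
        fix w assume "w \<in> cball a (2 * h)"
        then show "w \<in> cball z (3 * h)" using dist_triangle[of z w a] z(2) h by (simp add: dist_commute)
      qed
      then have "card {i \<in> {1..n}. x i \<in> cball a (2 * h)} \<le> card {i \<in> {1..n}. x i \<in> cball z (3 * h)}"
        by (intro card_mono) auto
      then show ?thesis by simp
    qed
    also have "\<dots> \<le> 4 * real n * p1" using nl(2) xs by auto
    finally show "real (card {i \<in> {1..n}. x i \<in> cball a (2 * h)}) \<le> 4 * real n * p1" .
  qed
  then show ?thesis using E mE by (intro bexI[of _ E]) (auto simp: E_def)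
qed

end

section \<open>Deterministic facts on Hausdorff distance, complexes and farthest point
  sampling\<close>

section \<open>Hausdorff distance\<close>

lemma hausdorff_dist_leI:
  assumes "A \<noteq> {}" "B \<noteq> {}" "\<And>a. a \<in> A \<Longrightarrow> infdist a B \<le> r" "\<And>b. b \<in> B \<Longrightarrow> infdist b A \<le> r"
  shows "hausdorff_dist A B \<le> r"
  unfolding hausdorff_dist_def using assms by (auto intro!: max.boundedI cSUP_least)

lemma bdd_above_infdist:
  assumes "bounded A" "B \<noteq> {}" shows "bdd_above ((\<lambda>a. infdist a B) ` A)"
proof -
  obtain b where b: "b \<in> B" using assms(2) by blast
  obtain r where r: "\<And>a. a \<in> A \<Longrightarrow> dist b a \<le> r" using assms(1) bounded_any_center[of A b] by blast
  have "infdist a B \<le> r" if "a \<in> A" for a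
    using infdist_le[OF b, of a] r[OF that] by (simp add: dist_commute)
  then show ?thesis by (intro bdd_aboveI2)
qed

lemma hausdorff_dist_leD:
  assumes "hausdorff_dist A B \<le> r" "bounded A" "bounded B" "A \<noteq> {}" "B \<noteq> {}"
  shows "a \<in> A \<Longrightarrow> infdist a B \<le> r" "b \<in> B \<Longrightarrow> infdist b A \<le> r"
proof -
  show "infdist a B \<le> r" if "a \<in> A"
    using cSUP_upper[OF that bdd_above_infdist[OF assms(2,5)]] assms(1) by (simp add: hausdorff_dist_def)
  show "infdist b A \<le> r" if "b \<in> B"
    using cSUP_upper[OF that bdd_above_infdist[OF assms(3,4)]] assms(1) by (simp add: hausdorff_dist_def)
qed

lemma hausdorff_dist_image_le:
  assumes hd: "hausdorff_dist (f ` A) B \<le> r" and bd: "bounded (f ` A)" "bounded B" "A \<noteq> {}" "B \<noteq> {}"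
    and f: "\<And>a. a \<in> A \<Longrightarrow> dist a (f a) \<le> s"
  shows "hausdorff_dist A B \<le> r + s"
proof (rule hausdorff_dist_leI)
  have ne: "f ` A \<noteq> {}" using bd(3) by simp
  note D = hausdorff_dist_leD[OF hd bd(1,2) ne bd(4)]
  show "infdist a B \<le> r + s" if "a \<in> A" for a
    using infdist_triangle[of a B "f a"] D(1)[of "f a"] f[OF that] that by simp
  show "infdist b A \<le> r + s" if b: "b \<in> B" for b
  \<comment> \<open>The infimum over the image need not be attained, as the sets are only assumed
    bounded.\<close>
  proof (rule field_le_epsilon)
    fix e :: real assume e: "0 < e"
    have "infdist b (f ` A) < r + e" using D(2)[OF b] e by linarith
    then obtain a where a: "a \<in> A" "dist b (f a) < r + e"
      using infdist_geI[OF ne, of "r + e" b] by (auto simp: not_le[symmetric])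
    have "infdist b A \<le> dist b a" by (rule infdist_le[OF a(1)])
    also have "\<dots> \<le> dist b (f a) + dist a (f a)" by (rule dist_triangle2)
    finally show "infdist b A \<le> r + s + e" using a f[OF a(1)] by linarith
  qed
qed (use bd in auto)


section \<open>Complexes and farthest point sampling\<close>

lemma abstract_complex_tdc: "finite P \<Longrightarrow> abstract_complex (tdc \<omega> D P T)"
proof -
  assume P: "finite P"
  have sub: "tdc \<omega> D P T \<subseteq> Pow P"
    by (auto simp: tdc_def restricted_delaunay_def restricted_simplices_def delaunay_def)
  then have "finite (tdc \<omega> D P T)" using P by (meson finite_Pow_iff finite_subset)
  moreover have "finite \<tau>" "\<tau> \<noteq> {}" if "\<tau> \<in> tdc \<omega> D P T" for \<tau>
  proof -
    show "finite \<tau>" using sub that P finite_subset by (metis PowD subsetD)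
    show "\<tau> \<noteq> {}" using that by (simp add: tdc_def restricted_delaunay_def)
  qed
  moreover have "\<tau>' \<in> tdc \<omega> D P T" if \<tau>: "\<tau> \<in> tdc \<omega> D P T" "\<tau>' \<subseteq> \<tau>" "\<tau>' \<noteq> {}" for \<tau> \<tau>'
  proof -
    obtain \<upsilon> where "\<upsilon> \<in> restricted_simplices D (\<omega> D P (restrict T P)) P T" "\<tau> \<subseteq> \<upsilon>"
      using \<tau>(1) by (auto simp: tdc_def restricted_delaunay_def)
    then show ?thesis using \<tau>(2,3) unfolding tdc_def restricted_delaunay_def
      by (intro CollectI conjI bexI[of _ \<upsilon>]) auto
  qed
  ultimately show ?thesis unfolding abstract_complex_def by blast
qed

lemma Union_tdc_subset: "\<Union>(tdc \<omega> D P T) \<subseteq> P"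
  by (auto simp: tdc_def restricted_delaunay_def restricted_simplices_def delaunay_def)

lemma underlying_tdc_subset: "underlying (tdc \<omega> D P T) \<subseteq> convex hull P"
proof -
  have "convex hull \<tau> \<subseteq> convex hull P" if "\<tau> \<in> tdc \<omega> D P T" for \<tau>
    using that Union_tdc_subset[of \<omega> D P T] by (intro hull_mono) blast
  then show ?thesis unfolding underlying_def by blast
qed

text \<open>Both the weights and the intersection condition see the family of spaces on
  \<open>P\<close> only.\<close>

lemma tdc_cong:
  assumes "\<And>p. p \<in> P \<Longrightarrow> T p = T' p" shows "tdc \<omega> D P T = tdc \<omega> D P T'"
proof -
  have r: "restrict T P = restrict T' P" by (intro restrict_ext assms)
  have "(\<Union>p\<in>\<tau>. (+) p ` T p) = (\<Union>p\<in>\<tau>. (+) p ` T' p)" if "\<tau> \<in> delaunay D w P" for \<tau> w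
    using that assms by (intro SUP_cong) (auto simp: delaunay_def)
  then show ?thesis
    unfolding tdc_def r restricted_delaunay_def restricted_simplices_def by (auto cong: conj_cong)
qed

text \<open>A point that maximises the distance to \<open>Q\<close> is at least as far as the one
  that kept the loop running, hence farther than \<epsilon> from all of \<open>Q\<close>.\<close>

lemma farthest_point_run:
  assumes "farthest_point_run X \<epsilon> Y" and X: "finite X"
  shows "Y \<subseteq> X \<and> Y \<noteq> {} \<and> (\<forall>p\<in>Y. \<forall>q\<in>Y - {p}. \<epsilon> \<le> dist p q)"
  using assms(1)
proof induction
  case (step Q q)
  obtain p where p: "p \<in> X" "infdist p Q > \<epsilon>" using step(2) by blast
  have "infdist q Q > \<epsilon>" using step(4) p by force
  then have "\<epsilon> \<le> dist q r" if "r \<in> Q" for r using infdist_le[OF that, of q] by linarith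
  then show ?case using step.IH step(3) by (auto simp: dist_commute)
qed auto

lemma tdc_estimateE:
  assumes "tdc_estimate \<omega> D d c1 c2 \<rho> \<sigma> n x K"
  obtains Y T where "Y \<subseteq> x ` {1..n}" "Y \<noteq> {}" "finite Y"
    "\<And>p q. p \<in> Y \<Longrightarrow> q \<in> Y \<Longrightarrow> p \<noteq> q \<Longrightarrow> net_scale c2 \<rho> \<sigma> (bandwidth c1 d n) \<le> dist p q"
    "\<And>p. p \<in> x ` {1..n} \<Longrightarrow> infdist p Y \<le> net_scale c2 \<rho> \<sigma> (bandwidth c1 d n)"
    "\<And>p. p \<in> Y \<Longrightarrow> \<exists>j\<in>{1..n}. x j = p \<and> top_eigenspan D d (local_cov n x (bandwidth c1 d n) j) (T p)"
    "K = tdc \<omega> D Y T"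
proof -
  let ?\<epsilon> = "net_scale c2 \<rho> \<sigma> (bandwidth c1 d n)"
  obtain Y T where Y: "farthest_point_output (x ` {1..n}) ?\<epsilon> Y"
    "\<And>p. p \<in> Y \<Longrightarrow> \<exists>j\<in>{1..n}. x j = p \<and> top_eigenspan D d (local_cov n x (bandwidth c1 d n) j) (T p)"
    "K = tdc \<omega> D Y T"
    using assms unfolding tdc_estimate_def by blast
  have r: "Y \<subseteq> x ` {1..n} \<and> Y \<noteq> {} \<and> (\<forall>p\<in>Y. \<forall>q\<in>Y - {p}. ?\<epsilon> \<le> dist p q)"
    using Y(1) unfolding farthest_point_output_def by (intro farthest_point_run) auto
  show ?thesis
  proof (rule that[of Y T])
    show "finite Y" using r by (meson finite_atLeastAtMost finite_imageI finite_subset)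
    show "infdist p Y \<le> ?\<epsilon>" if "p \<in> x ` {1..n}" for p
      using Y(1) that by (auto simp: farthest_point_output_def)
  qed (use r Y in auto)
qed

lemma tdc_estimate_complex:
  assumes "tdc_estimate \<omega> D d c1 c2 \<rho> \<sigma> n x K"
  shows "abstract_complex K" "\<Union>K \<subseteq> x ` {1..n}" "underlying K \<subseteq> convex hull (x ` {1..n})"
proof -
  obtain Y T where Y: "Y \<subseteq> x ` {1..n}" "finite Y" "K = tdc \<omega> D Y T"
    by (rule tdc_estimateE[OF assms])
  show "abstract_complex K" unfolding Y(3) by (rule abstract_complex_tdc[OF Y(2)])
  show "\<Union>K \<subseteq> x ` {1..n}" using Union_tdc_subset[of \<omega> D Y T] Y by blast
  show "underlying K \<subseteq> convex hull (x ` {1..n})"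
    using underlying_tdc_subset[of \<omega> D Y T] hull_mono[OF Y(1), of convex] Y(3) by blast
qed


section \<open>Transfer of the noise-free guarantee to estimated data\<close>

section \<open>Stability of the complex\<close>

text \<open>The two constants are exposed as parameters, so that those of the theorem can be
  expressed through them.\<close>

definition bg_holds :: "enat \<Rightarrow> nat \<Rightarrow> weight_assignment \<Rightarrow> real \<Rightarrow> real \<Rightarrow> bool" where
  "bg_holds k d \<omega> \<epsilon>d Cd \<longleftrightarrow> 0 < \<epsilon>d \<and> 0 < Cd \<and>
     (\<forall>D>d. \<forall>\<rho>>0. \<forall>\<epsilon>>0. \<epsilon> \<le> \<epsilon>d * \<rho> \<longrightarrow>
        (\<forall>M\<in>manifold_class k D d \<rho>. \<forall>P. net \<epsilon> (2 * \<epsilon>) M P \<longrightarrow>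
           hausdorff_dist M (underlying (tdc \<omega> D P (tangent_space M))) \<le> Cd * \<epsilon>\<^sup>2 / \<rho> \<and>
           ambient_isotopic D M (underlying (tdc \<omega> D P (tangent_space M)))))"

lemma boissonnat_ghosh_bg_holds:
  assumes "boissonnat_ghosh k d \<omega>" obtains \<epsilon>d Cd where "bg_holds k d \<omega> \<epsilon>d Cd"
  using assms unfolding boissonnat_ghosh_def bg_holds_def
  by (elim conjE exE) (rule that, unfold bg_holds_def, rule conjI, assumption, rule conjI, assumption, assumption)

context reach_manifold
begin

text \<open>The points \<open>p\<close> and the spaces \<open>S p\<close> are interpolated by the image of \<open>M\<close> under a diffeomorphism
  close to the identity, to which the guarantee for noise-free nets applies.\<close>

lemma tdc_stability:
  assumes bg: "bg_holds k d \<omega> \<epsilon>d Cd" and dD: "d < D"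
    and Y: "finite Y" "Y \<noteq> {}" "\<And>p q. p \<in> Y \<Longrightarrow> q \<in> Y \<Longrightarrow> p \<noteq> q \<Longrightarrow> \<epsilon> \<le> dist p q"
    and m: "\<And>p. p \<in> Y \<Longrightarrow> p \<in> Rn D" "\<And>p. p \<in> Y \<Longrightarrow> m p \<in> M" "\<And>p. p \<in> Y \<Longrightarrow> dist p (m p) \<le> \<sigma>"
    and S: "\<And>p. p \<in> Y \<Longrightarrow> fin_subspace (S p)" "\<And>p. p \<in> Y \<Longrightarrow> dim (S p) = d" "\<And>p. p \<in> Y \<Longrightarrow> S p \<subseteq> Rn D"
      "\<And>p. p \<in> Y \<Longrightarrow> sub_angle (S p) (T (m p)) \<theta>"
    and \<epsilon>: "0 < \<epsilon>" "\<epsilon> \<le> \<epsilon>d * (\<rho> / 4)" and \<sigma>: "0 \<le> \<sigma>" "6 * \<sigma> \<le> \<epsilon>" and \<theta>: "0 \<le> \<theta>" "\<theta> < 1"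
    and small: "4 * bump_bound * (\<sigma> / \<epsilon> + \<theta>) \<le> 1 / 10" "4 * bump_bound * (\<sigma> / \<epsilon>\<^sup>2 + \<theta> / \<epsilon>) \<le> 1 / \<rho>"
    and cover: "\<And>a. a \<in> M \<Longrightarrow> infdist a Y + 2 * bump_bound * (\<sigma> + \<theta> * \<epsilon>) \<le> 2 * \<epsilon>"
  shows "hausdorff_dist M (underlying (tdc \<omega> D Y S)) \<le> 4 * Cd * \<epsilon>\<^sup>2 / \<rho> + 2 * bump_bound * (\<sigma> + \<theta> * \<epsilon>)"
    "ambient_isotopic D M (underlying (tdc \<omega> D Y S))"
proof -
  \<comment> \<open>The identity plus \<open>A p\<close> sends a tangent vector at
    \<open>m p\<close> to its projection onto \<open>S p\<close> and fixes normal vectors; the angle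
    bound makes its size at most \<theta>.\<close>
  define A where "A p v = oproj (S p) (P (m p) v) - P (m p) v" for p v
  have ang: "sub_angle (T (m p)) (S p) \<theta>" if p: "p \<in> Y" for p
    by (rule sub_angle_sym[OF S(1)[OF p] T_fin[OF m(2)[OF p]] _ \<theta> S(4)[OF p]]) (simp add: S(2) T_dim m(2) p)
  interpret bf: bump_family Y \<epsilon> \<sigma> \<theta> m "\<lambda>p. p - m p" A
  proof (rule bump_family.intro)
    fix p assume p: "p \<in> Y"
    show "bump_data \<epsilon> \<sigma> \<theta> (p - m p) (A p)"
    proof (rule bump_data.intro)
      show "linear (A p)"
        unfolding A_def
        by (intro linear_compose_sub linear_compose[OF linear_oproj[OF T_fin[OF m(2)[OF p]]] linear_oproj[OF S(1)[OF p]], unfolded o_def]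
            linear_oproj[OF T_fin[OF m(2)[OF p]]])
      show "norm (p - m p) \<le> \<sigma>" using m(3)[OF p] by (simp add: dist_norm)
      fix v
      have "norm (A p v) \<le> \<theta> * norm (P (m p) v)"
        using ang[OF p] oproj_in[OF T_fin[OF m(2)[OF p]], of v]
        by (simp add: A_def sub_angle_def norm_minus_commute)
      also have "\<dots> \<le> \<theta> * norm v" using \<theta> by (intro mult_left_mono norm_oproj_le T_fin m(2) p) auto
      finally show "norm (A p v) \<le> \<theta> * norm v" .
    qed (use \<epsilon> \<sigma> \<theta> in auto)
  next
    fix p q assume pq: "p \<in> Y" "q \<in> Y" "p \<noteq> q"
    have "\<epsilon> \<le> dist p q" by (rule Y(3)[OF pq])
    also have "\<dots> \<le> dist p (m p) + dist (m p) (m q) + dist q (m q)"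
      using dist_triangle[of p q "m p"] dist_triangle[of "m p" q "m q"] by (simp add: dist_commute)
    \<comment> \<open>Passing from the points to their centres on \<open>M\<close> costs 2 \<sigma>
      \<le> \<epsilon>/3, and two supports of radius \<epsilon>/3 still fit.\<close>
    finally show "2 * \<epsilon> / 3 \<le> dist (m p) (m q)" using m(3)[OF pq(1)] m(3)[OF pq(2)] \<sigma> by simp
  qed (use Y \<epsilon> \<sigma> \<theta> in auto)
  have A_Rn: "A p v \<in> Rn D" if "p \<in> Y" for p v
    unfolding A_def using oproj_in[OF S(1)[OF that]] S(3)[OF that] oproj_in[OF T_fin[OF m(2)[OF that]]] T_subset[OF m(2)[OF that]]
    by (intro Rn_diff) auto
  interpret pt: perturbation k D d M \<rho> bf.disp bf.disp_deriv "2 * bump_bound * (\<sigma> + \<theta> * \<epsilon>)"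
  proof
    show "bf.disp x \<in> Rn D" if "x \<in> Rn D" for x
      using that m(1) in_Rn[OF m(2)] A_Rn by (intro bf.disp_in_Rn) (auto intro: Rn_diff)
    show "norm (bf.disp y - bf.disp x) \<le> 1 / 10 * norm (y - x)" for x y
      by (rule order_trans[OF bf.disp_lipschitz mult_right_mono[OF small(1) norm_ge_zero]])
    show "norm (bf.disp_deriv x v) \<le> 1 / 10 * norm v" for x v
      by (rule order_trans[OF bf.norm_disp_deriv mult_right_mono[OF small(1) norm_ge_zero]])
    show "norm (bf.disp y - bf.disp x - bf.disp_deriv x (y - x)) \<le> (norm (y - x))\<^sup>2 / \<rho>" for x y
      using bf.disp_taylor[of y x] mult_right_mono[OF small(2), of "(norm (y - x))\<^sup>2"] by simp
  qed (fact bf.has_derivative_disp bf.norm_disp bf.Ck_map_disp)+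
  let ?M' = "pt.\<Phi> ` M" and ?K = "underlying (tdc \<omega> D Y S)"
  have center: "pt.\<Phi> (m p) = p" if "p \<in> Y" for p
    using bf.disp_center(1)[OF that] by (simp add: pt.\<Phi>_def)
  have tan: "tangent_space ?M' p = S p" if p: "p \<in> Y" for p
  proof -
    have "tangent_space ?M' p = pt.\<Phi>' (m p) ` T (m p)"
      using pt.tangent_space_image[OF m(2)[OF p]] center[OF p] by simp
    also have "\<dots> = oproj (S p) ` T (m p)"
      using bf.disp_center(2)[OF p] oproj_id[OF T_fin[OF m(2)[OF p]]]
      by (intro image_cong) (auto simp: pt.\<Phi>'_def A_def)
    also have "\<dots> = S p"
      by (rule sub_angle_onto(1)[OF T_fin[OF m(2)[OF p]] S(1)[OF p] _ \<theta>(2) ang[OF p]]) (simp add: S(2) T_dim m(2) p)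
    finally show ?thesis .
  qed
  \<comment> \<open>The complex on the estimated data is literally the complex on exact data of the
    moved manifold.\<close>
  have eq: "tdc \<omega> D Y S = tdc \<omega> D Y (tangent_space ?M')" by (rule tdc_cong) (simp add: tan)
  have move: "dist a (pt.\<Phi> a) \<le> 2 * bump_bound * (\<sigma> + \<theta> * \<epsilon>)" for a
    using bf.norm_disp[of a] by (simp add: pt.\<Phi>_def dist_norm)
  have net: "net \<epsilon> (2 * \<epsilon>) ?M' Y"
    unfolding net_def
  proof (intro conjI ballI)
    show "Y \<subseteq> ?M'"
    proof
      fix p assume p: "p \<in> Y"
      show "p \<in> ?M'" by (rule image_eqI[of _ _ "m p"]) (simp_all add: center[OF p] m(2)[OF p])
    qed
    show "\<epsilon> \<le> dist p q" if "p \<in> Y" "q \<in> Y - {p}" for p q using Y(3)[of p q] that by auto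
    fix x assume "x \<in> ?M'"
    then obtain a where a: "a \<in> M" "x = pt.\<Phi> a" by blast
    show "infdist x Y \<le> 2 * \<epsilon>"
      using infdist_triangle[of x Y a] cover[OF a(1)] move[of a] a(2) by (simp add: dist_commute)
  qed (use Y in auto)
  have \<rho>4: "0 < \<rho> / 4" using \<rho> by simp
  have conc: "hausdorff_dist ?M' ?K \<le> Cd * \<epsilon>\<^sup>2 / (\<rho> / 4) \<and> ambient_isotopic D ?M' ?K"
    unfolding eq
    by (rule bg[unfolded bg_holds_def, THEN conjunct2, THEN conjunct2, rule_format, OF dD \<rho>4 \<epsilon> pt.image_class net])
  \<comment> \<open>\<open>infdist\<close> to the empty set is 0 by convention, so nonemptiness has
    to come from the isotopy before distances are compared.\<close>
  have K: "?K \<noteq> {}"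
  proof
    assume "?K = {}"
    then have "?M' = {}" using conc by (auto simp: ambient_isotopic_def)
    then show False using nonempty by simp
  qed
  have bK: "bounded ?K"
    using bounded_subset[OF finite_imp_bounded_convex_hull[OF Y(1)] underlying_tdc_subset] .
  have "hausdorff_dist M ?K \<le> Cd * \<epsilon>\<^sup>2 / (\<rho> / 4) + 2 * bump_bound * (\<sigma> + \<theta> * \<epsilon>)"
    by (rule hausdorff_dist_image_le[of pt.\<Phi>])
      (use conc K bK nonempty move compact_imp_bounded[OF compact_continuous_image[OF pt.continuous_\<Phi> compact]] in auto)
  then show "hausdorff_dist M ?K \<le> 4 * Cd * \<epsilon>\<^sup>2 / \<rho> + 2 * bump_bound * (\<sigma> + \<theta> * \<epsilon>)" by (simp add: mult_ac)
  show "ambient_isotopic D M ?K"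
    using ambient_isotopic_trans[OF pt.isotopic_image] conc by blast
qed

end

text \<open>Threshold for \<open>\<sigma> / h + h / \<rho>\<close>, where \<open>\<kappa>\<close> bounds the tangent error relative to this quantity.\<close>

definition scale_threshold :: "real \<Rightarrow> real \<Rightarrow> real \<Rightarrow> real" where
  "scale_threshold \<kappa> c2 \<epsilon>d = min (1 / 2000) (min (1 / (40 * bump_bound * (1 + \<kappa>))) (\<epsilon>d / (4 * c2)))"

context reach_manifold
begin

text \<open>Verifies the hypotheses of \<open>tdc_stability\<close> for \<theta> = \<kappa> \<tau>,
  where \<tau> = \<sigma>/h + h/\<rho>. The threshold on \<tau> makes the displacement small to
  first order, and the size of \<open>c2\<close> makes it small to second order.\<close>

lemma tdc_estimate_typical:
  fixes x :: "nat \<Rightarrow> fvec" and n :: nat and c1 c2 \<sigma> :: real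
  defines "h \<equiv> bandwidth c1 d n" and "\<epsilon> \<equiv> net_scale c2 \<rho> \<sigma> (bandwidth c1 d n)"
  assumes bg: "bg_holds k d \<omega> \<epsilon>d Cd" and d: "1 \<le> d" "d < D" and n: "2 \<le> n"
    and typi: "typical_sample D M n \<sigma> h cl cu x" and cl: "0 < cl"
    and \<kappa>: "real d * (25 * (cu / cl)) \<le> \<kappa>" and c2: "4 * bump_bound * (1 + 2 * \<kappa>) \<le> c2"
    and h: "0 < h" and \<sigma>: "0 \<le> \<sigma>" and thr: "\<sigma> / h + h / \<rho> \<le> scale_threshold \<kappa> c2 \<epsilon>d"
    and K: "tdc_estimate \<omega> D d c1 c2 \<rho> \<sigma> n x K"
  shows "hausdorff_dist M (underlying K) \<le> (4 * Cd + 4 * bump_bound) * \<epsilon>\<^sup>2 / \<rho>"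
    "ambient_isotopic D M (underlying K)"
proof -
  let ?B = bump_bound
  define \<tau> where "\<tau> = \<sigma> / h + h / \<rho>"
  define \<theta> where "\<theta> = \<kappa> * \<tau>"
  have B: "1 \<le> ?B" by (rule bump_bound(1))
  have ne: "\<exists>i. i \<in> {1..n} \<and> x i \<in> ball a (h / 10)" if "a \<in> M" for a
  proof -
    have "0 < real (card {i \<in> {1..n}. x i \<in> ball a (h / 10)})"
      using typi that cl unfolding typical_sample_def by (meson less_le_trans)
    then have "{i \<in> {1..n}. x i \<in> ball a (h / 10)} \<noteq> {}" by (metis card.empty of_nat_0 less_irrefl)
    then show ?thesis by blast
  qed
  have cu: "0 \<le> cu" using typi nonempty unfolding typical_sample_def by (meson ex_in_conv of_nat_0_le_iff order_trans)
  have \<kappa>0: "0 \<le> \<kappa>" using order_trans[OF _ \<kappa>] cu cl by simp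
  have c2B: "4 * ?B \<le> c2"   proof -
    have "4 * ?B * 1 \<le> 4 * ?B * (1 + 2 * \<kappa>)" using B \<kappa>0 by (intro mult_left_mono) auto
    then show ?thesis using c2 by linarith
  qed
  then have c24: "4 \<le> c2" using B by linarith
  have \<epsilon>d: "0 < \<epsilon>d" "0 < Cd" using bg by (auto simp: bg_holds_def)
  have \<tau>0: "0 \<le> \<tau>" using \<sigma> h \<rho> by (simp add: \<tau>_def)
  \<comment> \<open>The first entry keeps \<sigma> and \<open>h\<close> in the range of
    \<open>pca_tangent\<close>, the second keeps the Lipschitz constant of the displacement at most
    1/10, and the third gives \<open>\<epsilon> \<le> \<epsilon>d * (\<rho> / 4)\<close>, as
    required for reach \<rho>/4.\<close>
  have t1: "\<tau> \<le> 1 / 2000" and t2: "\<tau> \<le> 1 / (40 * ?B * (1 + \<kappa>))" and t3: "\<tau> \<le> \<epsilon>d / (4 * c2)"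
    using thr by (auto simp: scale_threshold_def \<tau>_def)
  have sh: "\<sigma> / h \<le> \<tau>" "h / \<rho> \<le> \<tau>" using \<sigma> h \<rho> by (auto simp: \<tau>_def)
  have \<sigma>h: "\<sigma> \<le> h / 2000"
    using order_trans[OF sh(1)[unfolded pos_divide_le_eq[OF h]] mult_right_mono[OF t1, of h]] h by simp
  have h\<rho>: "h \<le> \<rho> / 2000"
    using order_trans[OF sh(2)[unfolded pos_divide_le_eq[OF \<rho>]] mult_right_mono[OF t1, of \<rho>]] \<rho> by simp
  have \<epsilon>h: "c2 * h \<le> \<epsilon>" and \<epsilon>\<sigma>: "c2 * (\<rho> * \<sigma> / h) \<le> \<epsilon>"
    unfolding \<epsilon>_def h_def net_scale_def using c24 by (intro mult_left_mono max.cobounded1 max.cobounded2; simp)+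
  have h4: "4 * h \<le> \<epsilon>" using order_trans[OF mult_right_mono[OF c24, of h] \<epsilon>h] h by simp
  then have \<epsilon>0: "0 < \<epsilon>" using h by simp
  have \<epsilon>\<tau>: "\<epsilon> \<le> c2 * (\<rho> * \<tau>)"
  proof -
    have "h \<le> \<rho> * \<tau>" using sh(2) \<rho> by (simp add: pos_divide_le_eq mult.commute)
    moreover have "\<rho> * \<sigma> / h \<le> \<rho> * \<tau>" using mult_left_mono[OF sh(1), of \<rho>] \<rho> by simp
    ultimately show ?thesis unfolding \<epsilon>_def net_scale_def h_def[symmetric] using c24 by (intro mult_left_mono) auto
  qed
  have \<epsilon>2: "\<epsilon> \<le> \<epsilon>d * (\<rho> / 4)"
  proof -
    have "c2 * \<tau> \<le> \<epsilon>d / 4" using t3 c24 by (simp add: pos_le_divide_eq mult_ac)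
    then have "c2 * \<tau> * \<rho> \<le> \<epsilon>d / 4 * \<rho>" using \<rho> by (intro mult_right_mono) auto
    then show ?thesis using \<epsilon>\<tau> by (simp add: mult_ac)
  qed
  have \<theta>0: "0 \<le> \<theta>" using \<kappa>0 \<tau>0 by (simp add: \<theta>_def)
  have kt: "40 * ?B * ((1 + \<kappa>) * \<tau>) \<le> 1"
    using t2 B \<kappa>0 by (simp add: pos_le_divide_eq mult_ac)
  have Bt: "?B * (\<tau> + \<theta>) \<le> 1 / 40" using kt by (simp add: \<theta>_def algebra_simps)
  have "\<theta> \<le> ?B * (\<tau> + \<theta>)" using B \<theta>0 \<tau>0 mult_right_mono[of 1 ?B "\<tau> + \<theta>"] by simp
  then have \<theta>1: "\<theta> < 1" using Bt by simp
  have \<sigma>\<epsilon>: "\<sigma> / \<epsilon> \<le> \<tau>"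
    using order_trans[OF divide_left_mono[of h \<epsilon> \<sigma>] sh(1)] h4 h \<sigma> \<epsilon>0 by simp
  have s1: "4 * ?B * (\<sigma> / \<epsilon> + \<theta>) \<le> 1 / 10"
  proof -
    have "?B * (\<sigma> / \<epsilon> + \<theta>) \<le> ?B * (\<tau> + \<theta>)" using B \<sigma>\<epsilon> by (intro mult_left_mono) auto
    then show ?thesis using Bt by linarith
  qed
  have sq: "\<sigma> \<le> \<epsilon>\<^sup>2 / (c2\<^sup>2 * \<rho>)"
  proof -
    have "c2 * h * (c2 * (\<rho> * \<sigma> / h)) \<le> \<epsilon> * \<epsilon>"
      using \<epsilon>h \<epsilon>\<sigma> \<epsilon>0 c24 h \<rho> \<sigma> by (intro mult_mono) auto
    then have "\<sigma> * (c2\<^sup>2 * \<rho>) \<le> \<epsilon>\<^sup>2" using h by (simp add: power2_eq_square mult_ac)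
    then show ?thesis using c24 \<rho> by (simp add: pos_le_divide_eq)
  qed
  have \<tau>\<epsilon>: "\<tau> \<le> 2 * \<epsilon> / (c2 * \<rho>)"
  proof -
    have "\<sigma> / h \<le> \<epsilon> / (c2 * \<rho>)" using \<epsilon>\<sigma> c24 \<rho> by (simp add: pos_le_divide_eq mult_ac)
    moreover have "h / \<rho> \<le> \<epsilon> / (c2 * \<rho>)" using \<epsilon>h c24 \<rho> by (simp add: pos_le_divide_eq pos_divide_le_eq mult_ac)
    ultimately have "\<tau> \<le> \<epsilon> / (c2 * \<rho>) + \<epsilon> / (c2 * \<rho>)" unfolding \<tau>_def by (rule add_mono)
    then show ?thesis by (simp add: mult.commute)
  qed
  have \<theta>\<epsilon>: "\<theta> \<le> 2 * \<kappa> * \<epsilon> / (c2 * \<rho>)" using mult_left_mono[OF \<tau>\<epsilon> \<kappa>0] by (simp add: \<theta>_def mult_ac)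
  have c2sq: "c2 \<le> c2\<^sup>2" using c24 mult_right_mono[of 1 c2 c2] by (simp add: power2_eq_square)
  \<comment> \<open>This estimate dictates the lower bound
    \<open>4 * bump_bound * (1 + 2 * \<kappa>)\<close> on \<open>c2\<close>.\<close>
  have s2: "4 * ?B * (\<sigma> / \<epsilon>\<^sup>2 + \<theta> / \<epsilon>) \<le> 1 / \<rho>"
  proof -
    have "\<sigma> / \<epsilon>\<^sup>2 \<le> 1 / (c2\<^sup>2 * \<rho>)" using sq \<epsilon>0 c24 \<rho> by (simp add: pos_divide_le_eq pos_le_divide_eq mult_ac)
    also have "\<dots> \<le> 1 / (c2 * \<rho>)" using c2sq c24 \<rho> by (intro divide_left_mono mult_right_mono) auto
    finally have "\<sigma> / \<epsilon>\<^sup>2 \<le> 1 / (c2 * \<rho>)" .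
    moreover have "\<theta> / \<epsilon> \<le> 2 * \<kappa> / (c2 * \<rho>)" using \<theta>\<epsilon> \<epsilon>0 by (simp add: pos_divide_le_eq mult_ac)
    ultimately have "\<sigma> / \<epsilon>\<^sup>2 + \<theta> / \<epsilon> \<le> (1 + 2 * \<kappa>) / (c2 * \<rho>)" by (simp add: add_divide_distrib)
    then have "4 * ?B * (\<sigma> / \<epsilon>\<^sup>2 + \<theta> / \<epsilon>) \<le> 4 * ?B * ((1 + 2 * \<kappa>) / (c2 * \<rho>))" using B by (intro mult_left_mono) auto
    also have "\<dots> = 4 * ?B * (1 + 2 * \<kappa>) / (c2 * \<rho>)" by simp
    also have "\<dots> \<le> c2 / (c2 * \<rho>)" using c2 c24 \<rho> by (intro divide_right_mono) auto
    also have "\<dots> = 1 / \<rho>" using c24 by simp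
    finally show ?thesis .
  qed
  obtain Y S where Y: "Y \<subseteq> x ` {1..n}" "Y \<noteq> {}" "finite Y"
    "\<And>p q. p \<in> Y \<Longrightarrow> q \<in> Y \<Longrightarrow> p \<noteq> q \<Longrightarrow> \<epsilon> \<le> dist p q"
    "\<And>p. p \<in> x ` {1..n} \<Longrightarrow> infdist p Y \<le> \<epsilon>"
    "\<And>p. p \<in> Y \<Longrightarrow> \<exists>j\<in>{1..n}. x j = p \<and> top_eigenspan D d (local_cov n x h j) (S p)"
    "K = tdc \<omega> D Y S"
    unfolding \<epsilon>_def h_def by (rule tdc_estimateE[OF K]) blast
  obtain j where j: "\<And>p. p \<in> Y \<Longrightarrow> j p \<in> {1..n}" "\<And>p. p \<in> Y \<Longrightarrow> x (j p) = p"
    "\<And>p. p \<in> Y \<Longrightarrow> top_eigenspan D d (local_cov n x h (j p)) (S p)"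
    using Y(6) by metis
  \<comment> \<open>Nearest points on \<open>M\<close>; those of the net points serve as centres of
    the bumps.\<close>
  define y where "y i = (SOME a. a \<in> M \<and> infdist (x i) M = dist (x i) a)" for i
  have yM: "y i \<in> M" "infdist (x i) M = dist (x i) (y i)" for i
    using someI_ex[of "\<lambda>a. a \<in> M \<and> infdist (x i) M = dist (x i) a"] compact_nearest[OF compact nonempty, of "x i"]
    unfolding y_def by blast+
  have yd: "dist (x i) (y i) \<le> \<sigma>" if "i \<in> {1..n}" for i
  proof -
    have "infdist (x i) M \<le> \<sigma>" using typi that unfolding typical_sample_def by blast
    then show ?thesis unfolding yM(2)[of i] .
  qed
  have pca: "fin_subspace (S p) \<and> dim (S p) = d \<and> S p \<subseteq> Rn D \<and> sub_angle (S p) (T (y (j p))) \<theta>" if p: "p \<in> Y" for p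
  proof -
    have low: "\<And>a. a \<in> M \<Longrightarrow> cl \<le> real (card {i \<in> {1..n}. x i \<in> ball a (h / 10)})"
      and up: "\<And>a. a \<in> M \<Longrightarrow> real (card {i \<in> {1..n}. x i \<in> cball a (2 * h)}) \<le> cu"
      using typi by (auto simp: typical_sample_def)
    have hh: "h \<le> \<rho> / 100" "\<sigma> \<le> h / 100" using h\<rho> \<sigma>h \<rho> h by auto
    note pt = pca_tangent[OF h hh(1) \<sigma> hh(2) yM(1) yd n j(1)[OF p] d low cl up j(3)[OF p]]
    have "real d * (25 * (cu / cl) * (\<sigma> / h + h / \<rho>)) \<le> \<theta>"
      using mult_right_mono[OF \<kappa> \<tau>0] by (simp add: \<theta>_def \<tau>_def mult_ac)
    then show ?thesis using pt sub_angle_mono by blast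
  qed
  \<comment> \<open>Budget in units of \<epsilon>: 1 for the net in the sample, 1/40 for the nearest
    sample point since 4 h \<le> \<epsilon>, 1/2 for the noise and 1/20 for the tilt.\<close>
  have cover: "infdist a Y + 2 * ?B * (\<sigma> + \<theta> * \<epsilon>) \<le> 2 * \<epsilon>" if a: "a \<in> M" for a
  proof -
    obtain i where i: "i \<in> {1..n}" "dist a (x i) < h / 10" using ne[OF a] by auto
    have "infdist a Y \<le> infdist (x i) Y + dist a (x i)" by (rule infdist_triangle)
    then have 1: "infdist a Y \<le> \<epsilon> + h / 10" using Y(5)[of "x i"] i by auto
    have "?B * \<sigma> \<le> ?B * h" using \<sigma>h h B by (intro mult_left_mono) auto
    also have "\<dots> \<le> c2 / 4 * h" using c2B h by (intro mult_right_mono) auto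
    finally have 2: "2 * ?B * \<sigma> \<le> \<epsilon> / 2" using \<epsilon>h by simp
    have "?B * \<theta> \<le> 1 / 40" 
    proof -
      have "0 \<le> ?B * \<tau>" using B \<tau>0 by (intro mult_nonneg_nonneg) auto
      then show ?thesis using Bt by (simp add: distrib_left)
    qed
    then have "?B * \<theta> * \<epsilon> \<le> 1 / 40 * \<epsilon>" using \<epsilon>0 by (intro mult_right_mono) auto
    then have 3: "2 * ?B * (\<theta> * \<epsilon>) \<le> \<epsilon> / 20" by simp
    show ?thesis using 1 2 3 h4 \<epsilon>0 h unfolding distrib_left by linarith
  qed
  have \<sigma>6: "6 * \<sigma> \<le> \<epsilon>" using \<sigma>h h4 h by simp
  have xD: "p \<in> Rn D" if "p \<in> Y" for p
    using Y(1) that typi by (auto simp: typical_sample_def)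
  have m3: "dist p (y (j p)) \<le> \<sigma>" if "p \<in> Y" for p using yd[OF j(1)[OF that]] j(2)[OF that] by simp
  have res: "hausdorff_dist M (underlying (tdc \<omega> D Y S)) \<le> 4 * Cd * \<epsilon>\<^sup>2 / \<rho> + 2 * ?B * (\<sigma> + \<theta> * \<epsilon>)
      \<and> ambient_isotopic D M (underlying (tdc \<omega> D Y S))"
    by (intro conjI tdc_stability[where m = "\<lambda>p. y (j p)" and \<theta> = \<theta> and \<sigma> = \<sigma> and \<epsilon> = \<epsilon>, OF bg d(2) Y(3,2,4)])
      (use xD yM(1) m3 pca \<epsilon>0 \<epsilon>2 \<sigma> \<sigma>6 \<theta>0 \<theta>1 s1 s2 cover in auto)
  show "ambient_isotopic D M (underlying K)" using res Y(7) by simp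
  have "\<sigma> \<le> \<epsilon>\<^sup>2 / \<rho>"
  proof -
    have "1 \<le> c2\<^sup>2" using c24 c2sq by simp
    then have "\<epsilon>\<^sup>2 / (c2\<^sup>2 * \<rho>) \<le> \<epsilon>\<^sup>2 / (1 * \<rho>)" using \<rho> c24 by (intro divide_left_mono mult_right_mono mult_pos_pos) auto
    then show ?thesis using sq by simp
  qed
  moreover have "\<theta> * \<epsilon> \<le> \<epsilon>\<^sup>2 / \<rho>"
  proof -
    have "2 * \<kappa> \<le> c2" 
    proof -
      have "1 * (1 + 2 * \<kappa>) \<le> 4 * ?B * (1 + 2 * \<kappa>)" using B \<kappa>0 by (intro mult_right_mono) auto
      from order.trans[OF this c2] show ?thesis by simp
    qed
    then have "2 * \<kappa> * \<epsilon> / (c2 * \<rho>) \<le> c2 * \<epsilon> / (c2 * \<rho>)" using \<epsilon>0 c24 \<rho> by (intro divide_right_mono mult_right_mono) auto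
    also have "\<dots> = \<epsilon> / \<rho>" using c24 by simp
    finally have "\<theta> * \<epsilon> \<le> \<epsilon> / \<rho> * \<epsilon>" using \<theta>\<epsilon> \<epsilon>0 by (intro mult_right_mono) auto
    then show ?thesis by (simp add: power2_eq_square)
  qed
  ultimately have "2 * ?B * (\<sigma> + \<theta> * \<epsilon>) \<le> 2 * ?B * (\<epsilon>\<^sup>2 / \<rho> + \<epsilon>\<^sup>2 / \<rho>)" using B by (intro mult_left_mono add_mono) auto
  then have "hausdorff_dist M (underlying K) \<le> 4 * Cd * \<epsilon>\<^sup>2 / \<rho> + 2 * ?B * (\<epsilon>\<^sup>2 / \<rho> + \<epsilon>\<^sup>2 / \<rho>)"
    using res Y(7) by simp
  also have "\<dots> = (4 * Cd + 4 * ?B) * \<epsilon>\<^sup>2 / \<rho>" by (simp add: add_divide_distrib distrib_right)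
  finally show "hausdorff_dist M (underlying K) \<le> (4 * Cd + 4 * ?B) * \<epsilon>\<^sup>2 / \<rho>" .
qed

end

section \<open>Rates, expectations and the choice of the constants\<close>

section \<open>Risk bounds\<close>

lemma vol_lower_le_upper: "1 \<le> d \<Longrightarrow> vol_lower d \<le> vol_upper d"
proof -
  assume d: "1 \<le> d"
  let ?v = "unit_ball_vol (real d)"
  have "(1::real) \<le> (4 * real d) ^ d" "(1::real) \<le> (8 * real d) ^ d" using d by (intro one_le_power; simp)+
  then have "?v / (4 * real d) ^ d \<le> ?v / 1" "?v * 1 \<le> ?v * (8 * real d) ^ d"
    by (intro divide_left_mono mult_left_mono; simp)+
  then show ?thesis unfolding vol_lower_def vol_upper_def by linarith
qed

text \<open>Replaces n - 1 in the bandwidth by n, at the cost of a factor 2 on one side.\<close>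

lemma bandwidth_bounds:
  assumes c1: "0 < c1" and d: "1 \<le> d" and n: "3 \<le> n"
  shows "0 < bandwidth c1 d n" "c1 * ln (real n) / real n \<le> bandwidth c1 d n ^ d"
    "c1 powr (1 / real d) * (ln (real n) / real n) powr (1 / real d) \<le> bandwidth c1 d n"
    "bandwidth c1 d n \<le> (2 * c1) powr (1 / real d) * (ln (real n) / real n) powr (1 / real d)"
proof -
  let ?l = "ln (real n)"
  have l: "0 < ?l" using n by simp
  have n1: "0 < real n - 1" "real n / 2 \<le> real n - 1" using n by simp_all
  have lo: "?l / real n \<le> ?l / (real n - 1)" using n1 l n by (intro divide_left_mono) auto
  have "?l / (real n - 1) \<le> ?l / (real n / 2)" using n1 l n by (intro divide_left_mono) auto
  also have "\<dots> = 2 * (?l / real n)" by simp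
  finally have hi: "?l / (real n - 1) \<le> 2 * (?l / real n)" .
  have pos: "0 < c1 * (?l / (real n - 1))" using c1 l n1 by simp
  then show "0 < bandwidth c1 d n" unfolding bandwidth_def by (metis less_irrefl powr_gt_zero)
  have root: "(y powr (1 / real d)) ^ d = y" if "0 < y" for y :: real
    using that d by (simp add: powr_realpow[symmetric] powr_powr)
  have "bandwidth c1 d n ^ d = c1 * (?l / (real n - 1))"
    unfolding bandwidth_def by (rule root[OF pos])
  moreover have "c1 * (?l / real n) \<le> c1 * (?l / (real n - 1))" using lo c1 by (intro mult_left_mono) auto
  ultimately show "c1 * ?l / real n \<le> bandwidth c1 d n ^ d" by simp
  have "c1 powr (1 / real d) * (?l / real n) powr (1 / real d) = (c1 * (?l / real n)) powr (1 / real d)"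
    by (rule powr_mult[symmetric])
  also have "\<dots> \<le> bandwidth c1 d n"
    unfolding bandwidth_def using lo c1 l by (intro powr_mono2 mult_left_mono) auto
  finally show "c1 powr (1 / real d) * (?l / real n) powr (1 / real d) \<le> bandwidth c1 d n" .
  have "bandwidth c1 d n \<le> (2 * c1 * (?l / real n)) powr (1 / real d)"
    unfolding bandwidth_def using mult_left_mono[OF hi, of c1] c1 pos by (intro powr_mono2) (auto simp: mult_ac)
  also have "\<dots> = (2 * c1) powr (1 / real d) * (?l / real n) powr (1 / real d)"
    by (rule powr_mult)
  finally show "bandwidth c1 d n \<le> (2 * c1) powr (1 / real d) * (?l / real n) powr (1 / real d)" .
qed

lemma inner_prob_ge:
  assumes "prob_space N" "E \<in> sets N" "E \<subseteq> A" shows "measure N E \<le> inner_prob N A"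
  unfolding inner_prob_def
proof (rule cSUP_upper)
  show "bdd_above (measure N ` {B \<in> sets N. B \<subseteq> A})"
    using prob_space.prob_le_1[OF assms(1)] by (intro bdd_aboveI2)
qed (use assms in auto)

lemma inner_prob_le_1:
  assumes "prob_space N" shows "inner_prob N A \<le> 1"
  unfolding inner_prob_def
  by (rule cSUP_least) (use prob_space.prob_le_1[OF assms] in auto)

text \<open>\<open>f\<close> need not be measurable, so it is dominated by a step function:
  \<open>r\<close> on \<open>E\<close>, \<open>s\<close> on the rest of the almost sure event
  \<open>G\<close>, and \<top> on a null set.\<close>

lemma upper_expectation_le:
  assumes N: "prob_space N" and E: "E \<in> sets N" "1 - \<delta> \<le> measure N E" and G: "G \<in> sets N" "measure N G = 1"
    and f: "\<And>x. x \<in> E \<Longrightarrow> f x \<le> ennreal r" "\<And>x. x \<in> G \<Longrightarrow> f x \<le> ennreal s" and rs: "0 \<le> r" "0 \<le> s"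
  shows "upper_expectation N f \<le> ennreal (r + s * \<delta>)"
proof -
  interpret prob_space N by (rule N)
  define g where "g x = (if x \<in> E then ennreal r else if x \<in> G then ennreal s else \<top>)" for x
  have [measurable]: "E \<in> sets N" "G \<in> sets N" by (fact E G)+
  have "g \<in> borel_measurable N" unfolding g_def by measurable
  moreover have "\<forall>x\<in>space N. f x \<le> g x" using f by (simp add: g_def)
  ultimately have "upper_expectation N f \<le> (\<integral>\<^sup>+x. g x \<partial>N)"
    unfolding upper_expectation_def by (intro INF_lower) auto
  also have "\<dots> \<le> (\<integral>\<^sup>+x. ennreal r + ennreal s * indicator (space N - E) x \<partial>N)"
  proof (rule nn_integral_mono_AE)
    have "AE x in N. x \<in> G" using prob_eq_1[OF G(1)] G(2) by simp
    then show "AE x in N. g x \<le> ennreal r + ennreal s * indicator (space N - E) x"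
      using AE_space
    proof eventually_elim
      case (elim x) then show ?case by (cases "x \<in> E") (auto simp: g_def)
    qed
  qed
  also have "\<dots> = ennreal r + ennreal s * emeasure N (space N - E)"
    by (subst nn_integral_add) (auto simp: nn_integral_cmult_indicator emeasure_space_1)
  also have "\<dots> = ennreal (r + s * (1 - prob E))"
    using rs by (simp add: emeasure_eq_measure prob_compl ennreal_mult ennreal_plus)
  also have "\<dots> \<le> ennreal (r + s * \<delta>)"
    using E(2) rs by (intro ennreal_leI add_left_mono mult_left_mono) auto
  finally show ?thesis .
qed

definition diameter_bound :: "nat \<Rightarrow> real \<Rightarrow> real \<Rightarrow> real" where
  "diameter_bound d fmin \<rho> = \<rho> / 20 / (fmin * vol_lower d * (\<rho> / 40) ^ d)"

text \<open>The term \<open>Sup {}\<close> covers the junk value of \<open>hausdorff_dist\<close> at an empty complex.\<close>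

definition crude_bound :: "nat \<Rightarrow> real \<Rightarrow> real \<Rightarrow> real" where
  "crude_bound d fmin \<rho> = diameter_bound d fmin \<rho> + \<rho> + \<bar>Sup ({} :: real set)\<bar>"

context noisy_law
begin

lemma diameter_bound_nonneg: "0 \<le> diameter_bound d fmin \<rho>"
  using fmin vol_lower_pos[OF d] \<rho> by (simp add: diameter_bound_def)

text \<open>Outside the typical event the complex still lies in the convex hull of points within
  \<sigma> < \<rho> of \<open>M\<close>. Balls are convex, and \<open>diam_bound\<close> limits the
  diameter of \<open>M\<close>.\<close>

lemma hausdorff_dist_crude:
  assumes x: "x \<in> near_samples n" and K: "underlying K \<subseteq> convex hull (x ` {1..n})" and \<sigma>\<rho>: "\<sigma> < \<rho>"
  shows "hausdorff_dist M (underlying K) \<le> crude_bound d fmin \<rho>"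
proof (cases "underlying K = {}")
  case True
  \<comment> \<open>\<open>infdist\<close> to the empty set is 0, which leaves only the supremum
    over no points.\<close>
  have "(SUP a\<in>M. infdist a {}) = (0::real)" using nonempty by (simp add: infdist_def)
  then have "hausdorff_dist M (underlying K) = max 0 (Sup ({} :: real set))"
    by (simp add: hausdorff_dist_def True)
  then show ?thesis using diameter_bound_nonneg \<rho> by (simp add: crude_bound_def)
next
  case False
  have far: "dist a b \<le> diameter_bound d fmin \<rho> + \<rho>" if a: "a \<in> M" and b: "b \<in> underlying K" for a b
  proof -
    have "x ` {1..n} \<subseteq> cball a (diameter_bound d fmin \<rho> + \<rho>)"
    proof
      fix p assume "p \<in> x ` {1..n}"
      then have p: "infdist p M \<le> \<sigma>" using x by (auto simp: near_samples_def)
      obtain c where c: "c \<in> M" "infdist p M = dist p c" using compact_nearest[OF compact nonempty] .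
      have "dist a p \<le> dist a c + dist p c" by (rule dist_triangle2)
      then show "p \<in> cball a (diameter_bound d fmin \<rho> + \<rho>)"
        using diam_bound[OF a c(1)] p c(2) \<sigma>\<rho> by (simp add: diameter_bound_def)
    qed
    then have "convex hull (x ` {1..n}) \<subseteq> cball a (diameter_bound d fmin \<rho> + \<rho>)"
      using convex_cball by (rule hull_minimal)
    then show ?thesis using b K by auto
  qed
  obtain a0 b0 where ab: "a0 \<in> M" "b0 \<in> underlying K" using nonempty False by blast
  have "hausdorff_dist M (underlying K) \<le> diameter_bound d fmin \<rho> + \<rho>"
  proof (rule hausdorff_dist_leI[OF nonempty False])
    show "infdist a (underlying K) \<le> diameter_bound d fmin \<rho> + \<rho>" if "a \<in> M" for a
      using infdist_le[OF ab(2), of a] far[OF that ab(2)] by linarith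
    show "infdist b M \<le> diameter_bound d fmin \<rho> + \<rho>" if "b \<in> underlying K" for b
      using infdist_le[OF ab(1), of b] far[OF ab(1) that] by (simp add: dist_commute)
  qed
  then show ?thesis by (simp add: crude_bound_def)
qed

text \<open>The lower bound on \<open>c1\<close> makes n h^d a multiple of ln n large enough for the
  union bound. \<kappa> is 25 d times the ratio of the upper to the lower count, in which n and h
  cancel: 100 is the quotient of 4 h and h/25.\<close>

lemma tdc_estimate_event:
  assumes bg: "bg_holds k d \<omega> \<epsilon>d Cd" and dD: "d < D" and n: "3 \<le> n"
    and c1: "16 * 40 ^ d / (fmin * vol_lower d) \<le> c1"
    and \<kappa>: "\<kappa> = real d * (25 * (16 * (fmax * vol_upper d) * 100 ^ d / (fmin * vol_lower d)))"
    and c2: "4 * bump_bound * (1 + 2 * \<kappa>) \<le> c2"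
    and thr: "\<sigma> / bandwidth c1 d n + bandwidth c1 d n / \<rho> \<le> scale_threshold \<kappa> c2 \<epsilon>d"
    and Mhat: "\<And>x. x \<in> {1..n} \<rightarrow>\<^sub>E Rn D \<Longrightarrow> tdc_estimate \<omega> D d c1 c2 \<rho> \<sigma> n x (Mhat x)"
  obtains E where "E \<in> sets (PiM {1..n} (\<lambda>_. Q))" "1 - 1 / real n ^ 3 \<le> measure (PiM {1..n} (\<lambda>_. Q)) E"
    "\<And>x. x \<in> E \<Longrightarrow> hausdorff_dist M (underlying (Mhat x))
      \<le> (4 * Cd + 4 * bump_bound) * (net_scale c2 \<rho> \<sigma> (bandwidth c1 d n))\<^sup>2 / \<rho>"
    "\<And>x. x \<in> E \<Longrightarrow> ambient_isotopic D M (underlying (Mhat x))" "E \<subseteq> near_samples n"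
proof -
  let ?vl = "fmin * vol_lower d" and ?vu = "fmax * vol_upper d"
  define h where "h = bandwidth c1 d n"
  define p0 where "p0 = ?vl * (h / 25) ^ d"
  define p1 where "p1 = ?vu * (4 * h) ^ d"
  have vl: "0 < ?vl" using fmin vol_lower_pos[OF d] by simp
  have vu: "?vl \<le> ?vu" using fmin fmax vol_lower_le_upper[OF d] vol_lower_pos[OF d] by (intro mult_mono) auto
  have c10: "0 < c1" using less_le_trans[OF _ c1] vl by simp
  note bw = bandwidth_bounds[OF c10 d n, folded h_def]
  have h0: "0 < h" by (rule bw(1))
  have ln1: "1 \<le> ln (real n)"
  proof -
    have "exp 1 \<le> real n" using exp_le n by linarith
    then show ?thesis using n by (simp add: ln_ge_iff)
  qed
  have n0: "0 < real n" and n2: "2 \<le> n" using n by simp_all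
  have c1': "16 * 40 ^ d \<le> c1 * ?vl" using c1 vl by (simp add: pos_divide_le_eq)
  have nhd: "c1 * ln (real n) \<le> real n * h ^ d" using bw(2) n0 by (simp add: pos_divide_le_eq mult.commute)
  \<comment> \<open>The factor \<open>40 ^ d\<close> covers both the radius h/25 in
    \<open>p0\<close> and the packing radius h/40 of the net.\<close>
  have vhd: "16 * 40 ^ d * ln (real n) \<le> real n * (?vl * h ^ d)"
  proof -
    have "16 * 40 ^ d * ln (real n) \<le> c1 * ?vl * ln (real n)" using c1' ln1 by (intro mult_right_mono) auto
    also have "\<dots> = ?vl * (c1 * ln (real n))" by simp
    also have "\<dots> \<le> ?vl * (real n * h ^ d)" using nhd vl by (intro mult_left_mono) auto
    finally show ?thesis by (simp add: mult_ac)
  qed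
  have q0: "16 * ln (real n) \<le> real n * p0"
  proof -
    have "16 * 25 ^ d * ln (real n) \<le> 16 * 40 ^ d * ln (real n)"
      using ln1 by (intro mult_right_mono mult_left_mono power_mono) auto
    then have "16 * 25 ^ d * ln (real n) \<le> real n * (?vl * h ^ d)" using vhd by linarith
    then have "16 * ln (real n) \<le> real n * (?vl * h ^ d) / 25 ^ d" by (simp add: pos_le_divide_eq mult_ac)
    then show ?thesis by (simp add: p0_def power_divide)
  qed
  have "p0 \<le> p1"
    unfolding p0_def p1_def by (rule mult_mono[OF vu power_mono]) (use vu vl h0 in linarith | use h0 in simp)+
  then have q1: "16 * ln (real n) \<le> real n * p1" using q0 mult_left_mono[of p0 p1 "real n"] by linarith
  have K: "1 / (?vl * (h / 40) ^ d) \<le> real n / 2"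
  proof -
    have "2 * 40 ^ d * 1 \<le> 16 * 40 ^ d * ln (real n)" using ln1 by (intro mult_mono) auto
    then have "2 * 40 ^ d \<le> real n * (?vl * h ^ d)" using vhd by linarith
    then have "2 \<le> real n * (?vl * (h / 40) ^ d)" by (simp add: power_divide pos_le_divide_eq)
    then show ?thesis using vl h0 by (simp add: pos_divide_le_eq)
  qed
  have \<tau>: "\<sigma> / h + h / \<rho> \<le> 1 / 2000" using thr by (simp add: scale_threshold_def h_def)
  have "0 \<le> \<sigma> / h" "0 \<le> h / \<rho>" using \<sigma> h0 \<rho> by auto
  then have "\<sigma> / h \<le> 1 / 2000" "h / \<rho> \<le> 1 / 2000" using \<tau> by linarith+
  then have \<sigma>h: "\<sigma> \<le> h / 100" and h\<rho>: "h \<le> \<rho> / 100" using h0 \<rho> by (simp_all add: pos_divide_le_eq)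
  obtain E where E: "E \<in> sets (PiM {1..n} (\<lambda>_. Q))" "E \<subseteq> near_samples n"
    "\<forall>x\<in>E. typical_sample D M n \<sigma> h (real n * p0 / 4) (4 * real n * p1) x"
    "1 - 1 / real n ^ 3 \<le> measure (PiM {1..n} (\<lambda>_. Q)) E"
    using prob_typical_sample[OF h0 h\<rho> \<sigma>h p0_def p1_def q0 q1 n2 K] by blast
  have cl: "0 < real n * p0 / 4" using n0 vl h0 by (simp add: p0_def)
  have ratio: "real d * (25 * (4 * real n * p1 / (real n * p0 / 4))) \<le> \<kappa>"
  proof -
    have "4 * real n * p1 / (real n * p0 / 4) = 16 * p1 / p0" using n0 by simp
    also have "\<dots> = 16 * ?vu * 100 ^ d / ?vl"
    proof -
      have "4 * h = 100 * (h / 25)" by simp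
      then have *: "(4 * h) ^ d = 100 ^ d * (h / 25) ^ d" by (simp only: power_mult_distrib)
      have cancel: "16 * (v * (a * c)) / (w * c) = 16 * v * a / w" if "c \<noteq> 0" for v a c w :: real
        using that by simp
      show ?thesis unfolding p0_def p1_def * by (rule cancel) (use h0 in simp)
    qed
    finally show ?thesis by (simp only: \<kappa> order_refl)
  qed
  have est: "tdc_estimate \<omega> D d c1 c2 \<rho> \<sigma> n x (Mhat x)" if "x \<in> E" for x
    using that E(2) by (intro Mhat) (auto simp: near_samples_def space_PiM PiE_iff)
  have res: "hausdorff_dist M (underlying (Mhat x)) \<le> (4 * Cd + 4 * bump_bound) * (net_scale c2 \<rho> \<sigma> (bandwidth c1 d n))\<^sup>2 / \<rho>"
    "ambient_isotopic D M (underlying (Mhat x))" if x: "x \<in> E" for x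
    by (fact tdc_estimate_typical[OF bg d dD n2 bspec[OF E(3) x, unfolded h_def] cl ratio c2 h0[unfolded h_def] \<sigma> thr est[OF x]])+
  show ?thesis by (rule that[OF E(1,4) res E(2)])
qed

end

lemma net_scale_rate:
  assumes c1: "0 < c1" and c2: "0 \<le> c2" and d: "1 \<le> d" and n: "3 \<le> n" and \<rho>: "0 < \<rho>" and \<sigma>: "0 \<le> \<sigma>"
    and lam: "\<sigma> \<le> lam * (ln (real n) / real n) powr (1 / real d)"
  shows "\<sigma> / bandwidth c1 d n \<le> lam / c1 powr (1 / real d)" "0 \<le> lam"
    "(net_scale c2 \<rho> \<sigma> (bandwidth c1 d n))\<^sup>2
      \<le> c2\<^sup>2 * (((2 * c1) powr (1 / real d))\<^sup>2 + (\<rho> / c1 powr (1 / real d))\<^sup>2)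
          * max ((ln (real n) / real n) powr (2 / real d)) (lam\<^sup>2)"
proof -
  let ?L = "(ln (real n) / real n) powr (1 / real d)" and ?h = "bandwidth c1 d n"
  let ?R = "max ((ln (real n) / real n) powr (2 / real d)) (lam\<^sup>2)"
  let ?a = "(2 * c1) powr (1 / real d)" and ?b = "c1 powr (1 / real d)"
  have L: "0 < ?L" using n by simp
  have b: "0 < ?b" using c1 by simp
  note bw = bandwidth_bounds[OF c1 d n]
  \<comment> \<open>The theorem bounds \<open>lam\<close> only from above; its sign follows from 0
    \<le> \<sigma>.\<close>
  have "0 \<le> lam * ?L" using \<sigma> lam by linarith
  then show lam0: "0 \<le> lam" using L by (simp add: zero_le_mult_iff)
  have "\<sigma> / ?h \<le> lam * ?L / (?b * ?L)"
    using lam bw(3) L b \<sigma> by (intro frac_le mult_pos_pos) auto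
  also have "\<dots> = lam / ?b" using L by simp
  finally show s: "\<sigma> / ?h \<le> lam / ?b" .
  have L2: "?L\<^sup>2 = (ln (real n) / real n) powr (2 / real d)"
    by (simp add: power2_eq_square powr_add[symmetric])
  have h2: "?h\<^sup>2 \<le> ?a\<^sup>2 * ?R"
  proof -
    have "?h\<^sup>2 \<le> (?a * ?L)\<^sup>2" using bw(1,4) by (intro power_mono) auto
    also have "\<dots> \<le> ?a\<^sup>2 * ?R" unfolding power_mult_distrib L2 by (intro mult_left_mono) auto
    finally show ?thesis .
  qed
  have s2: "(\<rho> * \<sigma> / ?h)\<^sup>2 \<le> (\<rho> / ?b)\<^sup>2 * ?R"
  proof -
    have "\<rho> * (\<sigma> / ?h) \<le> \<rho> * (lam / ?b)" using s \<rho> by (intro mult_left_mono) auto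
    then have "(\<rho> * \<sigma> / ?h)\<^sup>2 \<le> (\<rho> / ?b * lam)\<^sup>2" using \<rho> \<sigma> bw(1) by (intro power_mono) auto
    also have "\<dots> \<le> (\<rho> / ?b)\<^sup>2 * ?R" unfolding power_mult_distrib by (intro mult_left_mono) auto
    finally show ?thesis .
  qed
  have "(max ?h (\<rho> * \<sigma> / ?h))\<^sup>2 \<le> ?h\<^sup>2 + (\<rho> * \<sigma> / ?h)\<^sup>2" by (simp add: max_def)
  also have "\<dots> \<le> (?a\<^sup>2 + (\<rho> / ?b)\<^sup>2) * ?R" unfolding distrib_right by (rule add_mono[OF h2 s2])
  finally have "c2\<^sup>2 * (max ?h (\<rho> * \<sigma> / ?h))\<^sup>2 \<le> c2\<^sup>2 * ((?a\<^sup>2 + (\<rho> / ?b)\<^sup>2) * ?R)"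
    by (intro mult_left_mono) auto
  then show "(net_scale c2 \<rho> \<sigma> ?h)\<^sup>2 \<le> c2\<^sup>2 * (?a\<^sup>2 + (\<rho> / ?b)\<^sup>2) * ?R"
    by (simp only: net_scale_def power_mult_distrib mult.assoc)
qed

text \<open>Lets the failure probability, which multiplies the crude bound in the expectation, be
  absorbed by the rate. The base is at most 1, so d = 1 with exponent 2 is the worst case.\<close>

lemma inverse_cube_le_rate:
  assumes d: "1 \<le> d" and n: "3 \<le> n" shows "1 / real n ^ 3 \<le> (ln (real n) / real n) powr (2 / real d)"
proof -
  have "exp 1 \<le> real n" using exp_le n by linarith
  then have ln1: "1 \<le> ln (real n)" using n by (simp add: ln_ge_iff)
  let ?x = "ln (real n) / real n"
  have x: "0 < ?x" "?x \<le> 1" "1 / real n \<le> ?x"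
    using ln1 n ln_le_minus_one[of "real n"] by (auto simp: divide_le_eq_1 divide_right_mono)
  have "1 / real n ^ 3 \<le> 1 / real n ^ 2" using n by (intro divide_left_mono power_increasing) auto
  also have "\<dots> = (1 / real n)\<^sup>2" by (simp add: power_divide)
  also have "\<dots> \<le> ?x\<^sup>2" using x(3) by (intro power_mono) auto
  also have "\<dots> = ?x powr 2" using x(1) by (simp add: powr_numeral)
  also have "\<dots> \<le> ?x powr (2 / real d)" using x(1,2) d by (intro powr_mono') (auto simp: divide_le_eq)
  finally show ?thesis .
qed

lemma bandwidth_tendsto_0: assumes "0 < c1" "1 \<le> d" shows "(\<lambda>n. bandwidth c1 d n) \<longlonglongrightarrow> 0"
proof (rule tendsto_sandwich)
  show "eventually (\<lambda>n. 0 \<le> bandwidth c1 d n) sequentially" by (simp add: bandwidth_def)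
  show "eventually (\<lambda>n. bandwidth c1 d n \<le> (2 * c1) powr (1 / real d) * (ln (real n) / real n) powr (1 / real d)) sequentially"
    using eventually_ge_at_top[of 3] by eventually_elim (rule bandwidth_bounds(4)[OF assms])
  have "(\<lambda>n. (ln (real n) / real n) powr (1 / real d)) \<longlonglongrightarrow> 0"
  proof (rule tendsto_zero_powrI[OF lim_ln_over_n tendsto_const])
    show "eventually (\<lambda>n. 0 \<le> ln (real n) / real n) sequentially"
      using eventually_ge_at_top[of 1] by eventually_elim simp
  qed (use assms in simp)
  from tendsto_mult_left[OF this]
  show "(\<lambda>n. (2 * c1) powr (1 / real d) * (ln (real n) / real n) powr (1 / real d)) \<longlonglongrightarrow> 0" by simp
qed simp

theorem theorem7:
  fixes k :: enat and d :: nat and fmin fmax :: real and \<omega> :: weight_assignment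
  assumes "1 \<le> k" and "1 \<le> d" and "0 < fmin" and "fmin \<le> fmax"
    and "boissonnat_ghosh k d \<omega>"
  shows
    "\<exists>c1_min>0. \<exists>c2_min>0. \<forall>c1\<ge>c1_min. \<forall>c2\<ge>c2_min.
       (\<forall>D>d. \<forall>\<rho>>0. \<forall>\<sigma>\<in>{0..<\<rho>}. \<forall>n\<ge>2. \<forall>x\<in>{1..n} \<rightarrow>\<^sub>E Rn D. \<forall>K.
          tdc_estimate \<omega> D d c1 c2 \<rho> \<sigma> n x K \<longrightarrow> abstract_complex K \<and> \<Union>K \<subseteq> x ` {1..n}) \<and>
       (\<exists>lam_star>0. \<forall>\<rho>>0. \<exists>C>0. \<exists>C'>0. \<forall>D>d. \<forall>(\<sigma> :: nat \<Rightarrow> real) (lam :: nat \<Rightarrow> real).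
          (\<forall>n\<ge>2. 0 \<le> \<sigma> n \<and> \<sigma> n < \<rho> \<and> lam n \<le> lam_star \<and>
                  \<sigma> n \<le> lam n * (ln (real n) / real n) powr (1 / real d)) \<longrightarrow>
          (\<forall>Mhat :: nat \<Rightarrow> (nat \<Rightarrow> fvec) \<Rightarrow> fvec set set.
             (\<forall>n\<ge>2. \<forall>x\<in>{1..n} \<rightarrow>\<^sub>E Rn D. tdc_estimate \<omega> D d c1 c2 \<rho> (\<sigma> n) n x (Mhat n x)) \<longrightarrow>
             (\<forall>Q M. (\<forall>n\<ge>2. (Q n, M n) \<in> noisy_model k D d fmin fmax \<rho> (\<sigma> n)) \<longrightarrow>
                (\<lambda>n. inner_prob (PiM {1..n} (\<lambda>_. Q n))
                       {x \<in> space (PiM {1..n} (\<lambda>_. Q n)).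
                          hausdorff_dist (M n) (underlying (Mhat n x))
                            \<le> C * max ((ln (real n) / real n) powr (2 / real d)) ((lam n)\<^sup>2) \<and>
                          ambient_isotopic D (M n) (underlying (Mhat n x))}) \<longlonglongrightarrow> 1) \<and>
             (\<forall>\<^sub>F n in sequentially.
                (SUP (Q, M) \<in> noisy_model k D d fmin fmax \<rho> (\<sigma> n).
                   upper_expectation (PiM {1..n} (\<lambda>_. Q))
                     (\<lambda>x. ennreal (hausdorff_dist M (underlying (Mhat n x)))))
                \<le> ennreal (C' * max ((ln (real n) / real n) powr (2 / real d)) ((lam n)\<^sup>2)))))"
proof -
  obtain \<epsilon>d Cd where bg: "bg_holds k d \<omega> \<epsilon>d Cd" by (rule boissonnat_ghosh_bg_holds[OF assms(5)])
  define \<kappa> where "\<kappa> = real d * (25 * (16 * (fmax * vol_upper d) * 100 ^ d / (fmin * vol_lower d)))"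
  define c1_min where "c1_min = 16 * 40 ^ d / (fmin * vol_lower d)"
  define c2_min where "c2_min = 4 * bump_bound * (1 + 2 * \<kappa>)"
  have B: "1 \<le> bump_bound" by (rule bump_bound(1))
  have \<epsilon>d: "0 < \<epsilon>d" "0 < Cd" using bg by (auto simp: bg_holds_def)
  have vl: "0 < fmin * vol_lower d" using assms vol_lower_pos by simp
  have \<kappa>0: "0 \<le> \<kappa>" using vl assms vol_upper_pos[of d] by (simp add: \<kappa>_def)
  have c10: "0 < c1_min" using vl by (simp add: c1_min_def)
  have c20: "0 < c2_min" using B \<kappa>0 by (simp add: c2_min_def)
  show ?thesis
  proof (rule exI[of _ c1_min], rule conjI[OF c10], rule exI[of _ c2_min], rule conjI[OF c20], intro allI impI, rule conjI)
    fix c1 c2 :: real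
    show "\<forall>D>d. \<forall>\<rho>>0. \<forall>\<sigma>\<in>{0..<\<rho>}. \<forall>n\<ge>2. \<forall>x\<in>{1..n} \<rightarrow>\<^sub>E Rn D. \<forall>K.
        tdc_estimate \<omega> D d c1 c2 \<rho> \<sigma> n x K \<longrightarrow> abstract_complex K \<and> \<Union>K \<subseteq> x ` {1..n}"
      by (intro allI ballI impI conjI) (erule tdc_estimate_complex(1,2))+
  next
    fix c1 c2 :: real assume c1: "c1_min \<le> c1" and c2: "c2_min \<le> c2"
    have c1p: "0 < c1" and c2p: "0 < c2" using c1 c2 c10 c20 by auto
    \<comment> \<open>This threshold is fixed before \<rho>, so the witness
      \<open>\<tau>0 / 2 * b\<close> for \<open>lam_star\<close> is free of \<rho>. Half of the
      threshold is for \<sigma>/h, the other half for h/\<rho> at large n.\<close>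
    define \<tau>0 where "\<tau>0 = scale_threshold \<kappa> c2 \<epsilon>d"
    define b where "b = c1 powr (1 / real d)"
    have b: "0 < b" using c1p by (simp add: b_def)
    have \<tau>0: "0 < \<tau>0" unfolding \<tau>0_def scale_threshold_def using B \<kappa>0 \<epsilon>d c2p by auto
    \<comment> \<open>The bound of \<open>tdc_estimate_event\<close>, with \<epsilon>^2 replaced by
      its rate from \<open>net_scale_rate\<close>.\<close>
    define C where "C \<rho> = (4 * Cd + 4 * bump_bound) * (c2\<^sup>2 * (((2 * c1) powr (1 / real d))\<^sup>2 + (\<rho> / b)\<^sup>2)) / \<rho>" for \<rho>
    have C: "0 < C \<rho>" if "0 < \<rho>" for \<rho>
      unfolding C_def using that \<epsilon>d B c1p c2p by (intro divide_pos_pos mult_pos_pos add_pos_nonneg) auto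
    have crude: "0 \<le> crude_bound d fmin \<rho>" if "0 < \<rho>" for \<rho>
      using that vl by (simp add: crude_bound_def diameter_bound_def)
    show "\<exists>lam_star>0. \<forall>\<rho>>0. \<exists>C>0. \<exists>C'>0. \<forall>D>d. \<forall>(\<sigma> :: nat \<Rightarrow> real) (lam :: nat \<Rightarrow> real).
          (\<forall>n\<ge>2. 0 \<le> \<sigma> n \<and> \<sigma> n < \<rho> \<and> lam n \<le> lam_star \<and>
                  \<sigma> n \<le> lam n * (ln (real n) / real n) powr (1 / real d)) \<longrightarrow>
          (\<forall>Mhat :: nat \<Rightarrow> (nat \<Rightarrow> fvec) \<Rightarrow> fvec set set.
             (\<forall>n\<ge>2. \<forall>x\<in>{1..n} \<rightarrow>\<^sub>E Rn D. tdc_estimate \<omega> D d c1 c2 \<rho> (\<sigma> n) n x (Mhat n x)) \<longrightarrow>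
             (\<forall>Q M. (\<forall>n\<ge>2. (Q n, M n) \<in> noisy_model k D d fmin fmax \<rho> (\<sigma> n)) \<longrightarrow>
                (\<lambda>n. inner_prob (PiM {1..n} (\<lambda>_. Q n))
                       {x \<in> space (PiM {1..n} (\<lambda>_. Q n)).
                          hausdorff_dist (M n) (underlying (Mhat n x))
                            \<le> C * max ((ln (real n) / real n) powr (2 / real d)) ((lam n)\<^sup>2) \<and>
                          ambient_isotopic D (M n) (underlying (Mhat n x))}) \<longlonglongrightarrow> 1) \<and>
             (\<forall>\<^sub>F n in sequentially.
                (SUP (Q, M) \<in> noisy_model k D d fmin fmax \<rho> (\<sigma> n).
                   upper_expectation (PiM {1..n} (\<lambda>_. Q))
                     (\<lambda>x. ennreal (hausdorff_dist M (underlying (Mhat n x)))))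
                \<le> ennreal (C' * max ((ln (real n) / real n) powr (2 / real d)) ((lam n)\<^sup>2))))"
    proof (rule exI[of _ "\<tau>0 / 2 * b"], rule conjI, goal_cases)
      case 1 show ?case using \<tau>0 b by simp
    next
      case 2 show ?case
      proof (intro allI impI)
        fix \<rho> :: real assume \<rho>: "0 < \<rho>"
        show "\<exists>C>0. \<exists>C'>0. \<forall>D>d. \<forall>(\<sigma> :: nat \<Rightarrow> real) (lam :: nat \<Rightarrow> real).
          (\<forall>n\<ge>2. 0 \<le> \<sigma> n \<and> \<sigma> n < \<rho> \<and> lam n \<le> \<tau>0 / 2 * b \<and>
                  \<sigma> n \<le> lam n * (ln (real n) / real n) powr (1 / real d)) \<longrightarrow>
          (\<forall>Mhat :: nat \<Rightarrow> (nat \<Rightarrow> fvec) \<Rightarrow> fvec set set.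
             (\<forall>n\<ge>2. \<forall>x\<in>{1..n} \<rightarrow>\<^sub>E Rn D. tdc_estimate \<omega> D d c1 c2 \<rho> (\<sigma> n) n x (Mhat n x)) \<longrightarrow>
             (\<forall>Q M. (\<forall>n\<ge>2. (Q n, M n) \<in> noisy_model k D d fmin fmax \<rho> (\<sigma> n)) \<longrightarrow>
                (\<lambda>n. inner_prob (PiM {1..n} (\<lambda>_. Q n))
                       {x \<in> space (PiM {1..n} (\<lambda>_. Q n)).
                          hausdorff_dist (M n) (underlying (Mhat n x))
                            \<le> C * max ((ln (real n) / real n) powr (2 / real d)) ((lam n)\<^sup>2) \<and>
                          ambient_isotopic D (M n) (underlying (Mhat n x))}) \<longlonglongrightarrow> 1) \<and>
             (\<forall>\<^sub>F n in sequentially.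
                (SUP (Q, M) \<in> noisy_model k D d fmin fmax \<rho> (\<sigma> n).
                   upper_expectation (PiM {1..n} (\<lambda>_. Q))
                     (\<lambda>x. ennreal (hausdorff_dist M (underlying (Mhat n x)))))
                \<le> ennreal (C' * max ((ln (real n) / real n) powr (2 / real d)) ((lam n)\<^sup>2))))"
        \<comment> \<open>The constant for the expectation adds the crude bound, paid on the
          exceptional event.\<close>
        proof (rule exI[of _ "C \<rho>"], rule conjI[OF C[OF \<rho>]], rule exI[of _ "C \<rho> + crude_bound d fmin \<rho>"],
            rule conjI, goal_cases)
          case 1 show ?case using C[OF \<rho>] crude[OF \<rho>] by simp
        next
          case 2 show ?case
          proof (intro allI impI)
            fix D :: nat and \<sigma> lam :: "nat \<Rightarrow> real" and Mhat :: "nat \<Rightarrow> (nat \<Rightarrow> fvec) \<Rightarrow> fvec set set"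
            assume D: "d < D"
              and sl: "\<forall>n\<ge>2. 0 \<le> \<sigma> n \<and> \<sigma> n < \<rho> \<and> lam n \<le> \<tau>0 / 2 * b \<and>
                  \<sigma> n \<le> lam n * (ln (real n) / real n) powr (1 / real d)"
              and Mh: "\<forall>n\<ge>2. \<forall>x\<in>{1..n} \<rightarrow>\<^sub>E Rn D. tdc_estimate \<omega> D d c1 c2 \<rho> (\<sigma> n) n x (Mhat n x)"
            let ?R = "\<lambda>n. max ((ln (real n) / real n) powr (2 / real d)) ((lam n)\<^sup>2)"
            let ?N = "\<lambda>n Q. PiM {1..n} (\<lambda>_. Q :: fvec measure)"
            \<comment> \<open>Serves both claims: \<open>E\<close> carries the rate, while
              \<open>G\<close> has full measure and carries the crude bound. The statement is for a
              fixed n and every law of the model, which covers the supremum.\<close>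
            have event: "\<exists>E G. E \<in> sets (?N n Q) \<and> G \<in> sets (?N n Q) \<and> measure (?N n Q) G = 1 \<and>
                1 - 1 / real n ^ 3 \<le> measure (?N n Q) E \<and> prob_space (?N n Q) \<and>
                (\<forall>x\<in>E. hausdorff_dist M (underlying (Mhat n x)) \<le> C \<rho> * ?R n \<and>
                   ambient_isotopic D M (underlying (Mhat n x))) \<and>
                (\<forall>x\<in>G. hausdorff_dist M (underlying (Mhat n x)) \<le> crude_bound d fmin \<rho>)"
              if n: "3 \<le> n" and hn: "bandwidth c1 d n \<le> \<rho> * (\<tau>0 / 2)"
                and QM: "(Q, M) \<in> noisy_model k D d fmin fmax \<rho> (\<sigma> n)" for n Q M
            proof -
              have sn: "0 \<le> \<sigma> n" "\<sigma> n < \<rho>" "lam n \<le> \<tau>0 / 2 * b"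
                "\<sigma> n \<le> lam n * (ln (real n) / real n) powr (1 / real d)"
                using sl n by auto
              obtain Q0 \<mu> where "noisy_law k D d M \<rho> fmin fmax Q0 (\<sigma> n) \<mu> Q"
                by (rule noisy_modelE[OF QM assms(1-4) \<rho> sn(1)])
              then interpret L: noisy_law k D d M \<rho> fmin fmax Q0 "\<sigma> n" \<mu> Q .
              note rate = net_scale_rate[OF c1p less_imp_le[OF c2p] assms(2) n \<rho> sn(1,4)]
              have "lam n / b \<le> \<tau>0 / 2" using sn(3) b by (simp add: pos_divide_le_eq)
              moreover have "bandwidth c1 d n / \<rho> \<le> \<tau>0 / 2" using hn \<rho> by (simp add: pos_divide_le_eq mult.commute)
              ultimately have thr: "\<sigma> n / bandwidth c1 d n + bandwidth c1 d n / \<rho> \<le> scale_threshold \<kappa> c2 \<epsilon>d"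
                using rate(1) unfolding \<tau>0_def[symmetric] b_def by linarith
              have est: "tdc_estimate \<omega> D d c1 c2 \<rho> (\<sigma> n) n x (Mhat n x)" if "x \<in> {1..n} \<rightarrow>\<^sub>E Rn D" for x
                using Mh n that by auto
              obtain E where E: "E \<in> sets (?N n Q)" "1 - 1 / real n ^ 3 \<le> measure (?N n Q) E"
                "\<And>x. x \<in> E \<Longrightarrow> hausdorff_dist M (underlying (Mhat n x))
                  \<le> (4 * Cd + 4 * bump_bound) * (net_scale c2 \<rho> (\<sigma> n) (bandwidth c1 d n))\<^sup>2 / \<rho>"
                "\<And>x. x \<in> E \<Longrightarrow> ambient_isotopic D M (underlying (Mhat n x))"
                using L.tdc_estimate_event[OF bg D n c1[unfolded c1_min_def] \<kappa>_def c2[unfolded c2_min_def] thr, of "Mhat n"] est by metis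
              have "(4 * Cd + 4 * bump_bound) * (net_scale c2 \<rho> (\<sigma> n) (bandwidth c1 d n))\<^sup>2 / \<rho> \<le> C \<rho> * ?R n"
              proof -
                have "(4 * Cd + 4 * bump_bound) * (net_scale c2 \<rho> (\<sigma> n) (bandwidth c1 d n))\<^sup>2 / \<rho>
                  \<le> (4 * Cd + 4 * bump_bound) * (c2\<^sup>2 * (((2 * c1) powr (1 / real d))\<^sup>2 + (\<rho> / b)\<^sup>2) * ?R n) / \<rho>"
                  using rate(3) \<epsilon>d B \<rho> unfolding b_def by (intro divide_right_mono mult_left_mono) auto
                then show ?thesis by (simp add: C_def mult.assoc)
              qed
              then have hE: "\<forall>x\<in>E. hausdorff_dist M (underlying (Mhat n x)) \<le> C \<rho> * ?R n \<and>
                   ambient_isotopic D M (underlying (Mhat n x))"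
                using E(3,4) order_trans by blast
              have hG: "\<forall>x\<in>L.near_samples n. hausdorff_dist M (underlying (Mhat n x)) \<le> crude_bound d fmin \<rho>"
              proof
                fix x assume x: "x \<in> L.near_samples n"
                then have "x \<in> {1..n} \<rightarrow>\<^sub>E Rn D" by (auto simp: L.near_samples_def space_PiM PiE_iff)
                then have "underlying (Mhat n x) \<subseteq> convex hull (x ` {1..n})"
                  by (rule tdc_estimate_complex(3)[OF est])
                then show "hausdorff_dist M (underlying (Mhat n x)) \<le> crude_bound d fmin \<rho>"
                  by (rule L.hausdorff_dist_crude[OF x _ sn(2)])
              qed
              show ?thesis
                using E(1,2) hE hG L.near_samples_sets L.prob_near_samples L.prob_PiM by blast
            qed
            \<comment> \<open>The bandwidth tends to 0, so h/\<rho> falls below its half of the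
              threshold, from an index on that does not depend on the law.\<close>
            have "0 < \<rho> * (\<tau>0 / 2)" using \<rho> \<tau>0 by simp
            then have "eventually (\<lambda>n. bandwidth c1 d n < \<rho> * (\<tau>0 / 2)) sequentially"
              by (rule order_tendstoD(2)[OF bandwidth_tendsto_0[OF c1p assms(2)]])
            then have ev: "eventually (\<lambda>n. 3 \<le> n \<and> bandwidth c1 d n \<le> \<rho> * (\<tau>0 / 2)) sequentially"
              using eventually_ge_at_top[of 3] by eventually_elim auto
            show "(\<forall>Q M. (\<forall>n\<ge>2. (Q n, M n) \<in> noisy_model k D d fmin fmax \<rho> (\<sigma> n)) \<longrightarrow>
                (\<lambda>n. inner_prob (PiM {1..n} (\<lambda>_. Q n))
                       {x \<in> space (PiM {1..n} (\<lambda>_. Q n)).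
                          hausdorff_dist (M n) (underlying (Mhat n x))
                            \<le> C \<rho> * max ((ln (real n) / real n) powr (2 / real d)) ((lam n)\<^sup>2) \<and>
                          ambient_isotopic D (M n) (underlying (Mhat n x))}) \<longlonglongrightarrow> 1) \<and>
             (\<forall>\<^sub>F n in sequentially.
                (SUP (Q, M) \<in> noisy_model k D d fmin fmax \<rho> (\<sigma> n).
                   upper_expectation (PiM {1..n} (\<lambda>_. Q))
                     (\<lambda>x. ennreal (hausdorff_dist M (underlying (Mhat n x)))))
                \<le> ennreal ((C \<rho> + crude_bound d fmin \<rho>) * max ((ln (real n) / real n) powr (2 / real d)) ((lam n)\<^sup>2)))"
            proof (intro conjI allI impI)
              fix Q M assume QM: "\<forall>n\<ge>2. (Q n, M n) \<in> noisy_model k D d fmin fmax \<rho> (\<sigma> n)"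
              let ?A = "\<lambda>n. {x \<in> space (?N n (Q n)). hausdorff_dist (M n) (underlying (Mhat n x)) \<le> C \<rho> * ?R n \<and>
                          ambient_isotopic D (M n) (underlying (Mhat n x))}"
              have bd: "eventually (\<lambda>n. 1 - 1 / real n ^ 3 \<le> inner_prob (?N n (Q n)) (?A n) \<and> inner_prob (?N n (Q n)) (?A n) \<le> 1) sequentially"
                using ev
              proof eventually_elim
                case (elim n)
                then have "(Q n, M n) \<in> noisy_model k D d fmin fmax \<rho> (\<sigma> n)" using QM by auto
                from event[OF _ _ this] elim obtain E where E: "E \<in> sets (?N n (Q n))"
                  "1 - 1 / real n ^ 3 \<le> measure (?N n (Q n)) E" "prob_space (?N n (Q n))"
                  "\<forall>x\<in>E. hausdorff_dist (M n) (underlying (Mhat n x)) \<le> C \<rho> * ?R n \<and>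
                   ambient_isotopic D (M n) (underlying (Mhat n x))" by blast
                have "E \<subseteq> ?A n" using E(4) sets.sets_into_space[OF E(1)] by blast
                then show ?case using inner_prob_ge[OF E(3,1)] inner_prob_le_1[OF E(3)] E(2) by (meson order_trans)
              qed
              have "(\<lambda>n. 1 - (1 / real n) ^ 3) \<longlonglongrightarrow> 1 - 0 ^ 3"
                by (intro tendsto_intros lim_1_over_n)
              then have "(\<lambda>n. 1 - 1 / real n ^ 3) \<longlonglongrightarrow> 1" by (simp add: power_one_over)
              then show "(\<lambda>n. inner_prob (?N n (Q n)) (?A n)) \<longlonglongrightarrow> 1"
                by (rule tendsto_sandwich[rotated 2, OF _ tendsto_const]) (use bd in \<open>auto elim: eventually_mono\<close>)
            next
              show "\<forall>\<^sub>F n in sequentially.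
                (SUP (Q, M) \<in> noisy_model k D d fmin fmax \<rho> (\<sigma> n).
                   upper_expectation (PiM {1..n} (\<lambda>_. Q)) (\<lambda>x. ennreal (hausdorff_dist M (underlying (Mhat n x)))))
                \<le> ennreal ((C \<rho> + crude_bound d fmin \<rho>) * ?R n)"
                using ev
              proof eventually_elim
                case (elim n)
                have "upper_expectation (?N n Q) (\<lambda>x. ennreal (hausdorff_dist M (underlying (Mhat n x))))
                    \<le> ennreal ((C \<rho> + crude_bound d fmin \<rho>) * ?R n)"
                  if QM: "(Q, M) \<in> noisy_model k D d fmin fmax \<rho> (\<sigma> n)" for Q M
                proof -
                  from event[OF _ _ QM] elim obtain E G where EG: "E \<in> sets (?N n Q)" "G \<in> sets (?N n Q)"
                    "measure (?N n Q) G = 1" "1 - 1 / real n ^ 3 \<le> measure (?N n Q) E" "prob_space (?N n Q)"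
                    "\<forall>x\<in>E. hausdorff_dist M (underlying (Mhat n x)) \<le> C \<rho> * ?R n"
                    "\<forall>x\<in>G. hausdorff_dist M (underlying (Mhat n x)) \<le> crude_bound d fmin \<rho>" by blast
                  have R: "1 / real n ^ 3 \<le> ?R n" using inverse_cube_le_rate[OF assms(2)] elim by (simp add: max.coboundedI1)
                  have R0: "0 \<le> ?R n" by (simp add: max.coboundedI2)
                  have "upper_expectation (?N n Q) (\<lambda>x. ennreal (hausdorff_dist M (underlying (Mhat n x))))
                    \<le> ennreal (C \<rho> * ?R n + crude_bound d fmin \<rho> * (1 / real n ^ 3))"
                    by (rule upper_expectation_le[OF EG(5,1,4,2,3)])
                      (use EG(6,7) C[OF \<rho>] crude[OF \<rho>] R0 in \<open>auto intro!: ennreal_leI\<close>)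
                  also have "\<dots> \<le> ennreal ((C \<rho> + crude_bound d fmin \<rho>) * ?R n)"
                    unfolding distrib_right using R crude[OF \<rho>] by (intro ennreal_leI add_left_mono mult_left_mono)
                  finally show ?thesis .
                qed
                then show ?case by (intro SUP_least) auto
              qed
            qed
          qed
        qed
      qed
    qed
  qed
qed

end
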